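(* Let $(\Omega,\mu)$ be a measure space, $1<p<\infty$, $p'=p/(p-1)$, and let $T:L^p(\Omega)\to L^p(\Omega)$ be a Ritt operator. The following are equivalent: (i) there is $C$ with $\|x\|_{T,1}\le C\|x\|_{L^p}$ for all $x\in L^p(\Omega)$ and $\|y\|_{T^*,1}\le C\|y\|_{L^{p'}}$ for all $y\in L^{p'}(\Omega)$, where $T^*$ is the adjoint on $L^{p'}(\Omega)$; (ii) $T$ is an $R$-Ritt operator and admits a loose dilation; (iii) $T$ is an $R$-Ritt operator and is $p$-polynomially bounded.
   Context: $T$ is Ritt if $\{T^n:n\ge0\}$ and $\{n(T^n-T^{n-1}):n\ge1\}$ are bounded; $R$-Ritt if these sets are $R$-bounded, where on $L^p$ a set $F$ is $R$-bounded iff there is $C$ with $\|(\sum_k|T_kx_k|^2)^{1/2}\|_{L^p}\le C\|(\sum_k|x_k|^2)^{1/2}\|_{L^p}$ for all finite families $T_k\in F$, $x_k$. For bounded $S$ on $L^q(\Omega)$, $\|x\|_{S,1}=\|(\sum_{k\ge1}k|S^kx-S^{k-1}x|^2)^{1/2}\|_{L^q}$ (infinite if the sequence $(k^{1/2}(S^kx-S^{k-1}x))_k$ is not in $L^q(\Omega;\ell^2)$). $T$ admits a loose dilation if there exist a measure space $\tilde\Omega$, bounded $J:L^p(\Omega)\to L^p(\tilde\Omega)$, $Q:L^p(\tilde\Omega)\to L^p(\Omega)$ and an isomorphism $U$ of $L^p(\tilde\Omega)$ with $\{U^n:n\in\mathbb{Z}\}$ bounded and $T^n=QU^nJ$ for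 all $n\ge0$. With $S$ the shift on $\ell^p_{\mathbb{Z}}$, $S((t_k))=(t_{k-1})$, and $\|\varphi\|_p=\|\varphi(S)\|_{B(\ell^p_{\mathbb{Z}})}$ for polynomials $\varphi$, $T$ is $p$-polynomially bounded if $\|\varphi(T)\|\le C\|\varphi\|_p$ for some $C$ and all complex polynomials $\varphi$. *)

theory Defs
  imports "HOL-Analysis.Analysis" "HOL-Computational_Algebra.Polynomial"
begin

definition memLp :: "real \<Rightarrow> 'a measure \<Rightarrow> ('a \<Rightarrow> 'b::{banach,second_countable_topology}) \<Rightarrow> bool" where
  "memLp p M f \<longleftrightarrow> f \<in> borel_measurable M \<and> integrable M (\<lambda>x. norm (f x) powr p)"

definition lp_norm :: "real \<Rightarrow> 'a measure \<Rightarrow> ('a \<Rightarrow> 'b::real_normed_vector) \<Rightarrow> real" where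
  "lp_norm p M f = (\<integral>x. norm (f x) powr p \<partial>M) powr (1 / p)"

text \<open>Bounded linear operators L^p(M) -> L^p(N), acting on representatives and
  respecting equality almost everywhere.\<close>
definition lp_op :: "real \<Rightarrow> 'a measure \<Rightarrow> 'b measure \<Rightarrow> (('a \<Rightarrow> complex) \<Rightarrow> ('b \<Rightarrow> complex)) \<Rightarrow> bool" where
  "lp_op p M N T \<longleftrightarrow>
     (\<forall>f. memLp p M f \<longrightarrow> memLp p N (T f)) \<and>
     (\<forall>f g. memLp p M f \<longrightarrow> memLp p M g \<longrightarrow> (AE x in M. f x = g x) \<longrightarrow> (AE y in N. T f y = T g y)) \<and>
     (\<forall>f g c. memLp p M f \<longrightarrow> memLp p M g \<longrightarrow>
        (AE y in N. T (\<lambda>x. f x + c * g x) y = T f y + c * T g y)) \<and>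
     (\<exists>C. \<forall>f. memLp p M f \<longrightarrow> lp_norm p N (T f) \<le> C * lp_norm p M f)"

definition op_set_bounded :: "real \<Rightarrow> 'a measure \<Rightarrow> (('a \<Rightarrow> complex) \<Rightarrow> ('a \<Rightarrow> complex)) set \<Rightarrow> bool" where
  "op_set_bounded p M F \<longleftrightarrow>
     (\<exists>C. \<forall>S\<in>F. \<forall>f. memLp p M f \<longrightarrow> lp_norm p M (S f) \<le> C * lp_norm p M f)"

text \<open>R-boundedness on L^p, via the square-function characterization of the paper.\<close>
definition R_bounded :: "real \<Rightarrow> 'a measure \<Rightarrow> (('a \<Rightarrow> complex) \<Rightarrow> ('a \<Rightarrow> complex)) set \<Rightarrow> bool" where
  "R_bounded p M F \<longleftrightarrow>
     (\<exists>C. \<forall>(n::nat) (Ts :: nat \<Rightarrow> ('a \<Rightarrow> complex) \<Rightarrow> ('a \<Rightarrow> complex)) (xs :: nat \<Rightarrow> 'a \<Rightarrow> complex).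
        (\<forall>k<n. Ts k \<in> F \<and> memLp p M (xs k)) \<longrightarrow>
        lp_norm p M (\<lambda>\<omega>. sqrt (\<Sum>k<n. (norm (Ts k (xs k) \<omega>))\<^sup>2))
          \<le> C * lp_norm p M (\<lambda>\<omega>. sqrt (\<Sum>k<n. (norm (xs k \<omega>))\<^sup>2)))"

definition powers_set :: "(('a \<Rightarrow> complex) \<Rightarrow> ('a \<Rightarrow> complex)) \<Rightarrow> (('a \<Rightarrow> complex) \<Rightarrow> ('a \<Rightarrow> complex)) set" where
  "powers_set T = {T ^^ n | n. True}"

definition ritt_diff_set :: "(('a \<Rightarrow> complex) \<Rightarrow> ('a \<Rightarrow> complex)) \<Rightarrow> (('a \<Rightarrow> complex) \<Rightarrow> ('a \<Rightarrow> complex)) set" where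
  "ritt_diff_set T = {(\<lambda>f \<omega>. of_nat n * ((T ^^ n) f \<omega> - (T ^^ (n - 1)) f \<omega>)) | n. n \<ge> 1}"

definition Ritt :: "real \<Rightarrow> 'a measure \<Rightarrow> (('a \<Rightarrow> complex) \<Rightarrow> ('a \<Rightarrow> complex)) \<Rightarrow> bool" where
  "Ritt p M T \<longleftrightarrow> lp_op p M M T \<and> op_set_bounded p M (powers_set T) \<and> op_set_bounded p M (ritt_diff_set T)"

definition R_Ritt :: "real \<Rightarrow> 'a measure \<Rightarrow> (('a \<Rightarrow> complex) \<Rightarrow> ('a \<Rightarrow> complex)) \<Rightarrow> bool" where
  "R_Ritt p M T \<longleftrightarrow> lp_op p M M T \<and> R_bounded p M (powers_set T) \<and> R_bounded p M (ritt_diff_set T)"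

text \<open>The square function \<open>\<parallel>x\<parallel>_{S,1}\<close> on L^q, with value \<infinity> if the sequence
  \<open>(k^{1/2}(S^k x - S^{k-1} x))_{k\<ge>1}\<close> is not in L^q(\<Omega>; \<ell>^2).\<close>
definition sqfun :: "real \<Rightarrow> 'a measure \<Rightarrow> (('a \<Rightarrow> complex) \<Rightarrow> ('a \<Rightarrow> complex)) \<Rightarrow> ('a \<Rightarrow> complex) \<Rightarrow> ereal" where
  "sqfun q M S x =
    (let g = (\<lambda>\<omega> k. real (Suc k) * (norm ((S ^^ Suc k) x \<omega> - (S ^^ k) x \<omega>))\<^sup>2);
         G = (\<lambda>\<omega>. sqrt (suminf (g \<omega>)))
     in if (AE \<omega> in M. summable (g \<omega>)) \<and> memLp q M G
        then ereal (lp_norm q M G) else \<infinity>)"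

text \<open>Banach-space adjoint w.r.t. the bilinear duality \<open>\<langle>x,y\<rangle> = \<integral> x y\<close>.\<close>
definition is_adjoint :: "real \<Rightarrow> 'a measure \<Rightarrow> (('a \<Rightarrow> complex) \<Rightarrow> ('a \<Rightarrow> complex)) \<Rightarrow> (('a \<Rightarrow> complex) \<Rightarrow> ('a \<Rightarrow> complex)) \<Rightarrow> bool" where
  "is_adjoint p M T Tstar \<longleftrightarrow> lp_op (p / (p - 1)) M M Tstar \<and>
     (\<forall>x y. memLp p M x \<longrightarrow> memLp (p / (p - 1)) M y \<longrightarrow>
        (\<integral>\<omega>. T x \<omega> * y \<omega> \<partial>M) = (\<integral>\<omega>. x \<omega> * Tstar y \<omega> \<partial>M))"

definition dilation_on :: "real \<Rightarrow> 'a measure \<Rightarrow> (('a \<Rightarrow> complex) \<Rightarrow> ('a \<Rightarrow> complex)) \<Rightarrow> 'b measure \<Rightarrow> bool" where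
  "dilation_on p M T N \<longleftrightarrow>
     (\<exists>(J :: ('a \<Rightarrow> complex) \<Rightarrow> ('b \<Rightarrow> complex)) (Q :: ('b \<Rightarrow> complex) \<Rightarrow> ('a \<Rightarrow> complex))
        (U :: ('b \<Rightarrow> complex) \<Rightarrow> ('b \<Rightarrow> complex)) (V :: ('b \<Rightarrow> complex) \<Rightarrow> ('b \<Rightarrow> complex)).
        lp_op p M N J \<and> lp_op p N M Q \<and> lp_op p N N U \<and> lp_op p N N V \<and>
        (\<forall>f. memLp p N f \<longrightarrow> (AE y in N. V (U f) y = f y) \<and> (AE y in N. U (V f) y = f y)) \<and>
        op_set_bounded p N (powers_set U \<union> powers_set V) \<and>
        (\<forall>n f. memLp p M f \<longrightarrow> (AE x in M. (T ^^ n) f x = Q ((U ^^ n) (J f)) x)))"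

definition loose_dilation :: "real \<Rightarrow> 'a measure \<Rightarrow> (('a \<Rightarrow> complex) \<Rightarrow> ('a \<Rightarrow> complex)) \<Rightarrow> bool" where
  "loose_dilation p M T \<longleftrightarrow> (\<exists>N :: ('a \<times> real) measure. dilation_on p M T N)"

definition poly_op :: "complex poly \<Rightarrow> (('a \<Rightarrow> complex) \<Rightarrow> ('a \<Rightarrow> complex)) \<Rightarrow> ('a \<Rightarrow> complex) \<Rightarrow> ('a \<Rightarrow> complex)" where
  "poly_op \<phi> T f = (\<lambda>\<omega>. \<Sum>j\<le>degree \<phi>. coeff \<phi> j * (T ^^ j) f \<omega>)"

definition shiftZ :: "(int \<Rightarrow> complex) \<Rightarrow> (int \<Rightarrow> complex)" where
  "shiftZ t = (\<lambda>k. t (k - 1))"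

definition poly_pnorm :: "real \<Rightarrow> complex poly \<Rightarrow> real" where
  "poly_pnorm p \<phi> = Sup ((\<lambda>t. lp_norm p (count_space UNIV) (poly_op \<phi> shiftZ t)) `
      {t. memLp p (count_space UNIV) t \<and> lp_norm p (count_space UNIV) t \<le> 1})"

definition p_poly_bounded :: "real \<Rightarrow> 'a measure \<Rightarrow> (('a \<Rightarrow> complex) \<Rightarrow> ('a \<Rightarrow> complex)) \<Rightarrow> bool" where
  "p_poly_bounded p M T \<longleftrightarrow>
     (\<exists>C. \<forall>\<phi> f. memLp p M f \<longrightarrow> lp_norm p M (poly_op \<phi> T f) \<le> C * poly_pnorm p \<phi> * lp_norm p M f)"

end

theory Submission
  imports Defs "HOL-Probability.Probability"
begin

text \<open>(ii) implies (iii) by Coifman--Weiss transference along the orbits of \<open>U\<close>.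

  For (iii) implies (i), a Bellman function bounds Haar shift operators on \<open>L\<^sup>p\<close> uniformly over random
  signs. Averaged over all translates of the dyadic grid they become convolutions with finitely
  supported kernels, so \<open>p\<close>-polynomial boundedness bounds the corresponding signed sums of
  polynomials in \<open>T\<close>. Khintchine's inequality turns this into a square function estimate over the
  scales \<open>4 ^ j\<close>, and R-boundedness of kernels built from \<open>T\<^sup>n\<close> and \<open>n (T\<^sup>n - T\<^sup>n\<^sup>-\<^sup>1)\<close> transfers it to
  \<open>\<parallel>x\<parallel>\<^bsub>T,1\<^esub>\<close>. The R-Ritt property passes to the adjoint by duality.

  (i) implies (ii) rests on the reproducing identity
  \<open>\<Sum>\<^bsub>s,l\<ge>0\<^esub> z\<^sup>s\<^sup>+\<^sup>l (1 - z) \<sqdot> z\<^sup>s\<^sup>+\<^sup>l (1 - z) \<sqdot> (1 + z)\<^sup>2 = 1\<close>, where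
  \<open>\<Sum>\<^bsub>s,l\<^esub> |T\<^sup>s\<^sup>+\<^sup>l (1 - T) x|\<^sup>2\<close> is controlled by \<open>\<parallel>x\<parallel>\<^bsub>T,1\<^esub>\<close>. Pairing the two factors with the square
  functions of \<open>T\<close> and \<open>T\<^sup>*\<close> gives R-boundedness. With independent signs \<open>r\<^bsub>s,l\<^esub>\<close>, \<open>s \<in> \<int>\<close>, the map
  \<open>x \<mapsto> \<Sum>\<^bsub>s,l\<ge>0\<^esub> T\<^sup>s\<^sup>+\<^sup>l (1 - T) x \<otimes> r\<^bsub>s,l\<^esub>\<close> intertwines \<open>T\<close> with the shift in \<open>s\<close> up to a defect that does
  not depend on the power of \<open>T\<close>; adding \<open>x \<otimes> 1\<close> absorbs this defect and yields the dilation.\<close>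

section \<open>Lebesgue spaces and their operators\<close>

text \<open>Operators act on representatives over an arbitrary measure, so identities for
  \<open>T\<close> hold only almost everywhere. The algebra is therefore done in the polynomial
  ring, and \<open>L^p\<close> enters only through bounds on \<open>poly_op \<phi> T\<close>.

  p-polynomial boundedness sees only one-sided convolutions on the integers, while martingale
  transforms are neither convolutions nor one-sided. Base 4 leaves the necessary room: a coefficient
  read on the left half of a block is written on its right half, so the average over all grids is a
  polynomial in the shift.

  The reproducing identity has two indices because the square function carries the weight
  \<open>k\<close>: exactly \<open>k\<close> pairs satisfy s + l = k - 1. The weight becomes a
  multiplicity, all terms have weight 1, and a translation in \<open>s\<close> preserves this form.
  A single index with weight \<open>k\<close> would not be compatible with a shift.

  The defect does not depend on the power of \<open>T\<close> because the Ritt bound makes T^m -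
  T^(m+n) of order n/m: whatever the truncated identity fails to reproduce is, in the limit, fixed
  by \<open>T\<close>.\<close>

lemma powr_convex_nonneg:
 fixes p :: real assumes "p \<ge> 1" shows "convex_on {0..} (\<lambda>x. x powr p)"
proof (rule convex_onI)
 fix t x y :: real assume t: "0 < t" "t < 1" and xy: "x \<in> {0..}" "y \<in> {0..}"
 have le: "s powr p \<le> s" if "0 < s" "s < 1" for s :: real
  using powr_mono'[of 1 p s] assms that by simp
 show "((1 - t) *\<^sub>R x + t *\<^sub>R y) powr p \<le> (1 - t) * x powr p + t * y powr p"
 proof (cases "x = 0 \<or> y = 0")
  case True
  then show ?thesis
   using xy t assms le[of t] le[of "1-t"] by (auto simp: powr_mult intro!: mult_right_mono)
 next
  case False
  then show ?thesis
   using convex_onD[OF powr_convex[OF assms], of t x y] xy t by (auto simp: scaleR_conv_of_real)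
 qed
qed simp

text \<open>Minkowski's inequality in pointwise form: convexity of the power with the weights
  \<open>A / (A + B)\<close> and \<open>B / (A + B)\<close>. With \<open>A\<close> and
  \<open>B\<close> close to the two norms, integration gives the triangle inequality.\<close>

lemma powr_add_le:
 fixes p a b A B :: real
 assumes "p \<ge> 1" "a \<ge> 0" "b \<ge> 0" "A > 0" "B > 0"
 shows "(a + b) powr p \<le> (A + B) powr p * (A / (A + B) * (a / A) powr p + B / (A + B) * (b / B) powr p)"
proof -
 define t where "t = B / (A + B)"
 have t: "0 \<le> t" "t \<le> 1" "1 - t = A / (A + B)" using assms by (auto simp: t_def field_simps)
 have "a + b = (A + B) * ((1 - t) * (a / A) + t * (b / B))"
 proof -
  have "(A + B) * ((1 - t) * (a / A) + t * (b / B)) = (A + B) / (A + B) * a + (A + B) / (A + B) * b"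
   unfolding t(3) unfolding t_def using assms by (simp only: distrib_left) simp
  moreover have "(A + B) / (A + B) = 1" using assms by simp
  ultimately show ?thesis by (metis mult_1)
 qed
 then have "(a + b) powr p = (A + B) powr p * ((1 - t) * (a / A) + t * (b / B)) powr p"
  using assms t(1,2) by (simp add: powr_mult)
 also have "... \<le> (A + B) powr p * ((1 - t) * (a / A) powr p + t * (b / B) powr p)"
  using convex_onD[OF powr_convex_nonneg[OF assms(1)], of t "a/A" "b/B"] assms t
  by (intro mult_left_mono) (auto simp: scaleR_conv_of_real)
 finally show ?thesis using t(3) by (simp add: t_def)
qed

lemma lp_norm_nonneg [simp]: "lp_norm p M f \<ge> 0"
 by (simp add: lp_norm_def)

lemma lp_norm_powr: "p > 0 ==> lp_norm p M f powr p = (\<integral>x. norm (f x) powr p \<partial>M)"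
 by (simp add: lp_norm_def powr_powr)

lemma lp_norm_le_iff:
 assumes "p > 0" "c \<ge> 0"
 shows "lp_norm p M f \<le> c \<longleftrightarrow> (\<integral>x. norm (f x) powr p \<partial>M) \<le> c powr p"
proof -
 have "lp_norm p M f \<le> c \<longleftrightarrow> lp_norm p M f powr p \<le> c powr p"
  using assms powr_mono2[of p "lp_norm p M f" c] powr_less_mono2[of p c "lp_norm p M f"]
  by (auto simp: not_le[symmetric])
 then show ?thesis using assms by (simp add: lp_norm_powr)
qed

lemma lp_norm_cong_AE:
 assumes "f \<in> borel_measurable M" "g \<in> borel_measurable M" "AE x in M. norm (f x) = norm (g x)"
 shows "lp_norm p M f = lp_norm p M g"
proof -
 have "(\<integral>x. norm (f x) powr p \<partial>M) = (\<integral>x. norm (g x) powr p \<partial>M)"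
  by (rule integral_cong_AE) (use assms in auto)
 then show ?thesis by (simp add: lp_norm_def)
qed

lemma memLp_meas: "memLp p M f ==> f \<in> borel_measurable M"
 by (simp add: memLp_def)

lemma memLp_bound:
 fixes f :: "'a => 'b::{banach,second_countable_topology}" and g :: "'a => 'c::{banach,second_countable_topology}"
 assumes p: "p > 0" and g: "memLp p M g" and f: "f \<in> borel_measurable M"
  and le: "AE x in M. norm (f x) \<le> norm (g x)"
 shows "memLp p M f" "lp_norm p M f \<le> lp_norm p M g"
proof -
 have ae: "AE x in M. norm (f x) powr p \<le> norm (g x) powr p"
  using le by eventually_elim (use p in \<open>auto intro: powr_mono2\<close>)
 show m: "memLp p M f" unfolding memLp_def
 proof
  show "integrable M (\<lambda>x. norm (f x) powr p)"
   by (rule Bochner_Integration.integrable_bound[of M "\<lambda>x. norm (g x) powr p"])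
    (use g f ae in \<open>auto simp: memLp_def\<close>)
 qed (fact f)
 show "lp_norm p M f \<le> lp_norm p M g"
  unfolding lp_norm_def
  by (intro powr_mono2 integral_mono_AE) (use ae p m g in \<open>auto simp: memLp_def\<close>)
qed

lemma memLp_zero [simp]: "memLp p M (\<lambda>x. 0)"
 by (simp add: memLp_def)

lemma lp_norm_zero [simp]: "lp_norm p M (\<lambda>x. 0) = 0"
 by (simp add: lp_norm_def)

lemma memLp_scale:
 fixes f :: "'a => 'b::{banach,second_countable_topology,real_normed_field}"
 shows "memLp p M f ==> memLp p M (\<lambda>x. c * f x)"
 unfolding memLp_def by (auto simp: norm_mult powr_mult)

lemma lp_norm_scale:
 fixes f :: "'a => 'b::{banach,second_countable_topology,real_normed_field}"
 assumes "p > 0"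
 shows "lp_norm p M (\<lambda>x. c * f x) = norm c * lp_norm p M f"
 using assms by (simp add: lp_norm_def norm_mult powr_mult powr_powr)

lemma memLp_norm_iff:
 fixes f :: "'a => 'b::{banach,second_countable_topology}"
 assumes "memLp p M f" shows "memLp p M (\<lambda>x. norm (f x))"
 using assms unfolding memLp_def by auto

lemma lp_norm_norm [simp]: "lp_norm p M (\<lambda>x. norm (f x)) = lp_norm p M f"
 by (simp add: lp_norm_def)

lemma lp_norm_uminus [simp]: "lp_norm p M (\<lambda>x. - f x) = lp_norm p M f"
 by (simp add: lp_norm_def)

lemma
 fixes f g :: "'a => 'b::{banach,second_countable_topology}"
 assumes p: "p \<ge> 1" and f: "memLp p M f" and g: "memLp p M g"
 shows memLp_add: "memLp p M (\<lambda>x. f x + g x)"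
  and lp_norm_add: "lp_norm p M (\<lambda>x. f x + g x) \<le> lp_norm p M f + lp_norm p M g"
proof -
 let ?F = "\<lambda>x. norm (f x) powr p" and ?G = "\<lambda>x. norm (g x) powr p"
 have [measurable]: "f \<in> borel_measurable M" "g \<in> borel_measurable M" and i: "integrable M ?F" "integrable M ?G"
  using f g by (auto simp: memLp_def)
 define H where "H A B x = (A + B) powr p * (A / (A + B) * (?F x / A powr p) + B / (A + B) * (?G x / B powr p))" for A B x
 have bd: "norm (f x + g x) powr p \<le> H A B x" if "A > 0" "B > 0" for A B x
 proof -
  have "norm (f x + g x) powr p \<le> (norm (f x) + norm (g x)) powr p"
   using p by (intro powr_mono2 norm_triangle_ineq) auto
  also have "... \<le> H A B x"
   using powr_add_le[OF p, of "norm (f x)" "norm (g x)" A B] that by (simp add: H_def powr_divide)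
  finally show ?thesis .
 qed
 have iH: "integrable M (H A B)" for A B
  unfolding H_def using i by auto
 have int: "integrable M (\<lambda>x. norm (f x + g x) powr p)"
  by (rule Bochner_Integration.integrable_bound[OF iH[of 1 1]]) (use bd[of 1 1] in \<open>auto intro!: AE_I2 order_trans[OF bd[of 1 1]]\<close>)
 then show "memLp p M (\<lambda>x. f x + g x)" by (simp add: memLp_def)
 show "lp_norm p M (\<lambda>x. f x + g x) \<le> lp_norm p M f + lp_norm p M g"
 proof (rule field_le_epsilon)
  fix e :: real assume e: "e > 0"
  \<comment> \<open>The extra \<open>e/2\<close> keeps the normalising constants positive when a
    norm vanishes.\<close>
  define A where "A = lp_norm p M f + e/2"
  define B where "B = lp_norm p M g + e/2"
  have pos: "A > 0" "B > 0" using e by (auto simp: A_def B_def intro: add_nonneg_pos)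
  have IF: "(\<integral>x. ?F x \<partial>M) \<le> A powr p"
   using lp_norm_le_iff[of p A M f] p pos e by (simp add: A_def)
  have IG: "(\<integral>x. ?G x \<partial>M) \<le> B powr p"
   using lp_norm_le_iff[of p B M g] p pos e by (simp add: B_def)
  have "(\<integral>x. norm (f x + g x) powr p \<partial>M) \<le> (\<integral>x. H A B x \<partial>M)"
   by (intro integral_mono int iH bd pos)
  also have "... = (A + B) powr p * (A / (A + B) * ((\<integral>x. ?F x \<partial>M) / A powr p) + B / (A + B) * ((\<integral>x. ?G x \<partial>M) / B powr p))"
   unfolding H_def using i by simp
  also have "... \<le> (A + B) powr p * (A / (A + B) * 1 + B / (A + B) * 1)"
   using IF IG pos by (intro mult_left_mono add_mono) (auto simp: field_simps)
  also have "... = (A + B) powr p" using pos by (simp add: add_divide_distrib[symmetric])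
  finally have "lp_norm p M (\<lambda>x. f x + g x) \<le> A + B"
   using lp_norm_le_iff[of p "A+B" M "\<lambda>x. f x + g x"] p pos by simp
  then show "lp_norm p M (\<lambda>x. f x + g x) \<le> lp_norm p M f + lp_norm p M g + e"
   by (simp add: A_def B_def)
 qed
qed

lemma
 fixes f :: "'i => 'a => 'b::{banach,second_countable_topology}"
 assumes p: "p \<ge> 1" and f: "\<And>i. i \<in> I ==> memLp p M (f i)"
 shows memLp_sum: "memLp p M (\<lambda>x. \<Sum>i\<in>I. f i x)"
  and lp_norm_sum: "lp_norm p M (\<lambda>x. \<Sum>i\<in>I. f i x) \<le> (\<Sum>i\<in>I. lp_norm p M (f i))"
proof -
 have "memLp p M (\<lambda>x. \<Sum>i\<in>I. f i x) \<and> lp_norm p M (\<lambda>x. \<Sum>i\<in>I. f i x) \<le> (\<Sum>i\<in>I. lp_norm p M (f i))"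
  using f
 proof (induction I rule: infinite_finite_induct)
  case (insert i I)
  then have 1: "memLp p M (f i)" "memLp p M (\<lambda>x. \<Sum>i\<in>I. f i x)" by auto
  show ?case using memLp_add[OF p 1] lp_norm_add[OF p 1] insert by auto
 qed auto
 then show "memLp p M (\<lambda>x. \<Sum>i\<in>I. f i x)" "lp_norm p M (\<lambda>x. \<Sum>i\<in>I. f i x) \<le> (\<Sum>i\<in>I. lp_norm p M (f i))"
  by auto
qed

lemma memLp_uminus:
 fixes f :: "'a => 'b::{banach,second_countable_topology}"
 shows "memLp p M f ==> memLp p M (\<lambda>x. - f x)"
 unfolding memLp_def by auto

lemma
 fixes f g :: "'a => 'b::{banach,second_countable_topology}"
 assumes p: "p \<ge> 1" and f: "memLp p M f" and g: "memLp p M g"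
 shows memLp_diff: "memLp p M (\<lambda>x. f x - g x)"
  and lp_norm_diff: "lp_norm p M (\<lambda>x. f x - g x) \<le> lp_norm p M f + lp_norm p M g"
 using memLp_add[OF p f memLp_uminus[OF g]] lp_norm_add[OF p f memLp_uminus[OF g]] by auto

lemma lp_norm_minus_commute:
 fixes f g :: "'a => 'b::{banach,second_countable_topology}"
 shows "lp_norm p M (\<lambda>x. f x - g x) = lp_norm p M (\<lambda>x. g x - f x)"
 by (simp add: lp_norm_def norm_minus_commute)

lemma lp_norm_triangle_sub:
 fixes f g :: "'a => 'b::{banach,second_countable_topology}"
 assumes p: "p \<ge> 1" and f: "memLp p M f" and g: "memLp p M g"
 shows "lp_norm p M f \<le> lp_norm p M g + lp_norm p M (\<lambda>x. f x - g x)"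
 using lp_norm_add[OF p g memLp_diff[OF p f g]] by simp

lemma lp_norm_triangle_diff:
 fixes f g h :: "'a => 'b::{banach,second_countable_topology}"
 assumes p: "p \<ge> 1" and f: "memLp p M f" and g: "memLp p M g" and h: "memLp p M h"
 shows "lp_norm p M (\<lambda>x. f x - h x) \<le> lp_norm p M (\<lambda>x. f x - g x) + lp_norm p M (\<lambda>x. g x - h x)"
 using lp_norm_add[OF p memLp_diff[OF p f g] memLp_diff[OF p g h]] by simp

lemma lp_norm_eq_0_iff:
 fixes f :: "'a => 'b::{banach,second_countable_topology}"
 assumes "p > 0" "memLp p M f"
 shows "lp_norm p M f = 0 \<longleftrightarrow> (AE x in M. f x = 0)"
proof -
 have "lp_norm p M f = 0 \<longleftrightarrow> (\<integral>x. norm (f x) powr p \<partial>M) = 0" using assms by (simp add: lp_norm_def)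
 also have "... \<longleftrightarrow> (AE x in M. norm (f x) powr p = 0)"
  using assms by (intro integral_nonneg_eq_0_iff_AE) (auto simp: memLp_def)
 also have "... \<longleftrightarrow> (AE x in M. f x = 0)" by simp
 finally show ?thesis .
qed

section \<open>Conjugate exponents and Hoelder's inequality\<close>

definition conj_exp :: "real => real => bool" where
 "conj_exp p q \<longleftrightarrow> p > 1 \<and> q > 1 \<and> 1/p + 1/q = 1"

lemma conj_expI: "p > 1 ==> conj_exp p (p / (p - 1))"
 by (auto simp: conj_exp_def field_simps)

lemma conj_exp_sym: "conj_exp p q ==> conj_exp q p"
 by (auto simp: conj_exp_def)

lemma
 fixes u v :: "'a => real"
 assumes pq: "conj_exp p q" and u: "memLp p M u" and v: "memLp q M v"
  and nn: "\<And>x. u x \<ge> 0" "\<And>x. v x \<ge> 0"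
 shows Hoelder_integrable_nonneg: "integrable M (\<lambda>x. u x * v x)"
  and Hoelder_nonneg: "(\<integral>x. u x * v x \<partial>M) \<le> lp_norm p M u * lp_norm q M v"
proof -
 have [measurable]: "u \<in> borel_measurable M" "v \<in> borel_measurable M"
  and i: "integrable M (\<lambda>x. u x powr p)" "integrable M (\<lambda>x. v x powr q)"
  using u v nn by (auto simp: memLp_def)
 have p: "p > 1" "q > 1" "1/p + 1/q = 1" using pq by (auto simp: conj_exp_def)
 show int: "integrable M (\<lambda>x. u x * v x)"
 proof (rule Bochner_Integration.integrable_bound[of M "\<lambda>x. u x powr p / p + v x powr q / q"])
  show "AE x in M. norm (u x * v x) \<le> norm (u x powr p / p + v x powr q / q)"
   using Youngs_inequality[OF p nn] nn p by (auto intro!: AE_I2)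
 qed (use i in auto)
 have key: "(\<integral>x. u x * v x \<partial>M) \<le> A * B" if AB: "A > 0" "B > 0" "lp_norm p M u \<le> A" "lp_norm q M v \<le> B" for A B
 proof -
  have Iu: "(\<integral>x. u x powr p \<partial>M) \<le> A powr p" using lp_norm_le_iff[of p A M u] AB p nn by simp
  have Iv: "(\<integral>x. v x powr q \<partial>M) \<le> B powr q" using lp_norm_le_iff[of q B M v] AB p nn by simp
  have "(\<integral>x. u x * v x \<partial>M) \<le> (\<integral>x. A * B * (u x powr p / A powr p / p + v x powr q / B powr q / q) \<partial>M)"
  proof (rule integral_mono[OF int])
   fix x
   have "u x * v x = A * B * ((u x / A) * (v x / B))" using AB by simp
   also have "... \<le> A * B * ((u x / A) powr p / p + (v x / B) powr q / q)"
    by (rule mult_left_mono[OF Youngs_inequality[OF p]]) (use AB nn in auto)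
   finally show "u x * v x \<le> A * B * (u x powr p / A powr p / p + v x powr q / B powr q / q)"
    using nn AB by (simp add: powr_divide)
  qed (use i in auto)
  also have "... = A * B * ((\<integral>x. u x powr p \<partial>M) / A powr p / p + (\<integral>x. v x powr q \<partial>M) / B powr q / q)"
   using i by simp
  also have "... \<le> A * B * (1 / p + 1 / q)"
   using Iu Iv AB p by (intro mult_left_mono add_mono divide_right_mono) (auto simp: field_simps)
  finally show ?thesis using p by simp
 qed
 show "(\<integral>x. u x * v x \<partial>M) \<le> lp_norm p M u * lp_norm q M v"
 proof (rule tendsto_lowerbound)
  show "((\<lambda>e. (lp_norm p M u + e) * (lp_norm q M v + e)) \<longlongrightarrow> lp_norm p M u * lp_norm q M v) (at_right 0)"
   by (auto intro!: tendsto_eq_intros)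
  show "\<forall>\<^sub>F e in at_right 0. (\<integral>x. u x * v x \<partial>M) \<le> (lp_norm p M u + e) * (lp_norm q M v + e)"
   by (auto simp: eventually_at_right_field intro!: exI[of _ 1] key add_nonneg_pos)
 qed auto
qed

lemma
 fixes f g :: "'a => complex"
 assumes pq: "conj_exp p q" and f: "memLp p M f" and g: "memLp q M g"
 shows Hoelder_integrable: "integrable M (\<lambda>x. f x * g x)"
  and Hoelder: "norm (\<integral>x. f x * g x \<partial>M) \<le> lp_norm p M f * lp_norm q M g"
proof -
 have [measurable]: "f \<in> borel_measurable M" "g \<in> borel_measurable M" using f g by (auto simp: memLp_def)
 have 1: "integrable M (\<lambda>x. norm (f x) * norm (g x))" "(\<integral>x. norm (f x) * norm (g x) \<partial>M) \<le> lp_norm p M f * lp_norm q M g"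
  using Hoelder_integrable_nonneg[OF pq memLp_norm_iff[OF f] memLp_norm_iff[OF g]]
   Hoelder_nonneg[OF pq memLp_norm_iff[OF f] memLp_norm_iff[OF g]] by auto
 show "integrable M (\<lambda>x. f x * g x)"
  by (rule Bochner_Integration.integrable_bound[OF 1(1)]) (auto simp: norm_mult)
 have "norm (\<integral>x. f x * g x \<partial>M) \<le> (\<integral>x. norm (f x * g x) \<partial>M)" by (rule integral_norm_bound)
 then show "norm (\<integral>x. f x * g x \<partial>M) \<le> lp_norm p M f * lp_norm q M g" using 1 by (simp add: norm_mult)
qed

section \<open>Convergence theorems and completeness\<close>

lemma lp_Fatou:
 fixes f :: "nat => 'a => 'b::{banach,second_countable_topology}"
 assumes p: "p > 0" and f: "\<And>n. memLp p M (f n)" and C: "\<forall>\<^sub>F n in sequentially. lp_norm p M (f n) \<le> C"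
  and g: "g \<in> borel_measurable M" and lim: "AE x in M. (\<lambda>n. f n x) \<longlonglongrightarrow> g x"
 shows "memLp p M g" "lp_norm p M g \<le> C"
proof -
 have [measurable]: "f n \<in> borel_measurable M" "g \<in> borel_measurable M" for n using f g by (auto simp: memLp_def)
 obtain n where "lp_norm p M (f n) \<le> C" using C by (auto simp: eventually_sequentially)
 then have C0: "C \<ge> 0" using lp_norm_nonneg[of p M "f n"] by linarith
 have "(\<integral>\<^sup>+x. ennreal (norm (g x) powr p) \<partial>M) = (\<integral>\<^sup>+x. liminf (\<lambda>n. ennreal (norm (f n x) powr p)) \<partial>M)"
 proof (rule nn_integral_cong_AE)
  show "AE x in M. ennreal (norm (g x) powr p) = liminf (\<lambda>n. ennreal (norm (f n x) powr p))"
   using lim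
  proof eventually_elim
   case (elim x)
   have "(\<lambda>n. ennreal (norm (f n x) powr p)) \<longlonglongrightarrow> ennreal (norm (g x) powr p)"
    using elim p by (intro tendsto_ennrealI tendsto_powr' tendsto_norm tendsto_const) auto
   then show ?case using lim_imp_Liminf[OF sequentially_bot] by metis
  qed
 qed
 also have "... \<le> liminf (\<lambda>n. \<integral>\<^sup>+x. ennreal (norm (f n x) powr p) \<partial>M)"
  by (rule nn_integral_liminf) auto
 also have "... \<le> ennreal (C powr p)"
 proof (rule Liminf_le)
  show "\<forall>\<^sub>F n in sequentially. (\<integral>\<^sup>+x. ennreal (norm (f n x) powr p) \<partial>M) \<le> ennreal (C powr p)"
   using C
  proof eventually_elim
   case (elim n)
   have "(\<integral>\<^sup>+x. ennreal (norm (f n x) powr p) \<partial>M) = ennreal (\<integral>x. norm (f n x) powr p \<partial>M)"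
    using f[of n] by (intro nn_integral_eq_integral) (auto simp: memLp_def)
   also have "... \<le> ennreal (C powr p)" using elim lp_norm_le_iff[OF p C0] by (intro ennreal_leI) auto
   finally show ?case .
  qed
 qed auto
 finally have le: "(\<integral>\<^sup>+x. ennreal (norm (g x) powr p) \<partial>M) \<le> ennreal (C powr p)" .
 have int: "integrable M (\<lambda>x. norm (g x) powr p)"
  by (rule integrableI_bounded) (use le in \<open>auto simp: less_top[symmetric] top_unique\<close>)
 then show "memLp p M g" by (simp add: memLp_def)
 have "ennreal (\<integral>x. norm (g x) powr p \<partial>M) \<le> ennreal (C powr p)"
  using nn_integral_eq_integral[OF int] le by simp
 then show "lp_norm p M g \<le> C" using lp_norm_le_iff[OF p C0, of M g] by (simp add: ennreal_le_iff)
qed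

text \<open>Monotone convergence: the supremum of the p-th powers has finite integral, hence is
  finite almost everywhere. This is how norm bounds on partial sums become pointwise
  summability.\<close>

lemma lp_monotone_bounded:
 fixes u :: "nat => 'a => real"
 assumes p: "p > 0" and u: "\<And>n. memLp p M (u n)" and C: "\<And>n. lp_norm p M (u n) \<le> C"
  and mono: "\<And>n x. u n x \<le> u (Suc n) x" and nn: "\<And>n x. 0 \<le> u n x"
 shows "AE x in M. \<exists>B. \<forall>n. u n x \<le> B"
proof -
 have [measurable]: "u n \<in> borel_measurable M" for n using u by (auto simp: memLp_def)
 have C0: "C \<ge> 0" using C[of 0] lp_norm_nonneg[of p M "u 0"] by linarith
 have inc: "incseq (\<lambda>n. u n x)" for x using mono by (auto intro: incseq_SucI)
 define U where "U n x = ennreal (u n x powr p)" for n x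
 have Um [measurable]: "U n \<in> borel_measurable M" for n unfolding U_def by measurable
 have "incseq U" using mono nn p
  by (auto intro!: incseq_SucI le_funI ennreal_leI powr_mono2 simp: U_def)
 then have "(\<integral>\<^sup>+x. (SUP n. U n x) \<partial>M) = (SUP n. \<integral>\<^sup>+x. U n x \<partial>M)"
  by (intro nn_integral_monotone_convergence_SUP) auto
 also have "... \<le> ennreal (C powr p)"
 proof (rule SUP_least)
  fix n
  have "(\<integral>\<^sup>+x. U n x \<partial>M) = ennreal (\<integral>x. norm (u n x) powr p \<partial>M)"
   unfolding U_def using u[of n] nn by (subst nn_integral_eq_integral) (auto simp: memLp_def)
  also have "... \<le> ennreal (C powr p)" using C[of n] lp_norm_le_iff[OF p C0, of M "u n"] by (intro ennreal_leI) simp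
  finally show "(\<integral>\<^sup>+x. U n x \<partial>M) \<le> ennreal (C powr p)" .
 qed
 finally have "(\<integral>\<^sup>+x. (SUP n. U n x) \<partial>M) \<noteq> \<infinity>" by (auto simp: top_unique)
 then have "AE x in M. (SUP n. U n x) \<noteq> \<infinity>" by (intro nn_integral_PInf_AE) auto
 then show ?thesis
 proof eventually_elim
  case (elim x)
  then obtain B where B: "(SUP n. U n x) = ennreal B" "B \<ge> 0" by (cases "SUP n. U n x") auto
  have "u n x \<le> B powr (1/p)" for n
  proof -
   have "U n x \<le> ennreal B" using B(1) by (metis SUP_upper UNIV_I)
   then have "u n x powr p \<le> B" using B by (simp add: U_def)
   then have "(u n x powr p) powr (1/p) \<le> B powr (1/p)" using p by (intro powr_mono2) auto
   then show ?thesis using p nn by (simp add: powr_powr)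
  qed
  then show ?case by blast
 qed
qed

lemma lp_dominated:
 fixes f :: "nat => 'a => 'b::{banach,second_countable_topology}" and h :: "'a => 'c::{banach,second_countable_topology}"
 assumes p: "p > 0" and f: "\<And>n. f n \<in> borel_measurable M" and h: "memLp p M h"
  and bd: "\<And>n. AE x in M. norm (f n x) \<le> norm (h x)" and lim: "AE x in M. (\<lambda>n. f n x) \<longlonglongrightarrow> 0"
 shows "(\<lambda>n. lp_norm p M (f n)) \<longlonglongrightarrow> 0"
proof -
 have "(\<lambda>n. \<integral>x. norm (f n x) powr p \<partial>M) \<longlonglongrightarrow> (\<integral>x. 0 \<partial>M)"
 proof (rule integral_dominated_convergence[where w="\<lambda>x. norm (h x) powr p"])
  show "AE x in M. (\<lambda>n. norm (f n x) powr p) \<longlonglongrightarrow> 0"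
   using lim
  proof eventually_elim
   case (elim x)
   have "(\<lambda>n. norm (f n x) powr p) \<longlonglongrightarrow> norm (0::'b) powr p"
    using p elim by (intro tendsto_powr' tendsto_norm) auto
   then show ?case by simp
  qed
  show "AE x in M. norm (norm (f n x) powr p) \<le> norm (h x) powr p" for n
   using bd[of n] by eventually_elim (use p in \<open>auto intro: powr_mono2\<close>)
 qed (use f h in \<open>auto simp: memLp_def\<close>)
 then have "(\<lambda>n. (\<integral>x. norm (f n x) powr p \<partial>M) powr (1/p)) \<longlonglongrightarrow> 0 powr (1/p)"
  using p by (intro tendsto_powr') auto
 then show ?thesis by (simp add: lp_norm_def)
qed

definition lp_Cauchy :: "real => 'a measure => (nat => 'a => 'b::{banach,second_countable_topology}) => bool" where
 "lp_Cauchy p M f \<longleftrightarrow> (\<forall>e>0. \<exists>N. \<forall>m\<ge>N. \<forall>n\<ge>N. lp_norm p M (\<lambda>x. f m x - f n x) < e)"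

lemma lp_complete:
 fixes f :: "nat => 'a => 'b::{banach,second_countable_topology}"
 assumes p: "p \<ge> 1" and f: "\<And>n. memLp p M (f n)" and C: "lp_Cauchy p M f"
 shows "\<exists>g. memLp p M g \<and> (\<lambda>n. lp_norm p M (\<lambda>x. f n x - g x)) \<longlonglongrightarrow> 0"
proof -
 have p0: "p > 0" using p by simp
 have [measurable]: "f n \<in> borel_measurable M" for n using f by (auto simp: memLp_def)
 have "\<exists>N. \<forall>m\<ge>N. \<forall>n\<ge>N. lp_norm p M (\<lambda>x. f m x - f n x) < (1/2)^k" for k
  using C unfolding lp_Cauchy_def by simp
 then obtain N where N: "\<And>k m n. m \<ge> N k ==> n \<ge> N k ==> lp_norm p M (\<lambda>x. f m x - f n x) < (1/2)^k"
  by metis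
 \<comment> \<open>The sum makes both \<open>r k\<close> and \<open>r (Suc k)\<close> at least
   \<open>N k\<close>, so consecutive terms are summably close; the summand \<open>k\<close> forces
   \<open>r k\<close> to infinity.\<close>
 define r where "r k = k + (\<Sum>i\<le>k. N i)" for k
 have rN: "r k \<ge> N k" "r (Suc k) \<ge> N k" "r k \<ge> k" for k
 proof -
  have 1: "N k \<le> (\<Sum>i\<le>k. N i)" by (rule member_le_sum) auto
  then show "r k \<ge> N k" "r k \<ge> k" by (auto simp: r_def)
  show "r (Suc k) \<ge> N k" using 1 by (simp add: r_def)
 qed
 define d where "d k x = norm (f (r (Suc k)) x - f (r k) x)" for k x
 have d: "memLp p M (d k)" "lp_norm p M (d k) \<le> (1/2)^k" for k
  unfolding d_def using memLp_norm_iff[OF memLp_diff[OF p f f]] N[OF rN(2) rN(1), of k] by auto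
 have "AE x in M. \<exists>B. \<forall>n. (\<Sum>k<n. d k x) \<le> B"
 proof (rule lp_monotone_bounded[OF p0, where C=2])
  show "memLp p M (\<lambda>x. \<Sum>k<n. d k x)" for n by (rule memLp_sum[OF p d(1)])
  fix n
  have "lp_norm p M (\<lambda>x. \<Sum>k<n. d k x) \<le> (\<Sum>k<n. lp_norm p M (d k))" by (rule lp_norm_sum[OF p d(1)])
  also have "... \<le> (\<Sum>k<n. (1/2)^k)" by (intro sum_mono d)
  also have "... \<le> 2" by (simp add: geometric_sum)
  finally show "lp_norm p M (\<lambda>x. \<Sum>k<n. d k x) \<le> 2" .
 qed (auto simp: d_def intro!: sum_nonneg)
 then have conv: "AE x in M. convergent (\<lambda>k. f (r k) x)"
 proof eventually_elim
  case (elim x)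
  then obtain B where "\<And>n. (\<Sum>k<n. d k x) \<le> B" by blast
  then have "summable (\<lambda>k. d k x)" by (intro bounded_imp_summable[of _ B]) (simp_all add: d_def lessThan_Suc_atMost[symmetric] del: sum.lessThan_Suc)
  then have "summable (\<lambda>k. f (r (Suc k)) x - f (r k) x)" unfolding d_def by (rule summable_norm_cancel)
  then have "convergent (\<lambda>n. f (r n) x - f (r 0) x)"
   unfolding summable_iff_convergent using sum_lessThan_telescope[of "\<lambda>n. f (r n) x"] by simp
  then show ?case by (simp add: convergent_diff_const_right_iff)
 qed
 define g where "g x = lim (\<lambda>k. f (r k) x)" for x
 have g [measurable]: "g \<in> borel_measurable M" unfolding g_def by measurable
 have lim: "AE x in M. (\<lambda>k. f (r k) x) \<longlonglongrightarrow> g x"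
  using conv by eventually_elim (simp add: g_def convergent_LIMSEQ_iff)
 \<comment> \<open>Fatou's lemma along the subsequence turns the Cauchy estimate between two terms
   into an estimate against the limit.\<close>
 have est: "memLp p M (\<lambda>x. f n x - g x) \<and> lp_norm p M (\<lambda>x. f n x - g x) \<le> (1/2)^k" if n: "n \<ge> N k" for n k
 proof -
  have 2: "\<forall>\<^sub>F m in sequentially. lp_norm p M (\<lambda>x. f n x - f (r m) x) \<le> (1/2)^k"
   using eventually_ge_at_top[of "N k"]
  proof eventually_elim
   case (elim m)
   then have "r m \<ge> N k" using rN(3)[of m] by linarith
   then show ?case using N[OF n, of "r m"] by simp
  qed
  have 3: "AE x in M. (\<lambda>m. f n x - f (r m) x) \<longlonglongrightarrow> f n x - g x"
   using lim by eventually_elim (intro tendsto_intros)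
  show ?thesis
   using lp_Fatou[OF p0 memLp_diff[OF p f f] 2 _ 3] by auto
 qed
 have "memLp p M (\<lambda>x. f (N 0) x - (f (N 0) x - g x))"
  by (rule memLp_diff[OF p f]) (use est[of 0 "N 0"] in simp)
 then have "memLp p M g" by simp
 moreover have "(\<lambda>n. lp_norm p M (\<lambda>x. f n x - g x)) \<longlonglongrightarrow> 0"
 proof (rule LIMSEQ_I)
  fix e :: real assume "e > 0"
  then obtain k where k: "(1/2)^k < e" using real_arch_pow_inv[of e "1/2"] by auto
  show "\<exists>no. \<forall>n\<ge>no. norm (lp_norm p M (\<lambda>x. f n x - g x) - 0) < e"
   using est k by (intro exI[of _ "N k"]) (auto intro: le_less_trans)
 qed
 ultimately show ?thesis by blast
qed

section \<open>Bounded operators between L^p spaces\<close>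

definition op_bd :: "real => 'a measure => 'b measure => (('a => complex) => ('b => complex)) => real => bool" where
 "op_bd p M N T C \<longleftrightarrow> C \<ge> 0 \<and> (\<forall>f. memLp p M f \<longrightarrow> lp_norm p N (T f) \<le> C * lp_norm p M f)"

lemma op_bdD: "op_bd p M N T C ==> memLp p M f ==> lp_norm p N (T f) \<le> C * lp_norm p M f"
 by (simp add: op_bd_def)

lemma op_bd_nonneg: "op_bd p M N T C ==> C \<ge> 0"
 by (simp add: op_bd_def)

lemma lp_op_mem: "lp_op p M N T ==> memLp p M f ==> memLp p N (T f)"
 by (simp add: lp_op_def)

lemma lp_op_cong: "lp_op p M N T ==> memLp p M f ==> memLp p M g ==> AE x in M. f x = g x ==> AE y in N. T f y = T g y"
 by (simp add: lp_op_def)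

lemma lp_op_lin: "lp_op p M N T ==> memLp p M f ==> memLp p M g ==> AE y in N. T (\<lambda>x. f x + c * g x) y = T f y + c * T g y"
 by (simp add: lp_op_def)

lemma lp_op_bd: assumes "lp_op p M N T" obtains C where "op_bd p M N T C"
proof -
 obtain C where C: "\<And>f. memLp p M f ==> lp_norm p N (T f) \<le> C * lp_norm p M f"
  using assms unfolding lp_op_def by blast
 have "op_bd p M N T (max C 0)"
  unfolding op_bd_def
 proof (intro conjI allI impI)
  fix f :: "_ => complex" assume f: "memLp p M f"
  show "lp_norm p N (T f) \<le> max C 0 * lp_norm p M f"
   by (rule order_trans[OF C[OF f] mult_right_mono]) auto
 qed auto
 then show ?thesis by (rule that)
qed

lemma lp_opI:
 assumes "\<And>f. memLp p M f ==> memLp p N (T f)"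
  "\<And>f g. memLp p M f ==> memLp p M g ==> AE x in M. f x = g x ==> AE y in N. T f y = T g y"
  "\<And>f g c. memLp p M f ==> memLp p M g ==> AE y in N. T (\<lambda>x. f x + c * g x) y = T f y + c * T g y"
  "op_bd p M N T C"
 shows "lp_op p M N T"
 using assms unfolding lp_op_def op_bd_def by blast

lemma lp_op_zero:
 assumes T: "lp_op p M N T" shows "AE y in N. T (\<lambda>x. 0) y = 0"
 using lp_op_lin[OF T memLp_zero memLp_zero, of "-1"] by (auto elim!: eventually_mono)

lemma lp_op_scale:
 assumes T: "lp_op p M N T" and f: "memLp p M f"
 shows "AE y in N. T (\<lambda>x. c * f x) y = c * T f y"
 using lp_op_lin[OF T memLp_zero f, of c] lp_op_zero[OF T] by (auto elim!: eventually_elim2)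

lemma lp_op_add:
 assumes T: "lp_op p M N T" and f: "memLp p M f" and g: "memLp p M g"
 shows "AE y in N. T (\<lambda>x. f x + g x) y = T f y + T g y"
 using lp_op_lin[OF T f g, of 1] by simp

lemma lp_op_diff:
 assumes T: "lp_op p M N T" and f: "memLp p M f" and g: "memLp p M g"
 shows "AE y in N. T (\<lambda>x. f x - g x) y = T f y - T g y"
 using lp_op_lin[OF T f g, of "-1"] by simp

lemma lp_op_sum:
 assumes p: "p \<ge> 1" and T: "lp_op p M N T" and f: "\<And>i. i \<in> I ==> memLp p M (f i)"
 shows "AE y in N. T (\<lambda>x. \<Sum>i\<in>I. c i * f i x) y = (\<Sum>i\<in>I. c i * T (f i) y)"
 using f
proof (induction I rule: infinite_finite_induct)
 case (insert i I)
 have m: "memLp p M (\<lambda>x. \<Sum>i\<in>I. c i * f i x)"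
  using insert by (intro memLp_sum[OF p] memLp_scale) auto
 have "AE y in N. T (\<lambda>x. (\<Sum>i\<in>I. c i * f i x) + c i * f i x) y = T (\<lambda>x. \<Sum>i\<in>I. c i * f i x) y + c i * T (f i) y"
  by (rule lp_op_lin[OF T m]) (use insert in auto)
 then show ?case using insert by (auto simp: add.commute elim!: eventually_elim2)
qed (use lp_op_zero[OF T] in auto)

lemma lp_op_id [simp]: "lp_op p M M (\<lambda>f. f)"
 by (rule lp_opI[where C=1]) (auto simp: op_bd_def)

lemma op_bd_id [simp]: "op_bd p M M (\<lambda>f. f) 1"
 by (auto simp: op_bd_def)

lemma op_bd_mono: "op_bd p M N T C ==> C \<le> D ==> op_bd p M N T D"
 unfolding op_bd_def by (meson lp_norm_nonneg mult_right_mono order_trans)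

lemma op_bd_comp:
 assumes "lp_op p M N T" "op_bd p M N T C" "op_bd p N K S D"
 shows "op_bd p M K (\<lambda>f. S (T f)) (D * C)"
proof -
 have "lp_norm p K (S (T f)) \<le> D * C * lp_norm p M f" if f: "memLp p M f" for f :: "_ => complex"
 proof -
  have "lp_norm p K (S (T f)) \<le> D * lp_norm p N (T f)" by (rule op_bdD[OF assms(3) lp_op_mem[OF assms(1) f]])
  also have "... \<le> D * (C * lp_norm p M f)"
   by (rule mult_left_mono[OF op_bdD[OF assms(2) f] op_bd_nonneg[OF assms(3)]])
  finally show ?thesis by (simp add: mult.assoc)
 qed
 then show ?thesis using assms by (auto simp: op_bd_def)
qed

lemma memLp_lincomb:
 fixes f g :: "'a => complex"
 assumes "p \<ge> 1" "memLp p M f" "memLp p M g" shows "memLp p M (\<lambda>x. f x + c * g x)"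
 using assms by (intro memLp_add memLp_scale)

lemma lp_op_comp:
 assumes p: "p \<ge> 1" and T: "lp_op p M N T" and S: "lp_op p N K S"
 shows "lp_op p M K (\<lambda>f. S (T f))"
proof -
 obtain C D where "op_bd p M N T C" "op_bd p N K S D" using T S lp_op_bd by metis
 note bd = op_bd_comp[OF T this]
 show ?thesis
 proof (rule lp_opI[OF _ _ _ bd])
  fix f g :: "_ => complex" assume fg: "memLp p M f" "memLp p M g"
  then show "memLp p K (S (T f))" by (intro lp_op_mem[OF S] lp_op_mem[OF T])
  have m: "memLp p N (T f)" "memLp p N (T g)" by (intro lp_op_mem[OF T] fg)+
  { assume "AE x in M. f x = g x"
   then show "AE y in K. S (T f) y = S (T g) y"
    by (intro lp_op_cong[OF S m] lp_op_cong[OF T fg]) }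
  fix c
  have "AE y in K. S (T (\<lambda>x. f x + c * g x)) y = S (\<lambda>y. T f y + c * T g y) y"
   by (intro lp_op_cong[OF S] lp_op_mem[OF T] memLp_lincomb[OF p] fg lp_op_lin[OF T])
  with lp_op_lin[OF S m, of c] show "AE y in K. S (T (\<lambda>x. f x + c * g x)) y = S (T f) y + c * S (T g) y"
   by eventually_elim simp
 qed
qed

lemma lp_op_lincomb:
 assumes p: "p \<ge> 1" and T: "lp_op p M N T" and S: "lp_op p M N S"
 shows "lp_op p M N (\<lambda>f y. T f y + c * S f y)"
proof -
 obtain C D where b: "op_bd p M N T C" "op_bd p M N S D" using T S lp_op_bd by metis
 have m: "memLp p N (\<lambda>y. T f y + c * S f y)" if "memLp p M f" for f :: "_ => complex"
  by (rule memLp_lincomb[OF p lp_op_mem[OF T that] lp_op_mem[OF S that]])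
 have bd: "op_bd p M N (\<lambda>f y. T f y + c * S f y) (C + norm c * D)"
  unfolding op_bd_def
 proof (intro conjI allI impI)
  show "0 \<le> C + norm c * D" using b by (simp add: op_bd_def)
  fix f :: "_ => complex" assume f: "memLp p M f"
  have "lp_norm p N (\<lambda>y. T f y + c * S f y) \<le> lp_norm p N (T f) + norm c * lp_norm p N (S f)"
   using lp_norm_add[OF p lp_op_mem[OF T f] memLp_scale[OF lp_op_mem[OF S f]]] p by (simp add: lp_norm_scale)
  also have "... \<le> C * lp_norm p M f + norm c * (D * lp_norm p M f)"
   using op_bdD[OF b(1) f] op_bdD[OF b(2) f] by (intro add_mono mult_left_mono) auto
  finally show "lp_norm p N (\<lambda>y. T f y + c * S f y) \<le> (C + norm c * D) * lp_norm p M f"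
   by (simp add: algebra_simps)
 qed
 show ?thesis
 proof (rule lp_opI[OF m _ _ bd])
  fix f g :: "_ => complex" assume fg: "memLp p M f" "memLp p M g"
  { assume "AE x in M. f x = g x"
   from lp_op_cong[OF T fg this] lp_op_cong[OF S fg this]
   show "AE y in N. T f y + c * S f y = T g y + c * S g y" by eventually_elim simp }
  fix d
  from lp_op_lin[OF T fg, of d] lp_op_lin[OF S fg, of d]
  show "AE y in N. T (\<lambda>x. f x + d * g x) y + c * S (\<lambda>x. f x + d * g x) y = T f y + c * S f y + d * (T g y + c * S g y)"
   by eventually_elim (simp add: algebra_simps)
 qed
qed

lemma lp_op_0: "lp_op p M N (\<lambda>f y. 0)"
 by (rule lp_opI[where C=0]) (auto simp: op_bd_def)

lemma lp_op_sum_ops: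
 assumes p: "p \<ge> 1" and T: "\<And>i. i \<in> I ==> lp_op p M N (T i)"
 shows "lp_op p M N (\<lambda>f y. \<Sum>i\<in>I. c i * T i f y)"
 using T
proof (induction I rule: infinite_finite_induct)
 case (insert i I)
 have "lp_op p M N (\<lambda>f y. (\<Sum>i\<in>I. c i * T i f y) + c i * T i f y)"
  by (rule lp_op_lincomb[OF p]) (use insert in auto)
 then show ?case using insert by (simp add: add.commute)
qed (simp_all add: lp_op_0)

lemma lp_op_pow:
 assumes p: "p \<ge> 1" and T: "lp_op p M M T" shows "lp_op p M M (T ^^ n)"
proof (induction n)
 case (Suc n)
 then show ?case using lp_op_comp[OF p Suc T] by (simp add: o_def)
qed (simp add: id_def)

lemma lp_op_poly:
 assumes p: "p \<ge> 1" and T: "lp_op p M M T" shows "lp_op p M M (poly_op \<phi> T)"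
 unfolding poly_op_def[abs_def] by (rule lp_op_sum_ops[OF p lp_op_pow[OF p T]])

section \<open>Polynomial functional calculus\<close>

lemma poly_op_alt:
 assumes "degree \<phi> \<le> n" shows "poly_op \<phi> T f w = (\<Sum>j\<le>n. coeff \<phi> j * (T ^^ j) f w)"
 unfolding poly_op_def using assms
 by (intro sum.mono_neutral_left) (auto simp: coeff_eq_0)

lemma poly_op_add: "poly_op (\<phi> + \<psi>) T f w = poly_op \<phi> T f w + poly_op \<psi> T f w"
proof -
 let ?n = "max (degree \<phi>) (degree \<psi>)"
 have "degree (\<phi> + \<psi>) \<le> ?n" by (rule degree_add_le_max)
 then show ?thesis
  by (simp add: poly_op_alt[of _ ?n] sum.distrib[symmetric] algebra_simps)
qed

lemma poly_op_smult: "poly_op (smult c \<phi>) T f w = c * poly_op \<phi> T f w"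
 using degree_smult_le[of c \<phi>]
 by (simp add: poly_op_alt[of _ "degree \<phi>"] sum_distrib_left mult.assoc)

lemma poly_op_0 [simp]: "poly_op 0 T f w = 0"
 by (simp add: poly_op_def)

lemma poly_op_uminus: "poly_op (- \<phi>) T f w = - poly_op \<phi> T f w"
 using poly_op_smult[of "-1" \<phi> T f w] by simp

lemma poly_op_diff: "poly_op (\<phi> - \<psi>) T f w = poly_op \<phi> T f w - poly_op \<psi> T f w"
 using poly_op_add[of \<phi> "-\<psi>" T f w] by (simp add: poly_op_uminus)

lemma poly_op_sum: "poly_op (\<Sum>i\<in>I. \<phi> i) T f w = (\<Sum>i\<in>I. poly_op (\<phi> i) T f w)"
 by (induction I rule: infinite_finite_induct) (auto simp: poly_op_add)

lemma poly_op_monom: "poly_op (monom c n) T f w = c * (T ^^ n) f w"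
proof -
 have "poly_op (monom c n) T f w = (\<Sum>j\<le>n. (if n = j then c else 0) * (T ^^ j) f w)"
  by (subst poly_op_alt[OF degree_monom_le]) (simp add: coeff_monom)
 also have "... = (\<Sum>j\<in>{..n}. if n = j then c * (T ^^ j) f w else 0)"
  by (intro sum.cong) auto
 finally show ?thesis by simp
qed

lemma poly_op_1 [simp]: "poly_op 1 T f = f"
 by (rule ext) (simp add: poly_op_def)

lemma funpow_poly_op:
 assumes p: "p \<ge> 1" and T: "lp_op p M M T" and f: "memLp p M f"
 shows "AE w in M. (T ^^ j) (poly_op \<psi> T f) w = poly_op (monom 1 j * \<psi>) T f w"
proof -
 have "AE w in M. (T ^^ j) (\<lambda>w. \<Sum>i\<le>degree \<psi>. coeff \<psi> i * (T ^^ i) f w) w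
   = (\<Sum>i\<le>degree \<psi>. coeff \<psi> i * (T ^^ j) ((T ^^ i) f) w)"
  by (rule lp_op_sum[OF p lp_op_pow[OF p T] lp_op_mem[OF lp_op_pow[OF p T] f]])
 moreover have "(\<Sum>i\<le>degree \<psi>. coeff \<psi> i * (T ^^ j) ((T ^^ i) f) w) = poly_op (monom 1 j * \<psi>) T f w" for w
 proof -
  have "monom 1 j * \<psi> = (\<Sum>i\<le>degree \<psi>. monom (coeff \<psi> i) (j + i))"
   by (subst (1) poly_as_sum_of_monoms[symmetric]) (simp add: sum_distrib_left mult_monom)
  then show ?thesis
   by (simp add: poly_op_sum poly_op_monom funpow_add)
 qed
 ultimately show ?thesis by (simp add: poly_op_def)
qed

text \<open>Linearity of \<open>T\<close> holds only almost everywhere, so the calculus is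
  multiplicative only off a null set. Finitely many powers occur, hence finitely many exceptional
  sets.\<close>

lemma poly_op_mult:
 assumes p: "p \<ge> 1" and T: "lp_op p M M T" and f: "memLp p M f"
 shows "AE w in M. poly_op (\<phi> * \<psi>) T f w = poly_op \<phi> T (poly_op \<psi> T f) w"
proof -
 have "AE w in M. \<forall>j\<in>{..degree \<phi>}. (T ^^ j) (poly_op \<psi> T f) w = poly_op (monom 1 j * \<psi>) T f w"
  by (rule AE_finite_allI) (simp_all add: funpow_poly_op[OF p T f])
 then show ?thesis
 proof eventually_elim
  case (elim w)
  have "\<phi> * \<psi> = (\<Sum>j\<le>degree \<phi>. monom (coeff \<phi> j) j) * \<psi>"
   by (simp add: poly_as_sum_of_monoms)
  also have "... = (\<Sum>j\<le>degree \<phi>. smult (coeff \<phi> j) (monom 1 j * \<psi>))"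
   by (simp add: sum_distrib_right mult_smult_left[symmetric] smult_monom del: mult_smult_left)
  finally have "poly_op (\<phi> * \<psi>) T f w = (\<Sum>j\<le>degree \<phi>. coeff \<phi> j * poly_op (monom 1 j * \<psi>) T f w)"
   by (simp add: poly_op_sum poly_op_smult)
  also have "... = poly_op \<phi> T (poly_op \<psi> T f) w"
   unfolding poly_op_def[of \<phi>] using elim by (intro sum.cong) auto
  finally show ?case .
 qed
qed

lemma op_bd_cong:
 assumes "\<And>f. memLp p M f ==> memLp p N (S f)" "\<And>f. memLp p M f ==> memLp p N (T f)"
  "\<And>f. memLp p M f ==> AE x in N. S f x = T f x" "op_bd p M N T C"
 shows "op_bd p M N S C"
proof -
 have "lp_norm p N (S f) = lp_norm p N (T f)" if "memLp p M f" for f :: "_ => complex"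
  using assms(1)[OF that] assms(2)[OF that] assms(3)[OF that]
  by (intro lp_norm_cong_AE) (auto simp: memLp_def elim!: eventually_mono)
 then show ?thesis using assms by (auto simp: op_bd_def)
qed

lemma lp_norm_cong_mem:
 fixes f g :: "'a => 'b::{banach,second_countable_topology}"
 assumes "memLp p M f" "memLp p M g" "AE x in M. f x = g x"
 shows "lp_norm p M f = lp_norm p M g"
 using assms by (intro lp_norm_cong_AE) (auto simp: memLp_def elim!: eventually_mono)

lemma op_bd_poly_mult:
 assumes p: "p \<ge> 1" and T: "lp_op p M M T"
  and b: "op_bd p M M (poly_op \<phi> T) C" "op_bd p M M (poly_op \<psi> T) D"
 shows "op_bd p M M (poly_op (\<phi> * \<psi>) T) (C * D)"
proof (rule op_bd_cong)
 show "op_bd p M M (\<lambda>f. poly_op \<phi> T (poly_op \<psi> T f)) (C * D)"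
  by (rule op_bd_comp[OF lp_op_poly[OF p T] b(2,1)])
 fix f :: "_ => complex" assume f: "memLp p M f"
 show "memLp p M (poly_op (\<phi> * \<psi>) T f)" by (rule lp_op_mem[OF lp_op_poly[OF p T] f])
 show "memLp p M (poly_op \<phi> T (poly_op \<psi> T f))" by (intro lp_op_mem[OF lp_op_poly[OF p T]] f)
 show "AE x in M. poly_op (\<phi> * \<psi>) T f x = poly_op \<phi> T (poly_op \<psi> T f) x" by (rule poly_op_mult[OF p T f])
qed

lemma op_bd_poly_add:
 assumes p: "p \<ge> 1" and T: "lp_op p M M T"
  and b: "op_bd p M M (poly_op \<phi> T) C" "op_bd p M M (poly_op \<psi> T) D"
 shows "op_bd p M M (poly_op (\<phi> + \<psi>) T) (C + D)"
 unfolding op_bd_def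
proof (intro conjI allI impI)
 show "0 \<le> C + D" using b by (simp add: op_bd_def)
 fix f :: "_ => complex" assume f: "memLp p M f"
 note m = lp_op_mem[OF lp_op_poly[OF p T] f]
 have "lp_norm p M (\<lambda>x. poly_op \<phi> T f x + poly_op \<psi> T f x) \<le> lp_norm p M (poly_op \<phi> T f) + lp_norm p M (poly_op \<psi> T f)"
  by (rule lp_norm_add[OF p m m])
 also have "... \<le> C * lp_norm p M f + D * lp_norm p M f" by (intro add_mono op_bdD[OF b(1) f] op_bdD[OF b(2) f])
 finally show "lp_norm p M (poly_op (\<phi> + \<psi>) T f) \<le> (C + D) * lp_norm p M f"
  by (simp add: poly_op_add[abs_def] algebra_simps)
qed

lemma op_bd_poly_smult:
 assumes p: "p \<ge> 1" and b: "op_bd p M M (poly_op \<phi> T) C"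
 shows "op_bd p M M (poly_op (smult c \<phi>) T) (norm c * C)"
 using b p unfolding op_bd_def by (auto simp: poly_op_smult[abs_def] lp_norm_scale mult.assoc intro!: mult_left_mono)

lemma op_bd_poly_sum:
 assumes p: "p \<ge> 1" and T: "lp_op p M M T"
  and b: "\<And>i. i \<in> I ==> op_bd p M M (poly_op (\<phi> i) T) (C i)"
 shows "op_bd p M M (poly_op (\<Sum>i\<in>I. \<phi> i) T) (\<Sum>i\<in>I. C i)"
 using b
proof (induction I rule: infinite_finite_induct)
 case (insert i I)
 then show ?case by (simp add: op_bd_poly_add[OF p T])
qed (auto simp: op_bd_def poly_op_def)

text \<open>Strong limits of uniformly bounded operators. The limit is chosen on representatives
  without any coherence between the choices; linearity and compatibility with equality almost
  everywhere are recovered from uniqueness of limits. Both halves of the dilation are built in this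
  way.\<close>

lemma lp_op_limit:
 assumes p: "p \<ge> 1" and T: "\<And>n. lp_op p M N (T n)" and C: "\<And>n. op_bd p M N (T n) C"
  and Cau: "\<And>f. memLp p M f ==> lp_Cauchy p N (\<lambda>n. T n f)"
 shows "\<exists>S. lp_op p M N S \<and> op_bd p M N S C \<and> (\<forall>f. memLp p M f \<longrightarrow> (\<lambda>n. lp_norm p N (\<lambda>y. T n f y - S f y)) \<longlonglongrightarrow> 0)"
proof -
 have "\<exists>g. memLp p N g \<and> (\<lambda>n. lp_norm p N (\<lambda>y. T n f y - g y)) \<longlonglongrightarrow> 0" if f: "memLp p M f" for f :: "_ => complex"
  by (rule lp_complete[OF p lp_op_mem[OF T f] Cau[OF f]])
 then obtain S where S: "\<And>f. memLp p M f ==> memLp p N (S f)"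
  "\<And>f. memLp p M f ==> (\<lambda>n. lp_norm p N (\<lambda>y. T n f y - S f y)) \<longlonglongrightarrow> 0" by metis
 have Tm: "memLp p N (T n f)" if "memLp p M f" for n and f :: "_ => complex" by (rule lp_op_mem[OF T that])
 have uniq: "AE y in N. g y = h y"
  if g: "memLp p N g" and h: "memLp p N h" and ft: "\<And>n. memLp p N (t n)" and lg: "(\<lambda>n. lp_norm p N (\<lambda>y. t n y - g y)) \<longlonglongrightarrow> 0"
   and lh: "(\<lambda>n. lp_norm p N (\<lambda>y. t n y - h y)) \<longlonglongrightarrow> 0" for g h :: "'b => complex" and t
 proof -
  have "(\<lambda>n. lp_norm p N (\<lambda>y. t n y - g y) + lp_norm p N (\<lambda>y. t n y - h y)) \<longlonglongrightarrow> 0"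
   using tendsto_add[OF lg lh] by simp
  moreover have "lp_norm p N (\<lambda>y. g y - h y) \<le> lp_norm p N (\<lambda>y. t n y - g y) + lp_norm p N (\<lambda>y. t n y - h y)" for n
   using lp_norm_triangle_diff[OF p g ft h, of n] lp_norm_minus_commute[of p N g "t n"] by simp
  ultimately have "lp_norm p N (\<lambda>y. g y - h y) \<le> 0" by (intro LIMSEQ_le_const) auto
  then have "lp_norm p N (\<lambda>y. g y - h y) = 0" using lp_norm_nonneg antisym by blast
  then show ?thesis using lp_norm_eq_0_iff[of p N "\<lambda>y. g y - h y"] memLp_diff[OF p g h] p by simp
 qed
 have bd: "op_bd p M N S C" unfolding op_bd_def
 proof (intro conjI allI impI)
  show "C \<ge> 0" by (rule op_bd_nonneg[OF C])
  fix f :: "_ => complex" assume f: "memLp p M f"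
  have "lp_norm p N (S f) \<le> C * lp_norm p M f + lp_norm p N (\<lambda>y. T n f y - S f y)" for n
   using lp_norm_triangle_sub[OF p S(1)[OF f] Tm[OF f], of n] op_bdD[OF C f, of n]
    lp_norm_minus_commute[of p N "S f" "T n f"] by simp
  moreover have "(\<lambda>n. C * lp_norm p M f + lp_norm p N (\<lambda>y. T n f y - S f y)) \<longlonglongrightarrow> C * lp_norm p M f + 0"
   by (intro tendsto_intros S f)
  ultimately show "lp_norm p N (S f) \<le> C * lp_norm p M f"
   by (metis (no_types, lifting) LIMSEQ_le_const add_0_right)
 qed
 have "lp_op p M N S"
 proof (rule lp_opI[OF S(1) _ _ bd])
  fix f g :: "_ => complex" assume fg: "memLp p M f" "memLp p M g"
  { assume ae: "AE x in M. f x = g x"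
   have "lp_norm p N (\<lambda>y. T n g y - S f y) = lp_norm p N (\<lambda>y. T n f y - S f y)" for n
    using lp_op_cong[OF T fg ae, of n] Tm S fg
    by (intro lp_norm_cong_mem memLp_diff[OF p]) (auto elim!: eventually_mono)
   then show "AE y in N. S f y = S g y"
    by (intro uniq[where t="\<lambda>n. T n g"] S Tm fg) (simp add: S fg) }
  fix c
  have m: "memLp p M (\<lambda>x. f x + c * g x)" by (intro memLp_lincomb p fg)
  show "AE y in N. S (\<lambda>x. f x + c * g x) y = S f y + c * S g y"
  proof (rule uniq[where t="\<lambda>n. T n (\<lambda>x. f x + c * g x)"])
   show "memLp p N (\<lambda>y. S f y + c * S g y)" by (intro memLp_lincomb p S fg)
   have b1: "lp_norm p N (\<lambda>y. T n (\<lambda>x. f x + c * g x) y - (S f y + c * S g y))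
     \<le> lp_norm p N (\<lambda>y. T n f y - S f y) + norm c * lp_norm p N (\<lambda>y. T n g y - S g y)" for n
   proof -
    have "lp_norm p N (\<lambda>y. T n (\<lambda>x. f x + c * g x) y - (S f y + c * S g y))
     = lp_norm p N (\<lambda>y. (T n f y - S f y) + c * (T n g y - S g y))"
     using lp_op_lin[OF T fg, where c=c]
     by (intro lp_norm_cong_mem memLp_diff[OF p] memLp_lincomb[OF p] Tm m S fg)
      (auto simp: algebra_simps elim!: eventually_mono)
    also have "... \<le> lp_norm p N (\<lambda>y. T n f y - S f y) + norm c * lp_norm p N (\<lambda>y. T n g y - S g y)"
     using lp_norm_add[OF p memLp_diff[OF p Tm[OF fg(1)] S(1)[OF fg(1)]]
       memLp_scale[OF memLp_diff[OF p Tm[OF fg(2)] S(1)[OF fg(2)]]], of n c n] p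
     by (simp add: lp_norm_scale)
    finally show ?thesis .
   qed
   have "(\<lambda>n. lp_norm p N (\<lambda>y. T n f y - S f y) + norm c * lp_norm p N (\<lambda>y. T n g y - S g y)) \<longlonglongrightarrow> 0 + norm c * 0"
    by (intro tendsto_intros S fg)
   then have b2: "(\<lambda>n. lp_norm p N (\<lambda>y. T n f y - S f y) + norm c * lp_norm p N (\<lambda>y. T n g y - S g y)) \<longlonglongrightarrow> 0"
    by simp
   show "(\<lambda>n. lp_norm p N (\<lambda>y. T n (\<lambda>x. f x + c * g x) y - (S f y + c * S g y))) \<longlonglongrightarrow> 0"
    by (rule Lim_null_comparison[OF always_eventually b2]) (simp add: b1)
  qed (use S Tm m in auto)
 qed
 then show ?thesis using bd S(2) by blast
qed

section \<open>Duality\<close>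

lemma powr_strict_midpoint:
 fixes p u v :: real
 assumes p: "p > 1" and uv: "0 \<le> u" "u < v"
 shows "((u + v) / 2) powr p < (u powr p + v powr p) / 2"
proof -
 define m where "m = (u + v) / 2"
 have m: "u < m" "m < v" "v - m = m - u" using uv by (auto simp: m_def field_simps)
 have der: "((\<lambda>x. x powr p) has_real_derivative p * x powr (p - 1)) (at x)" if "x > 0" for x :: real
  using that by (auto intro!: derivative_eq_intros)
 have cont: "continuous_on {a..b} (\<lambda>x::real. x powr p)" if "a \<ge> 0" for a b
  using p that by (intro continuous_on_powr' continuous_intros) auto
 have mvt: "\<exists>z. a < z \<and> z < b \<and> b powr p - a powr p = (b - a) * (p * z powr (p - 1))" if ab: "0 \<le> a" "a < b" for a b :: real
 proof -
  have "\<exists>l z. a < z \<and> z < b \<and> DERIV (\<lambda>x. x powr p) z :> l \<and> b powr p - a powr p = (b - a) * l"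
  proof (rule MVT[OF ab(2) cont[OF ab(1)]])
   show "(\<lambda>x. x powr p) differentiable at x" if "a < x" "x < b" for x
    using der[of x] ab that by (auto simp: real_differentiable_def)
  qed
  then obtain l z where z: "a < z" "z < b" "DERIV (\<lambda>x. x powr p) z :> l" "b powr p - a powr p = (b - a) * l" by blast
  have "l = p * z powr (p - 1)" using z ab by (intro DERIV_unique[OF z(3) der]) auto
  then show ?thesis using z by blast
 qed
 obtain x where x: "u < x" "x < m" "m powr p - u powr p = (m - u) * (p * x powr (p - 1))"
  using mvt[of u m] uv m by auto
 obtain y where y: "m < y" "y < v" "v powr p - m powr p = (v - m) * (p * y powr (p - 1))"
  using mvt[of m v] uv m by auto
 have "x powr (p - 1) < y powr (p - 1)" using x y uv p by (intro powr_less_mono2) auto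
 then have "(m - u) * (p * x powr (p - 1)) < (v - m) * (p * y powr (p - 1))"
  using m p by simp
 then have "m powr p - u powr p < v powr p - m powr p" using x y by simp
 then show ?thesis by (simp add: m_def[symmetric])
qed

lemma norm_powr_convex:
 fixes a b :: complex
 assumes "p \<ge> 1" "0 \<le> s" "0 \<le> t" "s + t = 1"
 shows "norm (s * a + t * b) powr p \<le> s * norm a powr p + t * norm b powr p"
proof -
 have "norm (s * a + t * b) \<le> s * norm a + t * norm b"
  using norm_triangle_ineq[of "s * a" "t * b"] assms by (simp add: norm_mult)
 then have "norm (s * a + t * b) powr p \<le> (s * norm a + t * norm b) powr p"
  using assms by (intro powr_mono2) auto
 also have "... \<le> s * norm a powr p + t * norm b powr p"
 proof -
  have s: "s = 1 - t" using assms by simp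
  show ?thesis
   using convex_onD[OF powr_convex_nonneg[OF assms(1)], of t "norm a" "norm b"] assms
   unfolding s by simp
 qed
 finally show ?thesis .
qed

text \<open>Strictness has two sources: for equal moduli the parallelogram law, for different moduli
  the strict convexity of the power.\<close>

lemma norm_powr_midpoint_strict:
 fixes a b :: complex
 assumes p: "p > 1" and ne: "a \<noteq> b"
 shows "norm ((a + b) / 2) powr p < (norm a powr p + norm b powr p) / 2"
proof (cases "norm a = norm b")
 case True
 have "norm (a + b) < 2 * norm a"
 proof -
  have "(norm (a + b))^2 + (norm (a - b))^2 = 2 * (norm a)^2 + 2 * (norm b)^2"
   unfolding cmod_power2 by (simp add: power2_eq_square algebra_simps)
  moreover have "(norm (a - b))^2 > 0" using ne by simp
  ultimately have "(norm (a + b))^2 < 2 * (norm a)^2 + 2 * (norm b)^2" by linarith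
  also have "... = (2 * norm a)^2" using True by (simp add: power_mult_distrib)
  finally have "(norm (a + b))^2 < (2 * norm a)^2" .
  then show ?thesis by (rule power_less_imp_less_base) simp
 qed
 then have "norm ((a + b) / 2) < norm a" by (simp add: norm_divide)
 then have "norm ((a + b) / 2) powr p < norm a powr p" using p by (intro powr_less_mono2) auto
 then show ?thesis using True by simp
next
 case False
 have "norm ((a + b) / 2) powr p \<le> ((norm a + norm b) / 2) powr p"
  using p norm_triangle_ineq[of a b] by (intro powr_mono2) (auto simp: norm_divide)
 also have "... < (norm a powr p + norm b powr p) / 2"
  using powr_strict_midpoint[OF p, of "norm a" "norm b"] powr_strict_midpoint[OF p, of "norm b" "norm a"] False
  by (cases "norm a < norm b") (auto simp: add.commute)
 finally show ?thesis .
qed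

text \<open>Uniform convexity in pointwise form: by homogeneity only the unit sphere of pairs matters, and
  on its compact part where \<open>a\<close> and \<open>b\<close> are apart the convexity defect is bounded below.\<close>

lemma norm_powr_uniformly_convex:
 assumes p: "p > 1" and e: "e > 0"
 shows "\<exists>c\<ge>0. \<forall>a b :: complex. norm (a - b) powr p
  \<le> e * (norm a powr p + norm b powr p) + c * ((norm a powr p + norm b powr p) / 2 - norm ((a + b) / 2) powr p)"
proof -
 define D where "D z = (norm (fst z) powr p + norm (snd z) powr p) / 2 - norm ((fst z + snd z) / 2) powr p" for z :: "complex \<times> complex"
 define E where "E z = norm (fst z - snd z) powr p - e * (norm (fst z) powr p + norm (snd z) powr p)" for z :: "complex \<times> complex"
 have cD: "continuous_on UNIV D" and cE: "continuous_on UNIV E"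
  unfolding D_def E_def using p by (auto intro!: continuous_intros continuous_on_powr')
 \<comment> \<open>On the unit sphere off \<open>K\<close> the required bound is trivial because
   \<open>E\<close> is negative. On \<open>K\<close> the points \<open>fst z\<close> and
   \<open>snd z\<close> differ, so \<open>D\<close> has a positive minimum by compactness.\<close>
 define K where "K = sphere 0 1 \<inter> {z. E z \<ge> 0}"
 have comp: "compact K" unfolding K_def
  by (intro compact_Int_closed compact_sphere closed_Collect_le cE continuous_on_const)
 have D0: "D z \<ge> 0" for z
 proof (cases "fst z = snd z")
  case False
  from norm_powr_midpoint_strict[OF p this] show ?thesis by (simp add: D_def)
 qed (simp add: D_def)
 have DK: "D z > 0" if "z \<in> K" for z
 proof -
  have "fst z \<noteq> snd z"
  proof
   assume eq: "fst z = snd z"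
   then have "fst z \<noteq> 0" using that by (cases z) (auto simp: K_def norm_Pair)
   then have "e * (norm (fst z) powr p + norm (snd z) powr p) > 0"
    using e by (intro mult_pos_pos add_pos_nonneg) auto
   then show False using that eq p by (simp add: K_def E_def)
  qed
  from norm_powr_midpoint_strict[OF p this] show ?thesis by (simp add: D_def)
 qed
 obtain d where d: "d > 0" "\<And>z. z \<in> K ==> d \<le> D z"
 proof (cases "K = {}")
  case False
  then obtain z where "z \<in> K" "\<forall>y\<in>K. D z \<le> D y"
   using continuous_attains_inf[OF comp False continuous_on_subset[OF cD]] by auto
  then show ?thesis using DK that by blast
 qed (use that[of 1] in auto)
 have unit: "E z \<le> 2 powr p / d * D z" if z: "norm z = 1" for z
 proof (cases "E z \<ge> 0")
  case True
  have "E z \<le> norm (fst z - snd z) powr p" using e by (simp add: E_def)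
  also have "... \<le> 2 powr p"
  proof (rule powr_mono2)
   have "norm (fst z) \<le> 1" "norm (snd z) \<le> 1" using norm_fst_le[of "fst z" "snd z"] norm_snd_le[of "snd z" "fst z"] z by auto
   then show "norm (fst z - snd z) \<le> 2" using norm_triangle_ineq4[of "fst z" "snd z"] by linarith
  qed (use p in auto)
  also have "... = 2 powr p / d * d" using d by simp
  also have "... \<le> 2 powr p / d * D z" using d True z by (intro mult_left_mono d) (auto simp: K_def)
  finally show ?thesis .
 next
  case False
  have "0 \<le> 2 powr p / d * D z" using d D0 by (intro mult_nonneg_nonneg) auto
  then show ?thesis using False by linarith
 qed
 have hom: "E (r *\<^sub>R z) = r powr p * E z" "D (r *\<^sub>R z) = r powr p * D z" if "r \<ge> 0" for r z
 proof -
  have nr: "norm (r *\<^sub>R a) powr p = r powr p * norm a powr p" for a :: complex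
   using that by (simp add: powr_mult)
  have d1: "r *\<^sub>R fst z - r *\<^sub>R snd z = r *\<^sub>R (fst z - snd z)" by (simp add: scaleR_diff_right)
  have d2: "(r *\<^sub>R fst z + r *\<^sub>R snd z) / 2 = r *\<^sub>R ((fst z + snd z) / 2)"
   by (simp add: scaleR_conv_of_real algebra_simps)
  show "E (r *\<^sub>R z) = r powr p * E z" "D (r *\<^sub>R z) = r powr p * D z"
   unfolding E_def D_def fst_scaleR snd_scaleR d1 d2 nr by (simp_all add: algebra_simps add_divide_distrib)
 qed
 have all: "E z \<le> 2 powr p / d * D z" for z
 proof (cases "z = 0")
  case True
  then show ?thesis using p by (simp add: E_def D_def)
 next
  case False
  have "E z = norm z powr p * E (z /\<^sub>R norm z)" "D z = norm z powr p * D (z /\<^sub>R norm z)"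
   using hom[of "norm z" "z /\<^sub>R norm z"] False by simp_all
  moreover have "E (z /\<^sub>R norm z) \<le> 2 powr p / d * D (z /\<^sub>R norm z)" by (rule unit) (use False in simp)
  ultimately show ?thesis
   using mult_left_mono[of "E (z /\<^sub>R norm z)" "2 powr p / d * D (z /\<^sub>R norm z)" "norm z powr p"] by (simp add: algebra_simps)
 qed
 show ?thesis
 proof (intro exI[of _ "2 powr p / d"] conjI allI)
  show "2 powr p / d \<ge> 0" using d by simp
  fix a b :: complex
  show "norm (a - b) powr p \<le> e * (norm a powr p + norm b powr p) + 2 powr p / d * ((norm a powr p + norm b powr p) / 2 - norm ((a + b) / 2) powr p)"
   using all[of "(a, b)"] by (simp add: E_def D_def)
 qed
qed

text \<open>For nonzero \<open>a\<close> the chain rule applies to the power \<open>p / 2\<close> of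
  the squared modulus. At \<open>a = 0\<close> the difference quotient has modulus
  \<open>|t| powr (p - 1)\<close> times a constant, and \<open>p > 1\<close> makes it
  vanish.\<close>

lemma norm_powr_deriv:
 fixes a b :: complex
 assumes p: "p > 1"
 shows "((\<lambda>t. norm (a + of_real t * b) powr p) has_real_derivative p * norm a powr (p - 2) * Re (cnj a * b)) (at 0)"
proof (cases "a = 0")
 case False
 define s where "s t = (norm a)^2 + 2 * t * Re (cnj a * b) + t^2 * (norm b)^2" for t :: real
 have s: "norm (a + of_real t * b) powr p = s t powr (p / 2)" for t
 proof -
  have "s t = (norm (a + of_real t * b))^2"
   unfolding s_def cmod_power2 by (simp add: power2_eq_square algebra_simps)
  also have "... = norm (a + of_real t * b) powr 2" by simp
  finally show ?thesis by (simp only: powr_powr) simp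
 qed
 have s0: "s 0 = (norm a)^2" by (simp add: s_def)
 have ds: "(s has_real_derivative 2 * Re (cnj a * b)) (at 0)"
  unfolding s_def by (auto intro!: derivative_eq_intros)
 have "((\<lambda>t. s t powr (p / 2)) has_real_derivative p / 2 * s 0 powr (p / 2 - 1) * (2 * Re (cnj a * b))) (at 0)"
  using DERIV_fun_powr[OF ds, of "p/2"] False s0 by (simp add: mult.assoc)
 moreover have "s 0 powr (p / 2 - 1) = norm a powr (p - 2)"
 proof -
  have "s 0 = norm a powr 2" using s0 by simp
  then show ?thesis by (simp only: powr_powr) (simp add: algebra_simps)
 qed
 ultimately show ?thesis unfolding s by (simp add: add_divide_distrib distrib_left mult.assoc)
next
 case True
 have "((\<lambda>h. norm (of_real h * b) powr p / h) \<longlongrightarrow> 0) (at 0)"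
 proof (rule Lim_null_comparison)
  have "\<bar>norm (of_real h * b) powr p / h\<bar> \<le> \<bar>h\<bar> powr (p - 1) * norm b powr p" if "h \<noteq> 0" for h :: real
   using that by (simp add: norm_mult powr_mult powr_diff)
  then show "\<forall>\<^sub>F h in at 0. norm (norm (of_real h * b) powr p / h) \<le> \<bar>h\<bar> powr (p - 1) * norm b powr p"
   by (auto simp: eventually_at intro!: exI[of _ 1])
  have "((\<lambda>h::real. \<bar>h\<bar> powr (p - 1)) \<longlongrightarrow> \<bar>0\<bar> powr (p - 1)) (at 0)"
   using p by (intro tendsto_powr' tendsto_rabs tendsto_ident_at tendsto_const) auto
  then show "((\<lambda>h. \<bar>h\<bar> powr (p - 1) * norm b powr p) \<longlongrightarrow> 0) (at 0)"
   using tendsto_mult_left_zero by fastforce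
 qed
 then show ?thesis using True p by (simp add: DERIV_def)
qed

text \<open>A bounded functional on \<open>L\<^sup>p\<close> is represented by the minimiser of
  \<open>f \<mapsto> \<integral>|f|\<^sup>p - Re (\<phi> f)\<close>; uniform convexity makes minimising sequences converge, so no
  \<open>\<sigma>\<close>-finiteness is needed.\<close>

lemma lp_dual_minimizer:
 fixes \<phi> :: "('a => complex) => complex"
 assumes pq: "conj_exp p q"
  and lin: "\<And>f g c. memLp p M f ==> memLp p M g ==> \<phi> (\<lambda>x. f x + c * g x) = \<phi> f + c * \<phi> g"
  and bd: "\<And>f. memLp p M f ==> norm (\<phi> f) \<le> C * lp_norm p M f"
 shows "\<exists>f. memLp p M f \<and> (\<forall>g. memLp p M g \<longrightarrow>
  (\<integral>x. norm (f x) powr p \<partial>M) - Re (\<phi> f) \<le> (\<integral>x. norm (g x) powr p \<partial>M) - Re (\<phi> g))"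
proof -
 have p: "p > 1" "p \<ge> 1" "p > 0" "q > 1" "1/p + 1/q = 1" using pq by (auto simp: conj_exp_def)
 define I where "I f = (\<integral>x. norm (f x) powr p \<partial>M)" for f :: "'a => complex"
 define J where "J f = I f - Re (\<phi> f)" for f
 have I_eq: "I f = lp_norm p M f powr p" for f using p by (simp add: I_def lp_norm_powr)
 define L where "L = \<bar>C\<bar> powr q / q"
 \<comment> \<open>Young's inequality makes the functional coercive: \<open>J\<close> is bounded
   below and controls \<open>I\<close>.\<close>
 have Re_le: "Re (\<phi> f) \<le> I f / p + L" if f: "memLp p M f" for f
 proof -
  have "Re (\<phi> f) \<le> C * lp_norm p M f" using bd[OF f] complex_Re_le_cmod[of "\<phi> f"] by linarith
  also have "... \<le> lp_norm p M f * \<bar>C\<bar>" by (simp add: mult.commute[of _ "\<bar>C\<bar>"] mult_right_mono)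
  also have "... \<le> lp_norm p M f powr p / p + \<bar>C\<bar> powr q / q"
   by (rule Youngs_inequality) (use p in auto)
  finally show ?thesis by (simp add: I_eq L_def)
 qed
 have J_lower: "I f * (1 - 1/p) \<le> J f + L" if f: "memLp p M f" for f
  using Re_le[OF f] by (simp add: J_def algebra_simps)
 have pp: "1 - 1/p > 0" using p by simp
 define S where "S = J ` {f. memLp p M f}"
 have bdd: "bdd_below S"
 proof (rule bdd_belowI)
  fix y assume "y \<in> S"
  then obtain f where f: "memLp p M f" "y = J f" by (auto simp: S_def)
  have "0 \<le> I f * (1 - 1/p)" using pp by (simp add: I_eq)
  then show "- L \<le> y" using J_lower[OF f(1)] f(2) by linarith
 qed
 have ne: "S \<noteq> {}" using memLp_zero[of p M] unfolding S_def by blast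
 define m where "m = Inf S"
 have m_le: "m \<le> J f" if "memLp p M f" for f
  unfolding m_def using that bdd by (intro cInf_lower) (auto simp: S_def)
 have "\<exists>f. memLp p M f \<and> J f < m + 1 / real (Suc n)" for n
 proof -
  have "Inf S < m + 1 / real (Suc n)" by (simp add: m_def)
  then show ?thesis using cInf_lessD[OF ne] unfolding S_def by blast
 qed
 then obtain F where F: "\<And>n. memLp p M (F n)" "\<And>n. J (F n) < m + 1 / real (Suc n)" by metis
 define B where "B = (m + 1 + L) / (1 - 1/p)"
 have IB: "I (F n) \<le> B" for n
 proof -
  have "1 / real (Suc n) \<le> 1" by simp
  then have "I (F n) * (1 - 1/p) \<le> m + 1 + L" using J_lower[OF F(1)[of n]] F(2)[of n] by linarith
  then show ?thesis unfolding B_def using pp by (simp add: pos_le_divide_eq)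
 qed
 have B0: "B \<ge> 0" using IB[of 0] by (auto simp: I_eq intro: order_trans[rotated])
 have int: "integrable M (\<lambda>x. norm (f x) powr p)" if "memLp p M f" for f :: "'a => complex"
  using that by (simp add: memLp_def)
 have mid: "memLp p M (\<lambda>x. (F k x + F l x) / 2)" for k l
  using memLp_scale[OF memLp_add[OF p(2) F(1) F(1)], of "1/2" k l] by simp
 have phi0: "\<phi> (\<lambda>x. 0) = 0"
 proof -
  have "\<phi> (\<lambda>x. 0 + 1 * 0) = \<phi> (\<lambda>x. 0) + 1 * \<phi> (\<lambda>x. 0)" by (rule lin) auto
  then show ?thesis by simp
 qed
 have phi_mid: "\<phi> (\<lambda>x. (F k x + F l x) / 2) = (\<phi> (F k) + \<phi> (F l)) / 2" for k l
 proof -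
  have "\<phi> (\<lambda>x. F k x / 2) = \<phi> (F k) / 2" for k
   using lin[OF memLp_zero F(1), of "1/2" k] phi0 by simp
  moreover have "memLp p M (\<lambda>x. F k x / 2)" for k using memLp_scale[OF F(1), of "1/2" k] by simp
  ultimately show ?thesis
   using lin[of "\<lambda>x. F k x / 2" "F l" "1/2"] F(1) by (simp add: add_divide_distrib)
 qed
 define D where "D k l x = (norm (F k x) powr p + norm (F l x) powr p) / 2 - norm ((F k x + F l x) / 2) powr p" for k l x
 \<comment> \<open>The linear part cancels at midpoints, so the convexity defect of the p-th powers
   equals that of \<open>J\<close>, which is small along a minimising sequence.\<close>
 have defect: "(\<integral>x. D k l x \<partial>M) \<le> 1 / real (Suc k) + 1 / real (Suc l)" for k l
 proof -
  have "(\<integral>x. D k l x \<partial>M) = (I (F k) + I (F l)) / 2 - I (\<lambda>x. (F k x + F l x) / 2)"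
   unfolding D_def I_def using int[OF F(1)] int[OF mid] by simp
  also have "... = (J (F k) + J (F l)) / 2 - J (\<lambda>x. (F k x + F l x) / 2)"
   unfolding J_def by (simp add: phi_mid field_simps)
  also have "... \<le> (m + 1 / real (Suc k) + (m + 1 / real (Suc l))) / 2 - m"
   using F(2)[of k] F(2)[of l] m_le[OF mid, of k l]
   by (intro diff_mono divide_right_mono add_mono) (auto intro: less_imp_le)
  also have "... = (1 / real (Suc k) + 1 / real (Suc l)) / 2"
  proof -
   have "(m + x + (m + y)) / 2 - m = (x + y) / 2" for x y by (simp add: field_simps)
   then show ?thesis .
  qed
  also have "... \<le> 1 / real (Suc k) + 1 / real (Suc l)"
  proof -
   have half: "(x + y) / 2 \<le> x + y" if "x \<ge> 0" "y \<ge> 0" for x y :: real using that by simp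
   show ?thesis by (rule half) auto
  qed
  finally show ?thesis .
 qed
 have "lp_Cauchy p M F"
  unfolding lp_Cauchy_def
 proof (intro allI impI)
  fix r :: real assume r: "r > 0"
  \<comment> \<open>With this \<open>e\<close> the first term of the uniform convexity bound is at
    most half of \<open>r powr p\<close>, whatever \<open>c\<close> turns out to be;
    \<open>N\<close> then takes care of the second term.\<close>
  define e where "e = r powr p / (4 * (B + 1))"
  have e: "e > 0" using r B0 by (simp add: e_def)
  obtain c where c: "c \<ge> 0" "\<And>a b :: complex. norm (a - b) powr p
    \<le> e * (norm a powr p + norm b powr p) + c * ((norm a powr p + norm b powr p) / 2 - norm ((a + b) / 2) powr p)"
   using norm_powr_uniformly_convex[OF p(1) e] by blast
  obtain N where N: "N > 0" "c / real N < r powr p / 4"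
  proof -
   obtain N :: nat where N: "4 * c / r powr p < real N" using reals_Archimedean2 by blast
   have "4 * c / r powr p \<ge> 0" using c by simp
   then have "N > 0" using N by (cases N) auto
   moreover have "c / real N < r powr p / 4" using N r \<open>N > 0\<close> by (simp add: field_simps)
   ultimately show ?thesis by (rule that)
  qed
  show "\<exists>N. \<forall>m\<ge>N. \<forall>n\<ge>N. lp_norm p M (\<lambda>x. F m x - F n x) < r"
  proof (intro exI[of _ N] allI impI)
   fix k l assume kl: "k \<ge> N" "l \<ge> N"
   have iD: "integrable M (D k l)" unfolding D_def using int[OF F(1)] int[OF mid] by auto
   have "I (\<lambda>x. F k x - F l x) \<le> (\<integral>x. e * (norm (F k x) powr p + norm (F l x) powr p) + c * D k l x \<partial>M)"
    unfolding I_def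
   proof (rule integral_mono[OF int[OF memLp_diff[OF p(2) F(1) F(1)]]])
    show "integrable M (\<lambda>x. e * (norm (F k x) powr p + norm (F l x) powr p) + c * D k l x)"
     using int[OF F(1)] iD by auto
    show "norm (F k x - F l x) powr p \<le> e * (norm (F k x) powr p + norm (F l x) powr p) + c * D k l x" for x
     unfolding D_def by (rule c(2))
   qed
   also have "... = e * (I (F k) + I (F l)) + c * (\<integral>x. D k l x \<partial>M)"
    unfolding I_def using int[OF F(1)] iD by simp
   also have "... \<le> e * (B + B) + c * (1 / real (Suc k) + 1 / real (Suc l))"
    using e c IB defect by (intro add_mono mult_left_mono) auto
   also have "... \<le> e * (2 * B) + c * (1 / real N + 1 / real N)"
   proof -
    have "1 / real (Suc k) \<le> 1 / real N" "1 / real (Suc l) \<le> 1 / real N"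
     using kl N by (auto intro!: divide_left_mono)
    then show ?thesis using c(1) e by (intro add_mono mult_left_mono) auto
   qed
   also have "... < r powr p"
   proof -
    have "e * (2 * B) \<le> r powr p / 2" using r B0 by (simp add: e_def field_simps)
    moreover have "c * (1 / real N + 1 / real N) = c / real N + c / real N" by (simp add: distrib_left)
    ultimately show ?thesis using N(2) by linarith
   qed
   finally have lt: "lp_norm p M (\<lambda>x. F k x - F l x) powr p < r powr p" by (simp add: I_eq)
   show "lp_norm p M (\<lambda>x. F k x - F l x) < r"
   proof (rule ccontr)
    assume "\<not> lp_norm p M (\<lambda>x. F k x - F l x) < r"
    then have "r powr p \<le> lp_norm p M (\<lambda>x. F k x - F l x) powr p" using r p by (intro powr_mono2) auto
    then show False using lt by simp
   qed
  qed
 qed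
 from lp_complete[OF p(2) F(1) this] obtain f where f: "memLp p M f"
  "(\<lambda>n. lp_norm p M (\<lambda>x. F n x - f x)) \<longlonglongrightarrow> 0" by blast
 have "(\<lambda>n. lp_norm p M (F n) - lp_norm p M f) \<longlonglongrightarrow> 0"
 proof (rule Lim_null_comparison[OF always_eventually f(2)], intro allI)
  fix n show "norm (lp_norm p M (F n) - lp_norm p M f) \<le> lp_norm p M (\<lambda>x. F n x - f x)"
   using lp_norm_triangle_sub[OF p(2) F(1) f(1), of n] lp_norm_triangle_sub[OF p(2) f(1) F(1), of n]
    lp_norm_minus_commute[of p M f "F n"] by simp
 qed
 then have n1: "(\<lambda>n. lp_norm p M (F n)) \<longlonglongrightarrow> lp_norm p M f" by (simp add: LIM_zero_iff)
 have "(\<lambda>n. \<phi> (F n) - \<phi> f) \<longlonglongrightarrow> 0"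
 proof (rule Lim_null_comparison[OF always_eventually tendsto_mult_right_zero[OF f(2)]], intro allI)
  fix n show "norm (\<phi> (F n) - \<phi> f) \<le> C * lp_norm p M (\<lambda>x. F n x - f x)"
   using bd[OF memLp_diff[OF p(2) F(1) f(1)], of n] lin[OF F(1) f(1), of n "-1"] by simp
 qed
 then have n2: "(\<lambda>n. \<phi> (F n)) \<longlonglongrightarrow> \<phi> f" by (simp add: LIM_zero_iff)
 have "(\<lambda>n. J (F n)) \<longlonglongrightarrow> J f"
  unfolding J_def I_eq using p by (intro tendsto_diff tendsto_powr' n1 tendsto_Re n2) auto
 moreover have "(\<lambda>n. m + 1 / real (Suc n)) \<longlonglongrightarrow> m + 0"
  by (intro tendsto_intros LIMSEQ_Suc[OF lim_1_over_n])
 ultimately have "J f \<le> m + 0"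
  by (rule LIMSEQ_le) (use F(2) in \<open>auto intro: less_imp_le\<close>)
 then have "\<forall>g. memLp p M g \<longrightarrow> J f \<le> J g" using m_le by fastforce
 then show ?thesis using f(1) unfolding J_def I_def by blast
qed

text \<open>The representation is the Euler-Lagrange equation of the minimiser \<open>f\<close>: the
  functional is the directional derivative at \<open>f\<close> of the integral of the p-th power,
  and the density of that derivative is \<open>p |f|^(p-2) cnj f\<close>.\<close>

theorem lp_dual_representation:
 fixes \<phi> :: "('a => complex) => complex"
 assumes pq: "conj_exp p q"
  and lin: "\<And>f g c. memLp p M f ==> memLp p M g ==> \<phi> (\<lambda>x. f x + c * g x) = \<phi> f + c * \<phi> g"
  and bd: "\<And>f. memLp p M f ==> norm (\<phi> f) \<le> C * lp_norm p M f"
 shows "\<exists>h. memLp q M h \<and> (\<forall>f. memLp p M f \<longrightarrow> \<phi> f = (\<integral>x. f x * h x \<partial>M))"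
proof -
 have p: "p > 1" "p \<ge> 1" "p > 0" "q > 1" "1/p + 1/q = 1" using pq by (auto simp: conj_exp_def)
 obtain f where f: "memLp p M f" and min: "\<And>g. memLp p M g ==>
   (\<integral>x. norm (f x) powr p \<partial>M) - Re (\<phi> f) \<le> (\<integral>x. norm (g x) powr p \<partial>M) - Re (\<phi> g)"
  using lp_dual_minimizer[of p q M \<phi> C, OF pq lin bd] by blast
 have [measurable]: "f \<in> borel_measurable M" using f by (rule memLp_meas)
 define h where "h x = of_real (p * norm (f x) powr (p - 2)) * cnj (f x)" for x
 have [measurable]: "(\<lambda>x. cnj (f x)) \<in> borel_measurable M"
  by (rule borel_measurable_continuous_on[where f=cnj]) (auto intro: continuous_intros)
 have hm [measurable]: "h \<in> borel_measurable M" unfolding h_def by measurable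
 have nh: "norm (h x) powr q = p powr q * norm (f x) powr p" for x
 proof (cases "f x = 0")
  case False
  have "norm (h x) = p * norm (f x) powr (p - 1)"
  proof -
   have "norm (f x) powr (p - 2) * norm (f x) = norm (f x) powr (p - 2) * norm (f x) powr 1"
    using False by simp
   also have "... = norm (f x) powr (p - 1)" by (subst powr_add[symmetric]) simp
   finally show ?thesis using p by (simp add: h_def norm_mult mult.assoc)
  qed
  moreover have "(p - 1) * q = p" using p by (simp add: field_simps)
  ultimately show ?thesis using p by (simp add: powr_mult powr_powr)
 qed (use p in \<open>simp add: h_def\<close>)
 have h: "memLp q M h" using f by (simp add: memLp_def nh)
 have int: "integrable M (\<lambda>x. norm (g x) powr p)" if "memLp p M g" for g :: "'a => complex"
  using that by (simp add: memLp_def)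
 \<comment> \<open>Only increments with \<open>t > 0\<close> are used, which yields an inequality.
   Applying it to the four multiples of \<open>g\<close> by 1, -1, \<open>\<i>\<close> and
   \<open>-\<i>\<close> turns it into an equality of complex numbers.\<close>
 have key: "Re (\<phi> g) \<le> Re (\<integral>x. g x * h x \<partial>M)" if g: "memLp p M g" for g
 proof -
  have [measurable]: "g \<in> borel_measurable M" using g by (rule memLp_meas)
  define t where "t n = 1 / real (Suc n)" for n
  have t: "0 < t n" "t n \<le> 1" for n by (auto simp: t_def)
  have fg: "memLp p M (\<lambda>x. f x + of_real (t n) * g x)" for n by (intro memLp_lincomb p f g)
  define Q where "Q n x = (norm (f x + of_real (t n) * g x) powr p - norm (f x) powr p) / t n" for n x
  have "(\<lambda>n. \<integral>x. Q n x \<partial>M) \<longlonglongrightarrow> (\<integral>x. Re (g x * h x) \<partial>M)"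
  proof (rule integral_dominated_convergence)
   show "integrable M (\<lambda>x. norm (f x + g x) powr p + norm (f x - g x) powr p + 2 * norm (f x) powr p)"
    using int[OF memLp_add[OF p(2) f g]] int[OF memLp_diff[OF p(2) f g]] int[OF f] by auto
   show "AE x in M. (\<lambda>n. Q n x) \<longlonglongrightarrow> Re (g x * h x)"
   proof (rule AE_I2)
    fix x
    have eq: "p * norm (f x) powr (p - 2) * Re (cnj (f x) * g x) = Re (g x * h x)"
     by (simp add: h_def algebra_simps)
    have "((\<lambda>s. (norm (f x + of_real s * g x) powr p - norm (f x) powr p) / s) \<longlongrightarrow> Re (g x * h x)) (at 0)"
     using norm_powr_deriv[OF p(1), of "f x" "g x"] unfolding DERIV_def eq by simp
    moreover have "filterlim t (at 0) sequentially"
    proof (rule filterlim_atI)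
     show "t \<longlonglongrightarrow> 0" unfolding t_def by (rule LIMSEQ_Suc[OF lim_1_over_n])
     show "\<forall>\<^sub>F n in sequentially. t n \<noteq> 0" using t by (auto simp: less_imp_neq[symmetric])
    qed
    ultimately show "(\<lambda>n. Q n x) \<longlonglongrightarrow> Re (g x * h x)"
     unfolding Q_def by (rule filterlim_compose)
   qed
   \<comment> \<open>Convexity bounds the quotients from both sides: \<open>f + t g\<close> lies on
     the segment from \<open>f\<close> to \<open>f + g\<close>, and \<open>f\<close> lies on the
     segment from \<open>f - g\<close> to \<open>f + t g\<close>.\<close>
   show "AE x in M. norm (Q n x) \<le> norm (f x + g x) powr p + norm (f x - g x) powr p + 2 * norm (f x) powr p" for n
   proof (rule AE_I2)
    fix x
    let ?t = "t n" and ?a = "f x" and ?b = "g x"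
    have "norm (of_real (1 - ?t) * ?a + of_real ?t * (?a + ?b)) powr p \<le> (1 - ?t) * norm ?a powr p + ?t * norm (?a + ?b) powr p"
     by (rule norm_powr_convex) (use p t[of n] in auto)
    moreover have "of_real (1 - ?t) * ?a + of_real ?t * (?a + ?b) = ?a + of_real ?t * ?b" by (simp add: algebra_simps)
    ultimately have "norm (?a + of_real ?t * ?b) powr p - norm ?a powr p \<le> ?t * (norm (?a + ?b) powr p - norm ?a powr p)"
     by (simp add: algebra_simps)
    then have up: "Q n x \<le> norm (?a + ?b) powr p - norm ?a powr p"
     unfolding Q_def using t[of n] by (simp add: pos_divide_le_eq mult.commute)
    let ?s = "1 / (1 + ?t)"
    have "norm (of_real ?s * (?a + of_real ?t * ?b) + of_real (?t * ?s) * (?a - ?b)) powr p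
      \<le> ?s * norm (?a + of_real ?t * ?b) powr p + ?t * ?s * norm (?a - ?b) powr p"
     by (rule norm_powr_convex) (use p t[of n] in \<open>auto simp: field_simps\<close>)
    moreover have "of_real ?s * (?a + of_real ?t * ?b) + of_real (?t * ?s) * (?a - ?b) = ?a"
    proof -
     have "c * (?a + u * ?b) + u * c * (?a - ?b) = (c * (1 + u)) * ?a" for c u
      by (simp add: algebra_simps)
     then have "of_real ?s * (?a + of_real ?t * ?b) + of_real (?t * ?s) * (?a - ?b) = of_real (?s * (1 + ?t)) * ?a"
      by (simp only: of_real_mult of_real_add of_real_1)
     also have "?s * (1 + ?t) = 1" using t(1)[of n] by simp
     finally show ?thesis by simp
    qed
    ultimately have "norm ?a powr p \<le> ?s * (norm (?a + of_real ?t * ?b) powr p + ?t * norm (?a - ?b) powr p)"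
     by (simp add: algebra_simps)
    then have "(1 + ?t) * norm ?a powr p \<le> norm (?a + of_real ?t * ?b) powr p + ?t * norm (?a - ?b) powr p"
     using t(1)[of n] by (simp add: field_simps)
    then have "?t * (norm ?a powr p - norm (?a - ?b) powr p) \<le> norm (?a + of_real ?t * ?b) powr p - norm ?a powr p"
     by (simp add: algebra_simps)
    then have lo: "norm ?a powr p - norm (?a - ?b) powr p \<le> Q n x"
     unfolding Q_def using t[of n] by (simp add: pos_le_divide_eq mult.commute)
    have nn: "norm ?a powr p \<ge> 0" "norm (?a + ?b) powr p \<ge> 0" "norm (?a - ?b) powr p \<ge> 0" by auto
    show "norm (Q n x) \<le> norm (?a + ?b) powr p + norm (?a - ?b) powr p + 2 * norm ?a powr p"
     unfolding real_norm_def using up lo nn by (intro abs_leI) linarith+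
   qed
  qed (auto simp: Q_def)
  moreover have "Re (\<phi> g) \<le> (\<integral>x. Q n x \<partial>M)" for n
  proof -
   have "(\<integral>x. Q n x \<partial>M) = ((\<integral>x. norm (f x + of_real (t n) * g x) powr p \<partial>M) - (\<integral>x. norm (f x) powr p \<partial>M)) / t n"
    unfolding Q_def using int[OF fg] int[OF f] by simp
   moreover have "t n * Re (\<phi> g) \<le> (\<integral>x. norm (f x + of_real (t n) * g x) powr p \<partial>M) - (\<integral>x. norm (f x) powr p \<partial>M)"
    using min[OF fg, of n] lin[OF f g, of "of_real (t n)"] by simp
   ultimately show ?thesis using t(1)[of n] by (simp add: pos_le_divide_eq mult.commute)
  qed
  ultimately have "Re (\<phi> g) \<le> (\<integral>x. Re (g x * h x) \<partial>M)" by (intro LIMSEQ_le_const) auto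
  also have "... = Re (\<integral>x. g x * h x \<partial>M)" by (rule integral_Re[OF Hoelder_integrable[OF pq g h]])
  finally show ?thesis .
 qed
 have scale: "\<phi> (\<lambda>x. c * g x) = c * \<phi> g" if g: "memLp p M g" for g c
 proof -
  have "\<phi> (\<lambda>x. 0 + 1 * 0) = \<phi> (\<lambda>x. 0) + 1 * \<phi> (\<lambda>x. 0)" by (rule lin) auto
  then show ?thesis using lin[OF memLp_zero g, of c] by simp
 qed
 have re: "Re (c * \<phi> g) \<le> Re (c * (\<integral>x. g x * h x \<partial>M))" if g: "memLp p M g" for g c
  using key[OF memLp_scale[OF g, of c]] scale[OF g, of c] Hoelder_integrable[OF pq g h] by (simp add: mult.assoc)
 have "\<phi> g = (\<integral>x. g x * h x \<partial>M)" if g: "memLp p M g" for g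
  using re[OF g, of 1] re[OF g, of "-1"] re[OF g, of \<i>] re[OF g, of "-\<i>"] by (intro complex_eqI) auto
 then show ?thesis using h by blast
qed

section \<open>Adjoints and L^p spaces with values in l^2\<close>

definition is_adj :: "real => real => 'a measure => (('a => complex) => ('a => complex)) => (('a => complex) => ('a => complex)) => bool" where
 "is_adj p q M T S \<longleftrightarrow> lp_op p M M T \<and> lp_op q M M S \<and>
   (\<forall>x y. memLp p M x \<longrightarrow> memLp q M y \<longrightarrow> (\<integral>w. T x w * y w \<partial>M) = (\<integral>w. x w * S y w \<partial>M))"

lemma is_adjD:
 assumes "is_adj p q M T S" "memLp p M x" "memLp q M y"
 shows "(\<integral>w. T x w * y w \<partial>M) = (\<integral>w. x w * S y w \<partial>M)"
 using assms by (simp add: is_adj_def)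

text \<open>The norm of \<open>L^p(M; l^2(I))\<close> for finite \<open>I\<close>. Over an infinite
  index set the sum is 0 by convention, and so is the norm.\<close>

definition mixn :: "real => 'a measure => 'i set => ('i => 'a => complex) => real" where
 "mixn p M I x = lp_norm p M (\<lambda>w. L2_set (\<lambda>i. cmod (x i w)) I)"

lemma mixn_nonneg [simp]: "mixn p M I x \<ge> 0"
 by (simp add: mixn_def)

lemma L2_set_measurable [measurable]:
 assumes "\<And>i. i \<in> I ==> f i \<in> borel_measurable M"
 shows "(\<lambda>w. L2_set (\<lambda>i. f i w :: real) I) \<in> borel_measurable M"
 unfolding L2_set_def using assms by measurable

lemma memLp_L2:
 fixes x :: "'i => 'a => complex"
 assumes p: "p \<ge> 1" and x: "\<And>i. i \<in> I ==> memLp p M (x i)"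
 shows "memLp p M (\<lambda>w. L2_set (\<lambda>i. cmod (x i w)) I)"
  and mixn_le_sum: "mixn p M I x \<le> (\<Sum>i\<in>I. lp_norm p M (x i))"
proof -
 have n: "memLp p M (\<lambda>w. cmod (x i w))" if "i \<in> I" for i using x[OF that] by (rule memLp_norm_iff)
 have m: "(\<lambda>w. L2_set (\<lambda>i. cmod (x i w)) I) \<in> borel_measurable M"
  using memLp_meas[OF n] by (intro L2_set_measurable)
 have le: "AE w in M. norm (L2_set (\<lambda>i. cmod (x i w)) I) \<le> norm (\<Sum>i\<in>I. cmod (x i w))"
  by (auto intro!: AE_I2 L2_set_le_sum simp: sum_nonneg)
 note b = memLp_bound[OF _ memLp_sum[OF p n] m le]
 show "memLp p M (\<lambda>w. L2_set (\<lambda>i. cmod (x i w)) I)" using b(1) p by simp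
 have "mixn p M I x \<le> lp_norm p M (\<lambda>w. \<Sum>i\<in>I. cmod (x i w))" unfolding mixn_def using b(2) p by simp
 also have "... \<le> (\<Sum>i\<in>I. lp_norm p M (\<lambda>w. cmod (x i w)))" by (rule lp_norm_sum[OF p n])
 finally show "mixn p M I x \<le> (\<Sum>i\<in>I. lp_norm p M (x i))" by simp
qed

lemma mixn_mono:
 fixes x :: "'i => 'a => complex" and y :: "'j => 'a => complex"
 assumes p: "p \<ge> 1" and x: "\<And>i. i \<in> I ==> memLp p M (x i)" and y: "\<And>i. i \<in> J ==> memLp p M (y i)"
  and c: "c \<ge> 0"
  and le: "AE w in M. (\<Sum>i\<in>I. (cmod (x i w))^2) \<le> c^2 * (\<Sum>j\<in>J. (cmod (y j w))^2)"
 shows "mixn p M I x \<le> c * mixn p M J y"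
proof -
 note m = memLp_L2(1)[of p I M x, OF p x] memLp_L2(1)[of p J M y, OF p y]
 have ae: "AE w in M. norm (L2_set (\<lambda>i. cmod (x i w)) I) \<le> norm (c * L2_set (\<lambda>i. cmod (y i w)) J)"
  using le
 proof eventually_elim
  case (elim w)
  have "sqrt (\<Sum>i\<in>I. (cmod (x i w))^2) \<le> sqrt (c^2 * (\<Sum>j\<in>J. (cmod (y j w))^2))" using elim by simp
  then show ?case using c by (simp add: L2_set_def real_sqrt_mult sum_nonneg)
 qed
 have "mixn p M I x \<le> lp_norm p M (\<lambda>w. c * L2_set (\<lambda>i. cmod (y i w)) J)"
  unfolding mixn_def by (rule memLp_bound(2)[OF _ memLp_scale[OF m(2)] memLp_meas[OF m(1)] ae]) (use p in auto)
 then show ?thesis using p c by (simp add: lp_norm_scale mixn_def)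
qed

lemma mixn_cong_AE:
 fixes x y :: "'i => 'a => complex"
 assumes p: "p \<ge> 1" and I: "finite I" and x: "\<And>i. i \<in> I ==> memLp p M (x i)" and y: "\<And>i. i \<in> I ==> memLp p M (y i)"
  and eq: "\<And>i. i \<in> I ==> AE w in M. cmod (x i w) = cmod (y i w)"
 shows "mixn p M I x = mixn p M I y"
proof -
 have ae: "AE w in M. \<forall>i\<in>I. cmod (x i w) = cmod (y i w)" by (rule AE_finite_allI[OF I eq])
 then have "AE w in M. L2_set (\<lambda>i. cmod (x i w)) I = L2_set (\<lambda>i. cmod (y i w)) I"
  by eventually_elim (auto intro: L2_set_cong)
 then show ?thesis
  unfolding mixn_def by (intro lp_norm_cong_mem memLp_L2(1) p x y)
qed

lemma mixn_single: "mixn p M {i} x = lp_norm p M (x i)"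
 by (simp add: mixn_def)

lemma mixn_add:
 fixes x y :: "'i => 'a => complex"
 assumes p: "p \<ge> 1" and x: "\<And>i. i \<in> I ==> memLp p M (x i)" and y: "\<And>i. i \<in> I ==> memLp p M (y i)"
 shows "mixn p M I (\<lambda>i w. x i w + y i w) \<le> mixn p M I x + mixn p M I y"
proof -
 note m = memLp_L2(1)[of p I M x, OF p x] memLp_L2(1)[of p I M y, OF p y]
 have le: "norm (L2_set (\<lambda>i. cmod (x i w + y i w)) I) \<le> norm (L2_set (\<lambda>i. cmod (x i w)) I + L2_set (\<lambda>i. cmod (y i w)) I)" for w
 proof -
  have "L2_set (\<lambda>i. cmod (x i w + y i w)) I \<le> L2_set (\<lambda>i. cmod (x i w) + cmod (y i w)) I"
   by (intro L2_set_mono norm_triangle_ineq) auto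
  also note L2_set_triangle_ineq
  finally show ?thesis by simp
 qed
 have "mixn p M I (\<lambda>i w. x i w + y i w) \<le> lp_norm p M (\<lambda>w. L2_set (\<lambda>i. cmod (x i w)) I + L2_set (\<lambda>i. cmod (y i w)) I)"
  unfolding mixn_def
  by (rule memLp_bound(2)[OF _ memLp_add[OF p m]]) (use p le memLp_meas[OF memLp_L2(1)[OF p memLp_add[OF p x y]]] in auto)
 also have "... \<le> mixn p M I x + mixn p M I y" unfolding mixn_def by (rule lp_norm_add[OF p m])
 finally show ?thesis .
qed

lemma mixn_sum:
 fixes x :: "'k => 'i => 'a => complex"
 assumes p: "p \<ge> 1" and x: "\<And>k i. k \<in> K ==> i \<in> I ==> memLp p M (x k i)"
 shows "mixn p M I (\<lambda>i w. \<Sum>k\<in>K. x k i w) \<le> (\<Sum>k\<in>K. mixn p M I (x k))"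
 using x
proof (induction K rule: infinite_finite_induct)
 case (insert k K)
 have "mixn p M I (\<lambda>i w. x k i w + (\<Sum>k\<in>K. x k i w)) \<le> mixn p M I (x k) + mixn p M I (\<lambda>i w. \<Sum>k\<in>K. x k i w)"
  by (intro mixn_add memLp_sum p insert.prems) auto
 then show ?case using insert by (auto intro: order_trans)
qed (auto simp: mixn_def L2_set_def)

lemma
 fixes x y :: "'i => 'a => complex"
 assumes pq: "conj_exp p q"
  and x: "\<And>i. i \<in> I ==> memLp p M (x i)" and y: "\<And>i. i \<in> I ==> memLp q M (y i)"
 shows mixn_Hoelder: "cmod (\<integral>w. (\<Sum>i\<in>I. x i w * y i w) \<partial>M) \<le> mixn p M I x * mixn q M I y"
proof -
 have p: "p \<ge> 1" "q \<ge> 1" using pq by (auto simp: conj_exp_def)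
 let ?X = "\<lambda>w. L2_set (\<lambda>i. cmod (x i w)) I" and ?Y = "\<lambda>w. L2_set (\<lambda>i. cmod (y i w)) I"
 have m: "memLp p M ?X" "memLp q M ?Y" by (intro memLp_L2(1) p x y; simp)+
 have iXY: "integrable M (\<lambda>w. ?X w * ?Y w)" by (rule Hoelder_integrable_nonneg[OF pq m]) auto
 have i: "integrable M (\<lambda>w. \<Sum>i\<in>I. x i w * y i w)"
  by (intro Bochner_Integration.integrable_sum Hoelder_integrable[OF pq] x y)
 have "cmod (\<integral>w. (\<Sum>i\<in>I. x i w * y i w) \<partial>M) \<le> (\<integral>w. cmod (\<Sum>i\<in>I. x i w * y i w) \<partial>M)"
  by (rule integral_norm_bound)
 also have "... \<le> (\<integral>w. ?X w * ?Y w \<partial>M)"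
 proof (rule integral_mono[OF integrable_norm[OF i] iXY])
  fix w
  have "cmod (\<Sum>i\<in>I. x i w * y i w) \<le> (\<Sum>i\<in>I. \<bar>cmod (x i w)\<bar> * \<bar>cmod (y i w)\<bar>)"
   by (rule order_trans[OF norm_sum]) (simp add: norm_mult)
  also have "... \<le> ?X w * ?Y w" by (rule L2_set_mult_ineq)
  finally show "cmod (\<Sum>i\<in>I. x i w * y i w) \<le> ?X w * ?Y w" .
 qed
 also have "... \<le> mixn p M I x * mixn q M I y"
  unfolding mixn_def by (rule Hoelder_nonneg[OF pq m]) auto
 finally show ?thesis .
qed

text \<open>The extremal test family is \<open>s^(p-2) cnj (x i)\<close>, where \<open>s\<close> is
  the pointwise l^2 norm: it pairs with \<open>x\<close> to the p-th power of the norm, and its own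
  dual norm is the power \<open>p - 1\<close> of the norm.\<close>

lemma mixn_dual:
 fixes x :: "'i => 'a => complex"
 assumes pq: "conj_exp p q" and K: "K \<ge> 0"
  and x: "\<And>i. i \<in> I ==> memLp p M (x i)"
  and z: "\<And>y. (\<And>i. i \<in> I ==> memLp q M (y i)) ==> cmod (\<integral>w. (\<Sum>i\<in>I. x i w * y i w) \<partial>M) \<le> K * mixn q M I y"
 shows "mixn p M I x \<le> K"
proof -
 have p: "p > 1" "p \<ge> 1" "q > 1" "1/p + 1/q = 1" using pq by (auto simp: conj_exp_def)
 have pq1: "(p - 1) * q = p" "p * (1/q) = p - 1" using p by (simp_all add: field_simps)
 define s where "s w = L2_set (\<lambda>i. cmod (x i w)) I" for w
 have s: "memLp p M s" unfolding s_def by (intro memLp_L2(1) p x)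
 have s0: "s w \<ge> 0" for w by (simp add: s_def)
 have [measurable]: "s \<in> borel_measurable M" using s by (rule memLp_meas)
 define y where "y i w = of_real (s w powr (p - 2)) * cnj (x i w)" for i w
 have L2y: "L2_set (\<lambda>i. cmod (y i w)) I = s w powr (p - 1)" for w
 proof -
  have "L2_set (\<lambda>i. cmod (y i w)) I = s w powr (p - 2) * s w"
   unfolding s_def by (simp add: y_def norm_mult L2_set_right_distrib s_def)
  also have "... = s w powr (p - 1)"
  proof (cases "s w = 0")
   case False
   then have "s w powr (p - 2) * s w = s w powr (p - 2) * s w powr 1" using s0[of w] by simp
   then show ?thesis by (subst (asm) powr_add[symmetric]) simp
  qed (use p in simp)
  finally show ?thesis .
 qed
 have yq: "memLp q M (y i)" if i: "i \<in> I" for i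
 proof -
  have [measurable]: "x i \<in> borel_measurable M" using x[OF i] by (rule memLp_meas)
  have [measurable]: "(\<lambda>w. cnj (x i w)) \<in> borel_measurable M"
   by (rule borel_measurable_continuous_on[where f=cnj]) (auto intro: continuous_intros)
  have ym: "y i \<in> borel_measurable M" unfolding y_def by measurable
  show ?thesis
  proof (cases "finite I")
   case fin: True
   have sq: "memLp q M (\<lambda>w. s w powr (p - 1))"
    using s s0 by (simp add: memLp_def powr_powr pq1)
   show ?thesis
   proof (rule memLp_bound(1)[OF _ sq ym])
    show "AE w in M. norm (y i w) \<le> norm (s w powr (p - 1))"
     using member_le_L2_set[OF fin i] L2y by (auto intro!: AE_I2 simp: L2y[symmetric])
   qed (use p in simp)
  next
   case False
   then have "s w = 0" for w by (simp add: s_def)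
   then show ?thesis unfolding y_def using p by simp
  qed
 qed
 define N where "N = mixn p M I x"
 have N: "N = lp_norm p M s" by (simp add: N_def mixn_def s_def[abs_def])
 have Np: "N powr p = (\<integral>w. s w powr p \<partial>M)" using p s0 by (simp add: N lp_norm_powr)
 have "(\<Sum>i\<in>I. x i w * y i w) = of_real (s w powr p)" for w
 proof -
  have "(\<Sum>i\<in>I. x i w * y i w) = of_real (s w powr (p - 2)) * (\<Sum>i\<in>I. x i w * cnj (x i w))"
   by (simp add: y_def sum_distrib_left algebra_simps)
  also have "(\<Sum>i\<in>I. x i w * cnj (x i w)) = of_real (\<Sum>i\<in>I. (cmod (x i w))^2)"
   by (simp only: of_real_sum complex_norm_square)
  also have "(\<Sum>i\<in>I. (cmod (x i w))^2) = (s w)^2" by (simp add: s_def L2_set_def sum_nonneg)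
  finally have *: "(\<Sum>i\<in>I. x i w * y i w) = of_real (s w powr (p - 2) * (s w)^2)" by simp
  have "s w powr (p - 2) * (s w)^2 = s w powr p"
  proof (cases "s w = 0")
   case False
   then have "s w powr (p - 2) * (s w)^2 = s w powr (p - 2) * s w powr 2" using s0[of w] by simp
   then show ?thesis by (subst (asm) powr_add[symmetric]) simp
  qed (use p in simp)
  then show ?thesis using * by simp
 qed
 then have "cmod (\<integral>w. (\<Sum>i\<in>I. x i w * y i w) \<partial>M) = N powr p" by (simp add: Np)
 moreover have "mixn q M I y = N powr (p - 1)"
 proof -
  have "mixn q M I y = (\<integral>w. s w powr p \<partial>M) powr (1/q)"
   by (simp add: mixn_def L2y lp_norm_def powr_powr pq1)
  also have "... = N powr (p - 1)" by (simp only: Np[symmetric] powr_powr pq1)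
  finally show ?thesis .
 qed
 moreover have "cmod (\<integral>w. (\<Sum>i\<in>I. x i w * y i w) \<partial>M) \<le> K * mixn q M I y" by (rule z) (rule yq)
 ultimately have le: "N powr p \<le> K * N powr (p - 1)" by simp
 show ?thesis
 proof (cases "N > 0")
  case True
  have "N powr p = N powr (p - 1) * N powr 1" by (subst powr_add[symmetric]) simp
  then show ?thesis using le True by (simp add: N_def[symmetric] mult.commute)
 qed (use K in \<open>simp add: N_def\<close>)
qed

lemma lp_norm_dual:
 fixes g :: "'a => complex"
 assumes pq: "conj_exp p q" and K: "K \<ge> 0" and g: "memLp p M g"
  and z: "\<And>y. memLp q M y ==> cmod (\<integral>w. g w * y w \<partial>M) \<le> K * lp_norm q M y"
 shows "lp_norm p M g \<le> K"
 using mixn_dual[OF pq K, of "{()}" M "\<lambda>_. g"] g z by (simp add: mixn_single)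

lemma AE_zero_dual:
 fixes g :: "'a => complex"
 assumes pq: "conj_exp p q" and g: "memLp p M g"
  and z: "\<And>y. memLp q M y ==> (\<integral>w. g w * y w \<partial>M) = 0"
 shows "AE w in M. g w = 0"
proof -
 have "lp_norm p M g \<le> 0" by (rule lp_norm_dual[OF pq _ g]) (use z in auto)
 then have "lp_norm p M g = 0" using lp_norm_nonneg[of p M g] by linarith
 then show ?thesis using lp_norm_eq_0_iff[OF _ g] pq by (simp add: conj_exp_def)
qed

text \<open>Pairing \<open>T f\<close> with a fixed \<open>y\<close> is a bounded functional of
  \<open>f\<close>, hence represented in \<open>L^q\<close>. Representatives are chosen arbitrarily,
  so linearity is proved by testing. Existence matters because condition (i) quantifies over all
  adjoints and its second half would be vacuous without one.\<close>

theorem adjoint_exists: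
 assumes pq: "conj_exp p q" and T: "lp_op p M M T"
 shows "\<exists>S. is_adj p q M T S"
proof -
 have p: "p \<ge> 1" "q \<ge> 1" using pq by (auto simp: conj_exp_def)
 obtain C where C: "op_bd p M M T C" using T lp_op_bd by metis
 have Tm: "memLp p M (T f)" if "memLp p M f" for f by (rule lp_op_mem[OF T that])
 have bound: "cmod (\<integral>w. T f w * y w \<partial>M) \<le> C * lp_norm q M y * lp_norm p M f"
  if y: "memLp q M y" and f: "memLp p M f" for y f
 proof -
  have "cmod (\<integral>w. T f w * y w \<partial>M) \<le> lp_norm p M (T f) * lp_norm q M y" by (rule Hoelder[OF pq Tm[OF f] y])
  also have "... \<le> C * lp_norm p M f * lp_norm q M y" by (rule mult_right_mono[OF op_bdD[OF C f]]) simp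
  finally show ?thesis by (simp add: algebra_simps)
 qed
 have "\<exists>h. memLp q M h \<and> (\<forall>f. memLp p M f \<longrightarrow> (\<integral>w. T f w * y w \<partial>M) = (\<integral>w. f w * h w \<partial>M))" if y: "memLp q M y" for y
 proof (rule lp_dual_representation[OF pq])
  fix f g :: "'a => complex" and c assume fg: "memLp p M f" "memLp p M g"
  have "(\<integral>w. T (\<lambda>x. f x + c * g x) w * y w \<partial>M) = (\<integral>w. T f w * y w + c * (T g w * y w) \<partial>M)"
  proof (rule integral_cong_AE)
   show "(\<lambda>w. T (\<lambda>x. f x + c * g x) w * y w) \<in> borel_measurable M" "(\<lambda>w. T f w * y w + c * (T g w * y w)) \<in> borel_measurable M"
    using memLp_meas[OF Tm[OF memLp_lincomb[OF p(1) fg, of c]]] memLp_meas[OF Tm[OF fg(1)]] memLp_meas[OF Tm[OF fg(2)]] memLp_meas[OF y]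
    by measurable
   show "AE w in M. T (\<lambda>x. f x + c * g x) w * y w = T f w * y w + c * (T g w * y w)"
    using lp_op_lin[OF T fg, of c] by eventually_elim (simp add: algebra_simps)
  qed
  then show "(\<integral>w. T (\<lambda>x. f x + c * g x) w * y w \<partial>M) = (\<integral>w. T f w * y w \<partial>M) + c * (\<integral>w. T g w * y w \<partial>M)"
   using Hoelder_integrable[OF pq Tm[OF fg(1)] y] Hoelder_integrable[OF pq Tm[OF fg(2)] y] by simp
 qed (rule bound[OF y])
 then obtain S where S: "\<And>y. memLp q M y ==> memLp q M (S y)"
  "\<And>f y. memLp q M y ==> memLp p M f ==> (\<integral>w. T f w * y w \<partial>M) = (\<integral>w. f w * S y w \<partial>M)" by metis
 note qp = conj_exp_sym[OF pq]
 have "lp_op q M M S"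
 proof (rule lp_opI[OF S(1)])
  show "op_bd q M M S C" unfolding op_bd_def
  proof (intro conjI allI impI)
   fix y :: "'a => complex" assume y: "memLp q M y"
   show "lp_norm q M (S y) \<le> C * lp_norm q M y"
   proof (rule lp_norm_dual[OF qp _ S(1)[OF y]])
    show "0 \<le> C * lp_norm q M y" using op_bd_nonneg[OF C] by simp
    fix f :: "'a => complex" assume f: "memLp p M f"
    show "cmod (\<integral>w. S y w * f w \<partial>M) \<le> C * lp_norm q M y * lp_norm p M f"
     using bound[OF y f] S(2)[OF y f] by (simp add: mult.commute)
   qed
  qed (rule op_bd_nonneg[OF C])
  fix y z :: "'a => complex" assume yz: "memLp q M y" "memLp q M z"
  { assume ae: "AE x in M. y x = z x"
   have "AE x in M. S y x - S z x = 0"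
   proof (rule AE_zero_dual[OF qp memLp_diff[OF p(2) S(1)[OF yz(1)] S(1)[OF yz(2)]]])
    fix f :: "'a => complex" assume f: "memLp p M f"
    have "(\<integral>w. T f w * y w \<partial>M) = (\<integral>w. T f w * z w \<partial>M)"
     using memLp_meas[OF Tm[OF f]] memLp_meas[OF yz(1)] memLp_meas[OF yz(2)] ae
     by (intro integral_cong_AE) auto
    then have "(\<integral>w. f w * S y w \<partial>M) = (\<integral>w. f w * S z w \<partial>M)" using S(2) yz f by simp
    then show "(\<integral>w. (S y w - S z w) * f w \<partial>M) = 0"
     using Hoelder_integrable[OF pq f S(1)[OF yz(1)]] Hoelder_integrable[OF pq f S(1)[OF yz(2)]]
     by (simp add: algebra_simps)
   qed
   then show "AE x in M. S y x = S z x" by simp }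
  fix c :: complex
  have m: "memLp q M (\<lambda>x. y x + c * z x)" by (rule memLp_lincomb[OF p(2) yz])
  have "AE x in M. S (\<lambda>x. y x + c * z x) x - (S y x + c * S z x) = 0"
  proof (rule AE_zero_dual[OF qp memLp_diff[OF p(2) S(1)[OF m] memLp_lincomb[OF p(2) S(1)[OF yz(1)] S(1)[OF yz(2)]]]])
   fix f :: "'a => complex" assume f: "memLp p M f"
   note i = Hoelder_integrable[OF pq f S(1)[OF yz(1)]] Hoelder_integrable[OF pq f S(1)[OF yz(2)]] Hoelder_integrable[OF pq f S(1)[OF m]]
    Hoelder_integrable[OF pq Tm[OF f] yz(1)] Hoelder_integrable[OF pq Tm[OF f] yz(2)]
   have "(\<integral>w. T f w * (y w + c * z w) \<partial>M) = (\<integral>w. T f w * y w + c * (T f w * z w) \<partial>M)"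
    by (simp add: algebra_simps)
   also have "... = (\<integral>w. f w * S y w \<partial>M) + c * (\<integral>w. f w * S z w \<partial>M)" using i S(2) f yz by simp
   finally have *: "(\<integral>w. f w * S (\<lambda>x. y x + c * z x) w \<partial>M) = (\<integral>w. f w * S y w \<partial>M) + c * (\<integral>w. f w * S z w \<partial>M)"
    using S(2)[OF m f] by simp
   have "(\<integral>w. (S (\<lambda>x. y x + c * z x) w - (S y w + c * S z w)) * f w \<partial>M)
    = (\<integral>w. f w * S (\<lambda>x. y x + c * z x) w - (f w * S y w + c * (f w * S z w)) \<partial>M)"
    by (simp add: algebra_simps)
   also have "... = 0" using i * by simp
   finally show "(\<integral>w. (S (\<lambda>x. y x + c * z x) w - (S y w + c * S z w)) * f w \<partial>M) = 0" .
  qed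
  then show "AE x in M. S (\<lambda>x. y x + c * z x) x = S y x + c * S z x" by simp
 qed
 then show ?thesis using T S(2) unfolding is_adj_def by blast
qed

lemma is_adj_pow:
 assumes pq: "conj_exp p q" and a: "is_adj p q M T S"
 shows "is_adj p q M (T ^^ n) (S ^^ n)"
proof -
 have p: "p \<ge> 1" "q \<ge> 1" and T: "lp_op p M M T" and S: "lp_op q M M S"
  using pq a by (auto simp: conj_exp_def is_adj_def)
 have "(\<integral>w. (T ^^ n) x w * y w \<partial>M) = (\<integral>w. x w * (S ^^ n) y w \<partial>M)" if "memLp p M x" "memLp q M y" for x y
  using that
 proof (induction n arbitrary: y)
  case (Suc n)
  have "(\<integral>w. T ((T ^^ n) x) w * y w \<partial>M) = (\<integral>w. (T ^^ n) x w * S y w \<partial>M)"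
   by (rule is_adjD[OF a lp_op_mem[OF lp_op_pow[OF p(1) T] Suc.prems(1)] Suc.prems(2)])
  also have "... = (\<integral>w. x w * (S ^^ n) (S y) w \<partial>M)"
   by (rule Suc.IH[OF Suc.prems(1) lp_op_mem[OF S Suc.prems(2)]])
  finally show ?case by (simp add: funpow_swap1)
 qed simp
 then show ?thesis using lp_op_pow[OF p(1) T] lp_op_pow[OF p(2) S] by (simp add: is_adj_def)
qed

lemma is_adj_poly:
 assumes pq: "conj_exp p q" and a: "is_adj p q M T S"
 shows "is_adj p q M (poly_op \<phi> T) (poly_op \<phi> S)"
proof -
 have p: "p \<ge> 1" "q \<ge> 1" and T: "lp_op p M M T" and S: "lp_op q M M S"
  using pq a by (auto simp: conj_exp_def is_adj_def)
 have "(\<integral>w. poly_op \<phi> T x w * y w \<partial>M) = (\<integral>w. x w * poly_op \<phi> S y w \<partial>M)" if x: "memLp p M x" and y: "memLp q M y" for x y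
 proof -
  note i = Hoelder_integrable[OF pq lp_op_mem[OF lp_op_pow[OF p(1) T] x] y]
   Hoelder_integrable[OF pq x lp_op_mem[OF lp_op_pow[OF p(2) S] y]]
  have "(\<integral>w. poly_op \<phi> T x w * y w \<partial>M) = (\<integral>w. (\<Sum>j\<le>degree \<phi>. coeff \<phi> j * ((T ^^ j) x w * y w)) \<partial>M)"
   by (simp add: poly_op_def sum_distrib_right mult.assoc)
  also have "... = (\<Sum>j\<le>degree \<phi>. coeff \<phi> j * (\<integral>w. x w * (S ^^ j) y w \<partial>M))"
   using i is_adjD[OF is_adj_pow[OF pq a] x y] by (simp add: Bochner_Integration.integral_sum)
  also have "... = (\<integral>w. (\<Sum>j\<le>degree \<phi>. coeff \<phi> j * (x w * (S ^^ j) y w)) \<partial>M)"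
   using i by (simp add: Bochner_Integration.integral_sum)
  also have "... = (\<integral>w. x w * poly_op \<phi> S y w \<partial>M)"
   by (simp add: poly_op_def sum_distrib_left algebra_simps)
  finally show ?thesis .
 qed
 then show ?thesis using lp_op_poly[OF p(1) T] lp_op_poly[OF p(2) S] by (simp add: is_adj_def)
qed

section \<open>Khintchine and Marcinkiewicz--Zygmund inequalities\<close>

text \<open>A sign pattern is encoded by the set of indices that carry a minus sign, so that
  expectations over finitely many signs are finite averages over subsets.\<close>

definition sg :: "'i set => 'i => real" where "sg A i = (if i \<in> A then -1 else 1)"

definition avg :: "'i set => ('i set => real) => real" where
 "avg I F = (\<Sum>A\<in>Pow I. F A) / 2 ^ card I"

lemma avg_insert:
 assumes "finite I" "i \<notin> I"
 shows "avg (insert i I) F = avg I (\<lambda>A. (F A + F (insert i A)) / 2)"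
proof -
 have "(\<Sum>A\<in>Pow (insert i I). F A) = (\<Sum>A\<in>Pow I. F A) + (\<Sum>A\<in>insert i ` Pow I. F A)"
  unfolding Pow_insert using assms by (intro sum.union_disjoint) auto
 also have "(\<Sum>A\<in>insert i ` Pow I. F A) = (\<Sum>A\<in>Pow I. F (insert i A))"
  using assms by (subst sum.reindex) (auto simp: inj_on_def dest!: insert_ident[THEN iffD1, rotated 2])
 finally show ?thesis using assms
  by (simp add: avg_def sum.distrib sum_divide_distrib[symmetric])
qed

lemma avg_empty [simp]: "avg {} F = F {}"
 by (simp add: avg_def)

lemma avg_mono: "(\<And>A. A \<subseteq> I ==> F A \<le> G A) ==> avg I F \<le> avg I G"
 unfolding avg_def by (intro divide_right_mono sum_mono) auto

lemma avg_add: "avg I (\<lambda>A. F A + G A) = avg I F + avg I G"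
 by (simp add: avg_def sum.distrib add_divide_distrib)

lemma avg_cmult: "avg I (\<lambda>A. c * F A) = c * avg I F"
 by (simp add: avg_def sum_distrib_left)

lemma avg_const: "finite I ==> avg I (\<lambda>A. c) = c"
 by (simp add: avg_def card_Pow)

lemma avg_cong: "(\<And>A. A \<subseteq> I ==> F A = G A) ==> avg I F = avg I G"
 unfolding avg_def by (metis (mono_tags, lifting) PowD sum.cong)

lemma sg_insert:
 assumes "i \<notin> I" "A \<subseteq> I" "j \<in> I" shows "sg (insert i A) j = sg A j"
 using assms by (auto simp: sg_def)

definition rsum :: "'i set => 'i set => ('i => complex) => complex" where
 "rsum I A v = (\<Sum>i\<in>I. of_real (sg A i) * v i)"

lemma rsum_insert:
 assumes "finite I" "i \<notin> I" "A \<subseteq> I"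
 shows "rsum (insert i I) A v = rsum I A v + v i" "rsum (insert i I) (insert i A) v = rsum I A v - v i"
proof -
 have "sg A i = 1" "sg (insert i A) i = -1" using assms by (auto simp: sg_def)
 moreover have "(\<Sum>j\<in>I. of_real (sg (insert i A) j) * v j) = (\<Sum>j\<in>I. of_real (sg A j) * v j)"
  using assms by (intro sum.cong) (auto simp: sg_insert)
 ultimately show "rsum (insert i I) A v = rsum I A v + v i" "rsum (insert i I) (insert i A) v = rsum I A v - v i"
  using assms by (simp_all add: rsum_def)
qed

text \<open>Over the two signs of a new index the cross term \<open>2 * R A\<close> cancels in the
  mean and leaves only its square in the second moment. Cauchy-Schwarz bounds that square by
  \<open>4 * N * n\<close>, and \<open>3 s^2 + 6 s n + n^2 \<le> 3 (s + n)^2\<close> closes the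
  induction.\<close>

lemma avg_square_moments:
 fixes v :: "'i => 'k => complex"
 assumes I: "finite I" and K: "finite K"
 defines "N \<equiv> \<lambda>I A. \<Sum>k\<in>K. (cmod (rsum I A (\<lambda>i. v i k)))^2"
  and "s \<equiv> \<lambda>I. \<Sum>i\<in>I. \<Sum>k\<in>K. (cmod (v i k))^2"
 shows "avg I (N I) = s I \<and> avg I (\<lambda>A. (N I A)^2) \<le> 3 * (s I)^2"
 using I
proof (induction I rule: finite_induct)
 case empty
 then show ?case by (simp add: N_def s_def rsum_def)
next
 case (insert i I)
 define n where "n = (\<Sum>k\<in>K. (cmod (v i k))^2)"
 have n0: "n \<ge> 0" by (simp add: n_def sum_nonneg)
 have N0: "N I A \<ge> 0" for A by (simp add: N_def sum_nonneg)
 define R where "R A = (\<Sum>k\<in>K. Re (rsum I A (\<lambda>i. v i k) * cnj (v i k)))" for A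
 have pm: "N (insert i I) A = N I A + n + 2 * R A" "N (insert i I) (insert i A) = N I A + n - 2 * R A" if "A \<subseteq> I" for A
 proof -
  have "(cmod (a + b))^2 = (cmod a)^2 + (cmod b)^2 + 2 * Re (a * cnj b)"
   "(cmod (a - b))^2 = (cmod a)^2 + (cmod b)^2 - 2 * Re (a * cnj b)" for a b
   unfolding cmod_power2 by (simp_all add: power2_eq_square algebra_simps)
  then show "N (insert i I) A = N I A + n + 2 * R A" "N (insert i I) (insert i A) = N I A + n - 2 * R A"
   unfolding N_def n_def R_def using rsum_insert[OF insert.hyps(1,2) that]
   by (simp_all add: sum.distrib sum_subtractf sum_distrib_left)
 qed
 have R2: "(R A)^2 \<le> N I A * n" for A
 proof -
  have Re_le: "\<bar>Re (a * cnj b)\<bar> \<le> cmod a * cmod b" for a b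
   using abs_Re_le_cmod[of "a * cnj b"] by (simp add: norm_mult)
  have "\<bar>R A\<bar> \<le> (\<Sum>k\<in>K. cmod (rsum I A (\<lambda>i. v i k)) * cmod (v i k))"
   unfolding R_def by (rule order_trans[OF sum_abs sum_mono[OF Re_le]])
  then have "(R A)^2 \<le> (\<Sum>k\<in>K. cmod (rsum I A (\<lambda>i. v i k)) * cmod (v i k))^2"
   by (rule power2_le_iff_abs_le[THEN iffD2, rotated]) (auto intro: sum_nonneg)
  also have "... \<le> N I A * n" unfolding N_def n_def by (rule Cauchy_Schwarz_ineq_sum)
  finally show ?thesis .
 qed
 have s: "s (insert i I) = s I + n" using insert by (simp add: s_def n_def)
 have 1: "avg (insert i I) (N (insert i I)) = s I + n"
 proof -
  have "avg (insert i I) (N (insert i I)) = avg I (\<lambda>A. N I A + n)"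
   unfolding avg_insert[OF insert.hyps(1,2)] by (rule avg_cong) (simp add: pm)
  then show ?thesis using insert by (simp add: avg_add avg_const)
 qed
 have "avg (insert i I) (\<lambda>A. (N (insert i I) A)^2) \<le> avg I (\<lambda>A. (N I A)^2 + (6 * n) * N I A + n^2)"
  unfolding avg_insert[OF insert.hyps(1,2)]
 proof (rule avg_mono)
  fix A assume A: "A \<subseteq> I"
  have "((N (insert i I) A)^2 + (N (insert i I) (insert i A))^2) / 2 = (N I A + n)^2 + 4 * (R A)^2"
   unfolding pm[OF A] by (simp add: power2_eq_square algebra_simps)
  also have "... \<le> (N I A)^2 + (6 * n) * N I A + n^2" using R2[of A] by (simp add: power2_eq_square algebra_simps)
  finally show "((N (insert i I) A)^2 + (N (insert i I) (insert i A))^2) / 2 \<le> (N I A)^2 + (6 * n) * N I A + n^2" .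
 qed
 also have "... = avg I (\<lambda>A. (N I A)^2) + 6 * n * s I + n^2"
  using insert by (simp add: avg_add avg_cmult avg_const)
 also have "... \<le> 3 * (s I)^2 + 6 * n * s I + n^2" using insert by simp
 also have "... \<le> 3 * (s I + n)^2" by (simp add: power2_eq_square algebra_simps)
 finally show ?case using 1 s by simp
qed

text \<open>The inequality \<open>t \<le> a t^r + t^2/12 + 1/4\<close> holds for every
  \<open>r > 0\<close> once \<open>a (1/4)^r = 12\<close>: small \<open>t\<close> is below the
  constant, large \<open>t\<close> below the square, and \<open>a t^r\<close> covers the rest.
  Averaged over the normalised squared sums, with moments 1 and at most 3, it leaves
  \<open>1/2\<close> on the left. The inner index \<open>k\<close> makes the statement l^2-valued,
  as the Marcinkiewicz-Zygmund extension requires.\<close>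

lemma Khintchine_lower:
 fixes v :: "'i => 'k => complex"
 assumes I: "finite I" and K: "finite K" and r: "r > 0"
 shows "(\<Sum>i\<in>I. \<Sum>k\<in>K. (cmod (v i k))^2) powr r
  \<le> 24 * 4 powr r * avg I (\<lambda>A. (\<Sum>k\<in>K. (cmod (rsum I A (\<lambda>i. v i k)))^2) powr r)"
proof -
 define N where "N A = (\<Sum>k\<in>K. (cmod (rsum I A (\<lambda>i. v i k)))^2)" for A
 define s where "s = (\<Sum>i\<in>I. \<Sum>k\<in>K. (cmod (v i k))^2)"
 define a where "a = 12 * 4 powr r"
 have mom: "avg I N = s" "avg I (\<lambda>A. (N A)^2) \<le> 3 * s^2"
  using avg_square_moments[OF I K, of v] unfolding N_def s_def by auto
 have N0: "N A \<ge> 0" for A by (simp add: N_def sum_nonneg)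
 have s0: "s \<ge> 0" by (simp add: s_def sum_nonneg)
 have pt: "t \<le> a * t powr r + t^2 / 12 + 1/4" if t: "t \<ge> 0" for t :: real
 proof -
  have nn: "a * t powr r \<ge> 0" "t^2 / 12 \<ge> 0" by (auto simp: a_def)
  consider "t \<le> 1/4" | "t \<ge> 12" | "1/4 < t" "t < 12" by linarith
  then show ?thesis
  proof cases
   case 1 then show ?thesis using nn by linarith
  next
   case 2
   then have "t * 12 \<le> t * t" using t by (intro mult_left_mono)
   then show ?thesis using nn(1) by (simp add: power2_eq_square)
  next
   case 3
   have "(1/4) powr r \<le> t powr r" using 3 r by (intro powr_mono2) auto
   then have "a * (1/4) powr r \<le> a * t powr r" by (intro mult_left_mono) (auto simp: a_def)
   moreover have "a * (1/4) powr r = 12" by (simp add: a_def powr_divide)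
   ultimately show ?thesis using 3 nn(2) by linarith
  qed
 qed
 have "s powr r \<le> 2 * a * avg I (\<lambda>A. N A powr r)"
 proof (cases "s = 0")
  case True
  have "avg I (\<lambda>A. N A powr r) \<ge> 0" unfolding avg_def by (intro divide_nonneg_nonneg sum_nonneg) auto
  then show ?thesis using True r by (simp add: a_def)
 next
  case False
  then have sp: "s > 0" using s0 by simp
  have "avg I (\<lambda>A. (1/s) * N A) = (1/s) * s" by (simp only: avg_cmult mom)
  then have "1 = avg I (\<lambda>A. (1/s) * N A)" using sp by simp
  also have "... \<le> avg I (\<lambda>A. (a / s powr r) * N A powr r + (1 / (12 * s^2)) * (N A)^2 + 1/4)"
  proof (rule avg_mono)
   fix A
   show "(1/s) * N A \<le> (a / s powr r) * N A powr r + (1 / (12 * s^2)) * (N A)^2 + 1/4"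
    using pt[of "N A / s"] sp N0[of A] by (simp add: powr_divide power_divide mult.commute)
  qed
  also have "... = (a / s powr r) * avg I (\<lambda>A. N A powr r) + (1 / (12 * s^2)) * avg I (\<lambda>A. (N A)^2) + 1/4"
   using I by (simp only: avg_add avg_cmult avg_const)
  also have "... \<le> (a / s powr r) * avg I (\<lambda>A. N A powr r) + (1 / (12 * s^2)) * (3 * s^2) + 1/4"
   using mom(2) sp by (intro add_mono mult_left_mono) (auto simp: a_def)
  also have "... = (a / s powr r) * avg I (\<lambda>A. N A powr r) + 1/2" using sp by simp
  finally have "1/2 \<le> (a / s powr r) * avg I (\<lambda>A. N A powr r)" by linarith
  then have "s powr r * (1/2) \<le> s powr r * ((a / s powr r) * avg I (\<lambda>A. N A powr r))" by (rule mult_left_mono) simp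
  then show ?thesis using sp by simp
 qed
 then show ?thesis unfolding s_def N_def a_def by simp
qed

lemma powr_le_exp: "\<bar>x\<bar> powr p \<le> p powr p * (exp x + exp (- x))" if "p > 0" for x p :: real
proof -
 have "\<bar>x\<bar> / p \<le> exp (\<bar>x\<bar> / p)" using exp_ge_add_one_self[of "\<bar>x\<bar> / p"] by linarith
 then have "(\<bar>x\<bar> / p) powr p \<le> exp (\<bar>x\<bar> / p) powr p"
  using that by (intro powr_mono2) auto
 also have "... = exp \<bar>x\<bar>" using that by (simp add: powr_def)
 finally have "\<bar>x\<bar> powr p \<le> p powr p * exp \<bar>x\<bar>" using that by (simp add: powr_divide field_simps)
 also have "... \<le> p powr p * (exp x + exp (- x))" by (intro mult_left_mono) (auto simp: abs_if)
 finally show ?thesis .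
qed

text \<open>A subgaussian bound, with \<open>x^2\<close> in place of the sharp \<open>x^2/2\<close>;
  it multiplies over independent signs.\<close>

lemma cosh_le_exp_square: "(exp x + exp (- x)) / 2 \<le> exp (x^2)" for x :: real
proof -
 have *: "(exp x + exp (- x)) / 2 \<le> exp (x^2)" if x: "x \<ge> 0" for x :: real
 proof (cases "x \<le> 1")
  case True
  have "(1 + x) * (1 - x + x^2) = 1 + x ^ 3" by (simp add: power2_eq_square power3_eq_cube algebra_simps)
  then have "1 / (1 + x) \<le> 1 - x + x^2" using x by (simp add: divide_le_eq mult.commute)
  moreover have "exp (- x) \<le> 1 / (1 + x)"
   using exp_ge_add_one_self[of x] x by (simp add: exp_minus divide_simps del: exp_ge_add_one_self)
  ultimately have "exp (- x) \<le> 1 - x + x^2" by (rule order_trans[rotated])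
  with exp_bound[OF x True] have "exp x + exp (- x) \<le> (1 + x + x^2) + (1 - x + x^2)" by (rule add_mono)
  then have "exp x + exp (- x) \<le> 2 * (1 + x^2)" by simp
  then have "(exp x + exp (- x)) / 2 \<le> 1 + x^2" by simp
  then show ?thesis by (rule order_trans[OF _ exp_ge_add_one_self])
 next
  case False
  then have "x \<le> x^2" by (simp add: power2_eq_square)
  then have 1: "exp x \<le> exp (x^2)" by simp
  have "exp (- x) \<le> exp x" using x by simp
  from add_mono[OF 1 order_trans[OF this 1]] show ?thesis by simp
 qed
 from *[of x] *[of "- x"] show ?thesis by (cases "x \<ge> 0") (auto simp: add.commute)
qed

lemma avg_exp_le:
 assumes "finite I"
 shows "avg I (\<lambda>A. exp (\<Sum>i\<in>I. sg A i * c i)) \<le> exp (\<Sum>i\<in>I. (c i)^2)"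
 using assms
proof (induction I rule: finite_induct)
 case (insert i I)
 let ?S = "\<lambda>A. \<Sum>i\<in>I. sg A i * c i"
 have "avg (insert i I) (\<lambda>A. exp (\<Sum>i\<in>insert i I. sg A i * c i)) = avg I (\<lambda>A. (exp (c i) + exp (- c i)) / 2 * exp (?S A))"
  unfolding avg_insert[OF insert.hyps(1,2)]
 proof (rule avg_cong)
  fix A assume A: "A \<subseteq> I"
  have "sg A i = 1" "sg (insert i A) i = -1" using A insert by (auto simp: sg_def)
  moreover have "(\<Sum>j\<in>I. sg (insert i A) j * c j) = ?S A"
   using A insert by (intro sum.cong) (auto simp: sg_insert)
  ultimately show "(exp (\<Sum>i\<in>insert i I. sg A i * c i) + exp (\<Sum>j\<in>insert i I. sg (insert i A) j * c j)) / 2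
    = (exp (c i) + exp (- c i)) / 2 * exp (?S A)"
   using insert by (simp add: exp_add exp_diff exp_minus field_simps)
 qed
 also have "... = (exp (c i) + exp (- c i)) / 2 * avg I (\<lambda>A. exp (?S A))" by (rule avg_cmult)
 also have "... \<le> exp ((c i)^2) * exp (\<Sum>i\<in>I. (c i)^2)"
  using insert by (intro mult_mono cosh_le_exp_square) (auto simp: avg_def intro!: sum_nonneg divide_nonneg_nonneg)
 finally show ?case using insert by (simp add: exp_add)
qed simp

text \<open>\<open>2 powr p\<close> separates real and imaginary part, \<open>p powr p\<close> comes
  from \<open>powr_le_exp\<close>, and \<open>4 * exp 1\<close> bounds the four exponential moments
  of plus and minus the real and the imaginary part.\<close>

definition KH :: "real => real" where "KH p = 2 powr p * 4 * exp 1 * p powr p"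

lemma KH_pos: "p > 0 ==> KH p > 0"
 by (simp add: KH_def)

lemma norm_powr_le_Re_Im:
 assumes "p > 0" shows "cmod z powr p \<le> 2 powr p * (\<bar>Re z\<bar> powr p + \<bar>Im z\<bar> powr p)"
proof -
 let ?m = "max \<bar>Re z\<bar> \<bar>Im z\<bar>"
 have "cmod z \<le> 2 * ?m" using cmod_le[of z] by linarith
 then have "cmod z powr p \<le> (2 * ?m) powr p" using assms by (intro powr_mono2) auto
 also have "... = 2 powr p * ?m powr p" by (simp add: powr_mult)
 also have "... \<le> 2 powr p * (\<bar>Re z\<bar> powr p + \<bar>Im z\<bar> powr p)"
  by (intro mult_left_mono) (auto simp: max_def)
 finally show ?thesis .
qed

lemma exp_moment_bound:
 fixes z :: complex
 assumes p: "p > 0" and s: "s > 0"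
 shows "cmod z powr p \<le> s powr p * (2 powr p * p powr p) *
  ((exp (Re z / s) + exp (- Re z / s)) + (exp (Im z / s) + exp (- Im z / s)))"
proof -
 have "cmod (z / of_real s) powr p \<le> 2 powr p * (\<bar>Re z / s\<bar> powr p + \<bar>Im z / s\<bar> powr p)"
  using norm_powr_le_Re_Im[OF p, of "z / of_real s"] by simp
 also have "... \<le> 2 powr p * (p powr p * (exp (Re z / s) + exp (- (Re z / s))) + p powr p * (exp (Im z / s) + exp (- (Im z / s))))"
  by (intro mult_left_mono add_mono powr_le_exp p) auto
 finally have "s powr p * cmod (z / of_real s) powr p \<le> s powr p * (2 powr p * p powr p *
   ((exp (Re z / s) + exp (- Re z / s)) + (exp (Im z / s) + exp (- Im z / s))))"
  by (intro mult_left_mono) (simp_all add: algebra_simps)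
 moreover have "s powr p * cmod (z / of_real s) powr p = cmod z powr p"
  using s by (simp add: norm_divide powr_divide)
 ultimately show ?thesis by (simp add: algebra_simps)
qed

text \<open>After division by the l^2 norm \<open>s\<close> the squares in \<open>avg_exp_le\<close>
  sum to at most 1, so each exponential moment is at most \<open>exp 1\<close>. Passing through
  exponentials treats all \<open>p > 0\<close> at once.\<close>

lemma Khintchine_upper:
 fixes c :: "'i => complex"
 assumes I: "finite I" and p: "p > 0"
 shows "avg I (\<lambda>A. cmod (rsum I A c) powr p) \<le> KH p * (\<Sum>i\<in>I. (cmod (c i))^2) powr (p / 2)"
proof -
 define s where "s = sqrt (\<Sum>i\<in>I. (cmod (c i))^2)"
 have s0: "s \<ge> 0" by (simp add: s_def sum_nonneg)
 have s2: "s^2 = (\<Sum>i\<in>I. (cmod (c i))^2)" by (simp add: s_def sum_nonneg)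
 have sp: "(\<Sum>i\<in>I. (cmod (c i))^2) powr (p / 2) = s powr p"
  using s0 by (simp only: s2[symmetric]) (simp add: powr_powr flip: powr_numeral)
 show ?thesis
 proof (cases "s = 0")
  case True
  then have "\<forall>i\<in>I. c i = 0" using I s2 by (auto simp: sum_nonneg_eq_0_iff)
  then have "rsum I A c = 0" for A by (simp add: rsum_def)
  then show ?thesis using True sp p by (simp add: avg_def)
 next
  case False
  then have spos: "s > 0" using s0 by simp
  have ex: "avg I (\<lambda>A. exp (\<Sum>i\<in>I. sg A i * d i)) \<le> exp 1" if "\<And>i. i \<in> I ==> \<bar>d i\<bar> \<le> cmod (c i) / s" for d
  proof -
   have "(\<Sum>i\<in>I. (d i)^2) \<le> (\<Sum>i\<in>I. (cmod (c i) / s)^2)"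
    using that by (intro sum_mono) (metis abs_ge_zero power2_abs power_mono)
   also have "... = 1" using spos by (simp add: power_divide sum_divide_distrib[symmetric] s2[symmetric])
   finally show ?thesis using avg_exp_le[OF I, of d] by (meson exp_le_cancel_iff order_trans)
  qed
  have Re: "Re (rsum I A c) / s = (\<Sum>i\<in>I. sg A i * (Re (c i) / s))" "- Re (rsum I A c) / s = (\<Sum>i\<in>I. sg A i * (- Re (c i) / s))"
   and Im: "Im (rsum I A c) / s = (\<Sum>i\<in>I. sg A i * (Im (c i) / s))" "- Im (rsum I A c) / s = (\<Sum>i\<in>I. sg A i * (- Im (c i) / s))" for A
   by (simp_all add: rsum_def sum_divide_distrib sum_negf)
  have "avg I (\<lambda>A. cmod (rsum I A c) powr p) \<le> avg I (\<lambda>A. s powr p * (2 powr p * p powr p) *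
   ((exp (Re (rsum I A c) / s) + exp (- Re (rsum I A c) / s)) + (exp (Im (rsum I A c) / s) + exp (- Im (rsum I A c) / s))))"
   by (intro avg_mono exp_moment_bound p spos)
  also have "... \<le> s powr p * (2 powr p * p powr p) * ((exp 1 + exp 1) + (exp 1 + exp 1))"
   unfolding avg_cmult avg_add Re Im
   by (intro mult_left_mono add_mono ex)
    (use spos in \<open>auto intro!: divide_right_mono abs_Re_le_cmod abs_Im_le_cmod\<close>)
  also have "... = KH p * s powr p" by (simp add: KH_def)
  finally show ?thesis by (simp add: sp)
 qed
qed

lemma lp_norm_powr_mixn:
 assumes "p > 0"
 shows "mixn p M I x powr p = (\<integral>w. (\<Sum>i\<in>I. (cmod (x i w))^2) powr (p / 2) \<partial>M)"
proof -
 have "(L2_set (\<lambda>i. cmod (x i w)) I) powr p = (\<Sum>i\<in>I. (cmod (x i w))^2) powr (p / 2)" for w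
  unfolding L2_set_def by (simp add: powr_half_sqrt[symmetric] powr_powr sum_nonneg)
 then show ?thesis using assms by (simp add: mixn_def lp_norm_powr)
qed

definition MZ :: "real => real" where "MZ p = (24 * 4 powr (p / 2) * KH p) powr (1 / p)"

lemma MZ_nonneg [simp]: "MZ p \<ge> 0"
 by (simp add: MZ_def)

text \<open>Marcinkiewicz--Zygmund: a square function estimate extends to \<open>\<ell>\<^sup>2\<close>-valued functions,
  by randomising the argument and applying both Khintchine inequalities pointwise.\<close>

lemma MZ_square_function:
 fixes A :: "'k => ('a => complex) => ('b => complex)" and x :: "'i => 'a => complex"
 assumes p: "p \<ge> 1" and K: "finite K" and I: "finite I" and C: "C \<ge> 0"
  and A: "\<And>k. k \<in> K ==> lp_op p M N (A k)"
  and bd: "\<And>f. memLp p M f ==> mixn p N K (\<lambda>k. A k f) \<le> C * lp_norm p M f"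
  and x: "\<And>i. i \<in> I ==> memLp p M (x i)"
 shows "mixn p N (I \<times> K) (\<lambda>(i, k). A k (x i)) \<le> MZ p * C * mixn p M I x"
proof -
 have p0: "p > 0" using p by simp
 define c where "c = 24 * 4 powr (p / 2)"
 define X where "X a = (\<lambda>w. rsum I a (\<lambda>i. x i w))" for a
 have Xm: "memLp p M (X a)" for a unfolding X_def rsum_def by (intro memLp_sum[OF p] memLp_scale x)
 have Am: "memLp p N (A k (x i))" if "i \<in> I" "k \<in> K" for i k by (rule lp_op_mem[OF A[OF that(2)] x[OF that(1)]])
 have AXm: "memLp p N (A k (X a))" if "k \<in> K" for k a by (rule lp_op_mem[OF A[OF that] Xm])
 have AX: "AE w in N. \<forall>a\<in>Pow I. \<forall>k\<in>K. A k (X a) w = rsum I a (\<lambda>i. A k (x i) w)"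
 proof (rule AE_finite_allI)
  fix a assume "a \<in> Pow I"
  show "AE w in N. \<forall>k\<in>K. A k (X a) w = rsum I a (\<lambda>i. A k (x i) w)"
  proof (rule AE_finite_allI[OF K])
   fix k assume k: "k \<in> K"
   show "AE w in N. A k (X a) w = rsum I a (\<lambda>i. A k (x i) w)"
    unfolding X_def rsum_def by (rule lp_op_sum[OF p A[OF k] x])
  qed
 qed (use I in simp)
 have iX: "integrable N (\<lambda>w. (\<Sum>k\<in>K. (cmod (A k (X a) w))^2) powr (p / 2))" for a
 proof -
  have "memLp p N (\<lambda>w. L2_set (\<lambda>k. cmod (A k (X a) w)) K)" by (rule memLp_L2(1)[OF p AXm])
  moreover have "norm (L2_set (\<lambda>k. cmod (A k (X a) w)) K) powr p = (\<Sum>k\<in>K. (cmod (A k (X a) w))^2) powr (p / 2)" for w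
   unfolding L2_set_def by (simp add: powr_half_sqrt[symmetric] powr_powr sum_nonneg)
  ultimately show ?thesis by (simp add: memLp_def)
 qed
 have iA: "integrable N (\<lambda>w. (\<Sum>i\<in>I\<times>K. (cmod ((case i of (i, k) => A k (x i)) w))^2) powr (p / 2))"
 proof -
  have "memLp p N (\<lambda>w. L2_set (\<lambda>j. cmod ((case j of (i, k) => A k (x i)) w)) (I \<times> K))"
   by (rule memLp_L2(1)[OF p]) (auto intro: Am)
  moreover have "norm (L2_set (\<lambda>j. cmod ((case j of (i, k) => A k (x i)) w)) (I \<times> K)) powr p
   = (\<Sum>i\<in>I\<times>K. (cmod ((case i of (i, k) => A k (x i)) w))^2) powr (p / 2)" for w
   unfolding L2_set_def by (simp add: powr_half_sqrt[symmetric] powr_powr sum_nonneg)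
  ultimately show ?thesis by (simp add: memLp_def)
 qed
 have ixa: "integrable M (\<lambda>w. cmod (X a w) powr p)" for a using Xm by (simp add: memLp_def)
 have ix: "integrable M (\<lambda>w. (\<Sum>i\<in>I. (cmod (x i w))^2) powr (p / 2))"
 proof -
  have "memLp p M (\<lambda>w. L2_set (\<lambda>i. cmod (x i w)) I)" by (rule memLp_L2(1)[OF p x])
  moreover have "norm (L2_set (\<lambda>i. cmod (x i w)) I) powr p = (\<Sum>i\<in>I. (cmod (x i w))^2) powr (p / 2)" for w
   unfolding L2_set_def by (simp add: powr_half_sqrt[symmetric] powr_powr sum_nonneg)
  ultimately show ?thesis by (simp add: memLp_def)
 qed
 have "mixn p N (I \<times> K) (\<lambda>(i, k). A k (x i)) powr p
   = (\<integral>w. (\<Sum>i\<in>I\<times>K. (cmod ((case i of (i, k) => A k (x i)) w))^2) powr (p / 2) \<partial>N)"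
  by (rule lp_norm_powr_mixn[OF p0])
 also have "... \<le> (\<integral>w. c * avg I (\<lambda>a. (\<Sum>k\<in>K. (cmod (A k (X a) w))^2) powr (p / 2)) \<partial>N)"
 proof (rule integral_mono_AE[OF iA])
  show "integrable N (\<lambda>w. c * avg I (\<lambda>a. (\<Sum>k\<in>K. (cmod (A k (X a) w))^2) powr (p / 2)))"
   unfolding avg_def using iX by (intro integrable_mult_right integrable_divide Bochner_Integration.integrable_sum)
  show "AE w in N. (\<Sum>i\<in>I\<times>K. (cmod ((case i of (i, k) => A k (x i)) w))^2) powr (p / 2)
   \<le> c * avg I (\<lambda>a. (\<Sum>k\<in>K. (cmod (A k (X a) w))^2) powr (p / 2))"
   using AX
  proof eventually_elim
   case (elim w)
   have "(\<Sum>i\<in>I\<times>K. (cmod ((case i of (i, k) => A k (x i)) w))^2) = (\<Sum>i\<in>I. \<Sum>k\<in>K. (cmod (A k (x i) w))^2)"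
    by (simp add: sum.cartesian_product case_prod_unfold)
   moreover have "avg I (\<lambda>a. (\<Sum>k\<in>K. (cmod (A k (X a) w))^2) powr (p / 2))
    = avg I (\<lambda>a. (\<Sum>k\<in>K. (cmod (rsum I a (\<lambda>i. A k (x i) w)))^2) powr (p / 2))"
    using elim by (intro avg_cong) (auto intro!: arg_cong[where f="\<lambda>t. t powr (p/2)"] sum.cong)
   ultimately show ?case
    using Khintchine_lower[OF I K, of "p/2" "\<lambda>i k. A k (x i) w"] p0 by (simp add: c_def)
  qed
 qed
 also have "... = c * avg I (\<lambda>a. mixn p N K (\<lambda>k. A k (X a)) powr p)"
  unfolding avg_def lp_norm_powr_mixn[OF p0] using iX by (simp add: Bochner_Integration.integral_sum)
 also have "... \<le> c * avg I (\<lambda>a. C powr p * lp_norm p M (X a) powr p)"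
 proof (intro mult_left_mono avg_mono)
  fix a
  have "mixn p N K (\<lambda>k. A k (X a)) powr p \<le> (C * lp_norm p M (X a)) powr p"
   using bd[OF Xm] p0 by (intro powr_mono2) auto
  then show "mixn p N K (\<lambda>k. A k (X a)) powr p \<le> C powr p * lp_norm p M (X a) powr p"
   using C by (simp add: powr_mult)
 qed (simp add: c_def)
 also have "... = c * C powr p * (\<integral>w. avg I (\<lambda>a. cmod (X a w) powr p) \<partial>M)"
  unfolding avg_cmult avg_def lp_norm_powr[OF p0] using ixa
  by (simp add: Bochner_Integration.integral_sum)
 also have "... \<le> c * C powr p * (\<integral>w. KH p * (\<Sum>i\<in>I. (cmod (x i w))^2) powr (p / 2) \<partial>M)"
 proof (intro mult_left_mono integral_mono)
  show "integrable M (\<lambda>w. avg I (\<lambda>a. cmod (X a w) powr p))"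
   unfolding avg_def using ixa by (intro integrable_divide Bochner_Integration.integrable_sum)
  show "integrable M (\<lambda>w. KH p * (\<Sum>i\<in>I. (cmod (x i w))^2) powr (p / 2))"
   by (intro integrable_mult_right ix)
  show "avg I (\<lambda>a. cmod (X a w) powr p) \<le> KH p * (\<Sum>i\<in>I. (cmod (x i w))^2) powr (p / 2)" for w
   unfolding X_def by (rule Khintchine_upper[OF I p0])
 qed (simp add: c_def)
 also have "... = c * KH p * C powr p * mixn p M I x powr p"
  unfolding lp_norm_powr_mixn[OF p0] using ix by simp
 also have "... = (MZ p * C * mixn p M I x) powr p"
 proof -
  have "MZ p powr p = c * KH p" using p0 KH_pos[OF p0] by (simp add: MZ_def c_def powr_powr)
  then show ?thesis using C by (simp add: powr_mult)
 qed
 finally show ?thesis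
  using p0 C powr_less_mono2[of p "MZ p * C * mixn p M I x" "mixn p N (I \<times> K) (\<lambda>(i, k). A k (x i))"]
  by (meson MZ_nonneg mixn_nonneg mult_nonneg_nonneg not_le)
qed

text \<open>A single bounded operator on \<open>L^p\<close> is R-bounded: boundedness extends to
  l^2-valued functions.\<close>

lemma MZ_single:
 fixes A :: "('a => complex) => ('b => complex)" and x :: "'i => 'a => complex"
 assumes p: "p \<ge> 1" and I: "finite I" and A: "lp_op p M N A" and bd: "op_bd p M N A C"
  and x: "\<And>i. i \<in> I ==> memLp p M (x i)"
 shows "mixn p N I (\<lambda>i. A (x i)) \<le> MZ p * C * mixn p M I x"
proof -
 have "mixn p N (I \<times> {()}) (\<lambda>(i, k). A (x i)) \<le> MZ p * C * mixn p M I x"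
  using MZ_square_function[OF p _ I op_bd_nonneg[OF bd], of "{()}" M N "\<lambda>_. A" x] A x op_bdD[OF bd]
  by (simp add: mixn_single)
 moreover have "mixn p N (I \<times> {()}) (\<lambda>(i, k). A (x i)) = mixn p N I (\<lambda>i. A (x i))"
 proof -
  have "L2_set (\<lambda>j. cmod ((case j of (i, k) => A (x i)) w)) (I \<times> {()}) = L2_set (\<lambda>i. cmod (A (x i) w)) I" for w
  proof -
   have "I \<times> {()} = (\<lambda>i. (i, ())) ` I" by auto
   then show ?thesis unfolding L2_set_def by (simp add: sum.reindex inj_on_def)
  qed
  then show ?thesis by (simp add: mixn_def)
 qed
 ultimately show ?thesis by simp
qed

section \<open>R-bounded families of polynomials in an operator\<close>

definition Rfam :: "real => 'a measure => (('a => complex) => ('a => complex)) => real => complex poly set => bool" where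
 "Rfam p M T C \<Phi> \<longleftrightarrow> C \<ge> 0 \<and> (\<forall>n \<phi> x. (\<forall>i<n. \<phi> i \<in> \<Phi> \<and> memLp p M (x i)) \<longrightarrow>
   mixn p M {..<n::nat} (\<lambda>i. poly_op (\<phi> i) T (x i)) \<le> C * mixn p M {..<n} x)"

lemma RfamD:
 fixes n :: nat
 assumes "Rfam p M T C \<Phi>" "\<And>i. i < n ==> \<phi> i \<in> \<Phi>" "\<And>i. i < n ==> memLp p M (x i)"
 shows "mixn p M {..<n} (\<lambda>i. poly_op (\<phi> i) T (x i)) \<le> C * mixn p M {..<n} x"
proof -
 have "\<forall>n \<phi> x. (\<forall>i<n. \<phi> i \<in> \<Phi> \<and> memLp p M (x i)) \<longrightarrow>
   mixn p M {..<n::nat} (\<lambda>i. poly_op (\<phi> i) T (x i)) \<le> C * mixn p M {..<n} x"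
  using assms(1) by (simp add: Rfam_def)
 from this[rule_format, of n \<phi> x] show ?thesis using assms(2,3) by auto
qed

lemma RfamI:
 assumes "C \<ge> 0" "\<And>n \<phi> x. (\<And>i. i < n ==> \<phi> i \<in> \<Phi>) ==> (\<And>i. i < n ==> memLp p M (x i)) ==>
   mixn p M {..<n::nat} (\<lambda>i. poly_op (\<phi> i) T (x i)) \<le> C * mixn p M {..<n} x"
 shows "Rfam p M T C \<Phi>"
 using assms by (auto simp: Rfam_def)

lemma Rfam_nonneg: "Rfam p M T C \<Phi> ==> C \<ge> 0" by (simp add: Rfam_def)

lemma Rfam_subset: "Rfam p M T C \<Phi> ==> \<Psi> \<subseteq> \<Phi> ==> Rfam p M T C \<Psi>"
 unfolding Rfam_def by blast

lemma Rfam_op_bd: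
 assumes "Rfam p M T C \<Phi>" "\<phi> \<in> \<Phi>"
 shows "op_bd p M M (poly_op \<phi> T) C"
 unfolding op_bd_def
proof (intro conjI allI impI)
 show "C \<ge> 0" using assms by (simp add: Rfam_def)
 fix f :: "'a => complex" assume f: "memLp p M f"
 have "mixn p M {..<1::nat} (\<lambda>i. poly_op \<phi> T f) \<le> C * mixn p M {..<1::nat} (\<lambda>i. f)"
  by (rule RfamD[OF assms(1), where n=1 and \<phi>="\<lambda>_. \<phi>" and x="\<lambda>_. f"]) (use assms f in auto)
 moreover have "{..<1::nat} = {0}" by auto
 ultimately show "lp_norm p M (poly_op \<phi> T f) \<le> C * lp_norm p M f" by (simp add: mixn_single)
qed

lemma Rfam_scale:
 assumes p: "p \<ge> 1" and T: "lp_op p M M T" and R: "Rfam p M T C \<Phi>" and b: "b \<ge> 0"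
 shows "Rfam p M T (b * C) {smult c \<phi> | c \<phi>. cmod c \<le> b \<and> \<phi> \<in> \<Phi>}"
proof (rule RfamI)
 show "0 \<le> b * C" using R b by (simp add: Rfam_def)
 fix n and \<phi> :: "nat => complex poly" and x :: "nat => 'a => complex"
 assume \<phi>: "\<And>i. i < n ==> \<phi> i \<in> {smult c \<phi> | c \<phi>. cmod c \<le> b \<and> \<phi> \<in> \<Phi>}" and x: "\<And>i. i < n ==> memLp p M (x i)"
 then have "\<exists>c \<psi>. i < n \<longrightarrow> \<phi> i = smult c \<psi> \<and> cmod c \<le> b \<and> \<psi> \<in> \<Phi>" for i by blast
 then obtain c \<psi> where c: "\<And>i. i < n ==> \<phi> i = smult (c i) (\<psi> i) \<and> cmod (c i) \<le> b \<and> \<psi> i \<in> \<Phi>" by metis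
 have pm: "memLp p M (poly_op \<eta> T (x i))" if "i < n" for i \<eta> by (rule lp_op_mem[OF lp_op_poly[OF p T] x[OF that]])
 have "mixn p M {..<n} (\<lambda>i. poly_op (\<phi> i) T (x i)) \<le> b * mixn p M {..<n} (\<lambda>i. poly_op (\<psi> i) T (x i))"
 proof (rule mixn_mono[OF p _ _ b])
  show "AE w in M. (\<Sum>i<n. (cmod (poly_op (\<phi> i) T (x i) w))^2) \<le> b^2 * (\<Sum>i<n. (cmod (poly_op (\<psi> i) T (x i) w))^2)"
   unfolding sum_distrib_left
   using c by (auto intro!: AE_I2 sum_mono mult_right_mono power_mono simp: poly_op_smult norm_mult power_mult_distrib)
 qed (auto intro: pm)
 also have "... \<le> b * (C * mixn p M {..<n} x)"
  by (intro mult_left_mono RfamD[OF R] b x) (use c in auto)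
 finally show "mixn p M {..<n} (\<lambda>i. poly_op (\<phi> i) T (x i)) \<le> b * C * mixn p M {..<n} x" by (simp add: mult.assoc)
qed

lemma Rfam_add:
 assumes p: "p \<ge> 1" and T: "lp_op p M M T" and R: "Rfam p M T C \<Phi>" "Rfam p M T D \<Psi>"
 shows "Rfam p M T (C + D) {\<phi> + \<psi> | \<phi> \<psi>. \<phi> \<in> \<Phi> \<and> \<psi> \<in> \<Psi>}"
proof (rule RfamI)
 show "0 \<le> C + D" using R by (simp add: Rfam_def)
 fix n and \<eta> :: "nat => complex poly" and x :: "nat => 'a => complex"
 assume \<eta>: "\<And>i. i < n ==> \<eta> i \<in> {\<phi> + \<psi> | \<phi> \<psi>. \<phi> \<in> \<Phi> \<and> \<psi> \<in> \<Psi>}" and x: "\<And>i. i < n ==> memLp p M (x i)"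
 then have "\<exists>\<phi> \<psi>. i < n \<longrightarrow> \<eta> i = \<phi> + \<psi> \<and> \<phi> \<in> \<Phi> \<and> \<psi> \<in> \<Psi>" for i by blast
 then obtain \<phi> \<psi> where c: "\<And>i. i < n ==> \<eta> i = \<phi> i + \<psi> i \<and> \<phi> i \<in> \<Phi> \<and> \<psi> i \<in> \<Psi>" by metis
 have pm: "memLp p M (poly_op \<zeta> T (x i))" if "i < n" for i \<zeta> by (rule lp_op_mem[OF lp_op_poly[OF p T] x[OF that]])
 have "mixn p M {..<n} (\<lambda>i. poly_op (\<eta> i) T (x i)) = mixn p M {..<n} (\<lambda>i w. poly_op (\<phi> i) T (x i) w + poly_op (\<psi> i) T (x i) w)"
  by (rule mixn_cong_AE[OF p]) (use c in \<open>auto intro!: pm memLp_add[OF p] simp: poly_op_add\<close>)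
 also have "... \<le> mixn p M {..<n} (\<lambda>i. poly_op (\<phi> i) T (x i)) + mixn p M {..<n} (\<lambda>i. poly_op (\<psi> i) T (x i))"
  by (rule mixn_add[OF p]) (auto intro: pm)
 also have "... \<le> C * mixn p M {..<n} x + D * mixn p M {..<n} x"
  by (intro add_mono RfamD[OF R(1)] RfamD[OF R(2)] x) (use c in auto)
 finally show "mixn p M {..<n} (\<lambda>i. poly_op (\<eta> i) T (x i)) \<le> (C + D) * mixn p M {..<n} x" by (simp add: distrib_right)
qed

text \<open>Together with sums and scalar multiples this makes R-boundedness a calculus on sets of
  polynomials. The sets stay the same when \<open>T\<close> is replaced by its adjoint, which is why
  families are indexed by polynomials rather than by operators.\<close>

lemma Rfam_mult:
 assumes p: "p \<ge> 1" and T: "lp_op p M M T" and R: "Rfam p M T C \<Phi>" "Rfam p M T D \<Psi>"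
 shows "Rfam p M T (C * D) {\<phi> * \<psi> | \<phi> \<psi>. \<phi> \<in> \<Phi> \<and> \<psi> \<in> \<Psi>}"
proof (rule RfamI)
 show "0 \<le> C * D" using R by (simp add: Rfam_def)
 fix n and \<eta> :: "nat => complex poly" and x :: "nat => 'a => complex"
 assume \<eta>: "\<And>i. i < n ==> \<eta> i \<in> {\<phi> * \<psi> | \<phi> \<psi>. \<phi> \<in> \<Phi> \<and> \<psi> \<in> \<Psi>}" and x: "\<And>i. i < n ==> memLp p M (x i)"
 then have "\<exists>\<phi> \<psi>. i < n \<longrightarrow> \<eta> i = \<phi> * \<psi> \<and> \<phi> \<in> \<Phi> \<and> \<psi> \<in> \<Psi>" for i by blast
 then obtain \<phi> \<psi> where c: "\<And>i. i < n ==> \<eta> i = \<phi> i * \<psi> i \<and> \<phi> i \<in> \<Phi> \<and> \<psi> i \<in> \<Psi>" by metis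
 have pm: "memLp p M (poly_op \<zeta> T f)" if "memLp p M f" for f \<zeta> by (rule lp_op_mem[OF lp_op_poly[OF p T] that])
 have "mixn p M {..<n} (\<lambda>i. poly_op (\<eta> i) T (x i)) = mixn p M {..<n} (\<lambda>i. poly_op (\<phi> i) T (poly_op (\<psi> i) T (x i)))"
 proof (rule mixn_cong_AE[OF p])
  fix i assume i: "i \<in> {..<n}"
  then have "AE w in M. poly_op (\<phi> i * \<psi> i) T (x i) w = poly_op (\<phi> i) T (poly_op (\<psi> i) T (x i)) w"
   by (intro poly_op_mult[OF p T x]) auto
  then show "AE w in M. cmod (poly_op (\<eta> i) T (x i) w) = cmod (poly_op (\<phi> i) T (poly_op (\<psi> i) T (x i)) w)"
   using c i by (auto elim!: eventually_mono)
 qed (auto intro: pm x)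
 also have "... \<le> C * mixn p M {..<n} (\<lambda>i. poly_op (\<psi> i) T (x i))"
  by (rule RfamD[OF R(1)]) (use c in \<open>auto intro: pm x\<close>)
 also have "... \<le> C * (D * mixn p M {..<n} x)"
  by (intro mult_left_mono RfamD[OF R(2)] x Rfam_nonneg[OF R(1)]) (use c in auto)
 finally show "mixn p M {..<n} (\<lambda>i. poly_op (\<eta> i) T (x i)) \<le> C * D * mixn p M {..<n} x" by (simp add: mult.assoc)
qed

text \<open>In the dual form of R-boundedness the pairings decouple, so that passing to the absolutely
  convex hull and to adjoints costs nothing.\<close>

lemma Rfam_pairing:
 fixes x y :: "nat => 'a => complex"
 assumes pq: "conj_exp p q" and T: "lp_op p M M T" and R: "Rfam p M T C \<Phi>"
  and \<phi>: "\<And>i. i < n ==> \<phi> i \<in> \<Phi>" and x: "\<And>i. i < n ==> memLp p M (x i)" and y: "\<And>i. i < n ==> memLp q M (y i)"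
 shows "(\<Sum>i<n. cmod (\<integral>w. poly_op (\<phi> i) T (x i) w * y i w \<partial>M)) \<le> C * mixn p M {..<n} x * mixn q M {..<n} y"
proof -
 have p: "p \<ge> 1" "q \<ge> 1" using pq by (auto simp: conj_exp_def)
 define u where "u i = (let z = (\<integral>w. poly_op (\<phi> i) T (x i) w * y i w \<partial>M) in if z = 0 then 1 else cnj z / of_real (cmod z))" for i
 have u: "cmod (u i) = 1" "u i * (\<integral>w. poly_op (\<phi> i) T (x i) w * y i w \<partial>M) = of_real (cmod (\<integral>w. poly_op (\<phi> i) T (x i) w * y i w \<partial>M))" for i
  by (auto simp: u_def Let_def norm_divide complex_norm_square[symmetric] power2_eq_square mult.commute)
 have pm: "memLp p M (poly_op (\<phi> i) T (x i))" if "i < n" for i by (rule lp_op_mem[OF lp_op_poly[OF p(1) T] x[OF that]])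
 have int: "integrable M (\<lambda>w. poly_op (\<phi> i) T (x i) w * y i w)" if "i < n" for i
  by (rule Hoelder_integrable[OF pq pm y]) (use that in auto)
 have "(\<integral>w. (\<Sum>i<n. poly_op (\<phi> i) T (x i) w * (u i * y i w)) \<partial>M) = (\<integral>w. (\<Sum>i<n. u i * (poly_op (\<phi> i) T (x i) w * y i w)) \<partial>M)"
  by (simp add: algebra_simps)
 also have "... = (\<Sum>i<n. u i * (\<integral>w. poly_op (\<phi> i) T (x i) w * y i w \<partial>M))"
  using int by (subst Bochner_Integration.integral_sum) auto
 also have "... = of_real (\<Sum>i<n. cmod (\<integral>w. poly_op (\<phi> i) T (x i) w * y i w \<partial>M))" by (simp add: u)
 finally have "(\<Sum>i<n. cmod (\<integral>w. poly_op (\<phi> i) T (x i) w * y i w \<partial>M))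
   = cmod (\<integral>w. (\<Sum>i<n. poly_op (\<phi> i) T (x i) w * (u i * y i w)) \<partial>M)"
  by (simp only: norm_of_real) (simp add: sum_nonneg)
 also have "... \<le> mixn p M {..<n} (\<lambda>i. poly_op (\<phi> i) T (x i)) * mixn q M {..<n} (\<lambda>i w. u i * y i w)"
  by (rule mixn_Hoelder[OF pq]) (auto intro: pm memLp_scale y)
 also have "... \<le> C * mixn p M {..<n} x * mixn q M {..<n} (\<lambda>i w. u i * y i w)"
  by (intro mult_right_mono RfamD[OF R] \<phi> x) auto
 also have "mixn q M {..<n} (\<lambda>i w. u i * y i w) = mixn q M {..<n} y" by (simp add: mixn_def norm_mult u)
 finally show ?thesis .
qed

lemma Rfam_hull:
 assumes pq: "conj_exp p q" and T: "lp_op p M M T" and R: "Rfam p M T C \<Phi>" and ne: "\<Phi> \<noteq> {}"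
 shows "Rfam p M T C {(\<Sum>j\<in>J. smult (c j) (\<psi> j)) | J c \<psi>. finite (J :: nat set) \<and> (\<forall>j\<in>J. \<psi> j \<in> \<Phi>) \<and> (\<Sum>j\<in>J. cmod (c j)) \<le> 1}"
  (is "Rfam p M T C ?H")
proof (rule RfamI)
 have p: "p \<ge> 1" "q \<ge> 1" using pq by (auto simp: conj_exp_def)
 show C0: "0 \<le> C" using R by (simp add: Rfam_def)
 fix n and \<eta> :: "nat => complex poly" and x :: "nat => 'a => complex"
 assume \<eta>: "\<And>i. i < n ==> \<eta> i \<in> ?H" and x: "\<And>i. i < n ==> memLp p M (x i)"
 have pm: "memLp p M (poly_op \<zeta> T (x i))" if "i < n" for i \<zeta> by (rule lp_op_mem[OF lp_op_poly[OF p(1) T] x[OF that]])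
 show "mixn p M {..<n} (\<lambda>i. poly_op (\<eta> i) T (x i)) \<le> C * mixn p M {..<n} x"
 proof (rule mixn_dual[OF pq])
  fix y :: "nat => 'a => complex" assume "\<And>i. i \<in> {..<n} ==> memLp q M (y i)"
  then have y: "memLp q M (y i)" if "i < n" for i using that by auto
  have int: "integrable M (\<lambda>w. poly_op \<zeta> T (x i) w * y i w)" if "i < n" for i \<zeta>
   by (rule Hoelder_integrable[OF pq pm y]) (use that in auto)
  define B where "B i \<zeta> = (\<integral>w. poly_op \<zeta> T (x i) w * y i w \<partial>M)" for i \<zeta>
  \<comment> \<open>A combination whose coefficients have moduli summing to at most 1 pairs no
    larger than its largest member, so a single element of \<open>\<Phi>\<close> can be assigned to
    each index. The moduli inside the sum over \<open>i\<close> are admissible by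
    \<open>Rfam_pairing\<close>.\<close>
  have "\<exists>\<psi>\<in>\<Phi>. cmod (B i (\<eta> i)) \<le> cmod (B i \<psi>)" if i: "i < n" for i
  proof -
   obtain J :: "nat set" and c \<psi> where J: "finite J" "\<And>j. j \<in> J ==> \<psi> j \<in> \<Phi>" "(\<Sum>j\<in>J. cmod (c j)) \<le> 1" "\<eta> i = (\<Sum>j\<in>J. smult (c j) (\<psi> j))"
    using \<eta>[OF i] by blast
   have B: "B i (\<eta> i) = (\<Sum>j\<in>J. c j * B i (\<psi> j))"
   proof -
    have "B i (\<eta> i) = (\<integral>w. (\<Sum>j\<in>J. c j * (poly_op (\<psi> j) T (x i) w * y i w)) \<partial>M)"
     by (simp add: B_def J(4) poly_op_sum poly_op_smult sum_distrib_right mult.assoc)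
    also have "... = (\<Sum>j\<in>J. c j * B i (\<psi> j))"
     unfolding B_def using int[OF i] by (subst Bochner_Integration.integral_sum) auto
    finally show ?thesis .
   qed
   show ?thesis
   proof (cases "J = {}")
    case True then show ?thesis using ne B by auto
   next
    case False
    define j0 where "j0 = (ARG_MAX (\<lambda>j. cmod (B i (\<psi> j))) j. j \<in> J)"
    have "\<exists>j0\<in>J. \<forall>j\<in>J. cmod (B i (\<psi> j)) \<le> cmod (B i (\<psi> j0))"
    proof -
     let ?S = "(\<lambda>j. cmod (B i (\<psi> j))) ` J"
     have "Max ?S \<in> ?S" using J(1) False by (intro Max_in) auto
     then obtain j0 where "j0 \<in> J" "Max ?S = cmod (B i (\<psi> j0))" by auto
     moreover have "\<forall>j\<in>J. cmod (B i (\<psi> j)) \<le> Max ?S" using J(1) by simp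
     ultimately show ?thesis by auto
    qed
    then obtain j0 where j0: "j0 \<in> J" "\<And>j. j \<in> J ==> cmod (B i (\<psi> j)) \<le> cmod (B i (\<psi> j0))" by blast
    have "cmod (B i (\<eta> i)) \<le> (\<Sum>j\<in>J. cmod (c j) * cmod (B i (\<psi> j)))"
     unfolding B by (rule order_trans[OF norm_sum]) (simp add: norm_mult)
    also have "... \<le> (\<Sum>j\<in>J. cmod (c j) * cmod (B i (\<psi> j0)))" by (intro sum_mono mult_left_mono j0) auto
    also have "... = (\<Sum>j\<in>J. cmod (c j)) * cmod (B i (\<psi> j0))" by (simp add: sum_distrib_right)
    also have "... \<le> 1 * cmod (B i (\<psi> j0))" by (intro mult_right_mono J) auto
    finally show ?thesis using J(2)[OF j0(1)] by auto
   qed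
  qed
  then obtain \<psi> where \<psi>: "\<And>i. i < n ==> \<psi> i \<in> \<Phi>" "\<And>i. i < n ==> cmod (B i (\<eta> i)) \<le> cmod (B i (\<psi> i))" by metis
  have "(\<integral>w. (\<Sum>i<n. poly_op (\<eta> i) T (x i) w * y i w) \<partial>M) = (\<Sum>i<n. B i (\<eta> i))"
   unfolding B_def using int by (subst Bochner_Integration.integral_sum) auto
  then have "cmod (\<integral>w. (\<Sum>i<n. poly_op (\<eta> i) T (x i) w * y i w) \<partial>M) \<le> (\<Sum>i<n. cmod (B i (\<eta> i)))"
   by (simp add: norm_sum)
  also have "... \<le> (\<Sum>i<n. cmod (B i (\<psi> i)))" by (intro sum_mono) (use \<psi> in auto)
  also have "... \<le> C * mixn p M {..<n} x * mixn q M {..<n} y"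
   unfolding B_def by (rule Rfam_pairing[OF pq T R \<psi>(1) x y])
  finally show "cmod (\<integral>w. (\<Sum>i<n. poly_op (\<eta> i) T (x i) w * y i w) \<partial>M) \<le> C * mixn p M {..<n} x * mixn q M {..<n} y" .
 qed (use C0 pm in auto)
qed

lemma Rfam_adjoint:
 assumes pq: "conj_exp p q" and a: "is_adj p q M T S" and R: "Rfam p M T C \<Phi>"
 shows "Rfam q M S C \<Phi>"
proof (rule RfamI)
 have p: "p \<ge> 1" "q \<ge> 1" and T: "lp_op p M M T" and S: "lp_op q M M S"
  using pq a by (auto simp: conj_exp_def is_adj_def)
 show C0: "0 \<le> C" using R by (simp add: Rfam_def)
 fix n and \<phi> :: "nat => complex poly" and y :: "nat => 'a => complex"
 assume \<phi>: "\<And>i. i < n ==> \<phi> i \<in> \<Phi>" and y: "\<And>i. i < n ==> memLp q M (y i)"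
 have Sm: "memLp q M (poly_op \<zeta> S (y i))" if "i < n" for i \<zeta> by (rule lp_op_mem[OF lp_op_poly[OF p(2) S] y[OF that]])
 show "mixn q M {..<n} (\<lambda>i. poly_op (\<phi> i) S (y i)) \<le> C * mixn q M {..<n} y"
 proof (rule mixn_dual[OF conj_exp_sym[OF pq]])
  fix x :: "nat => 'a => complex" assume "\<And>i. i \<in> {..<n} ==> memLp p M (x i)"
  then have x: "memLp p M (x i)" if "i < n" for i using that by auto
  have int: "integrable M (\<lambda>w. poly_op (\<phi> i) S (y i) w * x i w)" if "i < n" for i
   by (rule Hoelder_integrable[OF conj_exp_sym[OF pq] Sm x]) (use that in auto)
  have "(\<integral>w. (\<Sum>i<n. poly_op (\<phi> i) S (y i) w * x i w) \<partial>M) = (\<Sum>i<n. \<integral>w. poly_op (\<phi> i) S (y i) w * x i w \<partial>M)"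
   using int by (subst Bochner_Integration.integral_sum) auto
  also have "... = (\<Sum>i<n. \<integral>w. poly_op (\<phi> i) T (x i) w * y i w \<partial>M)"
   using is_adjD[OF is_adj_poly[OF pq a] x y] by (intro sum.cong) (auto simp: mult.commute)
  finally have "cmod (\<integral>w. (\<Sum>i<n. poly_op (\<phi> i) S (y i) w * x i w) \<partial>M) \<le> (\<Sum>i<n. cmod (\<integral>w. poly_op (\<phi> i) T (x i) w * y i w \<partial>M))"
   by (simp add: norm_sum)
  also have "... \<le> C * mixn p M {..<n} x * mixn q M {..<n} y" by (rule Rfam_pairing[OF pq T R \<phi> x y])
  finally show "cmod (\<integral>w. (\<Sum>i<n. poly_op (\<phi> i) S (y i) w * x i w) \<partial>M) \<le> C * mixn q M {..<n} y * mixn p M {..<n} x"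
   by (simp add: algebra_simps)
 qed (use C0 Sm in auto)
qed

lemma op_bd_adjoint:
 assumes pq: "conj_exp p q" and a: "is_adj p q M T S" and b: "op_bd p M M T C"
 shows "op_bd q M M S C"
 unfolding op_bd_def
proof (intro conjI allI impI)
 have T: "lp_op p M M T" and S: "lp_op q M M S" using a by (auto simp: is_adj_def)
 show "C \<ge> 0" by (rule op_bd_nonneg[OF b])
 fix y :: "'a => complex" assume y: "memLp q M y"
 show "lp_norm q M (S y) \<le> C * lp_norm q M y"
 proof (rule lp_norm_dual[OF conj_exp_sym[OF pq] _ lp_op_mem[OF S y]])
  show "0 \<le> C * lp_norm q M y" using op_bd_nonneg[OF b] by simp
  fix x :: "'a => complex" assume x: "memLp p M x"
  have "cmod (\<integral>w. S y w * x w \<partial>M) = cmod (\<integral>w. T x w * y w \<partial>M)"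
   using is_adjD[OF a x y] by (simp add: mult.commute)
  also have "... \<le> lp_norm p M (T x) * lp_norm q M y" by (rule Hoelder[OF pq lp_op_mem[OF T x] y])
  also have "... \<le> C * lp_norm p M x * lp_norm q M y" by (rule mult_right_mono[OF op_bdD[OF b x]]) simp
  finally show "cmod (\<integral>w. S y w * x w \<partial>M) \<le> C * lp_norm q M y * lp_norm p M x" by (simp add: algebra_simps)
 qed
qed

section \<open>A Bellman function and Haar shifts\<close>

text \<open>Burkholder's zigzag concavity, at midpoints: concavity in the directions whose second
  component is dominated by the first. It describes one step of a pair of martingales in which the
  differences of the second are dominated by those of the first.\<close>

definition zigzag :: "(real => real => real) => bool" where
 "zigzag U \<longleftrightarrow> (\<forall>x1 x2 y b. \<bar>b\<bar> \<le> \<bar>x1 - x2\<bar> / 2 \<longrightarrow> U x1 (y + b) + U x2 (y - b) \<le> 2 * U ((x1 + x2) / 2) y)"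

text \<open>\<open>belA\<close> equals \<open>4s + 8s(s-1)\<close>, the crude bound for the positive
  part of the second derivative. \<open>belk\<close> collects the losses in the middle term, and
  \<open>belB\<close> compensates everything once \<open>d + x^2\<close> is at least the fraction
  \<open>1 / belk^2\<close> of \<open>d + x^2 + y^2\<close>.\<close>

definition belA :: "real => real" where "belA s = 4 * s * (2 * s - 1)"
definition belk :: "real => real" where "belk s = 16 * (s - 1) + 8 * (s - 1) * \<bar>s - 2\<bar> + 1"
lemma belk_ge_1: "s \<ge> 1 ==> belk s \<ge> 1"
proof -
 assume "s \<ge> 1"
 then have "16 * (s - 1) \<ge> 0" "8 * (s - 1) * \<bar>s - 2\<bar> \<ge> 0" by auto
 then show ?thesis unfolding belk_def by linarith
qed

definition belB :: "real => real" where
 "belB s = 1 + (belA s + belA s * belk s) / (2 * s * (1 / (belk s)^2) powr (s - 1))"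
text \<open>Here \<open>s = p / 2\<close>. For \<open>d = 0\<close> this is
  \<open>|(x,y)|^p - A x^2 |(x,y)|^(p-2) - B |x|^p\<close>; a positive \<open>d\<close> keeps all
  powers smooth at the origin.\<close>

definition bel :: "real => real => real => real => real" where
 "bel s d x y = (d + x^2 + y^2) powr s - belA s * (x^2 * (d + x^2 + y^2) powr (s - 1)) - belB s * (d + x^2) powr s"

text \<open>The sign condition behind the concavity of \<open>bel\<close> along directions \<open>(a, b)\<close> with
  \<open>|b| \<le> |a|\<close>: where \<open>x\<close> is small the second term dominates, elsewhere the third one does.\<close>

lemma bel_second_derivative:
 fixes s d x y a b :: real
 assumes s: "s \<ge> 1" and d: "d > 0" and ab: "\<bar>b\<bar> \<le> \<bar>a\<bar>"
 defines "R \<equiv> d + x^2 + y^2" and "r \<equiv> d + x^2" and "D \<equiv> x * a + y * b" and "E \<equiv> a^2 + b^2"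
 shows "(s * R powr (s - 1) * (2 * E) + s * (s - 1) * R powr (s - 2) * (4 * D^2))
   - belA s * (2 * a^2 * R powr (s - 1) + 8 * (s - 1) * (x * a * D) * R powr (s - 2)
     + x^2 * (2 * (s - 1) * E * R powr (s - 2) + 4 * (s - 1) * (s - 2) * D^2 * R powr (s - 3)))
   - belB s * (2 * s * a^2 * r powr (s - 1) + 4 * s * (s - 1) * x^2 * a^2 * r powr (s - 2)) \<le> 0"
proof -
 define \<rho> where "\<rho> = r / R"
 have R: "R > 0" and r: "r > 0" "r \<le> R" using d by (auto simp: R_def r_def add_pos_nonneg)
 have rho: "0 < \<rho>" "\<rho> \<le> 1" "r = \<rho> * R" using R r by (auto simp: \<rho>_def)
 have b2: "b^2 \<le> a^2" using ab by (simp add: abs_le_square_iff)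
 have E: "0 \<le> E" "E \<le> 2 * a^2" using b2 by (auto simp: E_def)
 have D2: "D^2 \<le> 2 * a^2 * R"
 proof -
  have "D^2 \<le> (x^2 + y^2) * E"
   using sum_squares_ge_zero[of "x * b - y * a" 0] by (simp add: D_def E_def power2_eq_square algebra_simps)
  also have "... \<le> R * (2 * a^2)" using E d by (intro mult_mono) (auto simp: R_def)
  finally show ?thesis by (simp add: algebra_simps)
 qed
 define P where "P = R powr (s - 1)"
 have P: "P > 0" using R by (simp add: P_def)
 have P2: "R powr (s - 2) = P / R"
 proof -
  have "P = R powr (s - 2) * R powr 1" unfolding P_def by (subst powr_add[symmetric]) simp
  then show ?thesis using R by simp
 qed
 have P3: "R powr (s - 3) = P / R^2"
 proof -
  have "P = R powr (s - 3) * R powr 2" unfolding P_def by (subst powr_add[symmetric]) simp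
  then show ?thesis using R by simp
 qed
 have xr: "x^2 \<le> \<rho> * R" using d rho by (simp add: r_def)
 have xaD: "\<bar>x * a * D\<bar> \<le> 2 * sqrt \<rho> * a^2 * R"
 proof -
  have "(x * a * D)^2 = x^2 * a^2 * D^2" by (simp add: power_mult_distrib)
  also have "... \<le> (\<rho> * R) * a^2 * (2 * a^2 * R)" using xr D2 rho R by (intro mult_mono) auto
  also have "... = 2 * (\<rho> * (a^2)^2 * R^2)" by (simp add: power2_eq_square)
  also have "... \<le> 4 * (\<rho> * (a^2)^2 * R^2)" using rho by simp
  also have "... = (2 * sqrt \<rho> * a^2 * R)^2" using rho by (simp add: power_mult_distrib)
  finally have "\<bar>x * a * D\<bar> \<le> \<bar>2 * sqrt \<rho> * a^2 * R\<bar>" by (simp only: abs_le_square_iff)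
  also have "... = 2 * sqrt \<rho> * a^2 * R" using rho R by (intro abs_of_nonneg) auto
  finally show ?thesis .
 qed
 have t1: "s * P * (2 * E) + s * (s - 1) * (P / R) * (4 * D^2) \<le> belA s * a^2 * P"
 proof -
  have "s * P * (2 * E) \<le> s * P * (2 * (2 * a^2))" using E P s by (intro mult_left_mono) auto
  moreover have "s * (s - 1) * (P / R) * (4 * D^2) \<le> s * (s - 1) * (P / R) * (4 * (2 * a^2 * R))"
   using D2 P s R by (intro mult_left_mono) auto
  moreover have "s * (s - 1) * (P / R) * (4 * (2 * a^2 * R)) = s * (s - 1) * P * (8 * a^2)" using R by simp
  ultimately show ?thesis by (simp add: belA_def algebra_simps)
 qed
 define Q where "Q = 2 * a^2 * P + 8 * (s - 1) * (x * a * D) * (P / R)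
     + x^2 * (2 * (s - 1) * E * (P / R) + 4 * (s - 1) * (s - 2) * D^2 * (P / R^2))"
 define S3 where "S3 = 2 * s * a^2 * r powr (s - 1) + 4 * s * (s - 1) * x^2 * a^2 * r powr (s - 2)"
 have k1: "belk s \<ge> 1" by (rule belk_ge_1[OF s])
 have srho: "\<rho> \<le> sqrt \<rho>" "sqrt \<rho> \<le> 1" using rho by (auto simp: real_le_rsqrt power2_eq_square mult_left_le)
 have Qlow: "Q \<ge> a^2 * P * (2 - (belk s - 1) * sqrt \<rho>)"
 proof -
  have 1: "8 * (s - 1) * (x * a * D) * (P / R) \<ge> - (16 * (s - 1) * sqrt \<rho> * a^2 * P)"
  proof -
   have "8 * (s - 1) * (P / R) * (- (2 * sqrt \<rho> * a^2 * R)) \<le> 8 * (s - 1) * (P / R) * (x * a * D)"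
    using xaD s P R by (intro mult_left_mono) auto
   moreover have "8 * (s - 1) * (P / R) * (- (2 * sqrt \<rho> * a^2 * R)) = - (16 * (s - 1) * sqrt \<rho> * a^2 * P)" using R by simp
   ultimately show ?thesis by (simp add: algebra_simps)
  qed
  have 2: "x^2 * (4 * (s - 1) * (s - 2) * D^2 * (P / R^2)) \<ge> - (8 * (s - 1) * \<bar>s - 2\<bar> * sqrt \<rho> * a^2 * P)"
  proof -
   have "x^2 * D^2 \<le> (\<rho> * R) * (2 * a^2 * R)" using xr D2 rho R by (intro mult_mono) auto
   also have "... \<le> (sqrt \<rho> * R) * (2 * a^2 * R)" using srho R by (intro mult_right_mono) auto
   finally have *: "x^2 * D^2 \<le> 2 * sqrt \<rho> * a^2 * R^2" by (simp add: power2_eq_square algebra_simps)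
   have "- (4 * (s - 1) * \<bar>s - 2\<bar> * (P / R^2) * (2 * sqrt \<rho> * a^2 * R^2)) \<le> - (4 * (s - 1) * \<bar>s - 2\<bar> * (P / R^2) * (x^2 * D^2))"
    using * s P by (intro le_imp_neg_le mult_left_mono) auto
   also have "... \<le> 4 * (s - 1) * (s - 2) * (P / R^2) * (x^2 * D^2)"
   proof -
    define z where "z = 4 * (s - 1) * (P / R^2) * (x^2 * D^2)"
    have "z \<ge> 0" using s P by (simp add: z_def)
    then have "- \<bar>s - 2\<bar> * z \<le> (s - 2) * z" by (intro mult_right_mono) auto
    moreover have "4 * (s - 1) * \<bar>s - 2\<bar> * (P / R^2) * (x^2 * D^2) = \<bar>s - 2\<bar> * z"
     "4 * (s - 1) * (s - 2) * (P / R^2) * (x^2 * D^2) = (s - 2) * z" by (simp_all add: z_def mult_ac)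
    ultimately show ?thesis by simp
   qed
   finally have "- (4 * (s - 1) * \<bar>s - 2\<bar> * (P / R^2) * (2 * sqrt \<rho> * a^2 * R^2)) \<le> 4 * (s - 1) * (s - 2) * (P / R^2) * (x^2 * D^2)" .
   moreover have "4 * (s - 1) * \<bar>s - 2\<bar> * (P / R^2) * (2 * sqrt \<rho> * a^2 * R^2) = 8 * (s - 1) * \<bar>s - 2\<bar> * sqrt \<rho> * a^2 * P" using R by simp
   ultimately show ?thesis by (simp add: algebra_simps)
  qed
  have 3: "x^2 * (2 * (s - 1) * E * (P / R)) \<ge> 0" using s E P R by simp
  show ?thesis using 1 2 3 by (simp add: Q_def belk_def algebra_simps)
 qed
 have S3low: "S3 \<ge> 2 * s * a^2 * r powr (s - 1)" using s by (simp add: S3_def)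
 have A0: "belA s \<ge> 0" using s by (simp add: belA_def)
 have B1: "belB s \<ge> 1" using s A0 k1 by (simp add: belB_def)
 \<comment> \<open>Up to the threshold \<open>1 / belk s\<close> the loss in \<open>Qlow\<close> is
   at most 1, so \<open>Q\<close> alone absorbs the positive term. Beyond the threshold
   \<open>r\<close> is comparable to \<open>R\<close> and the last term dominates.\<close>
 have goal: "belA s * a^2 * P - belA s * Q - belB s * S3 \<le> 0"
 proof (cases "sqrt \<rho> \<le> 1 / belk s")
  case True
  have "(belk s - 1) * sqrt \<rho> \<le> (belk s - 1) * (1 / belk s)" using True k1 by (intro mult_left_mono) auto
  also have "... \<le> 1" using k1 by (simp add: field_simps)
  finally have "a^2 * P * 1 \<le> a^2 * P * (2 - (belk s - 1) * sqrt \<rho>)" using P by (intro mult_left_mono) auto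
  then have "a^2 * P \<le> Q" using Qlow by simp
  then have "belA s * (a^2 * P) \<le> belA s * Q" using A0 by (rule mult_left_mono)
  moreover have "belB s * S3 \<ge> 0" using B1 S3low s by (intro mult_nonneg_nonneg) (auto intro: order_trans[rotated])
  ultimately show ?thesis by (simp add: mult.assoc)
 next
  case False
  define \<rho>0 where "\<rho>0 = 1 / (belk s)^2"
  have "(1 / belk s)^2 < (sqrt \<rho>)^2" using False k1 by (intro power_strict_mono) auto
  then have rho0: "\<rho>0 \<le> \<rho>" "\<rho>0 > 0" using rho k1 by (auto simp: \<rho>0_def power_divide)
  have "Q \<ge> - (belk s * (a^2 * P))"
  proof -
   have "(belk s - 1) * sqrt \<rho> \<le> (belk s - 1) * 1" using srho k1 by (intro mult_left_mono) auto
   then have "- belk s \<le> 2 - (belk s - 1) * sqrt \<rho>" by simp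
   then have "a^2 * P * (- belk s) \<le> a^2 * P * (2 - (belk s - 1) * sqrt \<rho>)" using P by (intro mult_left_mono) auto
   then show ?thesis using Qlow by (simp add: algebra_simps)
  qed
  then have 1: "belA s * (- (belk s * (a^2 * P))) \<le> belA s * Q" using A0 by (intro mult_left_mono)
  have "\<rho>0 powr (s - 1) * P \<le> r powr (s - 1)"
  proof -
   have "\<rho>0 powr (s - 1) * P = (\<rho>0 * R) powr (s - 1)" using rho0 R by (simp add: P_def powr_mult)
   also have "... \<le> r powr (s - 1)" using rho rho0 R s by (intro powr_mono2) auto
   finally show ?thesis .
  qed
  then have "2 * s * a^2 * (\<rho>0 powr (s - 1) * P) \<le> 2 * s * a^2 * r powr (s - 1)" using s by (intro mult_left_mono) auto
  then have "2 * s * a^2 * (\<rho>0 powr (s - 1) * P) \<le> S3" using S3low by linarith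
  then have "belB s * (2 * s * a^2 * (\<rho>0 powr (s - 1) * P)) \<le> belB s * S3" using B1 by (intro mult_left_mono) auto
  moreover have "(belA s + belA s * belk s) * (a^2 * P) \<le> belB s * (2 * s * a^2 * (\<rho>0 powr (s - 1) * P))"
  proof -
   define w where "w = 2 * s * \<rho>0 powr (s - 1)"
   have w: "w > 0" using s rho0 by (simp add: w_def)
   have "belB s * w \<ge> belA s + belA s * belk s"
    using w unfolding belB_def \<rho>0_def[symmetric] w_def[symmetric] by (simp add: field_simps)
   then have "(belA s + belA s * belk s) * (a^2 * P) \<le> belB s * w * (a^2 * P)" using P by (intro mult_right_mono) auto
   then show ?thesis by (simp add: w_def algebra_simps)
  qed
  ultimately show ?thesis using 1 by (simp add: algebra_simps)
 qed
 show ?thesis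
  unfolding P2 P3 P_def[symmetric] Q_def[symmetric] S3_def[symmetric] using t1 goal by linarith
qed

text \<open>The two points and their midpoint lie on one line with direction \<open>(a, b)\<close>,
  at parameters 1, -1 and 0. Along this line \<open>bel_second_derivative\<close> gives the sign of
  the second derivative; the function is negated to fit the criterion for convexity.\<close>

lemma bel_zigzag:
 assumes s: "s \<ge> 1" and d: "d > 0" shows "zigzag (bel s d)"
 unfolding zigzag_def
proof (intro allI impI)
 fix x1 x2 y b :: real assume ab: "\<bar>b\<bar> \<le> \<bar>x1 - x2\<bar> / 2"
 define x where "x = (x1 + x2) / 2"
 define a where "a = (x1 - x2) / 2"
 have ab': "\<bar>b\<bar> \<le> \<bar>a\<bar>" using ab by (simp add: a_def)
 define X where "X t = x + t * a" for t
 define Y where "Y t = y + t * b" for t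
 define R where "R t = d + (X t)^2 + (Y t)^2" for t
 define r where "r t = d + (X t)^2" for t
 define D where "D t = X t * a + Y t * b" for t
 define E where "E = a^2 + b^2"
 have R: "R t > 0" and r: "r t > 0" for t using d by (auto simp: R_def r_def add_pos_nonneg)
 have dX: "(X has_real_derivative a) (at t)" and dY: "(Y has_real_derivative b) (at t)" for t
  unfolding X_def Y_def by (auto intro!: derivative_eq_intros)
 have dR: "(R has_real_derivative 2 * D t) (at t)" for t
  unfolding R_def D_def by (rule derivative_eq_intros dX dY refl)+ simp
 have dr: "(r has_real_derivative 2 * X t * a) (at t)" for t
  unfolding r_def by (rule derivative_eq_intros dX refl)+ simp
 have dD: "(D has_real_derivative E) (at t)" for t
  unfolding D_def E_def by (rule derivative_eq_intros dX dY refl)+ (simp add: power2_eq_square)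
 have dRp: "((\<lambda>t. R t powr u) has_real_derivative u * R t powr (u - 1) * (2 * D t)) (at t)" for t u
  using DERIV_fun_powr[OF dR R, of u] by simp
 have drp: "((\<lambda>t. r t powr u) has_real_derivative u * r t powr (u - 1) * (2 * X t * a)) (at t)" for t u
  using DERIV_fun_powr[OF dr r, of u] by simp
 define f where "f t = - bel s d (X t) (Y t)" for t
 define f' where "f' t = - (s * R t powr (s - 1) * (2 * D t)
   - belA s * (2 * X t * a * R t powr (s - 1) + (X t)^2 * ((s - 1) * R t powr (s - 2) * (2 * D t)))
   - belB s * (s * r t powr (s - 1) * (2 * X t * a)))" for t
 define f'' where "f'' t = - ((s * R t powr (s - 1) * (2 * E) + s * (s - 1) * R t powr (s - 2) * (4 * (D t)^2))
   - belA s * (2 * a^2 * R t powr (s - 1) + 8 * (s - 1) * (X t * a * D t) * R t powr (s - 2)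
     + (X t)^2 * (2 * (s - 1) * E * R t powr (s - 2) + 4 * (s - 1) * (s - 2) * (D t)^2 * R t powr (s - 3)))
   - belB s * (2 * s * a^2 * r t powr (s - 1) + 4 * s * (s - 1) * (X t)^2 * a^2 * r t powr (s - 2)))" for t
 have f_eq: "f = (\<lambda>t. - (R t powr s - belA s * ((X t)^2 * R t powr (s - 1)) - belB s * r t powr s))"
  by (rule ext) (simp add: f_def bel_def R_def r_def)
 have d1: "(f has_real_derivative f' t) (at t)" for t
  unfolding f_eq f'_def
  by (rule derivative_eq_intros dX dRp drp refl)+ (simp add: algebra_simps)
 have d2: "(f' has_real_derivative f'' t) (at t)" for t
  unfolding f'_def[abs_def] f''_def
  by (rule derivative_eq_intros dX dRp drp dD refl)+ (simp add: algebra_simps power2_eq_square)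
 have nn: "f'' t \<ge> 0" for t
  using bel_second_derivative[OF s d ab', of "X t" "Y t"] unfolding f''_def R_def r_def D_def E_def by linarith
 have "convex_on UNIV f"
  by (rule f''_ge0_imp_convex[where f'=f' and f''=f'']) (use d1 d2 nn in auto)
 then have "f ((1 - 1/2) *\<^sub>R (-1) + (1/2) *\<^sub>R 1) \<le> (1 - 1/2) * f (-1) + (1/2) * f 1"
  by (rule convex_onD) auto
 then have "2 * f 0 \<le> f (-1) + f 1" by simp
 moreover have "X 1 = x1" "X (-1) = x2" "Y 1 = y + b" "Y (-1) = y - b" "X 0 = x" "Y 0 = y"
  by (simp_all add: X_def Y_def x_def a_def field_simps)
 ultimately show "bel s d x1 (y + b) + bel s d x2 (y - b) \<le> 2 * bel s d ((x1 + x2) / 2) y"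
  by (simp add: f_def x_def[symmetric])
qed

section \<open>Martingale transforms on 4-adic blocks\<close>

definition mean4 :: "nat => int => (int => real) => real" where
 "mean4 J a f = (\<Sum>i<4 ^ J. f (a + int i)) / 4 ^ J"

text \<open>\<open>K j m q\<close> is the contribution of scale \<open>j\<close> on quarter
  \<open>q\<close> of a block whose quarters have the means \<open>m\<close>. The value at
  \<open>n\<close> adds these contributions over the nested blocks of length \<open>4^(j+1)\<close>,
  \<open>j < J\<close>, that contain \<open>n\<close>.\<close>

primrec blk :: "(nat => (int => real) => int => real) => nat => int => (int => real) => int => real" where
 "blk K 0 a f n = 0"
| "blk K (Suc J) a f n = blk K J (a + (n - a) div 4 ^ J * 4 ^ J) f n
   + K J (\<lambda>i. mean4 J (a + i * 4 ^ J) f) ((n - a) div 4 ^ J)"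

definition K1 :: "(nat => real) => nat => (int => real) => int => real" where
 "K1 e J m i = (let d = e J * ((m 0 - m 1) / 2) in if i = 0 then d else if i = 1 then - d else 0)"

lemma K1_values:
 "K1 e J m 0 = e J * ((m 0 - m 1) / 2)" "K1 e J m 1 = - (e J * ((m 0 - m 1) / 2))" "K1 e J m 2 = 0" "K1 e J m 3 = 0"
 by (simp_all add: K1_def Let_def)

text \<open>A transform for the binary tree that pairs quarter 0 with 2 and quarter 1 with 3. It
  sends the pattern (d, -d, 0, 0) produced by \<open>K1\<close> to (0, 0, d, -d), so that
  \<open>KS\<close> arises from two admissible transforms in succession.\<close>

definition K2 :: "nat => (int => real) => int => real" where
 "K2 J m i = (let A = ((m 0 + m 2) - (m 1 + m 3)) / 4; b = (m 0 - m 2) / 2; b' = (m 1 - m 3) / 2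
   in if i = 0 then A - b else if i = 2 then A + b else if i = 1 then - A - b' else if i = 3 then - A + b' else 0)"

definition KS :: "(nat => real) => nat => (int => real) => int => real" where
 "KS e J m i = (let d = e J * ((m 0 - m 1) / 2) in if i = 2 then d else if i = 3 then - d else 0)"

lemma sum_lessThan_4: "(\<Sum>q<4. F q) = F 0 + F 1 + F 2 + (F (3::nat) :: 'a :: comm_monoid_add)"
 by (simp add: eval_nat_numeral)

lemma sum_blocks:
 fixes F :: "int => 'a :: comm_monoid_add"
 shows "(\<Sum>i<4 ^ Suc J. F (a + int i)) = (\<Sum>q<4. \<Sum>i<4 ^ J. F (a + int q * 4 ^ J + int i))"
proof -
 have "(\<Sum>i<4 ^ Suc J. F (a + int i)) = (\<Sum>i<4 * 4 ^ J. F (a + int i))" by simp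
 also have "... = (\<Sum>q<4. \<Sum>i<4 ^ J. F (a + int (i + q * 4 ^ J)))"
 proof -
  have "sum G {m * k ..< m * k + k} = (\<Sum>i<k. G (i + m * k))" for G :: "nat => 'a" and m k
   using sum.shift_bounds_nat_ivl[of G 0 "m * k" k] by (simp add: atLeast0LessThan add.commute)
  then show ?thesis using sum.nat_group[of "\<lambda>i. F (a + int i)" "4 ^ J" 4] by simp
 qed
 finally show ?thesis by (simp add: algebra_simps)
qed

lemma mean4_Suc: "mean4 (Suc J) a f = (\<Sum>q<4. mean4 J (a + int q * 4 ^ J) f) / 4"
 unfolding mean4_def sum_blocks by (simp add: sum_divide_distrib mult.commute)

lemma div_block:
 fixes a :: int assumes "i < 4 ^ J"
 shows "(a + int q * 4 ^ J + int i - a) div 4 ^ J = int q"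
proof -
 have "int i < 4 ^ J" using assms by (metis of_nat_less_iff of_nat_numeral of_nat_power)
 then show ?thesis by (simp add: div_pos_pos_trivial)
qed

lemma blk_quarter:
 fixes a :: int assumes "i < 4 ^ J"
 shows "blk K (Suc J) a f (a + int q * 4 ^ J + int i) = blk K J (a + int q * 4 ^ J) f (a + int q * 4 ^ J + int i)
  + K J (\<lambda>i. mean4 J (a + i * 4 ^ J) f) (int q)"
 unfolding blk.simps div_block[OF assms] ..

text \<open>A four-way branching step of a martingale transform, seen as three zigzag steps.\<close>

definition admissible :: "(nat => (int => real) => int => real) => bool" where
 "admissible K \<longleftrightarrow> (\<forall>U. zigzag U \<longrightarrow> (\<forall>J m y. (\<Sum>q<4. U (m (int q)) (y + K J m (int q))) \<le> 4 * U ((\<Sum>q<4. m (int q)) / 4) y))"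

lemma blk_zigzag:
 assumes K: "admissible K" and U: "zigzag U"
 shows "(\<Sum>i<4 ^ J. U (f (a + int i)) (y + blk K J a f (a + int i))) \<le> 4 ^ J * U (mean4 J a f) y"
proof (induction J arbitrary: a y)
 case 0
 then show ?case by (simp add: mean4_def)
next
 case (Suc J)
 let ?m = "\<lambda>i. mean4 J (a + i * 4 ^ J) f"
 have "(\<Sum>i<4 ^ Suc J. U (f (a + int i)) (y + blk K (Suc J) a f (a + int i)))
   = (\<Sum>q<4. \<Sum>i<4 ^ J. U (f (a + int q * 4 ^ J + int i)) (y + blk K (Suc J) a f (a + int q * 4 ^ J + int i)))"
  by (rule sum_blocks)
 also have "... = (\<Sum>q<4. \<Sum>i<4 ^ J. U (f (a + int q * 4 ^ J + int i)) (y + K J ?m (int q) + blk K J (a + int q * 4 ^ J) f (a + int q * 4 ^ J + int i)))"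
 proof (intro sum.cong refl)
  fix q i :: nat assume "i \<in> {..<4 ^ J}"
  then have "y + blk K (Suc J) a f (a + int q * 4 ^ J + int i)
    = y + K J ?m (int q) + blk K J (a + int q * 4 ^ J) f (a + int q * 4 ^ J + int i)"
   by (subst blk_quarter) auto
  then show "U (f (a + int q * 4 ^ J + int i)) (y + blk K (Suc J) a f (a + int q * 4 ^ J + int i))
   = U (f (a + int q * 4 ^ J + int i)) (y + K J ?m (int q) + blk K J (a + int q * 4 ^ J) f (a + int q * 4 ^ J + int i))"
   by (simp only:)
 qed
 also have "... \<le> (\<Sum>q<4. 4 ^ J * U (?m (int q)) (y + K J ?m (int q)))"
  by (intro sum_mono Suc.IH)
 also have "... = 4 ^ J * (\<Sum>q<4. U (?m (int q)) (y + K J ?m (int q)))" by (simp add: sum_distrib_left)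
 also have "... \<le> 4 ^ J * (4 * U ((\<Sum>q<4. ?m (int q)) / 4) y)"
  by (intro mult_left_mono K[unfolded admissible_def, rule_format] U) simp
 finally show ?case by (simp add: mean4_Suc)
qed

lemma zigzagD:
 assumes "zigzag U" "\<bar>b\<bar> \<le> \<bar>x1 - x2\<bar> / 2"
 shows "U x1 (y + b) + U x2 (y - b) \<le> 2 * U ((x1 + x2) / 2) y"
 using assms unfolding zigzag_def by blast

lemma admissible_K1:
 assumes e: "\<And>j. \<bar>e j\<bar> \<le> 1" shows "admissible (K1 e)"
 unfolding admissible_def
proof (intro allI impI)
 fix U J and m :: "int => real" and y assume U: "zigzag U"
 define d where "d = e J * ((m 0 - m 1) / 2)"
 have "\<bar>d\<bar> \<le> \<bar>m 0 - m (1::int)\<bar> / 2"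
  using mult_right_mono[OF e[of J], of "\<bar>m 0 - m 1\<bar> / 2"] by (simp add: d_def abs_mult)
 from zigzagD[OF U this, of y] have 1: "U (m 0) (y + d) + U (m 1) (y - d) \<le> 2 * U ((m 0 + m 1) / 2) y" .
 from zigzagD[OF U, of 0 "m 2" "m 3" y] have 2: "U (m 2) y + U (m 3) y \<le> 2 * U ((m 2 + m 3) / 2) y" by simp
 have 3: "U ((m 0 + m 1) / 2) y + U ((m 2 + m 3) / 2) y \<le> 2 * U ((m 0 + m 1 + m 2 + m 3) / 4) y"
 proof -
  have e: "((m 0 + m 1) / 2 + (m 2 + m 3) / 2) / 2 = (m 0 + m 1 + m 2 + m 3) / 4" by (simp add: field_simps)
  show ?thesis using zigzagD[OF U, of 0 "(m 0 + m 1) / 2" "(m 2 + m 3) / 2" y] unfolding e by simp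
 qed
 show "(\<Sum>q<4. U (m (int q)) (y + K1 e J m (int q))) \<le> 4 * U ((\<Sum>q<4. m (int q)) / 4) y"
  using 1 2 3 by (simp add: sum_lessThan_4 K1_values d_def[symmetric] del: times_divide_eq_right)
qed

text \<open>The outer difference \<open>A\<close> between the pairs {0,2} and {1,3} is kept and the
  inner differences are reflected. Signs do not affect the domination that zigzag concavity asks
  for.\<close>

lemma admissible_K2: "admissible K2"
 unfolding admissible_def
proof (intro allI impI)
 fix U J and m :: "int => real" and y assume U: "zigzag U"
 define A where "A = ((m 0 + m 2) - (m 1 + m 3)) / 4"
 define b where "b = (m 0 - m 2) / 2"
 define b' where "b' = (m 1 - m 3) / 2"
 have 1: "U (m 0) (y + A - b) + U (m 2) (y + A + b) \<le> 2 * U ((m 0 + m 2) / 2) (y + A)"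
  using zigzagD[OF U, of "-b" "m 0" "m 2" "y + A"] by (simp add: b_def)
 have 2: "U (m 1) (y - A - b') + U (m 3) (y - A + b') \<le> 2 * U ((m 1 + m 3) / 2) (y - A)"
  using zigzagD[OF U, of "-b'" "m 1" "m 3" "y - A"] by (simp add: b'_def)
 have "(m 0 + m 2) / 2 - (m 1 + m 3) / 2 = 2 * A" by (simp add: A_def field_simps)
 then have "\<bar>A\<bar> \<le> \<bar>(m 0 + m 2) / 2 - (m 1 + m 3) / 2\<bar> / 2" by simp
 have 3: "U ((m 0 + m 2) / 2) (y + A) + U ((m 1 + m 3) / 2) (y - A) \<le> 2 * U ((m 0 + m 1 + m 2 + m 3) / 4) y"
 proof -
  have e: "((m 0 + m 2) / 2 + (m 1 + m 3) / 2) / 2 = (m 0 + m 1 + m 2 + m 3) / 4" by (simp add: field_simps)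
  show ?thesis using zigzagD[OF U \<open>\<bar>A\<bar> \<le> _\<close>, of y] unfolding e .
 qed
 have k: "K2 J m 0 = A - b" "K2 J m 1 = - A - b'" "K2 J m 2 = A + b" "K2 J m 3 = - A + b'"
  by (simp_all add: K2_def Let_def A_def b_def b'_def)
 show "(\<Sum>q<4. U (m (int q)) (y + K2 J m (int q))) \<le> 4 * U ((\<Sum>q<4. m (int q)) / 4) y"
  using 1 2 3 by (simp add: sum_lessThan_4 k algebra_simps)
qed

definition belC :: "real => real" where "belC s = 2 * (belA s * (2 * belA s) powr (s - 1) + belB s)"

text \<open>\<open>bel\<close> majorises \<open>|y|^p / 2\<close> up to a multiple of
  \<open>(d + x^2)^(p/2)\<close> and is nonpositive at \<open>y = 0\<close>. Starting
  \<open>blk_zigzag\<close> from \<open>y = 0\<close> therefore bounds the transform; letting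
  \<open>d\<close> tend to 0 removes the smoothing.\<close>

lemma blk_bound:
 assumes p: "p \<ge> 2" and K: "admissible K"
 shows "(\<Sum>i<4 ^ J. \<bar>blk K J a f (a + int i)\<bar> powr p) \<le> belC (p / 2) * (\<Sum>i<4 ^ J. \<bar>f (a + int i)\<bar> powr p)"
proof -
 define s where "s = p / 2"
 have s: "s \<ge> 1" using p by (simp add: s_def)
 let ?A = "belA s" and ?B = "belB s"
 have A: "?A > 0" using s by (simp add: belA_def)
 have k1: "belk s \<ge> 1" by (rule belk_ge_1[OF s])
 have B: "?B \<ge> 1" using s A k1 by (simp add: belB_def)
 have sq: "(t^2) powr s = \<bar>t\<bar> powr p" for t :: real
 proof -
  have "t^2 = \<bar>t\<bar> powr 2" by simp
  then show ?thesis by (simp only: powr_powr) (simp add: s_def)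
 qed
 let ?C = "?A * (2 * ?A) powr (s - 1)"
 let ?g = "\<lambda>i. blk K J a f (a + int i)" and ?f = "\<lambda>i. f (a + int i)"
 have main: "(\<Sum>i<4 ^ J. \<bar>?g i\<bar> powr p) \<le> belC s * (\<Sum>i<4 ^ J. (d + (?f i)^2) powr s)" if d: "d > 0" for d
 proof -
  have pt: "\<bar>y\<bar> powr p / 2 \<le> bel s d x y + (?C + ?B) * (d + x^2) powr s" for x y
  proof -
   define R where "R = d + x^2 + y^2"
   define r where "r = d + x^2"
   have R: "R > 0" "r > 0" using d by (auto simp: R_def r_def add_pos_nonneg)
   have Rs: "R powr s = R * R powr (s - 1)"
   proof -
    have "R powr s = R powr 1 * R powr (s - 1)" by (subst powr_add[symmetric]) simp
    then show ?thesis using R by simp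
   qed
   \<comment> \<open>If \<open>R\<close> is large against \<open>r\<close>, half of the leading
     power absorbs the middle term; otherwise \<open>R\<close> is at most \<open>2 * ?A * r\<close>
     and only powers of \<open>r\<close> remain.\<close>
   have "?A * (x^2 * R powr (s - 1)) \<le> R powr s / 2 + ?C * r powr s"
   proof (cases "2 * ?A * r \<le> R")
    case True
    have "?A * x^2 \<le> ?A * r" using A d by (intro mult_left_mono) (auto simp: r_def)
    then have "?A * x^2 \<le> R / 2" using True by simp
    then have "?A * x^2 * R powr (s - 1) \<le> R / 2 * R powr (s - 1)" by (intro mult_right_mono) auto
    moreover have "?C * r powr s \<ge> 0" using A by simp
    ultimately show ?thesis by (simp add: Rs mult.assoc)
   next
    case False
    have "R powr (s - 1) \<le> (2 * ?A * r) powr (s - 1)" using False R s by (intro powr_mono2) auto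
    also have "... = (2 * ?A) powr (s - 1) * r powr (s - 1)" using A R by (simp add: powr_mult)
    finally have "?A * (x^2 * R powr (s - 1)) \<le> ?A * (r * ((2 * ?A) powr (s - 1) * r powr (s - 1)))"
     using A d by (intro mult_left_mono mult_mono) (auto simp: r_def)
    also have "... = ?C * (r powr 1 * r powr (s - 1))" using R by simp
    also have "... = ?C * r powr s" by (subst powr_add[symmetric]) simp
    finally show ?thesis by (simp add: add_increasing)
   qed
   moreover have "\<bar>y\<bar> powr p \<le> R powr s"
    unfolding sq[symmetric] using d s by (intro powr_mono2) (auto simp: R_def)
   ultimately show ?thesis
    unfolding bel_def R_def[symmetric] unfolding r_def[symmetric] distrib_right by linarith
  qed
  have "(\<Sum>i<4 ^ J. bel s d (?f i) (0 + ?g i)) \<le> 4 ^ J * bel s d (mean4 J a f) 0"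
   by (rule blk_zigzag[OF K bel_zigzag[OF s d]])
  also have "... \<le> 0"
  proof -
   have "bel s d x 0 \<le> 0" for x
   proof -
    have "(d + x^2) powr s \<le> ?B * (d + x^2) powr s" using B by (simp add: mult_le_cancel_right1)
    moreover have "?A * (x^2 * (d + x^2) powr (s - 1)) \<ge> 0" using A by simp
    ultimately show ?thesis by (simp add: bel_def)
   qed
   then show ?thesis by (simp add: mult_nonneg_nonpos)
  qed
  finally have U: "(\<Sum>i<4 ^ J. bel s d (?f i) (?g i)) \<le> 0" by simp
  have "(\<Sum>i<4 ^ J. \<bar>?g i\<bar> powr p / 2) \<le> (\<Sum>i<4 ^ J. bel s d (?f i) (?g i) + (?C + ?B) * (d + (?f i)^2) powr s)"
   by (intro sum_mono pt)
  also have "... \<le> (?C + ?B) * (\<Sum>i<4 ^ J. (d + (?f i)^2) powr s)"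
   using U by (simp add: sum.distrib sum_distrib_left)
  finally have "(\<Sum>i<4 ^ J. \<bar>?g i\<bar> powr p) / 2 \<le> (?C + ?B) * (\<Sum>i<4 ^ J. (d + (?f i)^2) powr s)"
   by (simp only: sum_divide_distrib)
  then show ?thesis unfolding belC_def by (simp only: mult.assoc)
 qed
 have "((\<lambda>d. belC s * (\<Sum>i<4 ^ J. (d + (?f i)^2) powr s)) \<longlongrightarrow> belC s * (\<Sum>i<4 ^ J. (0 + (?f i)^2) powr s)) (at_right 0)"
  by (intro tendsto_intros tendsto_powr')
   (use s in \<open>auto intro: eventually_mono[OF eventually_at_right_less]\<close>)
 moreover have "\<forall>\<^sub>F d in at_right 0. (\<Sum>i<4 ^ J. \<bar>?g i\<bar> powr p) \<le> belC s * (\<Sum>i<4 ^ J. (d + (?f i)^2) powr s)"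
  using main by (auto simp: eventually_at_right_field intro!: exI[of _ 1])
 ultimately have "(\<Sum>i<4 ^ J. \<bar>?g i\<bar> powr p) \<le> belC s * (\<Sum>i<4 ^ J. (0 + (?f i)^2) powr s)"
  by (rule tendsto_lowerbound) simp
 then show ?thesis by (simp add: sq s_def[symmetric])
qed

lemma belC_nonneg: "s \<ge> 1 ==> belC s \<ge> 0"
proof -
 assume s: "s \<ge> 1"
 have "belA s > 0" "belk s \<ge> 1" using s by (auto simp: belA_def belk_ge_1)
 then have "belB s \<ge> 1" using s by (simp add: belB_def)
 then show ?thesis using \<open>belA s > 0\<close> by (simp add: belC_def)
qed

lemma mean4_shift:
 assumes "\<And>i. i < 4 ^ J ==> f (a + int i) = g (a + int i) + c"
 shows "mean4 J a f = mean4 J a g + c"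
proof -
 have "(\<Sum>i<4 ^ J. f (a + int i)) = (\<Sum>i<4 ^ J. g (a + int i) + c)" by (intro sum.cong) (auto simp: assms)
 then show ?thesis by (simp add: mean4_def sum.distrib add_divide_distrib)
qed

lemma quarter_index:
 fixes q i :: nat assumes "q < 4" "i < 4 ^ J" shows "q * 4 ^ J + i < 4 ^ Suc J"
proof -
 have "q * 4 ^ J + i < (q + 1) * 4 ^ J" using assms by simp
 also have "... \<le> 4 * 4 ^ J" using assms by (intro mult_right_mono) auto
 finally show ?thesis by simp
qed

text \<open>\<open>K2\<close> sees only differences of means. The coarser scales of the first
  transform are constant on a sub-block and therefore invisible to \<open>K2\<close> inside
  it.\<close>

lemma blk_K2_shift:
 assumes "\<And>i. i < 4 ^ J ==> f (a + int i) = g (a + int i) + c" and i: "i < 4 ^ J"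
 shows "blk K2 J a f (a + int i) = blk K2 J a g (a + int i)"
 using assms
proof (induction J arbitrary: a i)
 case (Suc J)
 define q where "q = i div 4 ^ J"
 define k where "k = i mod 4 ^ J"
 have qk: "q < 4" "k < 4 ^ J" "i = q * 4 ^ J + k"
 proof -
  show "q < 4" using Suc.prems(2) by (simp add: q_def less_mult_imp_div_less)
  show "k < 4 ^ J" by (simp add: k_def)
  show "i = q * 4 ^ J + k" unfolding q_def k_def by (rule div_mult_mod_eq[symmetric])
 qed
 have quarter: "f (a + int q * 4 ^ J + int i) = g (a + int q * 4 ^ J + int i) + c" if "q < 4" "i < 4 ^ J" for q i
  using Suc.prems(1)[OF quarter_index[OF that]] by (simp add: algebra_simps)
 have ai: "a + int i = a + int q * 4 ^ J + int k" by (simp add: qk(3))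
 have "mean4 J (a + int q * 4 ^ J) f = mean4 J (a + int q * 4 ^ J) g + c" if "q < 4" for q
  by (rule mean4_shift) (rule quarter[OF that])
 from this[of 0] this[of 1] this[of 2] this[of 3]
 have "K2 J (\<lambda>i. mean4 J (a + i * 4 ^ J) f) x = K2 J (\<lambda>i. mean4 J (a + i * 4 ^ J) g) x" for x
  by (simp add: K2_def Let_def)
 moreover have "blk K2 J (a + int q * 4 ^ J) f (a + int q * 4 ^ J + int k) = blk K2 J (a + int q * 4 ^ J) g (a + int q * 4 ^ J + int k)"
  by (rule Suc.IH[OF quarter[OF qk(1)] qk(2)])
 ultimately show ?case unfolding ai blk_quarter[OF qk(2)] by simp
qed simp

lemma mean4_blk_K1: "mean4 J a (blk (K1 e) J a f) = 0"
proof (induction J arbitrary: a)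
 case (Suc J)
 let ?c = "\<lambda>q. K1 e J (\<lambda>i. mean4 J (a + i * 4 ^ J) f) (int q)"
 have "mean4 J (a + int q * 4 ^ J) (blk (K1 e) (Suc J) a f) = mean4 J (a + int q * 4 ^ J) (blk (K1 e) J (a + int q * 4 ^ J) f) + ?c q" for q
  by (rule mean4_shift) (rule blk_quarter)
 then have m: "mean4 J (a + int q * 4 ^ J) (blk (K1 e) (Suc J) a f) = ?c q" for q using Suc.IH by simp
 show ?case unfolding mean4_Suc m sum_lessThan_4 by (simp add: K1_values)
qed (simp add: mean4_def)

text \<open>By \<open>mean4_blk_K1\<close> the finer scales of the first transform have mean 0, so
  its means over the four quarters are exactly the \<open>K1\<close> pattern of the present scale,
  which \<open>K2\<close> moves to the right half. The coarser scales drop out by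
  \<open>blk_K2_shift\<close>.\<close>

lemma blk_KS_eq:
 assumes "i < 4 ^ J"
 shows "blk K2 J a (blk (K1 e) J a f) (a + int i) = blk (KS e) J a f (a + int i)"
 using assms
proof (induction J arbitrary: a i)
 case (Suc J)
 define q where "q = i div 4 ^ J"
 define k where "k = i mod 4 ^ J"
 have qk: "q < 4" "k < 4 ^ J" "i = q * 4 ^ J + k"
 proof -
  show "q < 4" using Suc.prems by (simp add: q_def less_mult_imp_div_less)
  show "k < 4 ^ J" by (simp add: k_def)
  show "i = q * 4 ^ J + k" unfolding q_def k_def by (rule div_mult_mod_eq[symmetric])
 qed
 have ai: "a + int i = a + int q * 4 ^ J + int k" by (simp add: qk(3))
 let ?h = "blk (K1 e) (Suc J) a f" and ?a = "\<lambda>q. a + int q * 4 ^ J"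
 let ?c = "\<lambda>i. K1 e J (\<lambda>i. mean4 J (a + i * 4 ^ J) f) i"
 have "mean4 J (?a q) ?h = mean4 J (?a q) (blk (K1 e) J (?a q) f) + ?c (int q)" for q
  by (rule mean4_shift) (rule blk_quarter)
 then have m: "mean4 J (?a q) ?h = ?c (int q)" for q by (simp add: mean4_blk_K1)
 have "blk K2 J (?a q) ?h (?a q + int k) = blk K2 J (?a q) (blk (K1 e) J (?a q) f) (?a q + int k)"
  by (rule blk_K2_shift[OF _ qk(2)]) (rule blk_quarter)
 also have "... = blk (KS e) J (?a q) f (?a q + int k)" by (rule Suc.IH[OF qk(2)])
 finally have 1: "blk K2 J (?a q) ?h (?a q + int k) = blk (KS e) J (?a q) f (?a q + int k)" .
 have "K2 J (\<lambda>i. mean4 J (a + i * 4 ^ J) ?h) (int q) = KS e J (\<lambda>i. mean4 J (a + i * 4 ^ J) f) (int q)"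
 proof -
  have "q = 0 \<or> q = 1 \<or> q = 2 \<or> q = 3" using qk(1) by linarith
  then show ?thesis
   using m[of 0] m[of 1] m[of 2] m[of 3]
   by (auto simp: K2_def KS_def K1_def Let_def field_simps simp del: blk.simps)
 qed
 then show ?case unfolding ai blk_quarter[OF qk(2)] using 1 by simp
qed simp

lemma blk_KS_bound:
 assumes p: "p \<ge> 2" and e: "\<And>j. \<bar>e j\<bar> \<le> 1"
 shows "(\<Sum>i<4 ^ J. \<bar>blk (KS e) J a f (a + int i)\<bar> powr p) \<le> (belC (p / 2))^2 * (\<Sum>i<4 ^ J. \<bar>f (a + int i)\<bar> powr p)"
proof -
 have "(\<Sum>i<4 ^ J. \<bar>blk (KS e) J a f (a + int i)\<bar> powr p) = (\<Sum>i<4 ^ J. \<bar>blk K2 J a (blk (K1 e) J a f) (a + int i)\<bar> powr p)"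
  by (intro sum.cong) (auto simp: blk_KS_eq)
 also have "... \<le> belC (p / 2) * (\<Sum>i<4 ^ J. \<bar>blk (K1 e) J a f (a + int i)\<bar> powr p)"
  by (rule blk_bound[OF p admissible_K2])
 also have "... \<le> belC (p / 2) * (belC (p / 2) * (\<Sum>i<4 ^ J. \<bar>f (a + int i)\<bar> powr p))"
  by (intro mult_left_mono blk_bound[OF p admissible_K1] e belC_nonneg) (use p in simp)
 finally show ?thesis by (simp add: power2_eq_square mult.assoc)
qed

section \<open>Averaging over grids: from Haar shifts to polynomials in the shift\<close>

definition avgp :: "nat => complex poly" where
 "avgp L = smult (1 / of_nat L) (\<Sum>i<L. monom 1 i)"

text \<open>The convolution kernel that scale \<open>j\<close> leaves after averaging over grids, up
  to the factor \<open>-1/8\<close>: a second difference with step \<open>4^j\<close> of a twofold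
  moving average, delayed by one.\<close>

definition hphi :: "nat => complex poly" where
 "hphi j = monom 1 1 * (1 - monom 1 (4 ^ j))^2 * (avgp (4 ^ j))^2"

definition hPhi :: "(nat => real) => nat => complex poly" where
 "hPhi e J = (\<Sum>j<J. smult (of_real (e j)) (hphi j))"

lemma shiftZ_pow: "(shiftZ ^^ k) t n = t (n - int k)"
 by (induction k arbitrary: n) (auto simp: shiftZ_def algebra_simps)

lemma zpoly_alt: "degree \<phi> \<le> N ==> poly_op \<phi> shiftZ t n = (\<Sum>k\<le>N. coeff \<phi> k * t (n - int k))"
 by (simp add: poly_op_alt shiftZ_pow)

lemma zpoly_monom: "poly_op (monom c k) shiftZ t n = c * t (n - int k)"
 by (simp add: poly_op_monom shiftZ_pow)

lemma zpoly_monom_mult: "poly_op (monom 1 k * \<psi>) shiftZ t n = poly_op \<psi> shiftZ t (n - int k)"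
proof -
 have "monom 1 k * \<psi> = (\<Sum>i\<le>degree \<psi>. monom (coeff \<psi> i) (k + i))"
  by (subst (1) poly_as_sum_of_monoms[symmetric]) (simp add: sum_distrib_left mult_monom)
 then have "poly_op (monom 1 k * \<psi>) shiftZ t n = (\<Sum>i\<le>degree \<psi>. coeff \<psi> i * t (n - int (k + i)))"
  by (simp add: poly_op_sum zpoly_monom)
 then show ?thesis by (simp add: zpoly_alt[OF order_refl] algebra_simps)
qed

lemma zpoly_mult: "poly_op (\<phi> * \<psi>) shiftZ t n = poly_op \<phi> shiftZ (poly_op \<psi> shiftZ t) n"
proof -
 have "\<phi> * \<psi> = (\<Sum>j\<le>degree \<phi>. monom (coeff \<phi> j) j) * \<psi>"
  by (simp add: poly_as_sum_of_monoms)
 also have "... = (\<Sum>j\<le>degree \<phi>. smult (coeff \<phi> j) (monom 1 j * \<psi>))"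
  by (simp add: sum_distrib_right mult_smult_left[symmetric] smult_monom del: mult_smult_left)
 finally have "poly_op (\<phi> * \<psi>) shiftZ t n = (\<Sum>j\<le>degree \<phi>. coeff \<phi> j * poly_op \<psi> shiftZ t (n - int j))"
  by (simp add: poly_op_sum poly_op_smult zpoly_monom_mult)
 then show ?thesis by (simp add: zpoly_alt[OF order_refl])
qed

lemma zpoly_avgp: "poly_op (avgp L) shiftZ t n = (\<Sum>i<L. t (n - int i)) / of_nat L"
 by (simp add: avgp_def poly_op_smult poly_op_sum zpoly_monom)

definition avr :: "nat => (int => real) => int => real" where
 "avr L f n = (\<Sum>i<L. f (n - int i)) / real L"

lemma zpoly_avgp_real: "poly_op (avgp L) shiftZ (\<lambda>n. of_real (f n)) = (\<lambda>n. of_real (avr L f n))"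
 by (rule ext) (simp add: zpoly_avgp avr_def)

lemma zpoly_hphi_real:
 "poly_op (hphi j) shiftZ (\<lambda>n. of_real (f n)) n =
   of_real (avr (4^j) (avr (4^j) f) (n - 1) - 2 * avr (4^j) (avr (4^j) f) (n - 1 - 4^j) + avr (4^j) (avr (4^j) f) (n - 1 - 2 * 4^j))"
proof -
 let ?L = "4 ^ j :: nat"
 define m :: "complex poly" where "m = monom 1 1"
 define w :: "complex poly" where "w = monom 1 ?L"
 define A where "A = avgp ?L"
 have mw: "m * w = monom 1 (1 + ?L)" "m * w * w = monom 1 (1 + 2 * ?L)"
  unfolding m_def w_def by (simp_all add: mult_monom mult_2)
 have "hphi j = m * (A * A) - (m * w * (A * A) + m * w * (A * A)) + m * w * w * (A * A)"
  unfolding hphi_def m_def[symmetric] w_def[symmetric] A_def[symmetric]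
  by (simp add: power2_eq_square algebra_simps)
 then have "hphi j = monom 1 1 * (A * A) - (monom 1 (1 + ?L) * (A * A) + monom 1 (1 + ?L) * (A * A)) + monom 1 (1 + 2 * ?L) * (A * A)"
  unfolding mw(2) unfolding mw(1) unfolding m_def .
 moreover have "poly_op (A * A) shiftZ (\<lambda>n. of_real (f n)) x = of_real (avr ?L (avr ?L f) x)" for x
  unfolding A_def zpoly_mult zpoly_avgp_real ..
 ultimately show ?thesis
  by (simp only: poly_op_add poly_op_diff zpoly_monom_mult) (simp add: algebra_simps)
qed

lemma mod_add_dvd: "(m::int) dvd x ==> (y + x) mod m = y mod m"
 by (auto simp: dvd_def)

text \<open>Unrolling the recursion shows that scale \<open>j\<close> depends only on the position
  of a point modulo \<open>4^(j+1)\<close>. In this form the grid can be translated.\<close>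

lemma blk_explicit:
 assumes "i < 4 ^ J"
 shows "blk K J a f (a + int i) = (\<Sum>j<J. K j (\<lambda>q. mean4 j (a + int i - int i mod 4 ^ Suc j + q * 4 ^ j) f) (int i mod 4 ^ Suc j div 4 ^ j))"
 using assms
proof (induction J arbitrary: a i)
 case (Suc J)
 define q where "q = i div 4 ^ J"
 define k where "k = i mod 4 ^ J"
 have k: "k < 4 ^ J" "i = q * 4 ^ J + k"
  unfolding q_def k_def by (auto simp: div_mult_mod_eq)
 have ai: "a + int i = a + int q * 4 ^ J + int k" by (simp add: k(2))
 have top: "int i mod 4 ^ Suc J = int i"
 proof -
  have "int i < 4 ^ Suc J" using Suc.prems by (metis of_nat_less_iff of_nat_numeral of_nat_power)
  then show ?thesis by (intro mod_pos_pos_trivial) auto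
 qed
 have iq: "int i div 4 ^ J = int q" unfolding q_def by (simp add: zdiv_int)
 have modk: "int k mod 4 ^ Suc j = int i mod 4 ^ Suc j" if "j < J" for j
 proof -
  have "(4::int) ^ Suc j dvd 4 ^ J" using that by (intro le_imp_power_dvd) simp
  then have "(4::int) ^ Suc j dvd int q * 4 ^ J" by simp
  from mod_add_dvd[OF this, of "int k"] show ?thesis unfolding k(2) by (simp add: add.commute del: power_Suc)
 qed
 have "blk K (Suc J) a f (a + int i) = blk K J (a + int q * 4 ^ J) f (a + int q * 4 ^ J + int k)
   + K J (\<lambda>i. mean4 J (a + i * 4 ^ J) f) (int q)"
  unfolding ai by (rule blk_quarter[OF k(1)])
 also have "blk K J (a + int q * 4 ^ J) f (a + int q * 4 ^ J + int k)
   = (\<Sum>j<J. K j (\<lambda>r. mean4 j (a + int i - int i mod 4 ^ Suc j + r * 4 ^ j) f) (int i mod 4 ^ Suc j div 4 ^ j))"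
  unfolding Suc.IH[OF k(1)] unfolding ai[symmetric] by (intro sum.cong) (auto simp: modk simp del: power_Suc)
 also have "K J (\<lambda>i. mean4 J (a + i * 4 ^ J) f) (int q)
   = K J (\<lambda>r. mean4 J (a + int i - int i mod 4 ^ Suc J + r * 4 ^ J) f) (int i mod 4 ^ Suc J div 4 ^ J)"
  unfolding top iq by simp
 finally show ?case by simp
qed simp

text \<open>The Haar shift on all integers for the grid translated by \<open>\<tau>\<close>,
  restricted to the scales below \<open>J\<close>.\<close>

definition HZ :: "(nat => real) => nat => int => (int => real) => int => real" where
 "HZ e J \<tau> f n = (\<Sum>j<J. KS e j (\<lambda>q. mean4 j (n - (n - \<tau>) mod 4 ^ Suc j + q * 4 ^ j) f) ((n - \<tau>) mod 4 ^ Suc j div 4 ^ j))"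

lemma HZ_blk:
 assumes "i < 4 ^ J"
 shows "HZ e J \<tau> f (\<tau> + c * 4 ^ J + int i) = blk (KS e) J (\<tau> + c * 4 ^ J) f (\<tau> + c * 4 ^ J + int i)"
proof -
 have "(\<tau> + c * 4 ^ J + int i - \<tau>) mod 4 ^ Suc j = int i mod 4 ^ Suc j" if "j < J" for j
 proof -
  have "(4::int) ^ Suc j dvd 4 ^ J" using that by (intro le_imp_power_dvd) simp
  then have "(4::int) ^ Suc j dvd c * 4 ^ J" by simp
  moreover have "\<tau> + c * 4 ^ J + int i - \<tau> = int i + c * 4 ^ J" by simp
  ultimately show ?thesis by (simp only: mod_add_dvd)
 qed
 then show ?thesis unfolding HZ_def blk_explicit[OF assms] by (intro sum.cong) (auto simp del: power_Suc)
qed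

text \<open>The blocks of length \<open>4^J\<close> of the translated grid tile the integers, and
  the operator acts inside each of them. Norms are expressed by finite partial sums, hence the
  common bound \<open>S\<close> for all of them.\<close>

lemma HZ_bound:
 assumes p: "p \<ge> 2" and e: "\<And>j. \<bar>e j\<bar> \<le> 1"
  and S: "\<And>F. finite F ==> (\<Sum>n\<in>F. \<bar>f n\<bar> powr p) \<le> S" and F: "finite F"
 shows "(\<Sum>n\<in>F. \<bar>HZ e J \<tau> f n\<bar> powr p) \<le> (belC (p / 2))^2 * S"
proof -
 define C where "C = (\<lambda>n. (n - \<tau>) div 4 ^ J) ` F"
 define g where "g x = \<tau> + fst x * 4 ^ J + int (snd x)" for x :: "int \<times> nat"
 have finC: "finite C" using F by (simp add: C_def)
 have inj: "inj_on g (C \<times> {..<4 ^ J})"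
 proof (rule inj_onI)
  fix x y assume xy: "x \<in> C \<times> {..<4 ^ J}" "y \<in> C \<times> {..<4 ^ J}" "g x = g y"
  have lt: "int (snd z) < 4 ^ J" if "z \<in> C \<times> {..<4 ^ J}" for z
   using that by auto
  have d: "(g z - \<tau>) div 4 ^ J = fst z" if "z \<in> C \<times> {..<4 ^ J}" for z
   using lt[OF that] by (simp add: g_def div_pos_pos_trivial)
  have "fst x = fst y" using d[OF xy(1)] d[OF xy(2)] xy(3) by simp
  then show "x = y" using xy(3) by (auto simp: g_def prod_eq_iff)
 qed
 have sub: "F \<subseteq> g ` (C \<times> {..<4 ^ J})"
 proof
  fix n assume n: "n \<in> F"
  have m: "0 \<le> (n - \<tau>) mod 4 ^ J" "(n - \<tau>) mod 4 ^ J < 4 ^ J" by simp_all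
  have "g ((n - \<tau>) div 4 ^ J, nat ((n - \<tau>) mod 4 ^ J)) = n"
   using m div_mult_mod_eq[of "n - \<tau>" "4 ^ J"] by (simp add: g_def)
  moreover have "nat ((n - \<tau>) mod 4 ^ J) < 4 ^ J" using m by (simp add: nat_less_iff)
  ultimately show "n \<in> g ` (C \<times> {..<4 ^ J})" using n
   by (intro image_eqI[of _ _ "((n - \<tau>) div 4 ^ J, nat ((n - \<tau>) mod 4 ^ J))"]) (auto simp: C_def)
 qed
 have "(\<Sum>n\<in>F. \<bar>HZ e J \<tau> f n\<bar> powr p) \<le> (\<Sum>n\<in>g ` (C \<times> {..<4 ^ J}). \<bar>HZ e J \<tau> f n\<bar> powr p)"
  using finC sub by (intro sum_mono2) auto
 also have "... = (\<Sum>c\<in>C. \<Sum>i<4 ^ J. \<bar>HZ e J \<tau> f (\<tau> + c * 4 ^ J + int i)\<bar> powr p)"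
  by (subst sum.reindex[OF inj]) (simp add: g_def sum.cartesian_product case_prod_unfold)
 also have "... = (\<Sum>c\<in>C. \<Sum>i<4 ^ J. \<bar>blk (KS e) J (\<tau> + c * 4 ^ J) f (\<tau> + c * 4 ^ J + int i)\<bar> powr p)"
  by (intro sum.cong) (auto simp: HZ_blk)
 also have "... \<le> (\<Sum>c\<in>C. (belC (p / 2))^2 * (\<Sum>i<4 ^ J. \<bar>f (\<tau> + c * 4 ^ J + int i)\<bar> powr p))"
  by (intro sum_mono blk_KS_bound p e)
 also have "... = (belC (p / 2))^2 * (\<Sum>n\<in>g ` (C \<times> {..<4 ^ J}). \<bar>f n\<bar> powr p)"
  by (subst sum.reindex[OF inj]) (simp add: g_def sum.cartesian_product case_prod_unfold sum_distrib_left)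
 also have "... \<le> (belC (p / 2))^2 * S" using finC by (intro mult_left_mono S) auto
 finally show ?thesis .
qed

lemma sum_mod_full:
 fixes g :: "int => real"
 assumes N: "N > 0"
 shows "(\<Sum>\<tau><m * N. g ((n - int \<tau>) mod int N)) = real m * (\<Sum>r<N. g (int r))"
proof -
 have "(\<Sum>\<tau><m * N. g ((n - int \<tau>) mod int N)) = (\<Sum>q<m. \<Sum>i<N. g ((n - int (i + q * N)) mod int N))"
 proof -
  have "sum G {m * k ..< m * k + k} = (\<Sum>i<k. G (i + m * k))" for G :: "nat => real" and m k
   using sum.shift_bounds_nat_ivl[of G 0 "m * k" k] by (simp add: atLeast0LessThan add.commute)
  then show ?thesis using sum.nat_group[of "\<lambda>\<tau>. g ((n - int \<tau>) mod int N)" N m] by simp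
 qed
 also have "... = (\<Sum>q<m. \<Sum>r<N. g (int r))"
 proof (rule sum.cong[OF refl])
  fix q
  have "(\<Sum>i<N. g ((n - int (i + q * N)) mod int N)) = (\<Sum>i<N. g ((n - int i) mod int N))"
  proof (rule sum.cong[OF refl])
   fix i
   have "n - int (i + q * N) = (n - int i) + (- int q) * int N" by simp
   then show "g ((n - int (i + q * N)) mod int N) = g ((n - int i) mod int N)" by (metis mod_mult_self1)
  qed
  also have "... = (\<Sum>r<N. g (int r))"
  proof (rule sum.reindex_bij_witness[where j="\<lambda>i. nat ((n - int i) mod int N)" and i="\<lambda>r. nat ((n - int r) mod int N)"])
   have lt: "nat ((n - int i) mod int N) < N" for i using N by (simp add: nat_less_iff)
   have inv: "nat ((n - int (nat ((n - int i) mod int N))) mod int N) = i" if "i < N" for i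
   proof -
    have "int (nat ((n - int i) mod int N)) = (n - int i) mod int N" using N by simp
    then have "(n - int (nat ((n - int i) mod int N))) mod int N = (n - (n - int i)) mod int N"
     by (simp add: mod_diff_right_eq)
    also have "... = int i" using that by simp
    finally show ?thesis by simp
   qed
   show "nat ((n - int (nat ((n - int i) mod int N))) mod int N) = i" if "i \<in> {..<N}" for i using inv that by simp
   show "nat ((n - int (nat ((n - int r) mod int N))) mod int N) = r" if "r \<in> {..<N}" for r using inv that by simp
   show "nat ((n - int i) mod int N) \<in> {..<N}" if "i \<in> {..<N}" for i using lt by simp
   show "nat ((n - int r) mod int N) \<in> {..<N}" if "r \<in> {..<N}" for r using lt by simp
   show "g (int (nat ((n - int i) mod int N))) = g ((n - int i) mod int N)" for i using N by simp
  qed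
  finally show "(\<Sum>i<N. g ((n - int (i + q * N)) mod int N)) = (\<Sum>r<N. g (int r))" .
 qed
 finally show ?thesis by simp
qed

text \<open>Averaging the Haar shift over all translates of the grid produces the convolution operator
  whose symbol is \<open>hPhi\<close>; its kernel is one-sided since \<open>KS\<close> moves mass from the left half of a
  block to the right half.\<close>

lemma HZ_average:
 "(\<Sum>\<tau><4 ^ J. HZ e J (int \<tau>) f n) / 4 ^ J = (\<Sum>j<J. - (e j / 8) *
   (avr (4^j) (avr (4^j) f) (n - 1) - 2 * avr (4^j) (avr (4^j) f) (n - 1 - 4^j) + avr (4^j) (avr (4^j) f) (n - 1 - 2 * 4^j)))"
proof -
 have one: "(\<Sum>\<tau><4 ^ J. KS e j (\<lambda>q. mean4 j (n - (n - int \<tau>) mod 4 ^ Suc j + q * 4 ^ j) f) ((n - int \<tau>) mod 4 ^ Suc j div 4 ^ j)) / 4 ^ J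
   = - (e j / 8) * (avr (4^j) (avr (4^j) f) (n - 1) - 2 * avr (4^j) (avr (4^j) f) (n - 1 - 4^j) + avr (4^j) (avr (4^j) f) (n - 1 - 2 * 4^j))"
  if j: "j < J" for j
 proof -
  define G where "G r = KS e j (\<lambda>q. mean4 j (n - r + q * 4 ^ j) f) (r div 4 ^ j)" for r
  let ?L = "4 ^ j :: nat"
  define v where "v = avr ?L (avr ?L f)"
  have mean: "mean4 j x f = avr ?L f (x + 4 ^ j - 1)" for x
  proof -
   have "(\<Sum>i<?L. f (x + int i)) = (\<Sum>i<?L. f (x + 4 ^ j - 1 - int i))"
    by (rule sum.reindex_bij_witness[where i="\<lambda>i. ?L - 1 - i" and j="\<lambda>i. ?L - 1 - i"]) (auto simp: of_nat_diff algebra_simps)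
   then show ?thesis by (simp add: mean4_def avr_def)
  qed
  have W: "(\<Sum>i<?L. mean4 j (x - int i) f) = 4 ^ j * v (x + 4 ^ j - 1)" for x
  proof -
   have "(\<Sum>i<?L. mean4 j (x - int i) f) = (\<Sum>i<?L. avr ?L f (x + 4 ^ j - 1 - int i))"
    unfolding mean by (intro sum.cong) (auto simp: algebra_simps)
   then show ?thesis by (simp add: v_def avr_def[of _ "avr ?L f"])
  qed
  \<comment> \<open>The \<open>4^J\<close> translates meet every residue modulo
    \<open>4^(j+1)\<close> equally often, so the average at scale \<open>j\<close> does not depend
    on \<open>J\<close>.\<close>
  have J: "(4::nat) ^ J = 4 ^ (J - Suc j) * 4 ^ Suc j" using j by (simp only: power_add[symmetric]) simp
  have "(\<Sum>\<tau><4 ^ J. G ((n - int \<tau>) mod 4 ^ Suc j)) = 4 ^ (J - Suc j) * (\<Sum>r<4 ^ Suc j. G (int r))"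
   unfolding J using sum_mod_full[of "4 ^ Suc j" G n "4 ^ (J - Suc j)"] by simp
  moreover have "(4::real) ^ J = 4 ^ (J - Suc j) * 4 ^ Suc j" using j by (simp only: power_add[symmetric]) simp
  ultimately have "(\<Sum>\<tau><4 ^ J. G ((n - int \<tau>) mod 4 ^ Suc j)) / 4 ^ J = (\<Sum>r<4 ^ Suc j. G (int r)) / 4 ^ Suc j" by simp
  also have "(\<Sum>r<4 ^ Suc j. G (int r)) = (\<Sum>q<4. \<Sum>i<4 ^ j. G (int q * 4 ^ j + int i))"
   using sum_blocks[of G 0 j] by simp
  also have "... = (\<Sum>q<4. \<Sum>i<4 ^ j. KS e j (\<lambda>q'. mean4 j (n - (int q * 4 ^ j + int i) + q' * 4 ^ j) f) (int q))"
  proof (intro sum.cong refl)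
   fix q i :: nat assume "i \<in> {..<4 ^ j}"
   then show "G (int q * 4 ^ j + int i) = KS e j (\<lambda>q'. mean4 j (n - (int q * 4 ^ j + int i) + q' * 4 ^ j) f) (int q)"
    using div_block[of i j 0 q] by (simp add: G_def)
  qed
  \<comment> \<open>Only quarters 2 and 3 receive mass, and what they receive was read on quarters 0
    and 1, strictly to the left of \<open>n\<close>.\<close>
  also have "... = (\<Sum>i<4 ^ j. e j * ((mean4 j (n - 2 * 4 ^ j - int i) f - mean4 j (n - 4 ^ j - int i) f) / 2))
    - (\<Sum>i<4 ^ j. e j * ((mean4 j (n - 3 * 4 ^ j - int i) f - mean4 j (n - 2 * 4 ^ j - int i) f) / 2))"
   unfolding sum_lessThan_4 by (simp add: KS_def Let_def sum_negf algebra_simps)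
  also have "... = (e j / 2) * (((\<Sum>i<4 ^ j. mean4 j (n - 2 * 4 ^ j - int i) f) - (\<Sum>i<4 ^ j. mean4 j (n - 4 ^ j - int i) f))
    - ((\<Sum>i<4 ^ j. mean4 j (n - 3 * 4 ^ j - int i) f) - (\<Sum>i<4 ^ j. mean4 j (n - 2 * 4 ^ j - int i) f)))"
   by (simp add: sum_distrib_left[symmetric] sum_divide_distrib[symmetric] sum_subtractf[symmetric] right_diff_distrib[symmetric] diff_divide_distrib[symmetric])
  also have "... = (e j / 2) * 4 ^ j * (2 * v (n - 1 - 4 ^ j) - v (n - 1) - v (n - 1 - 2 * 4 ^ j))"
  proof -
   have "n - 2 * 4 ^ j + 4 ^ j - 1 = n - 1 - 4 ^ j" "n - 4 ^ j + 4 ^ j - 1 = n - 1" "n - 3 * 4 ^ j + 4 ^ j - 1 = n - 1 - 2 * 4 ^ j"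
    by simp_all
   then show ?thesis unfolding W by (simp only:) (simp add: algebra_simps)
  qed
  finally have "(\<Sum>\<tau><4 ^ J. G ((n - int \<tau>) mod 4 ^ Suc j)) / 4 ^ J
    = (e j / 2) * 4 ^ j * (2 * v (n - 1 - 4 ^ j) - v (n - 1) - v (n - 1 - 2 * 4 ^ j)) / 4 ^ Suc j" .
  also have "... = - (e j / 8) * (v (n - 1) - 2 * v (n - 1 - 4 ^ j) + v (n - 1 - 2 * 4 ^ j))"
   by (simp add: algebra_simps add_divide_distrib diff_divide_distrib)
  finally show ?thesis unfolding G_def v_def .
 qed
 have "(\<Sum>\<tau><4 ^ J. HZ e J (int \<tau>) f n) / 4 ^ J
   = (\<Sum>j<J. (\<Sum>\<tau><4 ^ J. KS e j (\<lambda>q. mean4 j (n - (n - int \<tau>) mod 4 ^ Suc j + q * 4 ^ j) f) ((n - int \<tau>) mod 4 ^ Suc j div 4 ^ j)) / 4 ^ J)"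
  unfolding HZ_def by (subst sum.swap) (simp only: sum_divide_distrib)
 then show ?thesis using one by simp
qed

section \<open>Bounds on l^p of the integers, uniform in the signs\<close>

abbreviation cZ :: "int measure" where "cZ \<equiv> count_space UNIV"

lemma count_space_sum_le:
 fixes g :: "int => real"
 assumes "integrable cZ g" "\<And>n. g n \<ge> 0" "finite F"
 shows "(\<Sum>n\<in>F. g n) \<le> (\<integral>n. g n \<partial>cZ)"
proof -
 have "(\<Sum>n\<in>F. g n) = (\<Sum>n | indicator F n * g n \<noteq> 0. indicator F n * g n)"
  using assms(3) by (intro sum.mono_neutral_cong_right) (auto simp: indicator_def split: if_splits)
 also have "... = (\<integral>n. indicator F n * g n \<partial>cZ)"
 proof -
  have "finite {n \<in> UNIV. indicator F n * g n \<noteq> 0}"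
   by (rule finite_subset[OF _ assms(3)]) (auto simp: indicator_def split: if_splits)
  from lebesgue_integral_count_space_finite_support[OF this] show ?thesis by simp
 qed
 also have "... \<le> (\<integral>n. g n \<partial>cZ)"
 proof (rule integral_mono_AE'[OF assms(1)])
  show "AE n in cZ. indicator F n * g n \<le> g n" using assms(2) by (auto simp: indicator_def)
  show "AE n in cZ. 0 \<le> g n" using assms(2) by auto
 qed
 finally show ?thesis .
qed

lemma count_space_bound:
 fixes g :: "int => real"
 assumes nn: "\<And>n. g n \<ge> 0" and B: "\<And>F. finite F ==> (\<Sum>n\<in>F. g n) \<le> B"
 shows "integrable cZ g" "(\<integral>n. g n \<partial>cZ) \<le> B"
proof -
 have "Infinite_Set_Sum.abs_summable_on g UNIV"
  by (rule abs_summable_finite_sumsI[where B=B]) (use nn B in simp)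
 then show i: "integrable cZ g" by (simp add: Infinite_Set_Sum.abs_summable_on_def)
 have "infsetsum g UNIV = infsum g UNIV"
  by (rule infsetsum_infsum) (use i in \<open>simp add: Infinite_Set_Sum.abs_summable_on_def\<close>)
 also have "... \<le> B"
 proof (rule infsum_le_finite_sums)
  have "Infinite_Set_Sum.abs_summable_on g UNIV"
   using i unfolding Infinite_Set_Sum.abs_summable_on_def .
  then have "Infinite_Sum.abs_summable_on g UNIV" using abs_summable_equivalent[of g UNIV] by (rule iffD2[rotated])
  then show "g summable_on UNIV" by (rule abs_summable_summable)
  show "sum g F \<le> B" if "finite F" for F using B that .
 qed
 finally show "(\<integral>n. g n \<partial>cZ) \<le> B" by (simp add: infsetsum_def)
qed

definition AVZ :: "(nat => real) => nat => (int => real) => int => real" where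
 "AVZ e J f n = (\<Sum>\<tau><4 ^ J. HZ e J (int \<tau>) f n) / 4 ^ J"

text \<open>Jensen's inequality: an average of operators with a common bound obeys that
  bound.\<close>

lemma AVZ_bound:
 assumes p: "p \<ge> 2" and e: "\<And>j. \<bar>e j\<bar> \<le> 1"
  and S: "\<And>F. finite F ==> (\<Sum>n\<in>F. \<bar>f n\<bar> powr p) \<le> S" and F: "finite F"
 shows "(\<Sum>n\<in>F. \<bar>AVZ e J f n\<bar> powr p) \<le> (belC (p / 2))^2 * S"
proof -
 let ?I = "{..<(4::nat) ^ J}"
 have "\<bar>AVZ e J f n\<bar> powr p \<le> (\<Sum>\<tau>\<in>?I. (1 / 4 ^ J) * \<bar>HZ e J (int \<tau>) f n\<bar> powr p)" for n
 proof -
  have "\<bar>AVZ e J f n\<bar> \<le> (\<Sum>\<tau>\<in>?I. (1 / 4 ^ J) *\<^sub>R \<bar>HZ e J (int \<tau>) f n\<bar>)"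
   unfolding AVZ_def by (simp add: sum_divide_distrib[symmetric] divide_right_mono sum_abs)
  then have "\<bar>AVZ e J f n\<bar> powr p \<le> (\<Sum>\<tau>\<in>?I. (1 / 4 ^ J) *\<^sub>R \<bar>HZ e J (int \<tau>) f n\<bar>) powr p"
   using p by (intro powr_mono2) auto
  also have "... \<le> (\<Sum>\<tau>\<in>?I. (1 / 4 ^ J) * \<bar>HZ e J (int \<tau>) f n\<bar> powr p)"
   by (rule convex_on_sum[where C="{0..}"]) (use p in \<open>auto intro: powr_convex_nonneg simp: lessThan_empty_iff\<close>)
  finally show ?thesis .
 qed
 then have "(\<Sum>n\<in>F. \<bar>AVZ e J f n\<bar> powr p) \<le> (\<Sum>n\<in>F. \<Sum>\<tau>\<in>?I. (1 / 4 ^ J) * \<bar>HZ e J (int \<tau>) f n\<bar> powr p)"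
  by (rule sum_mono)
 also have "... = (\<Sum>\<tau>\<in>?I. (1 / 4 ^ J) * (\<Sum>n\<in>F. \<bar>HZ e J (int \<tau>) f n\<bar> powr p))"
  by (subst sum.swap) (simp only: sum_distrib_left)
 also have "... \<le> (\<Sum>\<tau>\<in>?I. (1 / 4 ^ J) * ((belC (p / 2))^2 * S))"
  by (intro sum_mono mult_left_mono HZ_bound p e S F) auto
 also have "... = (belC (p / 2))^2 * S" by simp
 finally show ?thesis .
qed

text \<open>The factor \<open>-8\<close> cancels the \<open>-1/8\<close> of the averaged Haar shift.
  Real and imaginary parts are separated because the Bellman estimate concerns real
  functions.\<close>

lemma zpoly_hPhi:
 "poly_op (hPhi e J) shiftZ t n = of_real (- 8 * AVZ e J (\<lambda>n. Re (t n)) n) + \<i> * of_real (- 8 * AVZ e J (\<lambda>n. Im (t n)) n)"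
proof -
 have real: "poly_op (hPhi e J) shiftZ (\<lambda>n. of_real (f n)) n = of_real (- 8 * AVZ e J f n)" for f
  unfolding hPhi_def poly_op_sum poly_op_smult zpoly_hphi_real AVZ_def HZ_average
  by (simp add: sum_distrib_left of_real_sum)
 have "poly_op \<phi> shiftZ t n = poly_op \<phi> shiftZ (\<lambda>n. of_real (Re (t n))) n + \<i> * poly_op \<phi> shiftZ (\<lambda>n. of_real (Im (t n))) n" for \<phi>
 proof -
  have "poly_op \<phi> shiftZ t n = (\<Sum>k\<le>degree \<phi>. coeff \<phi> k * (of_real (Re (t (n - int k))) + \<i> * of_real (Im (t (n - int k)))))"
   by (simp add: zpoly_alt[OF order_refl] complex_eq[symmetric])
  then show ?thesis by (simp add: zpoly_alt[OF order_refl] distrib_left sum.distrib sum_distrib_left mult_ac)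
 qed
 then show ?thesis by (simp only: real)
qed

lemma memLp_shift_Z:
 fixes t :: "int => complex"
 assumes "bij h" "memLp p cZ t"
 shows "memLp p cZ (\<lambda>n. t (h n))" "lp_norm p cZ (\<lambda>n. t (h n)) = lp_norm p cZ t"
proof -
 show "memLp p cZ (\<lambda>n. t (h n))"
  using assms integrable_bij_count_space[OF assms(1), of "\<lambda>n. norm (t n) powr p"] by (simp add: memLp_def)
 show "lp_norm p cZ (\<lambda>n. t (h n)) = lp_norm p cZ t"
  using integral_bij_count_space[OF assms(1), of "\<lambda>n. norm (t n) powr p"] by (simp add: lp_norm_def)
qed

lemma lp_op_shift_Z:
 assumes "bij h" shows "lp_op p cZ cZ (\<lambda>t n. t (h n))"
 by (rule lp_opI[where C=1]) (use memLp_shift_Z[OF assms] in \<open>auto simp: op_bd_def AE_count_space\<close>)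

text \<open>\<open>2 powr p\<close> and the factor 2 come from the real and imaginary parts,
  \<open>8 powr p\<close> from the factor \<open>-8\<close>, and the square of \<open>belC\<close>
  from the two transforms that compose the Haar shift.\<close>

definition Kp :: "real => real" where
 "Kp p = (2 powr p * (8 powr p * (2 * (belC (p / 2))^2))) powr (1 / p)"

lemma Kp_nonneg [simp]: "Kp p \<ge> 0"
 by (simp add: Kp_def)

lemma hPhi_bound_ge2:
 assumes p: "p \<ge> 2" and e: "\<And>j. \<bar>e j\<bar> \<le> 1"
 shows "op_bd p cZ cZ (poly_op (hPhi e J) shiftZ) (Kp p)"
 unfolding op_bd_def
proof (intro conjI allI impI)
 show "0 \<le> Kp p" by simp
 fix t :: "int => complex" assume t: "memLp p cZ t"
 define S where "S = lp_norm p cZ t powr p"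
 have S: "S = (\<integral>n. cmod (t n) powr p \<partial>cZ)" using p by (simp add: S_def lp_norm_powr)
 have fin: "(\<Sum>n\<in>F. cmod (t n) powr p) \<le> S" if "finite F" for F
  unfolding S by (rule count_space_sum_le) (use t that in \<open>auto simp: memLp_def\<close>)
 have Re: "(\<Sum>n\<in>F. \<bar>Re (t n)\<bar> powr p) \<le> S" and Im: "(\<Sum>n\<in>F. \<bar>Im (t n)\<bar> powr p) \<le> S" if "finite F" for F
  using p by (auto intro!: order_trans[OF _ fin[OF that]] sum_mono powr_mono2 abs_Re_le_cmod abs_Im_le_cmod)
 let ?P = "poly_op (hPhi e J) shiftZ t"
 have fb: "(\<Sum>n\<in>F. cmod (?P n) powr p) \<le> Kp p powr p * S" if F: "finite F" for F
 proof -
  have "(\<Sum>n\<in>F. cmod (?P n) powr p) \<le> (\<Sum>n\<in>F. 2 powr p * (8 powr p * \<bar>AVZ e J (\<lambda>n. Re (t n)) n\<bar> powr p + 8 powr p * \<bar>AVZ e J (\<lambda>n. Im (t n)) n\<bar> powr p))"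
  proof (rule sum_mono)
   fix n
   have "cmod (?P n) powr p \<le> 2 powr p * (\<bar>Re (?P n)\<bar> powr p + \<bar>Im (?P n)\<bar> powr p)"
    by (rule norm_powr_le_Re_Im) (use p in simp)
   then show "cmod (?P n) powr p \<le> 2 powr p * (8 powr p * \<bar>AVZ e J (\<lambda>n. Re (t n)) n\<bar> powr p + 8 powr p * \<bar>AVZ e J (\<lambda>n. Im (t n)) n\<bar> powr p)"
    by (simp add: zpoly_hPhi abs_mult powr_mult)
  qed
  also have "... = 2 powr p * (8 powr p * ((\<Sum>n\<in>F. \<bar>AVZ e J (\<lambda>n. Re (t n)) n\<bar> powr p) + (\<Sum>n\<in>F. \<bar>AVZ e J (\<lambda>n. Im (t n)) n\<bar> powr p)))"
   by (simp add: sum_distrib_left[symmetric] sum.distrib[symmetric] distrib_left[symmetric])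
  also have "... \<le> 2 powr p * (8 powr p * ((belC (p / 2))^2 * S + (belC (p / 2))^2 * S))"
   by (intro mult_left_mono add_mono AVZ_bound p e Re Im F) auto
  also have "... = Kp p powr p * S" using p by (simp add: Kp_def powr_powr)
  finally show ?thesis .
 qed
 have "(\<integral>n. cmod (?P n) powr p \<partial>cZ) \<le> Kp p powr p * S" by (rule count_space_bound(2)[OF _ fb]) auto
 also have "... = (Kp p * lp_norm p cZ t) powr p" by (simp add: S_def powr_mult)
 finally show "lp_norm p cZ ?P \<le> Kp p * lp_norm p cZ t"
  using lp_norm_le_iff[of p "Kp p * lp_norm p cZ t" cZ ?P] p by simp
qed

text \<open>The Bellman function serves exponents at least 2. For smaller \<open>p\<close> the
  estimate for the conjugate exponent is dualised: the adjoint of the shift is the inverse shift,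
  and reflecting the integers turns it back into the shift.\<close>

lemma hPhi_bound:
 assumes p: "p > 1" and e: "\<And>j. \<bar>e j\<bar> \<le> 1"
 shows "op_bd p cZ cZ (poly_op (hPhi e J) shiftZ) (max (Kp p) (Kp (p / (p - 1))))"
proof (cases "p \<ge> 2")
 case True
 from op_bd_mono[OF hPhi_bound_ge2[OF True, of e J]] e show ?thesis by simp
next
 case False
 define q where "q = p / (p - 1)"
 have pq: "conj_exp p q" unfolding q_def by (rule conj_expI[OF p])
 have q2: "q \<ge> 2" using p False by (simp add: q_def field_simps)
 define S' :: "(int => complex) => int => complex" where "S' t n = t (n + 1)" for t n
 have bij1: "bij (\<lambda>n::int. n - 1)" by (rule o_bij[of "\<lambda>n. n + 1"]) (auto simp: fun_eq_iff)
 have bij2: "bij (\<lambda>n::int. n + 1)" by (rule o_bij[of "\<lambda>n. n - 1"]) (auto simp: fun_eq_iff)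
 have bij3: "bij (uminus :: int => int)" by (rule o_bij[of uminus]) (auto simp: fun_eq_iff)
 note bij = bij1 bij2 bij3
 have lS: "lp_op q cZ cZ shiftZ" "lp_op p cZ cZ S'"
  using lp_op_shift_Z[OF bij(1)] lp_op_shift_Z[OF bij(2)] unfolding shiftZ_def[abs_def] S'_def[abs_def] by auto
 have adj: "is_adj q p cZ shiftZ S'"
  unfolding is_adj_def
 proof (intro conjI lS allI impI)
  fix x y :: "int => complex"
  show "(\<integral>n. shiftZ x n * y n \<partial>cZ) = (\<integral>n. x n * S' y n \<partial>cZ)"
   using integral_bij_count_space[OF bij(1), of "\<lambda>n. x n * y (n + 1)"] by (simp add: shiftZ_def S'_def)
 qed
 have b: "op_bd p cZ cZ (poly_op (hPhi e J) S') (Kp q)"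
  by (rule op_bd_adjoint[OF conj_exp_sym[OF pq] is_adj_poly[OF conj_exp_sym[OF pq] adj] hPhi_bound_ge2[OF q2 e]])
 have pow: "(S' ^^ k) t n = t (n + int k)" for k t n
  by (induction k arbitrary: n) (auto simp: S'_def algebra_simps)
 have refl: "poly_op \<phi> shiftZ t n = poly_op \<phi> S' (\<lambda>n. t (- n)) (- n)" for \<phi> t n
  by (simp add: poly_op_def pow shiftZ_pow)
 have "op_bd p cZ cZ (poly_op (hPhi e J) shiftZ) (Kp q)"
  unfolding op_bd_def
 proof (intro conjI allI impI)
  show "0 \<le> Kp q" by simp
  fix t :: "int => complex" assume t: "memLp p cZ t"
  note t' = memLp_shift_Z[OF bij(3) t]
  have "lp_norm p cZ (poly_op (hPhi e J) shiftZ t) = lp_norm p cZ (\<lambda>n. poly_op (hPhi e J) S' (\<lambda>n. t (- n)) (- n))"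
   by (simp add: refl[abs_def])
  also have "... = lp_norm p cZ (poly_op (hPhi e J) S' (\<lambda>n. t (- n)))"
   by (rule memLp_shift_Z(2)[OF bij(3)]) (rule lp_op_mem[OF lp_op_poly[OF _ lS(2)] t'(1)], use p in simp)
  also have "... \<le> Kp q * lp_norm p cZ t" using op_bdD[OF b t'(1)] t'(2) by simp
  finally show "lp_norm p cZ (poly_op (hPhi e J) shiftZ t) \<le> Kp q * lp_norm p cZ t" .
 qed
 then show ?thesis by (rule op_bd_mono) (simp add: q_def)
qed

lemma hPhi_pnorm:
 assumes p: "p > 1" and e: "\<And>j. \<bar>e j\<bar> \<le> 1"
 shows "poly_pnorm p (hPhi e J) \<le> max (Kp p) (Kp (p / (p - 1)))"
 unfolding poly_pnorm_def
proof (rule cSup_least)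
 show "(\<lambda>t. lp_norm p cZ (poly_op (hPhi e J) shiftZ t)) ` {t. memLp p cZ t \<and> lp_norm p cZ t \<le> 1} \<noteq> {}"
  using memLp_zero[of p cZ] lp_norm_zero[of p cZ] by (auto intro!: exI[of _ "\<lambda>x. 0::complex"])
 let ?K = "max (Kp p) (Kp (p / (p - 1)))"
 fix r assume "r \<in> (\<lambda>t. lp_norm p cZ (poly_op (hPhi e J) shiftZ t)) ` {t. memLp p cZ t \<and> lp_norm p cZ t \<le> 1}"
 then obtain t where t: "memLp p cZ t" "lp_norm p cZ t \<le> 1" "r = lp_norm p cZ (poly_op (hPhi e J) shiftZ t)" by auto
 have "r \<le> ?K * lp_norm p cZ t" unfolding t(3) by (rule op_bdD[OF hPhi_bound[OF p e] t(1)])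
 also have "... \<le> ?K * 1" by (intro mult_left_mono t) (simp add: le_max_iff_disj)
 finally show "r \<le> ?K" by simp
qed

section \<open>The square function estimate\<close>

text \<open>The norm of the Wiener algebra. Polynomials bounded in it act as an R-bounded family as
  soon as the powers of the operator do.\<close>

definition l1 :: "complex poly => real" where "l1 \<phi> = (\<Sum>i\<le>degree \<phi>. cmod (coeff \<phi> i))"

lemma l1_alt: "degree \<phi> \<le> n ==> l1 \<phi> = (\<Sum>i\<le>n. cmod (coeff \<phi> i))"
 unfolding l1_def by (intro sum.mono_neutral_left) (auto simp: coeff_eq_0)

lemma l1_nonneg [simp]: "l1 \<phi> \<ge> 0" by (simp add: l1_def sum_nonneg)

lemma l1_add: "l1 (\<phi> + \<psi>) \<le> l1 \<phi> + l1 \<psi>"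
proof -
 let ?n = "max (degree \<phi>) (degree \<psi>)"
 have "l1 (\<phi> + \<psi>) = (\<Sum>i\<le>?n. cmod (coeff \<phi> i + coeff \<psi> i))"
  by (subst l1_alt[of _ ?n]) (auto intro: degree_add_le_max)
 also have "... \<le> (\<Sum>i\<le>?n. cmod (coeff \<phi> i) + cmod (coeff \<psi> i))" by (intro sum_mono norm_triangle_ineq)
 also have "... = l1 \<phi> + l1 \<psi>" by (simp add: l1_alt[of _ ?n] sum.distrib)
 finally show ?thesis .
qed

lemma l1_0 [simp]: "l1 0 = 0" by (simp add: l1_def)
lemma l1_1 [simp]: "l1 1 = 1" by (simp add: l1_def)

lemma l1_smult: "l1 (smult c \<phi>) = cmod c * l1 \<phi>"
proof -
 have "l1 (smult c \<phi>) = (\<Sum>i\<le>degree \<phi>. cmod c * cmod (coeff \<phi> i))"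
  by (subst l1_alt[of _ "degree \<phi>"]) (auto simp: norm_mult)
 then show ?thesis by (simp add: l1_def sum_distrib_left)
qed

lemma l1_uminus [simp]: "l1 (- \<phi>) = l1 \<phi>" by (simp add: l1_def)

lemma l1_diff: "l1 (\<phi> - \<psi>) \<le> l1 \<phi> + l1 \<psi>"
 using l1_add[of \<phi> "- \<psi>"] by simp

lemma l1_sum: "l1 (\<Sum>i\<in>I. \<phi> i) \<le> (\<Sum>i\<in>I. l1 (\<phi> i))"
proof (induction I rule: infinite_finite_induct)
 case (insert i I)
 then show ?case using l1_add[of "\<phi> i" "\<Sum>i\<in>I. \<phi> i"] by simp
qed auto

lemma l1_monom [simp]: "l1 (monom c n) = cmod c"
proof -
 have "l1 (monom c n) = (\<Sum>i\<le>n. cmod (if n = i then c else 0))"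
  by (subst l1_alt[OF degree_monom_le]) (simp add: coeff_monom)
 also have "... = (\<Sum>i\<le>n. if n = i then cmod c else 0)" by (intro sum.cong) auto
 finally have "l1 (monom c n) = (\<Sum>i\<le>n. if n = i then cmod c else 0)" .
 then show ?thesis by simp
qed

lemma l1_mult: "l1 (\<phi> * \<psi>) \<le> l1 \<phi> * l1 \<psi>"
proof -
 have "\<phi> * \<psi> = (\<Sum>j\<le>degree \<phi>. monom (coeff \<phi> j) j) * (\<Sum>i\<le>degree \<psi>. monom (coeff \<psi> i) i)"
  by (simp add: poly_as_sum_of_monoms)
 also have "... = (\<Sum>j\<le>degree \<phi>. \<Sum>i\<le>degree \<psi>. monom (coeff \<phi> j * coeff \<psi> i) (j + i))"
  by (simp add: sum_product mult_monom)
 finally have "l1 (\<phi> * \<psi>) \<le> (\<Sum>j\<le>degree \<phi>. \<Sum>i\<le>degree \<psi>. l1 (monom (coeff \<phi> j * coeff \<psi> i) (j + i)))"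
  by (auto intro!: order_trans[OF l1_sum] sum_mono)
 then have "l1 (\<phi> * \<psi>) \<le> (\<Sum>j\<le>degree \<phi>. \<Sum>i\<le>degree \<psi>. cmod (coeff \<phi> j) * cmod (coeff \<psi> i))"
  by (simp only: l1_monom norm_mult)
 then show ?thesis by (simp add: l1_def[of \<phi>] l1_def[of \<psi>] sum_product)
qed

lemma l1_mult_le: "l1 \<phi> \<le> a ==> l1 \<psi> \<le> b ==> l1 (\<phi> * \<psi>) \<le> a * b"
 by (rule order_trans[OF l1_mult]) (meson l1_nonneg mult_mono order_trans)

lemma l1_add_le: "l1 \<phi> \<le> a ==> l1 \<psi> \<le> b ==> l1 (\<phi> + \<psi>) \<le> a + b"
 using l1_add[of \<phi> \<psi>] by linarith

lemma l1_diff_le: "l1 \<phi> \<le> a ==> l1 \<psi> \<le> b ==> l1 (\<phi> - \<psi>) \<le> a + b"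
 using l1_diff[of \<phi> \<psi>] by linarith

lemma l1_power_le: "l1 \<phi> \<le> a ==> l1 (\<phi> ^ n) \<le> a ^ n"
proof (induction n)
 case (Suc n)
 then show ?case using l1_mult_le[of \<phi> a "\<phi> ^ n" "a ^ n"] by simp
qed simp

definition pows :: "complex poly set" where "pows = {monom 1 n | n. True}"
definition diffs :: "complex poly set" where "diffs = {smult (of_nat n) (monom 1 n - monom 1 (n - 1)) | n. n \<ge> 1}"

lemma Rfam_l1:
 assumes pq: "conj_exp p q" and T: "lp_op p M M T" and R: "Rfam p M T C pows" and b: "b > 0"
 shows "Rfam p M T (b * C) {\<phi>. l1 \<phi> \<le> b}"
proof -
 have p: "p \<ge> 1" using pq by (simp add: conj_exp_def)
 let ?H = "{(\<Sum>j\<in>J. smult (c j) (\<psi> j)) | J c \<psi>. finite (J :: nat set) \<and> (\<forall>j\<in>J. \<psi> j \<in> pows) \<and> (\<Sum>j\<in>J. cmod (c j)) \<le> 1}"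
 have "Rfam p M T C ?H" by (rule Rfam_hull[OF pq T R]) (auto simp: pows_def)
 from Rfam_scale[OF p T this, of b] b have "Rfam p M T (b * C) {smult c \<phi> | c \<phi>. cmod c \<le> b \<and> \<phi> \<in> ?H}" by simp
 then show ?thesis
 proof (rule Rfam_subset)
  show "{\<phi>. l1 \<phi> \<le> b} \<subseteq> {smult c \<phi> | c \<phi>. cmod c \<le> b \<and> \<phi> \<in> ?H}"
  proof
   fix \<phi> assume "\<phi> \<in> {\<phi>. l1 \<phi> \<le> b}"
   then have l: "l1 \<phi> \<le> b" by simp
   define c where "c i = coeff \<phi> i / of_real b" for i
   have "(\<Sum>i\<le>degree \<phi>. cmod (c i)) \<le> 1"
    using l b by (simp add: c_def norm_divide l1_def sum_divide_distrib[symmetric])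
   then have "(\<Sum>i\<in>{..degree \<phi>}. smult (c i) (monom 1 i)) \<in> ?H"
    by (intro CollectI exI[of _ "{..degree \<phi>}"] exI[of _ c] exI[of _ "monom 1"]) (auto simp: pows_def)
   moreover have "\<phi> = smult (of_real b) (\<Sum>i\<in>{..degree \<phi>}. smult (c i) (monom 1 i))"
   proof -
    have "smult (of_real b) (\<Sum>i\<in>{..degree \<phi>}. smult (c i) (monom 1 i)) = (\<Sum>i\<le>degree \<phi>. monom (coeff \<phi> i) i)"
     using b by (intro poly_eqI) (simp add: coeff_sum sum_distrib_left c_def if_distrib cong: if_cong)
    then show ?thesis by (simp add: poly_as_sum_of_monoms)
   qed
   ultimately show "\<phi> \<in> {smult c \<phi> | c \<phi>. cmod c \<le> b \<and> \<phi> \<in> ?H}" using b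
    by (intro CollectI exI[of _ "of_real b"] exI[of _ "\<Sum>i\<in>{..degree \<phi>}. smult (c i) (monom 1 i)"]) auto
  qed
 qed
qed

text \<open>With the coefficients \<open>sg A\<close> the operators \<open>hPhi (sg A) J\<close> are
  Rademacher sums of the \<open>hphi j\<close>. The lower Khintchine inequality converts their
  uniform bound into a bound for the square function over the scales.\<close>

lemma square_fun_hphi:
 assumes p: "p \<ge> 1" and T: "lp_op p M M T"
  and H: "\<And>e. (\<And>j. \<bar>e j\<bar> \<le> 1) ==> op_bd p M M (poly_op (hPhi e J) T) C" and f: "memLp p M f"
 shows "mixn p M {..<J} (\<lambda>j. poly_op (hphi j) T f) \<le> (24 * 4 powr (p / 2)) powr (1 / p) * C * lp_norm p M f"
proof -
 have p0: "p > 0" using p by simp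
 define c where "c = 24 * 4 powr (p / 2)"
 have C0: "C \<ge> 0" using op_bd_nonneg[OF H[of "\<lambda>_. 0"]] by simp
 have m: "memLp p M (poly_op \<phi> T f)" for \<phi> by (rule lp_op_mem[OF lp_op_poly[OF p T] f])
 have rs: "rsum {..<J} A (\<lambda>j. poly_op (hphi j) T f w) = poly_op (hPhi (sg A) J) T f w" for A w
  by (simp add: rsum_def hPhi_def poly_op_sum poly_op_smult)
 have i1: "integrable M (\<lambda>w. cmod (poly_op \<phi> T f w) powr p)" for \<phi> using m by (simp add: memLp_def)
 have i2: "integrable M (\<lambda>w. (\<Sum>j<J. (cmod (poly_op (hphi j) T f w))^2) powr (p / 2))"
 proof -
  have "memLp p M (\<lambda>w. L2_set (\<lambda>j. cmod (poly_op (hphi j) T f w)) {..<J})" by (rule memLp_L2(1)[OF p m])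
  moreover have "norm (L2_set (\<lambda>j. cmod (poly_op (hphi j) T f w)) {..<J}) powr p = (\<Sum>j<J. (cmod (poly_op (hphi j) T f w))^2) powr (p / 2)" for w
   unfolding L2_set_def by (simp add: powr_half_sqrt[symmetric] powr_powr sum_nonneg)
  ultimately show ?thesis by (simp add: memLp_def)
 qed
 have "mixn p M {..<J} (\<lambda>j. poly_op (hphi j) T f) powr p = (\<integral>w. (\<Sum>j<J. (cmod (poly_op (hphi j) T f w))^2) powr (p / 2) \<partial>M)"
  by (rule lp_norm_powr_mixn[OF p0])
 also have "... \<le> (\<integral>w. c * avg {..<J} (\<lambda>A. cmod (poly_op (hPhi (sg A) J) T f w) powr p) \<partial>M)"
 proof (rule integral_mono[OF i2])
  show "integrable M (\<lambda>w. c * avg {..<J} (\<lambda>A. cmod (poly_op (hPhi (sg A) J) T f w) powr p))"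
   unfolding avg_def using i1 by (intro integrable_mult_right integrable_divide Bochner_Integration.integrable_sum)
  fix w
  have pw: "((cmod z)^2) powr (p / 2) = cmod z powr p" for z
  proof -
   have "(cmod z)^2 = cmod z powr 2" by simp
   then show ?thesis by (simp only: powr_powr) simp
  qed
  show "(\<Sum>j<J. (cmod (poly_op (hphi j) T f w))^2) powr (p / 2) \<le> c * avg {..<J} (\<lambda>A. cmod (poly_op (hPhi (sg A) J) T f w) powr p)"
   using Khintchine_lower[of "{..<J}" "{()}" "p/2" "\<lambda>j _. poly_op (hphi j) T f w"] p0
   by (simp add: rs pw c_def)
 qed
 also have "... = c * avg {..<J} (\<lambda>A. lp_norm p M (poly_op (hPhi (sg A) J) T f) powr p)"
  unfolding avg_def lp_norm_powr[OF p0] using i1 by (simp add: Bochner_Integration.integral_sum)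
 also have "... \<le> c * avg {..<J} (\<lambda>A. (C * lp_norm p M f) powr p)"
 proof (intro mult_left_mono avg_mono powr_mono2)
  fix A :: "nat set"
  show "lp_norm p M (poly_op (hPhi (sg A) J) T f) \<le> C * lp_norm p M f"
   by (rule op_bdD[OF H f]) (simp add: sg_def)
 qed (use p0 in \<open>auto simp: c_def\<close>)
 also have "... = c * (C * lp_norm p M f) powr p" by (simp add: avg_const)
 also have "... = (c powr (1 / p) * C * lp_norm p M f) powr p"
  using C0 p0 by (simp add: powr_mult powr_powr c_def)
 finally show ?thesis
  using p0 C0 powr_less_mono2[of p "c powr (1 / p) * C * lp_norm p M f" "mixn p M {..<J} (\<lambda>j. poly_op (hphi j) T f)"]
  unfolding c_def[symmetric] by (meson lp_norm_nonneg mixn_nonneg mult_nonneg_nonneg not_le powr_ge_zero)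
qed

abbreviation zz :: "complex poly" where "zz \<equiv> monom 1 1"

lemma monom_zz: "monom 1 n = zz ^ n"
 by (simp add: monom_power)

lemma avgp_zz: "avgp L = smult (1 / of_nat L) (\<Sum>i<L. zz ^ i)"
 unfolding avgp_def by (intro arg_cong2[where f=smult] sum.cong refl monom_zz)

section \<open>A resolution of the identity over the scales 4^j\<close>

definition ap :: "nat => complex poly" where "ap j = avgp (4 ^ j)"
definition Dp :: "nat => complex poly" where "Dp j = smult (4 ^ j) (1 - zz)"
definition wp :: "nat => complex poly" where "wp j = monom 1 (4 ^ j)"
text \<open>The quotient of \<open>1 - ap j\<close> by \<open>Dp j\<close>. Like \<open>kp\<close>
  and \<open>rp\<close> below it is bounded in \<open>l1\<close> uniformly in \<open>j\<close>,
  whereas \<open>Dp j\<close> itself is of order \<open>4^j\<close>.\<close>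

definition cp :: "nat => complex poly" where "cp j = smult (1 / 4 ^ j * (1 / 4 ^ j)) (\<Sum>i<4 ^ j. \<Sum>m<i. zz ^ m)"
definition kp :: "nat => complex poly" where "kp j = smult (1/4) (1 + wp j + (wp j)^2 + (wp j) ^ 3)"
definition rp :: "nat => complex poly" where "rp j = smult (1/4) (3 + 2 * wp j + (wp j)^2)"

lemma Dp_ap: "Dp j * ap j = 1 - wp j"
proof -
 have "Dp j * ap j = (1 - zz) * (\<Sum>i<4 ^ j. zz ^ i)"
  by (simp add: Dp_def ap_def avgp_zz)
 also have "... = 1 - zz ^ (4 ^ j)" by (rule one_diff_power_eq[symmetric])
 finally show ?thesis unfolding wp_def monom_zz[of "4 ^ j"] .
qed

lemma one_minus_ap: "1 - ap j = Dp j * cp j"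
proof -
 have "(\<Sum>i<4 ^ j. 1 - zz ^ i) = (1 - zz) * (\<Sum>i<4 ^ j. \<Sum>m<i. zz ^ m)"
  unfolding sum_distrib_left by (intro sum.cong refl) (simp add: one_diff_power_eq sum_distrib_left)
 moreover have "(\<Sum>i<4 ^ j. 1 - zz ^ i) = smult (4 ^ j) (1 - ap j)"
  by (simp add: sum_subtractf ap_def avgp_zz smult_diff_right of_nat_poly)
 ultimately have "smult (4 ^ j) (1 - ap j) = (1 - zz) * (\<Sum>i<4 ^ j. \<Sum>m<i. zz ^ m)" by simp
 then have "smult (1 / 4 ^ j) (smult (4 ^ j) (1 - ap j)) = smult (1 / 4 ^ j) ((1 - zz) * (\<Sum>i<4 ^ j. \<Sum>m<i. zz ^ m))" by simp
 then show ?thesis by (simp add: Dp_def cp_def)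
qed

text \<open>Multiplied by \<open>Dp (Suc j)\<close> both sides become \<open>1 - wp j ^ 4\<close>.
  The factor is nonzero and cancels in the polynomial ring.\<close>

lemma ap_Suc: "ap (Suc j) = ap j * kp j"
proof -
 have w: "wp (Suc j) = wp j ^ 4" by (simp add: wp_def monom_power mult.commute)
 have ne: "Dp (Suc j) \<noteq> 0"
 proof
  assume "Dp (Suc j) = 0"
  then have "coeff (1 - zz) 1 = 0" by (simp add: Dp_def)
  then show False by simp
 qed
 have "Dp (Suc j) * ap (Suc j) = 1 - wp j ^ 4" using Dp_ap[of "Suc j"] w by simp
 also have "... = (1 - wp j) * (1 + wp j + (wp j)^2 + (wp j) ^ 3)" by (simp add: algebra_simps eval_nat_numeral)
 also have "... = Dp j * ap j * smult 4 (kp j)" by (simp add: Dp_ap kp_def)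
 also have "... = Dp (Suc j) * (ap j * kp j)"
 proof -
  have "Dp (Suc j) = smult 4 (Dp j)" by (simp add: Dp_def)
  then show ?thesis by (simp add: mult.assoc)
 qed
 finally show ?thesis using ne by simp
qed

lemma one_minus_kp: "1 - kp j = Dp j * ap j * rp j"
proof -
 have "smult 4 (1 - kp j) = 3 - wp j - (wp j)^2 - (wp j) ^ 3"
 proof -
  have "smult 4 (1 - kp j) = smult 4 1 - (1 + wp j + (wp j)^2 + (wp j) ^ 3)" by (simp add: kp_def smult_diff_right)
  moreover have "smult 4 1 = (4 :: complex poly)" by (simp add: numeral_poly)
  ultimately show ?thesis by (simp add: algebra_simps)
 qed
 also have "... = (1 - wp j) * (3 + 2 * wp j + (wp j)^2)" by (simp add: algebra_simps eval_nat_numeral)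
 also have "... = smult 4 (Dp j * ap j * rp j)" by (simp add: Dp_ap rp_def)
 finally have "smult (1/4) (smult 4 (1 - kp j)) = smult (1/4) (smult 4 (Dp j * ap j * rp j))" by (rule arg_cong)
 then show ?thesis unfolding smult_smult by simp
qed

definition gp :: "nat => complex poly" where "gp j = cp j * (1 + ap j + ap j ^ 2 + ap j ^ 3 + ap j ^ 4)"
definition Rp :: "nat => complex poly" where
 "Rp j = rp j * (1 + kp j + kp j ^ 2 + kp j ^ 3 + kp j ^ 4) * (gp j ^ 2 + smult 4 (gp j * gp (Suc j)) + smult 16 (gp (Suc j) ^ 2))"
text \<open>The exponents are dictated by the difference of consecutive terms, which must contain
  \<open>Dp^3 ap^6\<close>. The part \<open>Dp^2 ap^4\<close> is \<open>hphi\<close> up to a factor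
  \<open>zz\<close>, a third \<open>Dp\<close> gives the decay for \<open>4^j \<le> k\<close>, and
  two more \<open>ap\<close> tame \<open>(1 - zz) * Dp\<close> for \<open>4^j > k\<close>. The cube
  supplies two factors \<open>Dp\<close> besides the one in \<open>1 - kp j\<close>, and the fifth
  power together with the \<open>ap\<close> found there makes the sixth.\<close>

definition Bp :: "nat => complex poly" where "Bp j = 1 - (1 - ap j ^ 5) ^ 3"

lemma one_minus_power5: "1 - x ^ 5 = (1 - x) * (1 + x + x ^ 2 + x ^ 3 + x ^ 4)" for x :: "'a :: comm_ring_1"
 by (simp add: algebra_simps eval_nat_numeral)

lemma Bp_diff: "Bp j - Bp (Suc j) = ((Dp j)^2 * ap j ^ 4) * (Dp j * (ap j)^2 * Rp j)"
proof -
 let ?D = "Dp j" and ?a = "ap j"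
 define u where "u = 1 - ap j ^ 5"
 define v where "v = 1 - ap (Suc j) ^ 5"
 have u: "u = ?D * gp j" unfolding u_def one_minus_power5 one_minus_ap gp_def by (simp add: mult.assoc)
 have "v = Dp (Suc j) * gp (Suc j)" unfolding v_def one_minus_power5 one_minus_ap gp_def by (simp add: mult.assoc)
 then have v: "v = ?D * smult 4 (gp (Suc j))" by (simp add: Dp_def)
 have "v - u = ?a ^ 5 * (1 - kp j ^ 5)" unfolding u_def v_def ap_Suc by (simp add: power_mult_distrib algebra_simps)
 also have "... = ?a ^ 5 * (?D * ?a * rp j * (1 + kp j + kp j ^ 2 + kp j ^ 3 + kp j ^ 4))"
  unfolding one_minus_power5 one_minus_kp ..
 finally have vu: "v - u = ?a ^ 5 * (?D * ?a * rp j * (1 + kp j + kp j ^ 2 + kp j ^ 3 + kp j ^ 4))" .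
 have "Bp j - Bp (Suc j) = v ^ 3 - u ^ 3" by (simp add: Bp_def u_def v_def)
 also have "... = (v - u) * (u^2 + u * v + v^2)" by (simp add: algebra_simps eval_nat_numeral)
 also have "u^2 + u * v + v^2 = ?D^2 * (gp j ^ 2 + smult 4 (gp j * gp (Suc j)) + smult 16 (gp (Suc j) ^ 2))"
  unfolding u v by (simp add: power2_eq_square algebra_simps)
 finally have 1: "Bp j - Bp (Suc j) = ?a ^ 5 * (?D * ?a * rp j * (1 + kp j + kp j ^ 2 + kp j ^ 3 + kp j ^ 4)) *
   (?D^2 * (gp j ^ 2 + smult 4 (gp j * gp (Suc j)) + smult 16 (gp (Suc j) ^ 2)))" unfolding vu .
 have gen: "a ^ 5 * (D * a * r * h) * (D^2 * g) = (D^2 * a ^ 4) * (D * a^2 * (r * h * g))" for a D r h g :: "complex poly"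
  by (simp add: algebra_simps eval_nat_numeral)
 show ?thesis unfolding 1 Rp_def by (rule gen)
qed

lemma hphi_eq: "hphi j = zz * ((Dp j)^2 * ap j ^ 4)"
proof -
 have "hphi j = zz * (Dp j * ap j)^2 * (ap j)^2"
  unfolding Dp_ap by (simp add: hphi_def ap_def wp_def)
 then show ?thesis by (simp add: algebra_simps eval_nat_numeral)
qed

lemma l1_ap: "l1 (ap j) \<le> 1"
proof -
 have "l1 (ap j) \<le> (1 / 4 ^ j) * (\<Sum>i<(4::nat) ^ j. 1)"
  unfolding ap_def avgp_def l1_smult
  by (intro mult_mono order_trans[OF l1_sum] sum_mono) (auto simp: norm_divide norm_power)
 then show ?thesis by simp
qed

lemma l1_wp: "l1 (wp j) \<le> 1" by (simp add: wp_def)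

lemma l1_cp: "l1 (cp j) \<le> 1"
proof -
 have "l1 (\<Sum>i<4 ^ j. \<Sum>m<i. zz ^ m) \<le> (\<Sum>i<(4::nat) ^ j. \<Sum>m<i. 1)"
  by (intro order_trans[OF l1_sum] sum_mono order_trans[OF l1_power_le[of zz 1]]) (simp_all only: l1_monom, simp_all)
 also have "... \<le> (\<Sum>i<(4::nat) ^ j. 4 ^ j)" by (intro sum_mono) (auto intro: less_imp_le)
 also have "... = 4 ^ j * 4 ^ j" by simp
 finally have "l1 (cp j) \<le> (1 / 4 ^ j * (1 / 4 ^ j)) * (4 ^ j * 4 ^ j)"
  unfolding cp_def l1_smult by (intro mult_mono) (auto simp: norm_mult norm_divide norm_power)
 then show ?thesis by simp
qed

lemma l1_kp: "l1 (kp j) \<le> 1"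
proof -
 have "l1 (1 + wp j + (wp j)^2 + (wp j) ^ 3) \<le> 1 + 1 + 1 ^ 2 + 1 ^ 3"
  by (intro l1_add_le l1_power_le l1_wp) simp
 then show ?thesis by (simp add: kp_def l1_smult)
qed

lemma l1_numeral [simp]: "l1 (numeral n) = numeral n"
 by (simp add: numeral_poly l1_def)

lemma l1_rp: "l1 (rp j) \<le> 3/2"
proof -
 have "l1 (3 + 2 * wp j + (wp j)^2) \<le> 3 + 2 * 1 + 1 ^ 2"
  by (intro l1_add_le l1_mult_le l1_power_le l1_wp) simp_all
 then show ?thesis by (simp add: rp_def l1_smult)
qed

lemma l1_geom5: "l1 x \<le> 1 ==> l1 (1 + x + x ^ 2 + x ^ 3 + x ^ 4) \<le> 5"
 using l1_add_le[OF l1_add_le[OF l1_add_le[OF l1_add_le[of 1 1 x 1] l1_power_le[of x 1 2]] l1_power_le[of x 1 3]] l1_power_le[of x 1 4]] by simp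

lemma l1_gp: "l1 (gp j) \<le> 5"
 using l1_mult_le[OF l1_cp l1_geom5[OF l1_ap], of j j] by (simp add: gp_def)

lemma l1_Rp: "l1 (Rp j) \<le> 4000"
proof -
 have "l1 (gp j ^ 2 + smult 4 (gp j * gp (Suc j)) + smult 16 (gp (Suc j) ^ 2)) \<le> 5 ^ 2 + 4 * (5 * 5) + 16 * 5 ^ 2"
  using l1_mult_le[OF l1_gp l1_gp, of j "Suc j"] l1_power_le[OF l1_gp, of "Suc j" 2]
  by (intro l1_add_le l1_power_le l1_gp) (simp_all add: l1_smult)
 then have "l1 (Rp j) \<le> 3/2 * 5 * (5 ^ 2 + 4 * (5 * 5) + 16 * 5 ^ 2)"
  unfolding Rp_def by (intro l1_mult_le l1_rp l1_geom5 l1_kp)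
 then show ?thesis by simp
qed

lemma Bp_0: "Bp 0 = 1"
 by (simp add: Bp_def ap_def avgp_def pCons_one)

lemma Bp_telescope: "1 = (\<Sum>j<J. Bp j - Bp (Suc j)) + Bp J"
 unfolding sum_lessThan_telescope' Bp_0 diff_add_cancel ..

text \<open>Index \<open>i\<close> stands for \<open>k = i + 1\<close>: these polynomials produce
  the sequence whose l^2 norm defines the square function.\<close>

definition sqp :: "nat => complex poly" where
 "sqp i = smult (of_real (sqrt (real (Suc i)))) (monom 1 (Suc i) - monom 1 i)"

text \<open>One R-bounded set for both regimes of \<open>kernel_factor\<close>. For
  \<open>4^j \<le> k\<close> it provides a product of two Ritt differences, where 6 is the loss from
  splitting the exponent and 4000 rounds up the \<open>l1\<close> bound of \<open>Rp\<close>. For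
  \<open>4^j > k\<close> it provides a polynomial with bounded coefficients, where
  \<open>16000 = 4 * 4000\<close> accounts for \<open>(1 - wp j)^2\<close> and
  \<open>Rp j\<close>.\<close>

definition kerset :: "complex poly set" where
 "kerset = {\<phi> + \<psi> | \<phi> \<psi>. \<phi> \<in> {smult c \<eta> | c \<eta>. cmod c \<le> 6 \<and> \<eta> \<in> {\<delta> * \<psi> | \<delta> \<psi>. \<delta> \<in> {\<phi> * \<psi> | \<phi> \<psi>. \<phi> \<in> diffs \<and> \<psi> \<in> diffs} \<and> \<psi> \<in> {\<phi>. l1 \<phi> \<le> 4000}}}
   \<and> \<psi> \<in> {\<phi>. l1 \<phi> \<le> 16000}}"

lemma Rfam_kerset:
 assumes pq: "conj_exp p q" and T: "lp_op p M M T" and R: "Rfam p M T C1 pows" and D: "Rfam p M T C2 diffs"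
 shows "Rfam p M T (6 * (C2 * C2 * (4000 * C1)) + 16000 * C1) kerset"
proof -
 have p: "p \<ge> 1" using pq by (simp add: conj_exp_def)
 show ?thesis unfolding kerset_def
  by (intro Rfam_add[OF p T] Rfam_scale[OF p T] Rfam_mult[OF p T] D Rfam_l1[OF pq T R]) auto
qed

lemma zero_in_kerset: "0 \<in> kerset"
proof -
 have "smult 1 (monom 1 1 - monom 1 0) \<in> diffs" unfolding diffs_def by (intro CollectI exI[of _ 1]) simp
 then have "smult 0 (smult 1 (monom 1 1 - monom 1 0) * smult 1 (monom 1 1 - monom 1 0) * 0) + 0 \<in> kerset"
  unfolding kerset_def by (intro CollectI exI conjI) (rule refl | assumption | simp)+
 then show ?thesis by simp
qed

text \<open>The almost orthogonality between time \<open>k\<close> and scale \<open>4^j\<close>: it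
  decays geometrically away from \<open>4^j = k\<close>.\<close>

definition ckj :: "nat => nat => real" where "ckj k j = min (4 ^ j / real k) (real k / 4 ^ j)"

lemma monom_step: "monom 1 (Suc a) - monom 1 a = - (zz ^ a * (1 - zz))"
proof -
 have "monom 1 (Suc a) = zz * zz ^ a" using monom_zz[of "Suc a"] by simp
 moreover have "monom 1 a = zz ^ a" by (rule monom_zz)
 ultimately show ?thesis by (simp add: algebra_simps)
qed

text \<open>For \<open>4^j \<le> k\<close> the two factors \<open>1 - zz\<close> are joined to two
  halves of the power \<open>zz ^ (k - 2)\<close>; each difference then gains \<open>1 / k\<close>
  from the Ritt property, and \<open>k * 4^j / k^2\<close> remains. For \<open>4^j > k\<close> the
  factor \<open>1 - zz\<close> is written as \<open>Dp j / 4^j\<close>, and since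
  \<open>Dp^2 ap^2 = (1 - wp)^2\<close> is bounded in \<open>l1\<close>, only \<open>k / 4^j\<close>
  remains.\<close>

lemma kernel_factor:
 assumes k: "k \<ge> 2"
 shows "\<exists>Q\<in>kerset. smult (of_nat k) (zz ^ (k - 2) * (1 - zz) * (Dp j * (ap j)^2 * Rp j)) = smult (of_real (ckj k j)) Q"
proof (cases "4 ^ j \<le> k")
 case True
 \<comment> \<open>Nearly equal halves of \<open>k - 2\<close>: both \<open>a + 1\<close> and
   \<open>b + 1\<close> are comparable to \<open>k\<close>, and \<open>k * k\<close> is at most 6
   times their product.\<close>
 define a where "a = (k - 2) div 2"
 define b where "b = k - 2 - a"
 have ab: "a + b = k - 2" "3 * (a + 1) \<ge> k" "2 * (b + 1) \<ge> k"
  using k by (auto simp: a_def b_def)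
 define da where "da = smult (of_nat (Suc a)) (monom 1 (Suc a) - monom (1::complex) (Suc a - 1))"
 define db where "db = smult (of_nat (Suc b)) (monom 1 (Suc b) - monom (1::complex) (Suc b - 1))"
 have "smult (of_nat (Suc n)) (monom 1 (Suc n) - monom 1 (Suc n - 1)) \<in> diffs" for n
  unfolding diffs_def by (rule CollectI, rule exI[of _ "Suc n"]) simp
 then have d: "da \<in> diffs" "db \<in> diffs" unfolding da_def db_def by this+
 have da: "da = smult (- of_nat (Suc a)) (zz ^ a * (1 - zz))" and db: "db = smult (- of_nat (Suc b)) (zz ^ b * (1 - zz))"
  unfolding da_def db_def by (simp_all only: diff_Suc_1 monom_step smult_minus_right smult_minus_left)
 define c where "c = (of_nat k * of_nat k / (of_nat (Suc a) * of_nat (Suc b)) :: complex)"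
 have c: "cmod c \<le> 6"
 proof -
  have "real k * real k \<le> real (3 * (a + 1)) * real (2 * (b + 1))"       by (intro mult_mono of_nat_mono ab(2) ab(3)) auto
  also have "... = 6 * (real (Suc a) * real (Suc b))" by (simp add: algebra_simps)
  finally have "real k * real k \<le> 6 * (real (Suc a) * real (Suc b))" .
  moreover have "real (Suc a) * real (Suc b) > 0" by simp
  ultimately have "real k * real k / (real (Suc a) * real (Suc b)) \<le> 6" by (simp only: pos_divide_le_eq)
  moreover have "cmod c = real k * real k / (real (Suc a) * real (Suc b))" by (simp add: c_def norm_divide norm_mult del: of_nat_Suc)
  ultimately show ?thesis by simp
 qed
 define \<psi> where "\<psi> = (ap j)^2 * Rp j"
 have \<psi>: "l1 \<psi> \<le> 4000"
  using l1_mult_le[OF l1_power_le[OF l1_ap, of j 2] l1_Rp, of j] by (simp add: \<psi>_def)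
 have Q: "smult c (da * db * \<psi>) + 0 \<in> kerset"
  unfolding kerset_def using c d \<psi> by (intro CollectI exI conjI) (rule refl | assumption | simp)+
 have dd: "da * db = smult (of_nat (Suc a) * of_nat (Suc b)) (zz ^ (k - 2) * ((1 - zz) * (1 - zz)))"
 proof -
  have "zz ^ a * (1 - zz) * (zz ^ b * (1 - zz)) = zz ^ (k - 2) * ((1 - zz) * (1 - zz))"
   unfolding ab(1)[symmetric] power_add by (simp only: mult_ac)
  moreover have "smult x X * smult y Y = smult (x * y) (X * Y)" for x y and X Y :: "complex poly" by (simp add: mult.commute)
  ultimately show ?thesis unfolding da db by (simp only: minus_mult_minus)
 qed
 have ck: "ckj k j = 4 ^ j / real k"
 proof -
  have "(4::real) ^ j \<le> real k" using of_nat_mono[OF True, where 'a=real] by simp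
  then have "4 ^ j / real k \<le> 1" "1 \<le> real k / 4 ^ j" using k by (auto simp: field_simps)
  then have "4 ^ j / real k \<le> real k / 4 ^ j" by (rule order_trans)
  then show ?thesis by (simp only: ckj_def min_absorb1)
 qed
 have "smult (of_real (ckj k j)) (smult c (da * db * \<psi>))
   = smult (of_real (ckj k j) * c * (of_nat (Suc a) * of_nat (Suc b))) (zz ^ (k - 2) * ((1 - zz) * (1 - zz)) * \<psi>)"
  unfolding dd by (simp add: mult_ac del: of_nat_Suc)
 also have "of_real (ckj k j) * c * (of_nat (Suc a) * of_nat (Suc b)) = (4 ^ j * of_nat k :: complex)"
  using k unfolding ck c_def by (simp add: field_simps del: of_nat_Suc)
 also have "smult (4 ^ j * of_nat k) (zz ^ (k - 2) * ((1 - zz) * (1 - zz)) * \<psi>)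
   = smult (of_nat k) (zz ^ (k - 2) * (1 - zz) * (smult (4 ^ j) (1 - zz) * \<psi>))"
  by (simp only: mult_smult_right mult_smult_left smult_smult mult_ac)
 finally show ?thesis using Q unfolding \<psi>_def Dp_def
  by (intro bexI[of _ "smult c (da * db * \<psi>)"]) (simp_all add: \<psi>_def mult.assoc)
next
 case False
 have "k \<le> 4 ^ j" using False by simp
 from of_nat_mono[OF this, where 'a=real] have "(4::real) ^ j \<ge> real k" by simp
 then have "real k / 4 ^ j \<le> 1" "1 \<le> 4 ^ j / real k" using k by (auto simp: field_simps)
 then have "real k / 4 ^ j \<le> 4 ^ j / real k" by (rule order_trans)
 then have ck: "ckj k j = real k / 4 ^ j" by (simp only: ckj_def min_absorb2)
 define Q where "Q = zz ^ (k - 2) * (1 - wp j)^2 * Rp j"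
 have "l1 Q \<le> 1 ^ (k - 2) * (1 + 1)^2 * 4000"
  unfolding Q_def by (intro l1_mult_le l1_power_le l1_diff_le l1_Rp l1_wp) simp_all
 moreover have "smult 1 (monom 1 1 - monom 1 0) \<in> diffs" unfolding diffs_def by (intro CollectI exI[of _ 1]) simp
 ultimately have "smult 0 (smult 1 (monom 1 1 - monom 1 0) * smult 1 (monom 1 1 - monom 1 0) * 0) + Q \<in> kerset"
  unfolding kerset_def by (intro CollectI exI conjI) (rule refl | assumption | simp)+
 then have "Q \<in> kerset" by simp
 moreover have "smult (of_real (ckj k j)) Q = smult (of_nat k) (zz ^ (k - 2) * (1 - zz) * (Dp j * (ap j)^2 * Rp j))"
 proof -
  have "smult (of_real (ckj k j)) Q = smult (of_nat k / 4 ^ j) (zz ^ (k - 2) * (Dp j * ap j)^2 * Rp j)"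
   unfolding Q_def ck Dp_ap by simp
  also have "(Dp j * ap j)^2 = smult (4 ^ j) (1 - zz) * (Dp j * (ap j)^2)"
   by (simp add: Dp_def power2_eq_square mult_ac)
  finally show ?thesis by (simp add: mult_ac)
 qed
 ultimately show ?thesis by (intro bexI[of _ Q]) simp_all
qed

definition Qkj :: "nat => nat => complex poly" where
 "Qkj k j = (SOME Q. Q \<in> kerset \<and> smult (of_nat k) (zz ^ (k - 2) * (1 - zz) * (Dp j * (ap j)^2 * Rp j)) = smult (of_real (ckj k j)) Q)"

lemma Qkj:
 assumes "k \<ge> 2"
 shows "Qkj k j \<in> kerset" "smult (of_nat k) (zz ^ (k - 2) * (1 - zz) * (Dp j * (ap j)^2 * Rp j)) = smult (of_real (ckj k j)) (Qkj k j)"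
proof -
 have "Qkj k j \<in> kerset \<and> smult (of_nat k) (zz ^ (k - 2) * (1 - zz) * (Dp j * (ap j)^2 * Rp j)) = smult (of_real (ckj k j)) (Qkj k j)"
  unfolding Qkj_def by (rule someI_ex) (use kernel_factor[OF assms, of j] in blast)
 then show "Qkj k j \<in> kerset" "smult (of_nat k) (zz ^ (k - 2) * (1 - zz) * (Dp j * (ap j)^2 * Rp j)) = smult (of_real (ckj k j)) (Qkj k j)"
  by auto
qed

text \<open>What is left of the entry \<open>k\<close> after \<open>J\<close> scales, apart from the
  scalar \<open>- sqrt k / 4^J\<close>.\<close>

definition remp :: "nat => nat => complex poly" where
 "remp k J = zz ^ (k - 1) * (1 - wp J) * (ap J ^ 4 * (3 - 3 * ap J ^ 5 + (ap J ^ 5)^2))"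

lemma l1_remp: "l1 (remp k J) \<le> 14"
proof -
 have "l1 (remp k J) \<le> 1 ^ (k - 1) * (1 + 1) * (1 ^ 4 * (3 + 3 * 1 ^ 5 + (1 ^ 5)^2))"
  unfolding remp_def by (intro l1_mult_le l1_power_le l1_diff_le l1_add_le l1_wp l1_ap) simp_all
 then show ?thesis by simp
qed

text \<open>The telescoping sum for 1 is multiplied by the entry of the square function. One factor
  \<open>zz\<close> is spent on \<open>hphi\<close>, which leaves \<open>zz ^ (k - 2)\<close> and
  explains \<open>k \<ge> 2\<close>. Writing \<open>sqrt k\<close> as \<open>k / sqrt k\<close> puts
  the full factor \<open>k\<close> into the kernel and leaves the weight \<open>1 / sqrt k\<close>
  for the summation over \<open>k\<close>.\<close>

lemma sqp_resolution:
 assumes k: "k \<ge> 2"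
 shows "sqp (k - 1) = (\<Sum>j<J. smult (- of_real (ckj k j / sqrt (real k))) (Qkj k j * hphi j))
   + smult (- of_real (sqrt (real k) / 4 ^ J)) (remp k J)"
proof -
 let ?d = "1 - zz"
 have sq: "complex_of_real (sqrt (real k)) * of_real (sqrt (real k)) = of_nat k"
  by (simp flip: of_real_mult)
 have z2: "zz ^ (k - 1) = zz * zz ^ (k - 2)" using k by (metis Suc_diff_Suc Suc_1 diff_Suc_1 less_eq_Suc_le power_Suc)
 have s1: "sqp (k - 1) = smult (- of_real (sqrt (real k))) (zz ^ (k - 1) * ?d)"
 proof -
  have kk: "Suc (k - 1) = k" using k by simp
  have "zz ^ k = zz * zz ^ (k - 1)" using kk by (metis power_Suc)
  then have "monom 1 k - monom 1 (k - 1) = - (zz ^ (k - 1) * ?d)" unfolding monom_zz[of k] monom_zz[of "k - 1"] by (simp add: algebra_simps)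
  then show ?thesis unfolding sqp_def kk by simp
 qed
 have tm: "smult (- of_real (sqrt (real k))) (zz ^ (k - 1) * ?d * (Bp j - Bp (Suc j))) = smult (- of_real (ckj k j / sqrt (real k))) (Qkj k j * hphi j)" for j
 proof -
  let ?E = "zz ^ (k - 2) * ?d * (Dp j * (ap j)^2 * Rp j)"
  have "zz ^ (k - 1) * ?d * (Bp j - Bp (Suc j)) = ?E * hphi j"
   unfolding Bp_diff hphi_eq z2 by (simp only: mult_ac)
  moreover have "- complex_of_real (sqrt (real k)) = - (1 / of_real (sqrt (real k))) * of_nat k"
  proof -
   have "complex_of_real (sqrt (real k)) \<noteq> 0" using k by simp
   then show ?thesis unfolding sq[symmetric] by simp
  qed
  ultimately have "smult (- of_real (sqrt (real k))) (zz ^ (k - 1) * ?d * (Bp j - Bp (Suc j)))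
    = smult (- (1 / of_real (sqrt (real k)))) (smult (of_nat k) ?E * hphi j)" by (simp only: smult_smult mult_smult_left)
  also have "... = smult (- of_real (ckj k j / sqrt (real k))) (Qkj k j * hphi j)"
   unfolding Qkj(2)[OF k] by (simp add: mult.commute)
  finally show ?thesis .
 qed
 have rem: "smult (- of_real (sqrt (real k))) (zz ^ (k - 1) * ?d * Bp J) = smult (- of_real (sqrt (real k) / 4 ^ J)) (remp k J)"
 proof -
  have "Bp J = ap J * (ap J ^ 4 * (3 - 3 * ap J ^ 5 + (ap J ^ 5)^2))" by (simp add: Bp_def algebra_simps eval_nat_numeral)
  moreover have "?d = smult (1 / 4 ^ J) (Dp J)" by (simp add: Dp_def)
  ultimately have "zz ^ (k - 1) * ?d * Bp J = smult (1 / 4 ^ J) (zz ^ (k - 1) * (Dp J * ap J) * (ap J ^ 4 * (3 - 3 * ap J ^ 5 + (ap J ^ 5)^2)))"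
   by (simp only: mult_smult_left mult_smult_right mult_ac)
  then have "zz ^ (k - 1) * ?d * Bp J = smult (1 / 4 ^ J) (remp k J)" unfolding Dp_ap remp_def .
  then show ?thesis by simp
 qed
 have "sqp (k - 1) = smult (- of_real (sqrt (real k))) (zz ^ (k - 1) * ?d * ((\<Sum>j<J. Bp j - Bp (Suc j)) + Bp J))"
  unfolding s1 Bp_telescope[of J, symmetric] by simp
 also have "... = (\<Sum>j<J. smult (- of_real (sqrt (real k))) (zz ^ (k - 1) * ?d * (Bp j - Bp (Suc j)))) + smult (- of_real (sqrt (real k))) (zz ^ (k - 1) * ?d * Bp J)"
 proof -
  have sm: "smult c (\<Sum>j<J. F j) = (\<Sum>j<J. smult c (F j))" for c :: complex and F
   by (induction J) (auto simp: smult_add_right)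
  show ?thesis by (simp only: distrib_left smult_add_right sum_distrib_left sm)
 qed
 finally show ?thesis unfolding tm rem .
qed

text \<open>The integer part of the logarithm of \<open>k\<close> to base 4, that is, the scale on
  the diagonal.\<close>

definition ml :: "nat => nat" where "ml k = (SOME m. 4 ^ m \<le> k \<and> k < 4 ^ Suc m)"

lemma ml: assumes "k \<ge> 1" shows "4 ^ ml k \<le> k" "k < 4 ^ Suc (ml k)"
proof -
 have "\<exists>m. 4 ^ m \<le> k \<and> k < 4 ^ (m + 1)" by (rule ex_power_ivl1) (use assms in auto)
 then have "\<exists>m. 4 ^ m \<le> k \<and> k < 4 ^ Suc m" by simp
 from someI_ex[OF this] show "4 ^ ml k \<le> k" "k < 4 ^ Suc (ml k)" unfolding ml_def by auto
qed

lemma ml_le: "k \<ge> 1 ==> ml k \<le> k"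
proof -
 assume k: "k \<ge> 1"
 have "ml k \<le> 2 ^ ml k" by (rule less_imp_le[OF less_exp])
 also have "... \<le> 4 ^ ml k" by (rule power_mono) auto
 also have "... \<le> k" by (rule ml(1)[OF k])
 finally show ?thesis .
qed

lemma ckj_decay:
 assumes k: "k \<ge> 1" shows "ckj k j \<le> 4 * (1 / 4) ^ nat \<bar>int j - int (ml k)\<bar>"
proof -
 have r: "(4::real) ^ ml k \<le> real k" "real k \<le> 4 ^ Suc (ml k)"
  using of_nat_mono[OF ml(1)[OF k], where 'a=real] of_nat_mono[OF less_imp_le[OF ml(2)[OF k]], where 'a=real] by simp_all
 show ?thesis
 proof (cases "ml k \<le> j")
  case True
  have "ckj k j \<le> real k / 4 ^ j" by (simp add: ckj_def)
  also have "... \<le> 4 ^ Suc (ml k) / 4 ^ j" using r by (intro divide_right_mono) auto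
  also have "... = 4 * (1 / 4) ^ (j - ml k)"
   using True by (simp add: power_diff power_one_over field_simps)
  finally show ?thesis using True by (simp add: nat_diff_distrib of_nat_diff[symmetric] del: of_nat_diff)
 next
  case False
  have "ckj k j \<le> 4 ^ j / real k" by (simp add: ckj_def)
  also have "... \<le> 4 ^ j / 4 ^ ml k" using r k by (intro divide_left_mono) auto
  also have "... = (1 / 4) ^ (ml k - j)"
   using False by (simp add: power_diff power_one_over field_simps)
  finally have "ckj k j \<le> 4 * (1 / 4) ^ (ml k - j)" by (simp add: order_trans[of _ "(1/4) ^ (ml k - j)"])
  moreover have "nat \<bar>int j - int (ml k)\<bar> = ml k - j" using False by simp
  ultimately show ?thesis by (simp only:)
 qed
qed

lemma sum_inverse_block: "(\<Sum>i | i < n \<and> ml (i + 2) = m. 1 / real (i + 2)) \<le> 3"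
proof -
 let ?S = "{i. i < n \<and> ml (i + 2) = m}"
 have sub: "?S \<subseteq> {i. 4 ^ m \<le> i + 2 \<and> i + 2 < 4 ^ Suc m}"
 proof
  fix i assume "i \<in> ?S"
  then show "i \<in> {i. 4 ^ m \<le> i + 2 \<and> i + 2 < 4 ^ Suc m}" using ml[of "i + 2"] by auto
 qed
 have "card ?S \<le> card ((\<lambda>i. i + 2) ` ?S)" by (subst card_image) (auto simp: inj_on_def)
 also have "... \<le> card {4 ^ m..<(4::nat) ^ Suc m}" using sub by (intro card_mono) auto
 also have "... = 3 * 4 ^ m" by simp
 finally have "card ?S \<le> 3 * 4 ^ m" .
 from of_nat_mono[OF this, where 'a=real] have c: "real (card ?S) \<le> 3 * 4 ^ m" by simp
 have "(\<Sum>i\<in>?S. 1 / real (i + 2)) \<le> (\<Sum>i\<in>?S. 1 / 4 ^ m)"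
 proof (rule sum_mono)
  fix i assume "i \<in> ?S"
  then have "4 ^ m \<le> i + 2" using sub by auto
  from of_nat_mono[OF this, where 'a=real] have "(4::real) ^ m \<le> real (i + 2)" by simp
  then show "1 / real (i + 2) \<le> 1 / 4 ^ m" by (intro divide_left_mono) auto
 qed
 also have "... = real (card ?S) / 4 ^ m" by simp
 also have "... \<le> 3" using c by (simp add: divide_le_eq)
 finally show ?thesis .
qed

lemma sum_quarter_powers: "(\<Sum>d\<in>{- int N..int N}. (1 / 4 :: real) ^ nat \<bar>d\<bar>) \<le> 2"
proof -
 have "(\<Sum>d\<in>{- int N..int N}. (1 / 4 :: real) ^ nat \<bar>d\<bar>) = 5/3 - 2/3 * (1/4) ^ N"
 proof (induction N)
  case (Suc N)
  have "{- int (Suc N)..int (Suc N)} = insert (int (Suc N)) (insert (- int (Suc N)) {- int N..int N})" by auto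
  then have "(\<Sum>d\<in>{- int (Suc N)..int (Suc N)}. (1 / 4 :: real) ^ nat \<bar>d\<bar>)
    = (\<Sum>d\<in>insert (int (Suc N)) (insert (- int (Suc N)) {- int N..int N}). (1 / 4) ^ nat \<bar>d\<bar>)" by (rule arg_cong)
  also have "... = (1 / 4) ^ nat \<bar>int (Suc N)\<bar> + ((1 / 4) ^ nat \<bar>- int (Suc N)\<bar> + (\<Sum>d\<in>{- int N..int N}. (1 / 4) ^ nat \<bar>d\<bar>))"
   by (subst sum.insert, simp, simp, subst sum.insert, simp, simp, rule refl)
  also have "nat \<bar>int (Suc N)\<bar> = Suc N" by simp
  also have "nat \<bar>- int (Suc N)\<bar> = Suc N" by simp
  finally show ?case unfolding Suc by simp
 qed simp
 moreover have "(1/4 :: real) ^ N \<ge> 0" by simp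
 ultimately show ?thesis by linarith
qed

text \<open>The sum over scales is reorganised by the offset \<open>d = j - m\<close> from the
  diagonal. For a fixed offset each \<open>k\<close> meets just one kernel, so R-boundedness can be
  applied once per offset.\<close>

lemma sum_by_offset:
 fixes t :: "nat => complex" assumes "m + J \<le> N"
 shows "(\<Sum>j<J. t j) = (\<Sum>d\<in>{- int N..int N}. if 0 \<le> int m + d \<and> int m + d < int J then t (nat (int m + d)) else 0)"
proof -
 have "(\<Sum>d\<in>{- int N..int N}. if 0 \<le> int m + d \<and> int m + d < int J then t (nat (int m + d)) else 0)
  = (\<Sum>d\<in>{- int m..<int J - int m}. t (nat (int m + d)))"
  using assms by (intro sum.mono_neutral_cong_right) auto
 also have "... = (\<Sum>j<J. t j)"
  by (rule sum.reindex_bij_witness[where i="\<lambda>j. int j - int m" and j="\<lambda>d. nat (int m + d)"]) auto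
 finally show ?thesis by simp
qed

text \<open>For a fixed offset, scale \<open>j\<close> is met only by those \<open>k\<close> that
  lie in one block from \<open>4^m\<close> to \<open>4^(m+1)\<close>, and there the weights
  \<open>1 / k\<close> sum to at most 3. The interaction \<open>ckj\<close> is bounded by
  \<open>k0\<close> along the whole diagonal.\<close>

lemma diagonal_energy:
 fixes h :: "nat => real"
 assumes h: "\<And>j. h j \<ge> 0" and d: "k0 = 4 * (1/4) ^ nat \<bar>d\<bar>"
 shows "(\<Sum>i<n. if 0 \<le> int (ml (i + 2)) + d \<and> int (ml (i + 2)) + d < int J
   then (ckj (i + 2) (nat (int (ml (i + 2)) + d)))^2 / real (i + 2) * h (nat (int (ml (i + 2)) + d)) else 0)
  \<le> k0^2 * 3 * (\<Sum>j<J. h j)"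
proof -
 let ?m = "\<lambda>i. ml (i + 2)"
 define V where "V = {i. i < n \<and> 0 \<le> int (?m i) + d \<and> int (?m i) + d < int J}"
 define g where "g i = nat (int (?m i) + d)" for i
 have fV: "finite V" by (simp add: V_def)
 have gV: "g ` V \<subseteq> {..<J}" by (auto simp: V_def g_def)
 have c: "(ckj (i + 2) (g i))^2 \<le> k0^2" if "i \<in> V" for i
 proof -
  have "ckj (i + 2) (g i) \<ge> 0" by (simp add: ckj_def)
  moreover have "ckj (i + 2) (g i) \<le> k0"
  proof -
   have "int (g i) - int (?m i) = d" using that by (simp add: V_def g_def)
   then show ?thesis using ckj_decay[of "i + 2" "g i"] d by simp
  qed
  ultimately show ?thesis by (intro power_mono)
 qed
 have "(\<Sum>i<n. if 0 \<le> int (?m i) + d \<and> int (?m i) + d < int J then (ckj (i + 2) (nat (int (?m i) + d)))^2 / real (i + 2) * h (nat (int (?m i) + d)) else 0)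
   = (\<Sum>i\<in>V. (ckj (i + 2) (g i))^2 / real (i + 2) * h (g i))"
  by (rule sum.mono_neutral_cong_right) (auto simp: V_def g_def)
 also have "... \<le> (\<Sum>i\<in>V. k0^2 * (1 / real (i + 2) * h (g i)))"
 proof (rule sum_mono)
  fix i assume "i \<in> V"
  then have "(ckj (i + 2) (g i))^2 * (1 / real (i + 2) * h (g i)) \<le> k0^2 * (1 / real (i + 2) * h (g i))"
   using h by (intro mult_right_mono c) auto
  then show "(ckj (i + 2) (g i))^2 / real (i + 2) * h (g i) \<le> k0^2 * (1 / real (i + 2) * h (g i))" by simp
 qed
 also have "... = k0^2 * (\<Sum>j<J. \<Sum>i\<in>{i \<in> V. g i = j}. 1 / real (i + 2) * h (g i))"
  by (subst sum.group[OF fV _ gV]) (simp_all add: sum_distrib_left)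
 also have "... \<le> k0^2 * (\<Sum>j<J. 3 * h j)"
 proof (intro mult_left_mono sum_mono)
  fix j
  have "(\<Sum>i\<in>{i \<in> V. g i = j}. 1 / real (i + 2) * h (g i)) = (\<Sum>i\<in>{i \<in> V. g i = j}. 1 / real (i + 2)) * h j"
   unfolding sum_distrib_right by (intro sum.cong) auto
  also have "... \<le> (\<Sum>i | i < n \<and> ml (i + 2) = nat (int j - d). 1 / real (i + 2)) * h j"
   by (intro mult_right_mono sum_mono2 h) (auto simp: V_def g_def)
  also have "... \<le> 3 * h j" by (intro mult_right_mono sum_inverse_block h)
  finally show "(\<Sum>i\<in>{i \<in> V. g i = j}. 1 / real (i + 2) * h (g i)) \<le> 3 * h j" .
 qed simp
 also have "... = k0^2 * 3 * (\<Sum>j<J. h j)" by (simp add: sum_distrib_left mult.assoc)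
 finally show ?thesis .
qed

definition Ksq :: "real => real => real => real => real" where
 "Ksq p C1 C2 C3 = 2 * C1 + (6 * (C2 * C2 * (4000 * C1)) + 16000 * C1) * 8 * sqrt 3 * ((24 * 4 powr (p / 2)) powr (1 / p) * C3)"

text \<open>By R-boundedness of \<open>kerset\<close> and \<open>diagonal_energy\<close>, the offset
  \<open>d\<close> from the diagonal contributes \<open>4 * sqrt 3\<close> times
  \<open>(1/4) ^ |d|\<close>. The geometric factors sum to at most 2, whence
  \<open>8 * sqrt 3\<close> in \<open>Ksq\<close>.\<close>

theorem square_function_estimate:
 assumes pq: "conj_exp p q" and T: "lp_op p M M T" and R: "Rfam p M T C1 pows" and D: "Rfam p M T C2 diffs"
  and H: "\<And>e J. (\<And>j. \<bar>e j\<bar> \<le> 1) ==> op_bd p M M (poly_op (hPhi e J) T) C3" and f: "memLp p M f"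
 shows "mixn p M {..<n} (\<lambda>i. poly_op (sqp i) T f) \<le> Ksq p C1 C2 C3 * lp_norm p M f"
proof -
 have p: "p \<ge> 1" "p > 0" using pq by (auto simp: conj_exp_def)
 define CX where "CX = 6 * (C2 * C2 * (4000 * C1)) + 16000 * C1"
 define Cb where "Cb = (24 * 4 powr (p / 2)) powr (1 / p) * C3"
 have RX: "Rfam p M T CX kerset" unfolding CX_def by (rule Rfam_kerset[OF pq T R D])
 have CX: "CX \<ge> 0" by (rule Rfam_nonneg[OF RX])
 have C1: "C1 \<ge> 0" by (rule Rfam_nonneg[OF R])
 have m: "memLp p M (poly_op \<phi> T f)" for \<phi> by (rule lp_op_mem[OF lp_op_poly[OF p(1) T] f])
 let ?h = "\<lambda>j. poly_op (hphi j) T f"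
 let ?v = "\<lambda>i d J. 0 \<le> int (ml (i + 2)) + d \<and> int (ml (i + 2)) + d < int J"
 let ?j = "\<lambda>i d. nat (int (ml (i + 2)) + d)"
 have main: "mixn p M {..<n} (\<lambda>i. poly_op (sqp (i + 1)) T f)
   \<le> CX * 8 * sqrt 3 * (Cb * lp_norm p M f) + (\<Sum>i<n. sqrt (real (i + 2)) * (14 * C1) * lp_norm p M f) * (1/4) ^ J" for J
 proof -
  define N where "N = n + 2 + J"
  \<comment> \<open>The scalars are put into the arguments, so that the kernels belong to
    \<open>kerset\<close> itself. Offsets leading outside the range of scales get the argument 0 and
    the kernel 0.\<close>
  define x where "x d i w = (if ?v i d J then - of_real (ckj (i + 2) (?j i d) / sqrt (real (i + 2))) * ?h (?j i d) w else 0)" for d i w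
  define Q where "Q d i = (if ?v i d J then Qkj (i + 2) (?j i d) else 0)" for d i
  define y where "y d i = poly_op (Q d i) T (x d i)" for d i
  define rem where "rem i w = - of_real (sqrt (real (i + 2)) / 4 ^ J) * poly_op (remp (i + 2) J) T f w" for i w
  have xm: "memLp p M (x d i)" for d i
  proof (cases "?v i d J")
   case True
   then have "x d i = (\<lambda>w. - of_real (ckj (i + 2) (?j i d) / sqrt (real (i + 2))) * ?h (?j i d) w)"
    by (simp add: x_def fun_eq_iff)
   then show ?thesis using memLp_scale[OF m, of "- of_real (ckj (i + 2) (?j i d) / sqrt (real (i + 2)))" "hphi (?j i d)"] by simp
  next
   case False
   then have "x d i = (\<lambda>w. 0)" by (auto simp: x_def fun_eq_iff)
   then show ?thesis by simp
  qed
  have ym: "memLp p M (y d i)" for d i unfolding y_def by (rule lp_op_mem[OF lp_op_poly[OF p(1) T] xm])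
  have rm: "memLp p M (rem i)" for i unfolding rem_def[abs_def] by (rule memLp_scale[OF m])
  have QX: "Q d i \<in> kerset" for d i using Qkj(1)[of "i + 2"] zero_in_kerset by (simp add: Q_def)
  have dec: "AE w in M. poly_op (sqp (i + 1)) T f w = (\<Sum>d\<in>{- int N..int N}. y d i w) + rem i w" if i: "i < n" for i
  proof -
   let ?c = "\<lambda>j. - complex_of_real (ckj (i + 2) j / sqrt (real (i + 2)))"
   have 1: "AE w in M. \<forall>j\<in>{..<J}. poly_op (Qkj (i + 2) j * hphi j) T f w = poly_op (Qkj (i + 2) j) T (?h j) w"
    by (rule AE_finite_allI) (auto intro: poly_op_mult[OF p(1) T f])
   have 2: "AE w in M. \<forall>d\<in>{- int N..int N}. ?v i d J \<longrightarrow> y d i w = ?c (?j i d) * poly_op (Qkj (i + 2) (?j i d)) T (?h (?j i d)) w"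
   proof (rule AE_finite_allI)
    fix d
    show "AE w in M. ?v i d J \<longrightarrow> y d i w = ?c (?j i d) * poly_op (Qkj (i + 2) (?j i d)) T (?h (?j i d)) w"
    proof (cases "?v i d J")
     case True
     have "x d i = (\<lambda>w. ?c (?j i d) * ?h (?j i d) w)" unfolding x_def using True by simp
     then have "y d i = poly_op (Qkj (i + 2) (?j i d)) T (\<lambda>w. ?c (?j i d) * ?h (?j i d) w)"
      using True by (simp add: y_def Q_def)
     then show ?thesis using lp_op_scale[OF lp_op_poly[OF p(1) T] m, of "Qkj (i + 2) (?j i d)" "?c (?j i d)" "hphi (?j i d)"]
      by (auto elim!: eventually_mono)
    next
     case False
     then show ?thesis by (intro AE_I2) blast
    qed
   qed simp
   have z: "AE w in M. \<forall>d\<in>{- int N..int N}. \<not> ?v i d J \<longrightarrow> y d i w = 0"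
    by (rule AE_finite_allI) (auto simp: y_def Q_def)
   from 1 2 z show ?thesis
   proof eventually_elim
    case (elim w)
    let ?t = "\<lambda>j. ?c j * poly_op (Qkj (i + 2) j) T (?h j) w"
    have res: "sqp (i + 1) = (\<Sum>j<J. smult (?c j) (Qkj (i + 2) j * hphi j)) + smult (- of_real (sqrt (real (i + 2)) / 4 ^ J)) (remp (i + 2) J)"
     using sqp_resolution[of "i + 2" J] by simp
    have mle: "ml (i + 2) + J \<le> N" using ml_le[of "i + 2"] i by (simp add: N_def)
    have "poly_op (sqp (i + 1)) T f w = (\<Sum>j<J. ?t j) + rem i w"
     unfolding res poly_op_add poly_op_sum poly_op_smult rem_def
     by (intro arg_cong2[where f="(+)"] sum.cong refl) (use elim(1) in auto)
    also have "(\<Sum>j<J. ?t j) = (\<Sum>d\<in>{- int N..int N}. if ?v i d J then ?t (?j i d) else 0)"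
     by (rule sum_by_offset[OF mle])
    also have "... = (\<Sum>d\<in>{- int N..int N}. y d i w)"
     using elim(2,3) by (intro sum.cong) auto
    finally show ?case .
   qed
  qed
  have xb: "mixn p M {..<n} (x d) \<le> (4 * (1/4) ^ nat \<bar>d\<bar> * sqrt 3) * mixn p M {..<J} ?h" for d
  proof (rule mixn_mono[OF p(1) xm m])
   show "AE w in M. (\<Sum>i<n. (cmod (x d i w))^2) \<le> (4 * (1/4) ^ nat \<bar>d\<bar> * sqrt 3)^2 * (\<Sum>j<J. (cmod (?h j w))^2)"
   proof (rule AE_I2)
    fix w
    have "(\<Sum>i<n. (cmod (x d i w))^2) = (\<Sum>i<n. if ?v i d J
      then (ckj (i + 2) (?j i d))^2 / real (i + 2) * (cmod (?h (?j i d) w))^2 else 0)"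
    proof (rule sum.cong[OF refl])
     fix i
     show "(cmod (x d i w))^2 = (if ?v i d J then (ckj (i + 2) (?j i d))^2 / real (i + 2) * (cmod (?h (?j i d) w))^2 else 0)"
      by (simp add: x_def norm_mult norm_divide power_mult_distrib power_divide)
    qed
    also have "... \<le> (4 * (1/4) ^ nat \<bar>d\<bar>)^2 * 3 * (\<Sum>j<J. (cmod (?h j w))^2)"
     by (rule diagonal_energy) auto
    finally show "(\<Sum>i<n. (cmod (x d i w))^2) \<le> (4 * (1/4) ^ nat \<bar>d\<bar> * sqrt 3)^2 * (\<Sum>j<J. (cmod (?h j w))^2)"
     by (simp add: power_mult_distrib)
   qed
  qed simp
  have hb: "mixn p M {..<J} ?h \<le> Cb * lp_norm p M f"
   unfolding Cb_def by (rule square_fun_hphi[OF p(1) T H f])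
  have yb: "mixn p M {..<n} (y d) \<le> CX * (4 * sqrt 3 * (Cb * lp_norm p M f)) * (1/4) ^ nat \<bar>d\<bar>" for d
  proof -
   have "mixn p M {..<n} (y d) \<le> CX * mixn p M {..<n} (x d)"
    unfolding y_def by (rule RfamD[OF RX QX xm])
   also have "... \<le> CX * ((4 * (1/4) ^ nat \<bar>d\<bar> * sqrt 3) * (Cb * lp_norm p M f))"
    by (intro mult_left_mono order_trans[OF xb mult_left_mono[OF hb]] CX) auto
   finally show ?thesis by (simp add: mult_ac)
  qed
  have rb: "mixn p M {..<n} rem \<le> (\<Sum>i<n. sqrt (real (i + 2)) * (14 * C1) * lp_norm p M f) * (1/4) ^ J"
  proof -
   have "mixn p M {..<n} rem \<le> (\<Sum>i<n. lp_norm p M (rem i))" by (rule mixn_le_sum[OF p(1) rm])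
   also have "... \<le> (\<Sum>i<n. sqrt (real (i + 2)) * (14 * C1) * lp_norm p M f * (1/4) ^ J)"
   proof (rule sum_mono)
    fix i
    have "op_bd p M M (poly_op (remp (i + 2) J) T) (14 * C1)"
     by (rule Rfam_op_bd[OF Rfam_l1[OF pq T R]]) (auto simp: l1_remp)
    from op_bdD[OF this f] have "(sqrt (real (i + 2)) / 4 ^ J) * lp_norm p M (poly_op (remp (i + 2) J) T f) \<le> (sqrt (real (i + 2)) / 4 ^ J) * (14 * C1 * lp_norm p M f)"
     by (intro mult_left_mono) auto
    moreover have "lp_norm p M (rem i) = (sqrt (real (i + 2)) / 4 ^ J) * lp_norm p M (poly_op (remp (i + 2) J) T f)"
     unfolding rem_def[abs_def] lp_norm_scale[OF p(2)] by (simp add: norm_divide norm_power)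
    ultimately show "lp_norm p M (rem i) \<le> sqrt (real (i + 2)) * (14 * C1) * lp_norm p M f * (1/4) ^ J"
     by (simp add: power_one_over)
   qed
   finally show ?thesis by (simp add: sum_distrib_right)
  qed
  have "mixn p M {..<n} (\<lambda>i. poly_op (sqp (i + 1)) T f) = mixn p M {..<n} (\<lambda>i w. (\<Sum>d\<in>{- int N..int N}. y d i w) + rem i w)"
  proof (rule mixn_cong_AE[OF p(1)])
   fix i assume "i \<in> {..<n}"
   then have "i < n" by simp
   from dec[OF this] show "AE w in M. cmod (poly_op (sqp (i + 1)) T f w) = cmod ((\<Sum>d\<in>{- int N..int N}. y d i w) + rem i w)"
    by eventually_elim simp
  qed (auto intro!: m memLp_add memLp_sum p ym rm)
  also have "... \<le> mixn p M {..<n} (\<lambda>i w. \<Sum>d\<in>{- int N..int N}. y d i w) + mixn p M {..<n} rem"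
   by (rule mixn_add[OF p(1) memLp_sum[OF p(1) ym] rm])
  also have "mixn p M {..<n} (\<lambda>i w. \<Sum>d\<in>{- int N..int N}. y d i w) \<le> (\<Sum>d\<in>{- int N..int N}. mixn p M {..<n} (y d))"
   by (rule mixn_sum[OF p(1) ym])
  also have "... \<le> (\<Sum>d\<in>{- int N..int N}. CX * (4 * sqrt 3 * (Cb * lp_norm p M f)) * (1/4) ^ nat \<bar>d\<bar>)"
   by (intro sum_mono yb)
  also have "... = CX * (4 * sqrt 3 * (Cb * lp_norm p M f)) * (\<Sum>d\<in>{- int N..int N}. (1/4) ^ nat \<bar>d\<bar>)"
   by (simp only: sum_distrib_left)
  also have "... \<le> CX * (4 * sqrt 3 * (Cb * lp_norm p M f)) * 2"
  proof (rule mult_left_mono[OF sum_quarter_powers])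
   have "0 \<le> Cb * lp_norm p M f" using mixn_nonneg[of p M "{..<J}" ?h] hb by linarith
   then show "0 \<le> CX * (4 * sqrt 3 * (Cb * lp_norm p M f))" using CX by simp
  qed
  finally show ?thesis using rb by (simp add: mult_ac)
 qed
 \<comment> \<open>The remainder is \<open>4^(-J)\<close> times a constant depending on
   \<open>n\<close>. Since the main term does not depend on \<open>J\<close>, the remainder
   disappears as \<open>J\<close> grows with \<open>n\<close> fixed.\<close>
 have "mixn p M {..<n} (\<lambda>i. poly_op (sqp (i + 1)) T f) \<le> CX * 8 * sqrt 3 * (Cb * lp_norm p M f)"
 proof (rule LIMSEQ_le_const)
  let ?S = "\<Sum>i<n. sqrt (real (i + 2)) * (14 * C1) * lp_norm p M f"
  have "(\<lambda>J. CX * 8 * sqrt 3 * (Cb * lp_norm p M f) + ?S * (1/4) ^ J) \<longlonglongrightarrow> CX * 8 * sqrt 3 * (Cb * lp_norm p M f) + ?S * 0"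
   by (intro tendsto_intros LIMSEQ_power_zero) simp
  then show "(\<lambda>J. CX * 8 * sqrt 3 * (Cb * lp_norm p M f) + ?S * (1/4) ^ J) \<longlonglongrightarrow> CX * 8 * sqrt 3 * (Cb * lp_norm p M f)" by simp
 qed (use main in auto)
 \<comment> \<open>The resolution starts at \<open>k = 2\<close>, so the entry \<open>k = 1\<close>
   is split off and estimated by \<open>l1 (sqp 0) \<le> 2\<close>.\<close>
 moreover have "mixn p M {..<n} (\<lambda>i. poly_op (sqp i) T f) \<le> 2 * C1 * lp_norm p M f + mixn p M {..<n} (\<lambda>i. poly_op (sqp (i + 1)) T f)"
 proof -
  let ?x = "\<lambda>i. poly_op (sqp i) T f"
  define y1 where "y1 i w = (if i = 0 then ?x 0 w else 0)" for i :: nat and w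
  define y2 where "y2 i w = (if i = 0 then 0 else ?x i w)" for i :: nat and w
  have ym: "memLp p M (y1 i)" "memLp p M (y2 i)" for i
   unfolding y1_def[abs_def] y2_def[abs_def] by (cases "i = 0"; simp add: m)+
  have "?x = (\<lambda>i w. y1 i w + y2 i w)" by (auto simp: y1_def y2_def fun_eq_iff)
  then have "mixn p M {..<n} ?x \<le> mixn p M {..<n} y1 + mixn p M {..<n} y2" using mixn_add[OF p(1) ym, of "{..<n}"] by simp
  moreover have "mixn p M {..<n} y1 \<le> 1 * mixn p M {0::nat} (\<lambda>_. ?x 0)"
  proof (rule mixn_mono[OF p(1) ym(1) m])
   have "(\<Sum>i<n. (cmod (y1 i w))^2) \<le> (cmod (?x 0 w))^2" for w
   proof -
    have "(\<Sum>i<n. (cmod (y1 i w))^2) = (\<Sum>i<n. if i = 0 then (cmod (?x 0 w))^2 else 0)"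
     by (intro sum.cong) (auto simp: y1_def)
    then show ?thesis by simp
   qed
   then show "AE w in M. (\<Sum>i<n. (cmod (y1 i w))^2) \<le> 1^2 * (\<Sum>j\<in>{0::nat}. (cmod (?x 0 w))^2)" by simp
  qed simp
  moreover have "mixn p M {..<n} y2 \<le> 1 * mixn p M {..<n} (\<lambda>i. ?x (i + 1))"
  proof (rule mixn_mono[OF p(1) ym(2) m])
   have "(\<Sum>i<n. (cmod (y2 i w))^2) \<le> (\<Sum>i<n. (cmod (?x (i + 1) w))^2)" for w
   proof (cases n)
    case (Suc k)
    have "(\<Sum>i<Suc k. (cmod (y2 i w))^2) = (\<Sum>i<k. (cmod (?x (i + 1) w))^2)"
     by (subst sum.lessThan_Suc_shift) (simp add: y2_def)
    then show ?thesis using Suc by simp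
   qed simp
   then show "AE w in M. (\<Sum>i<n. (cmod (y2 i w))^2) \<le> 1^2 * (\<Sum>i<n. (cmod (?x (i + 1) w))^2)" by simp
  qed simp
  moreover have "lp_norm p M (?x 0) \<le> 2 * C1 * lp_norm p M f"
  proof (rule op_bdD[OF Rfam_op_bd[OF Rfam_l1[OF pq T R]] f])
   have "l1 (sqp 0) \<le> 1 + 1" unfolding sqp_def using l1_diff_le[of "monom 1 (Suc 0)" 1 "monom 1 0" 1] by (simp add: l1_smult)
   then show "sqp 0 \<in> {\<phi>. l1 \<phi> \<le> 2}" by simp
  qed simp
  ultimately show ?thesis by (simp add: mixn_single)
 qed
 ultimately show ?thesis unfolding Ksq_def CX_def[symmetric] Cb_def[symmetric] by (simp add: algebra_simps)
qed

lemma poly_op_sqp: "poly_op (sqp i) T f w = of_real (sqrt (real (Suc i))) * ((T ^^ Suc i) f w - (T ^^ i) f w)"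
 by (simp add: sqp_def poly_op_smult poly_op_diff poly_op_monom del: funpow.simps)

lemma sqp_square: "real (Suc k) * (cmod ((T ^^ Suc k) f w - (T ^^ k) f w))^2 = (cmod (poly_op (sqp k) T f w))^2"
 unfolding poly_op_sqp by (simp add: norm_mult power_mult_distrib del: funpow.simps)

text \<open>Bounds on all finite truncations already force summability almost everywhere and
  membership in \<open>L^p\<close>, by monotone convergence and Fatou; the value infinity is thereby
  excluded. All estimates are proved for truncations only.\<close>

lemma sqfun_le_iff:
 assumes p: "p \<ge> 1" and T: "lp_op p M M T" and f: "memLp p M f"
 shows "sqfun p M T f \<le> ereal B \<longleftrightarrow> (\<forall>n. mixn p M {..<n} (\<lambda>i. poly_op (sqp i) T f) \<le> B)"
proof -
 have p0: "p > 0" using p by simp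
 define g where "g w k = (cmod (poly_op (sqp k) T f w))^2" for w k
 define G where "G w = sqrt (suminf (g w))" for w
 define u where "u n w = L2_set (\<lambda>i. cmod (poly_op (sqp i) T f w)) {..<n}" for n w
 have m: "memLp p M (poly_op \<phi> T f)" for \<phi> by (rule lp_op_mem[OF lp_op_poly[OF p T] f])
 have [measurable]: "poly_op \<phi> T f \<in> borel_measurable M" for \<phi> using m by (rule memLp_meas)
 have um: "memLp p M (u n)" for n unfolding u_def by (rule memLp_L2(1)[OF p m])
 have un: "lp_norm p M (u n) = mixn p M {..<n} (\<lambda>i. poly_op (sqp i) T f)" for n by (simp add: u_def[abs_def] mixn_def)
 have u_eq: "u n w = sqrt (\<Sum>i<n. g w i)" for n w by (simp add: u_def L2_set_def g_def)
 have sq: "sqfun p M T f = (if (AE w in M. summable (g w)) \<and> memLp p M G then ereal (lp_norm p M G) else \<infinity>)"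
  unfolding sqfun_def Let_def sqp_square g_def G_def ..
 have [measurable]: "G \<in> borel_measurable M" unfolding G_def g_def by measurable
 show ?thesis
 proof
  assume "sqfun p M T f \<le> ereal B"
  then have s: "AE w in M. summable (g w)" "memLp p M G" "lp_norm p M G \<le> B"
   unfolding sq by (auto split: if_splits)
  show "\<forall>n. mixn p M {..<n} (\<lambda>i. poly_op (sqp i) T f) \<le> B"
  proof
   fix n
   have "AE w in M. norm (u n w) \<le> norm (G w)"
    using s(1)
   proof eventually_elim
    case (elim w)
    have "(\<Sum>i<n. g w i) \<le> suminf (g w)" by (rule sum_le_suminf[OF elim]) (auto simp: g_def)
    then have "sqrt (\<Sum>i<n. g w i) \<le> sqrt (suminf (g w))" by simp
    moreover have "0 \<le> sqrt (\<Sum>i<n. g w i)" by (simp add: sum_nonneg g_def)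
    ultimately show ?case unfolding u_eq G_def real_norm_def by linarith
   qed
   from memLp_bound(2)[OF p0 s(2) memLp_meas[OF um] this] s(3)
   show "mixn p M {..<n} (\<lambda>i. poly_op (sqp i) T f) \<le> B" unfolding un by simp
  qed
 next
  assume B: "\<forall>n. mixn p M {..<n} (\<lambda>i. poly_op (sqp i) T f) \<le> B"
  have "AE w in M. \<exists>b. \<forall>n. u n w \<le> b"
  proof (rule lp_monotone_bounded[OF p0 um])
   show "lp_norm p M (u n) \<le> B" for n using B by (simp add: un)
   show "u n w \<le> u (Suc n) w" for n w unfolding u_eq by (simp add: g_def)
   show "0 \<le> u n w" for n w unfolding u_def by simp
  qed
  then have s: "AE w in M. summable (g w)"
  proof eventually_elim
   case (elim w)
   then obtain b where b: "\<And>n. u n w \<le> b" by blast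
   have "(\<Sum>i<n. g w i) \<le> b^2" for n
   proof -
    have "sqrt (\<Sum>i<n. g w i) \<le> b" using b[of n] by (simp add: u_eq)
    then show ?thesis by (metis real_sqrt_le_iff real_sqrt_abs abs_ge_self order_trans)
   qed
   then show ?case by (intro bounded_imp_summable[of _ "b^2"]) (simp_all add: g_def lessThan_Suc_atMost[symmetric] del: sum.lessThan_Suc)
  qed
  have lim: "AE w in M. (\<lambda>n. u n w) \<longlonglongrightarrow> G w"
   using s by eventually_elim (auto simp: u_eq G_def intro!: tendsto_real_sqrt summable_LIMSEQ)
  have ev: "\<forall>\<^sub>F n in sequentially. lp_norm p M (u n) \<le> B" using B by (simp add: un)
  have "memLp p M G" "lp_norm p M G \<le> B"
   using lp_Fatou[OF p0 um ev _ lim] by simp_all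
  then show "sqfun p M T f \<le> ereal B" unfolding sq using s by simp
 qed
qed

section \<open>Transference\<close>

lemma powers_set_eq: "powers_set T = (\<lambda>\<phi>. poly_op \<phi> T) ` pows"
proof -
 have h: "poly_op (monom 1 n) T = T ^^ n" for n by (intro ext) (simp add: poly_op_monom)
 show ?thesis unfolding powers_set_def pows_def setcompr_eq_image image_image h ..
qed

lemma ritt_diff_set_eq: "ritt_diff_set T = (\<lambda>\<phi>. poly_op \<phi> T) ` diffs"
proof -
 have h: "poly_op (smult (of_nat n) (monom 1 n - monom 1 (n - 1))) T = (\<lambda>f w. of_nat n * ((T ^^ n) f w - (T ^^ (n - 1)) f w))" for n
  by (intro ext) (simp add: poly_op_monom poly_op_smult poly_op_diff)
 show ?thesis unfolding ritt_diff_set_def diffs_def setcompr_eq_image image_image h ..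
qed

lemma R_bounded_iff_Rfam: "R_bounded p M ((\<lambda>\<phi>. poly_op \<phi> T) ` \<Phi>) \<longleftrightarrow> (\<exists>C. Rfam p M T C \<Phi>)"
proof
 {
  assume "R_bounded p M ((\<lambda>\<phi>. poly_op \<phi> T) ` \<Phi>)"
  then obtain C where C: "\<And>(n::nat) Ts xs. (\<forall>k<n. Ts k \<in> (\<lambda>\<phi>. poly_op \<phi> T) ` \<Phi> \<and> memLp p M (xs k)) ==>
    lp_norm p M (\<lambda>w. sqrt (\<Sum>k<n. (norm (Ts k (xs k) w))^2)) \<le> C * lp_norm p M (\<lambda>w. sqrt (\<Sum>k<n. (norm (xs k w))^2))"
   unfolding R_bounded_def by blast
  have "Rfam p M T (max C 0) \<Phi>"
  proof (rule RfamI)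
   fix n and \<phi> :: "nat => complex poly" and x :: "nat => 'a => complex"
   assume "\<And>i. i < n ==> \<phi> i \<in> \<Phi>" "\<And>i. i < n ==> memLp p M (x i)"
   then have "mixn p M {..<n} (\<lambda>i. poly_op (\<phi> i) T (x i)) \<le> C * mixn p M {..<n} x"
    using C[of n "\<lambda>i. poly_op (\<phi> i) T" x] by (simp add: mixn_def L2_set_def)
   also have "... \<le> max C 0 * mixn p M {..<n} x" by (rule mult_right_mono) auto
   finally show "mixn p M {..<n} (\<lambda>i. poly_op (\<phi> i) T (x i)) \<le> max C 0 * mixn p M {..<n} x" .
  qed simp
  then show "\<exists>C. Rfam p M T C \<Phi>" by blast
 }
 assume "\<exists>C. Rfam p M T C \<Phi>"
 then obtain C where C: "Rfam p M T C \<Phi>" by blast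
 show "R_bounded p M ((\<lambda>\<phi>. poly_op \<phi> T) ` \<Phi>)" unfolding R_bounded_def
 proof (intro exI[of _ C] allI impI)
  fix n :: nat and Ts and xs :: "nat => 'a => complex"
  assume a: "\<forall>k<n. Ts k \<in> (\<lambda>\<phi>. poly_op \<phi> T) ` \<Phi> \<and> memLp p M (xs k)"
  then have "\<exists>\<phi>. k < n \<longrightarrow> \<phi> \<in> \<Phi> \<and> Ts k = poly_op \<phi> T" for k by blast
  then obtain \<phi> where \<phi>: "\<And>k. k < n ==> \<phi> k \<in> \<Phi> \<and> Ts k = poly_op (\<phi> k) T" by metis
  have "mixn p M {..<n} (\<lambda>i. Ts i (xs i)) = mixn p M {..<n} (\<lambda>i. poly_op (\<phi> i) T (xs i))"
   unfolding mixn_def using \<phi> by (intro arg_cong[where f="lp_norm p M"] ext L2_set_cong) auto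
  also have "... \<le> C * mixn p M {..<n} xs" by (rule RfamD[OF C]) (use \<phi> a in auto)
  finally show "lp_norm p M (\<lambda>w. sqrt (\<Sum>k<n. (norm (Ts k (xs k) w))^2)) \<le> C * lp_norm p M (\<lambda>w. sqrt (\<Sum>k<n. (norm (xs k w))^2))"
   by (simp add: mixn_def L2_set_def)
 qed
qed

lemma R_Ritt_iff: "R_Ritt p M T \<longleftrightarrow> lp_op p M M T \<and> (\<exists>C. Rfam p M T C pows) \<and> (\<exists>C. Rfam p M T C diffs)"
 unfolding R_Ritt_def powers_set_eq ritt_diff_set_eq R_bounded_iff_Rfam ..

lemma lp_op_shiftZ: "lp_op p cZ cZ shiftZ"
proof -
 have "bij (\<lambda>n::int. n - 1)" by (rule o_bij[of "\<lambda>n. n + 1"]) (auto simp: fun_eq_iff)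
 from lp_op_shift_Z[OF this] show ?thesis unfolding shiftZ_def[abs_def] .
qed

text \<open>A supremum of reals carries information only for a set that is bounded above.
  Boundedness holds since every polynomial in the shift is a bounded operator; the bound then
  extends from the unit ball by homogeneity.\<close>

lemma
 assumes p: "p \<ge> 1"
 shows poly_pnorm_nonneg: "poly_pnorm p \<phi> \<ge> 0"
  and poly_pnorm_bound: "memLp p cZ t ==> lp_norm p cZ (poly_op \<phi> shiftZ t) \<le> poly_pnorm p \<phi> * lp_norm p cZ t"
proof -
 let ?S = "(\<lambda>t. lp_norm p cZ (poly_op \<phi> shiftZ t)) ` {t. memLp p cZ t \<and> lp_norm p cZ t \<le> 1}"
 note P = lp_op_poly[OF p lp_op_shiftZ, of \<phi>]
 obtain C where C: "op_bd p cZ cZ (poly_op \<phi> shiftZ) C" using lp_op_bd[OF P] by blast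
 have bdd: "bdd_above ?S"
 proof (rule bdd_aboveI)
  fix r assume "r \<in> ?S"
  then obtain t where t: "memLp p cZ t" "lp_norm p cZ t \<le> 1" "r = lp_norm p cZ (poly_op \<phi> shiftZ t)" by auto
  have "r \<le> C * lp_norm p cZ t" unfolding t(3) by (rule op_bdD[OF C t(1)])
  also have "... \<le> C * 1" by (rule mult_left_mono[OF t(2) op_bd_nonneg[OF C]])
  finally show "r \<le> C" by simp
 qed
 have up: "lp_norm p cZ (poly_op \<phi> shiftZ t) \<le> poly_pnorm p \<phi>" if "memLp p cZ t" "lp_norm p cZ t \<le> 1" for t
  unfolding poly_pnorm_def by (rule cSup_upper[OF _ bdd]) (use that in auto)
 show nn: "poly_pnorm p \<phi> \<ge> 0" using order_trans[OF lp_norm_nonneg up[of "\<lambda>x. 0"]] by simp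
 show "lp_norm p cZ (poly_op \<phi> shiftZ t) \<le> poly_pnorm p \<phi> * lp_norm p cZ t" if t: "memLp p cZ t"
 proof (cases "lp_norm p cZ t = 0")
  case True
  then show ?thesis using op_bdD[OF C t] by simp
 next
  case False
  define s where "s = lp_norm p cZ t"
  have s: "s > 0" using False by (simp add: s_def less_le)
  let ?u = "\<lambda>x. of_real (1 / s) * t x"
  have c: "cmod (of_real (1 / s)) = 1 / s" unfolding norm_of_real using s by simp
  have "lp_norm p cZ ?u = 1" using s p lp_norm_scale[of p cZ "of_real (1 / s)" t] unfolding c by (simp add: s_def)
  then have "lp_norm p cZ (poly_op \<phi> shiftZ ?u) \<le> poly_pnorm p \<phi>"
   by (intro up memLp_scale t) (simp only: order_refl)
  moreover have "poly_op \<phi> shiftZ ?u = (\<lambda>n. of_real (1 / s) * poly_op \<phi> shiftZ t n)"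
   by (rule ext) (simp add: zpoly_alt[OF order_refl] sum_divide_distrib)
  ultimately have "(1 / s) * lp_norm p cZ (poly_op \<phi> shiftZ t) \<le> poly_pnorm p \<phi>"
   using s p lp_norm_scale[of p cZ "of_real (1 / s)" "poly_op \<phi> shiftZ t"] unfolding c by simp
  then show ?thesis using s by (simp add: s_def[symmetric] field_simps)
 qed
qed

text \<open>The inputs of \<open>square_function_estimate\<close> are R-boundedness of the powers
  and of the differences and the uniform bound on \<open>hPhi\<close>. Each passes to any adjoint
  with the same constant, so the dual estimate is the same theorem with exchanged exponents.\<close>

theorem R_Ritt_poly_bounded_imp_square_functions:
 assumes p: "p > 1" and RR: "R_Ritt p M T" and P: "p_poly_bounded p M T"
 shows "\<exists>C. (\<forall>x. memLp p M x \<longrightarrow> sqfun p M T x \<le> ereal (C * lp_norm p M x)) \<and>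
  (\<forall>Tstar. is_adjoint p M T Tstar \<longrightarrow> (\<forall>y. memLp (p / (p - 1)) M y \<longrightarrow>
    sqfun (p / (p - 1)) M Tstar y \<le> ereal (C * lp_norm (p / (p - 1)) M y)))"
proof -
 define q where "q = p / (p - 1)"
 have pq: "conj_exp p q" unfolding q_def by (rule conj_expI[OF p])
 have p1: "p \<ge> 1" "q \<ge> 1" using pq by (auto simp: conj_exp_def)
 obtain C1 C2 where T: "lp_op p M M T" and R: "Rfam p M T C1 pows" and D: "Rfam p M T C2 diffs"
  using RR unfolding R_Ritt_iff by blast
 obtain C where C: "\<And>\<phi> f. memLp p M f ==> lp_norm p M (poly_op \<phi> T f) \<le> C * poly_pnorm p \<phi> * lp_norm p M f"
  using P unfolding p_poly_bounded_def by blast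
 \<comment> \<open>The constant in \<open>p_poly_bounded\<close> carries no sign condition, hence
   the absolute value.\<close>
 define C3 where "C3 = \<bar>C\<bar> * max (Kp p) (Kp q)"
 have H: "op_bd p M M (poly_op (hPhi e J) T) C3" if e: "\<And>j. \<bar>e j\<bar> \<le> 1" for e J
  unfolding op_bd_def
 proof (intro conjI allI impI)
  show "0 \<le> C3" by (simp add: C3_def le_max_iff_disj)
  fix f :: "'a => complex" assume f: "memLp p M f"
  have "C * poly_pnorm p (hPhi e J) \<le> \<bar>C\<bar> * poly_pnorm p (hPhi e J)"
   by (rule mult_right_mono[OF abs_ge_self poly_pnorm_nonneg[OF p1(1)]])
  also have "... \<le> C3" unfolding C3_def q_def by (intro mult_left_mono hPhi_pnorm[OF p e]) auto
  finally show "lp_norm p M (poly_op (hPhi e J) T f) \<le> C3 * lp_norm p M f"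
   by (intro order_trans[OF C[OF f]] mult_right_mono) auto
 qed
 define K where "K = max (Ksq p C1 C2 C3) (Ksq q C1 C2 C3)"
 show ?thesis unfolding q_def[symmetric]
 proof (intro exI[of _ K] conjI allI impI)
  fix x :: "'a => complex" assume x: "memLp p M x"
  show "sqfun p M T x \<le> ereal (K * lp_norm p M x)"
   unfolding sqfun_le_iff[OF p1(1) T x]
  proof
   fix n
   show "mixn p M {..<n} (\<lambda>i. poly_op (sqp i) T x) \<le> K * lp_norm p M x"
    by (rule order_trans[OF square_function_estimate[OF pq T R D H x] mult_right_mono]) (auto simp: K_def)
  qed
 next
  fix S and y :: "'a => complex" assume "is_adjoint p M T S" and y: "memLp q M y"
  then have a: "is_adj p q M T S" using T by (simp add: is_adj_def is_adjoint_def q_def)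
  then have S: "lp_op q M M S" by (simp add: is_adj_def)
  have HS: "op_bd q M M (poly_op (hPhi e J) S) C3" if e: "\<And>j. \<bar>e j\<bar> \<le> 1" for e J
   by (rule op_bd_adjoint[OF pq is_adj_poly[OF pq a] H[OF e]])
  show "sqfun q M S y \<le> ereal (K * lp_norm q M y)"
   unfolding sqfun_le_iff[OF p1(2) S y]
  proof
   fix n
   show "mixn q M {..<n} (\<lambda>i. poly_op (sqp i) S y) \<le> K * lp_norm q M y"
    by (rule order_trans[OF square_function_estimate[OF conj_exp_sym[OF pq] S Rfam_adjoint[OF pq a R] Rfam_adjoint[OF pq a D] HS y] mult_right_mono])
     (auto simp: K_def)
  qed
 qed
qed

lemma count_space_finite_support:
 fixes t :: "int => complex"
 assumes p: "p > 0" and F: "finite F" and t: "\<And>n. n \<notin> F ==> t n = 0"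
 shows "memLp p cZ t" "lp_norm p cZ t powr p = (\<Sum>n\<in>F. cmod (t n) powr p)"
proof -
 have fin: "finite {n \<in> UNIV. cmod (t n) powr p \<noteq> 0}" by (rule finite_subset[OF _ F]) (use t in auto)
 have "(\<Sum>n\<in>G. cmod (t n) powr p) \<le> (\<Sum>n\<in>F. cmod (t n) powr p)" if "finite G" for G
 proof -
  have "(\<Sum>n\<in>G. cmod (t n) powr p) = (\<Sum>n\<in>G \<inter> F. cmod (t n) powr p)"
   using that t p by (intro sum.mono_neutral_right) auto
  also have "... \<le> (\<Sum>n\<in>F. cmod (t n) powr p)" by (rule sum_mono2[OF F]) auto
  finally show ?thesis .
 qed
 from count_space_bound(1)[OF _ this] show "memLp p cZ t" by (simp add: memLp_def)
 have "lp_norm p cZ t powr p = (\<integral>n. cmod (t n) powr p \<partial>cZ)" by (rule lp_norm_powr[OF p])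
 also have "... = (\<Sum>n | n \<in> UNIV \<and> cmod (t n) powr p \<noteq> 0. cmod (t n) powr p)"
  using lebesgue_integral_count_space_finite_support[OF fin] by simp
 also have "... = (\<Sum>n\<in>F. cmod (t n) powr p)" using F t by (intro sum.mono_neutral_left) auto
 finally show "lp_norm p cZ t powr p = (\<Sum>n\<in>F. cmod (t n) powr p)" .
qed

lemma funpow_left_inverse_AE:
 assumes p: "p \<ge> 1" and U: "lp_op p N N U" and V: "lp_op p N N V"
  and inv: "\<And>f. memLp p N f ==> AE y in N. V (U f) y = f y" and f: "memLp p N f"
 shows "AE y in N. (V ^^ m) ((U ^^ m) f) y = f y"
 using f
proof (induction m)
 case (Suc m)
 have um: "memLp p N ((U ^^ m) f)" by (rule lp_op_mem[OF lp_op_pow[OF p U] Suc.prems])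
 have "AE y in N. (V ^^ m) (V (U ((U ^^ m) f))) y = (V ^^ m) ((U ^^ m) f) y"
  by (rule lp_op_cong[OF lp_op_pow[OF p V] lp_op_mem[OF V lp_op_mem[OF U um]] um inv[OF um]])
 with Suc.IH[OF Suc.prems] have "AE y in N. (V ^^ m) (V (U ((U ^^ m) f))) y = f y" by eventually_elim simp
 then show ?case by (simp add: funpow_swap1)
qed simp

text \<open>Coifman--Weiss transference: along an orbit of \<open>U\<close> the operator \<open>\<phi>(U)\<close> acts as \<open>\<phi>(shiftZ)\<close>.\<close>

lemma transference:
 assumes p: "p > 1" and U: "lp_op p N N U" and V: "lp_op p N N V"
  and inv: "\<And>f. memLp p N f ==> AE y in N. V (U f) y = f y"
  and bU: "\<And>n. op_bd p N N (U ^^ n) C" and bV: "\<And>n. op_bd p N N (V ^^ n) C" and g: "memLp p N g"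
 shows "lp_norm p N (poly_op \<phi> U g) \<le> C * C * poly_pnorm p \<phi> * lp_norm p N g"
proof -
 have p1: "p \<ge> 1" "p > 0" using p by auto
 have C0: "C \<ge> 0" by (rule op_bd_nonneg[OF bU])
 define G where "G = poly_op \<phi> U g"
 have G: "memLp p N G" unfolding G_def by (rule lp_op_mem[OF lp_op_poly[OF p1(1) U] g])
 define d where "d = degree \<phi>"
 define P where "P = poly_pnorm p \<phi>"
 have P: "P \<ge> 0" unfolding P_def by (rule poly_pnorm_nonneg[OF p1(1)])
 have Um: "memLp p N ((U ^^ m) f)" if "memLp p N f" for m f by (rule lp_op_mem[OF lp_op_pow[OF p1(1) U] that])
 have key: "real K * lp_norm p N G powr p \<le> real (d + K) * (C * C * P * lp_norm p N g) powr p" for K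
 proof -
  define L where "L = d + K"
  \<comment> \<open>A finite piece of the orbit in reversed order: the shift replaces entry
    \<open>k\<close> by entry \<open>k - 1\<close>, which contains one more application of
    \<open>U\<close>.\<close>
  define t where "t y k = (if 0 \<le> k \<and> k < int L then (U ^^ nat (int L - k)) g y else 0)" for y k
  have tm: "memLp p cZ (t y)" "lp_norm p cZ (t y) powr p = (\<Sum>k\<in>{0..<int L}. cmod (t y k) powr p)" for y
  proof -
   have z: "t y n = 0" if "n \<notin> {0..<int L}" for n using that by (auto simp: t_def)
   show "memLp p cZ (t y)" "lp_norm p cZ (t y) powr p = (\<Sum>k\<in>{0..<int L}. cmod (t y k) powr p)"
    using count_space_finite_support[OF p1(2) finite_atLeastLessThan_int z] by auto
  qed
  have tsum: "(\<Sum>k\<in>{0..<int L}. cmod (t y k) powr p) = (\<Sum>i<L. cmod ((U ^^ (L - i)) g y) powr p)" for y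
   by (rule sum.reindex_bij_witness[where i=int and j=nat]) (auto simp: t_def of_nat_diff nat_diff_distrib)
  \<comment> \<open>From position \<open>d\<close> on, the polynomial does not reach past the left
    end of the piece. This is the reason for the \<open>d\<close> extra entries in
    \<open>L = d + K\<close>.\<close>
  have orbit: "poly_op \<phi> shiftZ (t y) (int (d + i)) = poly_op (monom 1 (K - i) * \<phi>) U g y" if i: "i < K" for i y
  proof -
   have "monom 1 (K - i) * \<phi> = (\<Sum>j\<le>d. monom (coeff \<phi> j) (K - i + j))"
    unfolding d_def by (subst (1) poly_as_sum_of_monoms[symmetric]) (simp add: sum_distrib_left mult_monom)
   then have "poly_op (monom 1 (K - i) * \<phi>) U g y = (\<Sum>j\<le>d. coeff \<phi> j * (U ^^ (K - i + j)) g y)"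
    by (simp add: poly_op_sum poly_op_monom)
   also have "... = (\<Sum>j\<le>d. coeff \<phi> j * t y (int (d + i) - int j))"
   proof (intro sum.cong refl)
    fix j assume "j \<in> {..d}"
    then have "0 \<le> int (d + i) - int j \<and> int (d + i) - int j < int L" "nat (int L - (int (d + i) - int j)) = K - i + j"
     using i by (auto simp: L_def)
    then show "coeff \<phi> j * (U ^^ (K - i + j)) g y = coeff \<phi> j * t y (int (d + i) - int j)" by (simp add: t_def)
   qed
   finally show ?thesis unfolding d_def by (simp add: zpoly_alt[OF order_refl])
  qed
  have pt: "(\<Sum>i<K. cmod (poly_op (monom 1 (K - i) * \<phi>) U g y) powr p) \<le> P powr p * (\<Sum>i<L. cmod ((U ^^ (L - i)) g y) powr p)" for y
  proof -
   have "(\<Sum>i<K. cmod (poly_op (monom 1 (K - i) * \<phi>) U g y) powr p) = (\<Sum>i<K. cmod (poly_op \<phi> shiftZ (t y) (int (d + i))) powr p)"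
    using orbit by (intro sum.cong) auto
   also have "... = (\<Sum>n\<in>(\<lambda>i. int (d + i)) ` {..<K}. cmod (poly_op \<phi> shiftZ (t y) n) powr p)"
    by (subst sum.reindex) (auto simp: inj_on_def)
   also have "... \<le> (\<integral>n. cmod (poly_op \<phi> shiftZ (t y) n) powr p \<partial>cZ)"
    by (rule count_space_sum_le) (use lp_op_mem[OF lp_op_poly[OF p1(1) lp_op_shiftZ] tm(1)] in \<open>auto simp: memLp_def\<close>)
   also have "... = lp_norm p cZ (poly_op \<phi> shiftZ (t y)) powr p" by (simp add: lp_norm_powr[OF p1(2)])
   also have "... \<le> (P * lp_norm p cZ (t y)) powr p"
    unfolding P_def using p by (intro powr_mono2 poly_pnorm_bound[OF p1(1) tm(1)]) auto
   also have "... = P powr p * (\<Sum>i<L. cmod ((U ^^ (L - i)) g y) powr p)"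
    using P by (simp add: powr_mult tm(2) tsum)
   finally show ?thesis .
  qed
  \<comment> \<open>Powers of \<open>V\<close> undo powers of \<open>U\<close>, so \<open>G\<close>
    is controlled by each of its orbit points. One factor \<open>C\<close> is spent here, the other
    on the orbit of \<open>g\<close>.\<close>
  have each: "lp_norm p N G powr p \<le> C powr p * (\<integral>y. cmod (poly_op (monom 1 (K - i) * \<phi>) U g y) powr p \<partial>N)" for i
  proof -
   let ?m = "K - i"
   have "lp_norm p N G = lp_norm p N ((V ^^ ?m) ((U ^^ ?m) G))"
    by (rule lp_norm_cong_mem[OF G lp_op_mem[OF lp_op_pow[OF p1(1) V] Um[OF G]]])
     (use funpow_left_inverse_AE[OF p1(1) U V inv G, of ?m] in \<open>auto elim!: eventually_mono\<close>)
   also have "... \<le> C * lp_norm p N ((U ^^ ?m) G)" by (rule op_bdD[OF bV Um[OF G]])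
   also have "lp_norm p N ((U ^^ ?m) G) = lp_norm p N (poly_op (monom 1 ?m * \<phi>) U g)"
    unfolding G_def
    by (rule lp_norm_cong_mem[OF _ _ funpow_poly_op[OF p1(1) U g]])
     (intro lp_op_mem[OF lp_op_pow[OF p1(1) U]] lp_op_mem[OF lp_op_poly[OF p1(1) U]] g)+
   finally have "lp_norm p N G powr p \<le> (C * lp_norm p N (poly_op (monom 1 ?m * \<phi>) U g)) powr p"
    using p by (intro powr_mono2) auto
   then show ?thesis using C0 by (simp add: powr_mult lp_norm_powr[OF p1(2)])
  qed
  have i1: "integrable N (\<lambda>y. cmod (poly_op \<psi> U g y) powr p)" for \<psi>
   using lp_op_mem[OF lp_op_poly[OF p1(1) U] g] by (simp add: memLp_def)
  have i2: "integrable N (\<lambda>y. cmod ((U ^^ m) g y) powr p)" for m using Um[OF g] by (simp add: memLp_def)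
  have "real K * lp_norm p N G powr p = (\<Sum>i<K. lp_norm p N G powr p)" by simp
  also have "... \<le> (\<Sum>i<K. C powr p * (\<integral>y. cmod (poly_op (monom 1 (K - i) * \<phi>) U g y) powr p \<partial>N))" by (intro sum_mono each)
  also have "... = C powr p * (\<integral>y. (\<Sum>i<K. cmod (poly_op (monom 1 (K - i) * \<phi>) U g y) powr p) \<partial>N)"
   using i1 by (simp add: Bochner_Integration.integral_sum sum_distrib_left)
  also have "... \<le> C powr p * (\<integral>y. P powr p * (\<Sum>i<L. cmod ((U ^^ (L - i)) g y) powr p) \<partial>N)"
   by (intro mult_left_mono integral_mono pt Bochner_Integration.integrable_sum integrable_mult_right i1 i2) auto
  also have "... = C powr p * (P powr p * (\<Sum>i<L. lp_norm p N ((U ^^ (L - i)) g) powr p))"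
   using i2 by (simp add: Bochner_Integration.integral_sum lp_norm_powr[OF p1(2)])
  also have "... \<le> C powr p * (P powr p * (\<Sum>i<L. (C * lp_norm p N g) powr p))"
   by (intro mult_left_mono sum_mono powr_mono2 op_bdD[OF bU g]) (use p in auto)
  also have "... = real (d + K) * (C * C * P * lp_norm p N g) powr p"
   using C0 P by (simp add: powr_mult L_def)
  finally show ?thesis .
 qed
 define X where "X = lp_norm p N G powr p"
 define Y where "Y = (C * C * P * lp_norm p N g) powr p"
 \<comment> \<open>Dividing by the number \<open>K\<close> of good positions leaves the ratio
   \<open>(d + K) / K\<close>, which tends to 1: the truncation costs nothing in the limit.\<close>
 have "X \<le> Y"
 proof (rule LIMSEQ_le_const)
  have "(\<lambda>K. Y + (real d * Y) * (1 / real (Suc K))) \<longlonglongrightarrow> Y + (real d * Y) * 0"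
   by (intro tendsto_intros LIMSEQ_Suc[OF lim_1_over_n])
  then show "(\<lambda>K. Y + (real d * Y) * (1 / real (Suc K))) \<longlonglongrightarrow> Y" by simp
  have "X \<le> Y + (real d * Y) * (1 / real (Suc K))" for K
  proof -
   have "real (Suc K) * X \<le> real (d + Suc K) * Y" using key[of "Suc K"] by (simp add: X_def Y_def)
   also have "... = real (Suc K) * (Y + (real d * Y) * (1 / real (Suc K)))"
    unfolding of_nat_add by (simp add: field_simps del: of_nat_Suc)
   finally show ?thesis by (simp del: of_nat_Suc)
  qed
  then show "\<exists>N. \<forall>n\<ge>N. X \<le> Y + (real d * Y) * (1 / real (Suc n))" by blast
 qed
 then show ?thesis
  using powr_less_mono2[of p "C * C * P * lp_norm p N g" "lp_norm p N G"] p1 C0 P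
  unfolding X_def Y_def G_def P_def by (meson lp_norm_nonneg mult_nonneg_nonneg not_le)
qed

text \<open>The dilation identity extends by linearity to \<open>\<phi>(T) = Q \<phi>(U) J\<close>
  almost everywhere, so the estimate for \<open>U\<close> is inherited.\<close>

theorem dilation_imp_poly_bounded:
 assumes p: "p > 1" and T: "lp_op p M M T" and dil: "dilation_on p M T N"
 shows "p_poly_bounded p M T"
proof -
 have p1: "p \<ge> 1" using p by simp
 obtain J Q U V where J: "lp_op p M N J" and Q: "lp_op p N M Q" and U: "lp_op p N N U" and V: "lp_op p N N V"
  and inv: "\<And>f. memLp p N f ==> (AE y in N. V (U f) y = f y) \<and> (AE y in N. U (V f) y = f y)"
  and bd: "op_set_bounded p N (powers_set U \<union> powers_set V)"
  and eq: "\<And>n f. memLp p M f ==> AE x in M. (T ^^ n) f x = Q ((U ^^ n) (J f)) x"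
  using dil unfolding dilation_on_def by blast
 obtain C where C: "\<And>S f. S \<in> powers_set U \<union> powers_set V ==> memLp p N f ==> lp_norm p N (S f) \<le> C * lp_norm p N f"
  using bd unfolding op_set_bounded_def by blast
 have b: "op_bd p N N S (max C 0)" if "S \<in> powers_set U \<union> powers_set V" for S
  unfolding op_bd_def
 proof (intro conjI allI impI)
  fix f :: "'b => complex" assume f: "memLp p N f"
  show "lp_norm p N (S f) \<le> max C 0 * lp_norm p N f"
   by (rule order_trans[OF C[OF that f] mult_right_mono]) auto
 qed simp
 have bU: "op_bd p N N (U ^^ n) (max C 0)" and bV: "op_bd p N N (V ^^ n) (max C 0)" for n
  by (auto intro!: b simp: powers_set_def)
 obtain CJ CQ where CJ: "op_bd p M N J CJ" and CQ: "op_bd p N M Q CQ" using lp_op_bd[OF J] lp_op_bd[OF Q] by metis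
 define D where "D = max C 0"
 show ?thesis unfolding p_poly_bounded_def
 proof (intro exI[of _ "CQ * (D * D) * CJ"] allI impI)
  fix \<phi> and f :: "'a => complex" assume f: "memLp p M f"
  have Jf: "memLp p N (J f)" by (rule lp_op_mem[OF J f])
  have UJ: "memLp p N ((U ^^ n) (J f))" for n by (rule lp_op_mem[OF lp_op_pow[OF p1 U] Jf])
  have PU: "memLp p N (poly_op \<phi> U (J f))" by (rule lp_op_mem[OF lp_op_poly[OF p1 U] Jf])
  have 1: "AE x in M. \<forall>j\<in>{..degree \<phi>}. (T ^^ j) f x = Q ((U ^^ j) (J f)) x"
   by (rule AE_finite_allI) (auto intro: eq[OF f])
  have 2: "AE x in M. Q (\<lambda>y. \<Sum>j\<le>degree \<phi>. coeff \<phi> j * (U ^^ j) (J f) y) x = (\<Sum>j\<le>degree \<phi>. coeff \<phi> j * Q ((U ^^ j) (J f)) x)"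
   by (rule lp_op_sum[OF p1 Q UJ])
  have "AE x in M. poly_op \<phi> T f x = Q (poly_op \<phi> U (J f)) x"
   using 1 2 by eventually_elim (simp add: poly_op_def)
  then have "lp_norm p M (poly_op \<phi> T f) = lp_norm p M (Q (poly_op \<phi> U (J f)))"
   by (rule lp_norm_cong_mem[OF lp_op_mem[OF lp_op_poly[OF p1 T] f] lp_op_mem[OF Q PU]])
  also have "... \<le> CQ * lp_norm p N (poly_op \<phi> U (J f))" by (rule op_bdD[OF CQ PU])
  also have "... \<le> CQ * (D * D * poly_pnorm p \<phi> * lp_norm p N (J f))"
   unfolding D_def using inv by (intro mult_left_mono transference[OF p U V _ bU bV Jf] op_bd_nonneg[OF CQ]) auto
  also have "... \<le> CQ * (D * D * poly_pnorm p \<phi> * (CJ * lp_norm p M f))"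
   by (intro mult_left_mono op_bdD[OF CJ f] op_bd_nonneg[OF CQ] mult_nonneg_nonneg poly_pnorm_nonneg[OF p1]) (auto simp: D_def)
  finally show "lp_norm p M (poly_op \<phi> T f) \<le> CQ * (D * D) * CJ * poly_pnorm p \<phi> * lp_norm p M f"
   by (simp add: mult_ac)
 qed
qed

section \<open>R-boundedness from square functions\<close>

lemma pairing_split:
 assumes pq: "conj_exp p q" and a: "is_adj p q M T S" and x: "memLp p M x" and y: "memLp q M y"
 shows "(\<integral>w. poly_op (\<phi> * \<psi>) T x w * y w \<partial>M) = (\<integral>w. poly_op \<phi> T x w * poly_op \<psi> S y w \<partial>M)"
proof -
 have p: "p \<ge> 1" "q \<ge> 1" and T: "lp_op p M M T" using pq a by (auto simp: conj_exp_def is_adj_def)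
 have m: "memLp p M (poly_op \<phi> T f)" if "memLp p M f" for \<phi> f by (rule lp_op_mem[OF lp_op_poly[OF p(1) T] that])
 have "(\<integral>w. poly_op (\<psi> * \<phi>) T x w * y w \<partial>M) = (\<integral>w. poly_op \<psi> T (poly_op \<phi> T x) w * y w \<partial>M)"
 proof (rule integral_cong_AE)
  show "AE w in M. poly_op (\<psi> * \<phi>) T x w * y w = poly_op \<psi> T (poly_op \<phi> T x) w * y w"
   using poly_op_mult[OF p(1) T x, of \<psi> \<phi>] by eventually_elim simp
 qed (auto intro!: borel_measurable_times memLp_meas[OF m] memLp_meas[OF y] m x)
 also have "... = (\<integral>w. poly_op \<phi> T x w * poly_op \<psi> S y w \<partial>M)"
  by (rule is_adjD[OF is_adj_poly[OF pq a] m[OF x] y])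
 finally show ?thesis by (simp add: mult.commute)
qed

text \<open>A common scheme for R-boundedness. In the pairing, the factors \<open>\<alpha>\<close>
  stay with \<open>T\<close> and the factors \<open>\<beta>\<close> move to the adjoint, and both
  are estimated by square functions. The part that is not reproduced splits in two:
  \<open>\<rho> N\<close> is the same for all \<open>i\<close> and is handled by the l^2 extension
  of one operator, while \<open>\<tau> N i\<close> vanishes in norm as \<open>N\<close>
  grows.\<close>

lemma pairing_bound:
 fixes \<alpha> \<beta> :: "nat => nat => 'k => complex poly" and x :: "nat => 'a => complex"
 assumes pq: "conj_exp p q" and a: "is_adj p q M T S"
  and eq: "\<And>N i. i < n ==> \<phi> i = (\<Sum>u\<in>K N. \<alpha> N i u * (\<beta> N i u * \<eta>)) + \<rho> N + \<tau> N i"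
  and K: "\<And>N. finite (K N)" and AB: "A \<ge> 0" "B \<ge> 0"
  and A: "\<And>N. mixn p M ({..<n} \<times> K N) (\<lambda>(i, u). poly_op (\<alpha> N i u) T (x i)) \<le> A * mixn p M {..<n} x"
  and B: "\<And>N y. (\<And>i. i < n ==> memLp q M (y i)) ==>
   mixn q M ({..<n} \<times> K N) (\<lambda>(i, u). poly_op (\<beta> N i u) S (y i)) \<le> B * mixn q M {..<n} y"
  and \<eta>: "op_bd q M M (poly_op \<eta> S) c1" and \<rho>: "\<And>N. op_bd p M M (poly_op (\<rho> N) T) c2"
  and \<tau>: "\<And>N i. i < n ==> op_bd p M M (poly_op (\<tau> N i) T) (t N)" and t: "t \<longlonglongrightarrow> 0"
  and x: "\<And>i. i < n ==> memLp p M (x i)"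
 shows "mixn p M {..<n} (\<lambda>i. poly_op (\<phi> i) T (x i)) \<le> (A * (B * (MZ q * c1)) + MZ p * c2) * mixn p M {..<n} x"
proof (rule mixn_dual[OF pq])
 have p: "p \<ge> 1" "q \<ge> 1" and T: "lp_op p M M T" and S: "lp_op q M M S" using pq a by (auto simp: conj_exp_def is_adj_def)
 have m: "memLp p M (poly_op \<phi> T f)" if "memLp p M f" for \<phi> f by (rule lp_op_mem[OF lp_op_poly[OF p(1) T] that])
 have mS: "memLp q M (poly_op \<phi> S f)" if "memLp q M f" for \<phi> f by (rule lp_op_mem[OF lp_op_poly[OF p(2) S] that])
 define X where "X = mixn p M {..<n} x"
 have c: "c1 \<ge> 0" "c2 \<ge> 0" using op_bd_nonneg[OF \<eta>] op_bd_nonneg[OF \<rho>] by auto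
 show "0 \<le> (A * (B * (MZ q * c1)) + MZ p * c2) * mixn p M {..<n} x" using AB c by simp
 show "memLp p M (poly_op (\<phi> i) T (x i))" if "i \<in> {..<n}" for i using m x that by simp
 fix y :: "nat => 'a => complex" assume "\<And>i. i \<in> {..<n} ==> memLp q M (y i)"
 then have y: "memLp q M (y i)" if "i < n" for i using that by simp
 define Y where "Y = mixn q M {..<n} y"
 define B0 where "B0 \<psi> i = (\<integral>w. poly_op \<psi> T (x i) w * y i w \<partial>M)" for \<psi> i
 have int: "integrable M (\<lambda>w. poly_op \<psi> T (x i) w * y i w)" if "i < n" for \<psi> i
  by (rule Hoelder_integrable[OF pq m[OF x[OF that]] y[OF that]])
 have B0_add: "B0 (\<psi> + \<xi>) i = B0 \<psi> i + B0 \<xi> i" if "i < n" for \<psi> \<xi> i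
  unfolding B0_def using int[OF that] by (simp add: poly_op_add distrib_right)
 have B0_sum: "B0 (\<Sum>u\<in>L. \<psi> u) i = (\<Sum>u\<in>L. B0 (\<psi> u) i)" if "i < n" for \<psi> i and L :: "'k set"
  unfolding B0_def using int[OF that] by (simp add: poly_op_sum sum_distrib_right Bochner_Integration.integral_sum)
 have total: "(\<integral>w. (\<Sum>i<n. poly_op (\<phi> i) T (x i) w * y i w) \<partial>M) = (\<Sum>i<n. B0 (\<phi> i) i)"
  unfolding B0_def using int by (subst Bochner_Integration.integral_sum) auto
 have bound: "cmod (\<Sum>i<n. B0 (\<phi> i) i) \<le> (A * (B * (MZ q * c1)) + MZ p * c2) * X * Y + t N * (\<Sum>i<n. lp_norm p M (x i) * lp_norm q M (y i))" for N
 proof -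
  define y' where "y' i = poly_op \<eta> S (y i)" for i
  have y'm: "memLp q M (y' i)" if "i < n" for i unfolding y'_def by (rule mS[OF y[OF that]])
  have y'b: "mixn q M {..<n} y' \<le> MZ q * c1 * Y"
   unfolding y'_def Y_def by (rule MZ_single[OF p(2) finite_lessThan lp_op_poly[OF p(2) S] \<eta>]) (use y in auto)
  have "B0 (\<phi> i) i = (\<Sum>u\<in>K N. B0 (\<alpha> N i u * (\<beta> N i u * \<eta>)) i) + B0 (\<rho> N) i + B0 (\<tau> N i) i" if "i < n" for i
   unfolding eq[OF that, of N] B0_add[OF that] B0_sum[OF that] ..
  then have split: "(\<Sum>i<n. B0 (\<phi> i) i) = (\<Sum>i<n. \<Sum>u\<in>K N. B0 (\<alpha> N i u * (\<beta> N i u * \<eta>)) i) + (\<Sum>i<n. B0 (\<rho> N) i) + (\<Sum>i<n. B0 (\<tau> N i) i)"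
   by (simp add: sum.distrib)
  have 1: "cmod (\<Sum>i<n. \<Sum>u\<in>K N. B0 (\<alpha> N i u * (\<beta> N i u * \<eta>)) i) \<le> A * X * (B * (MZ q * c1 * Y))"
  proof -
   let ?a = "\<lambda>(i, u). poly_op (\<alpha> N i u) T (x i)" and ?b = "\<lambda>(i, u). poly_op (\<beta> N i u) S (y' i)"
   have am: "memLp p M (?a j)" if "j \<in> {..<n} \<times> K N" for j using that m x by auto
   have bm: "memLp q M (?b j)" if "j \<in> {..<n} \<times> K N" for j using that mS y'm by auto
   have tm: "B0 (\<alpha> N i u * (\<beta> N i u * \<eta>)) i = (\<integral>w. ?a (i, u) w * ?b (i, u) w \<partial>M)" if i: "i < n" for i u
   proof -
    have "B0 (\<alpha> N i u * (\<beta> N i u * \<eta>)) i = (\<integral>w. poly_op (\<alpha> N i u) T (x i) w * poly_op (\<beta> N i u * \<eta>) S (y i) w \<partial>M)"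
     unfolding B0_def by (rule pairing_split[OF pq a x[OF i] y[OF i]])
    also have "... = (\<integral>w. poly_op (\<alpha> N i u) T (x i) w * poly_op (\<beta> N i u) S (y' i) w \<partial>M)"
    proof (rule integral_cong_AE)
     show "AE w in M. poly_op (\<alpha> N i u) T (x i) w * poly_op (\<beta> N i u * \<eta>) S (y i) w
       = poly_op (\<alpha> N i u) T (x i) w * poly_op (\<beta> N i u) S (y' i) w"
      using poly_op_mult[OF p(2) S y[OF i], of "\<beta> N i u" \<eta>] unfolding y'_def by eventually_elim simp
    qed (auto intro!: borel_measurable_times memLp_meas[OF m] memLp_meas[OF mS] x y y'm i)
    finally show ?thesis by simp
   qed
   have "(\<Sum>i<n. \<Sum>u\<in>K N. B0 (\<alpha> N i u * (\<beta> N i u * \<eta>)) i) = (\<Sum>j\<in>{..<n} \<times> K N. \<integral>w. ?a j w * ?b j w \<partial>M)"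
    using tm by (simp add: sum.cartesian_product case_prod_unfold)
   also have "... = (\<integral>w. (\<Sum>j\<in>{..<n} \<times> K N. ?a j w * ?b j w) \<partial>M)"
    by (rule Bochner_Integration.integral_sum[symmetric]) (rule Hoelder_integrable[OF pq am bm])
   also have "cmod ... \<le> mixn p M ({..<n} \<times> K N) ?a * mixn q M ({..<n} \<times> K N) ?b"
    by (rule mixn_Hoelder[OF pq am bm])
   also have "... \<le> (A * X) * (B * (MZ q * c1 * Y))"
    unfolding X_def
    by (intro mult_mono A order_trans[OF B[OF y'm] mult_left_mono[OF y'b]] AB mult_nonneg_nonneg) auto
   finally show ?thesis .
  qed
  have 2: "cmod (\<Sum>i<n. B0 (\<rho> N) i) \<le> MZ p * c2 * X * Y"
  proof -
   have "(\<Sum>i<n. B0 (\<rho> N) i) = (\<integral>w. (\<Sum>i<n. poly_op (\<rho> N) T (x i) w * y i w) \<partial>M)"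
    unfolding B0_def using int by (subst Bochner_Integration.integral_sum) auto
   also have "cmod ... \<le> mixn p M {..<n} (\<lambda>i. poly_op (\<rho> N) T (x i)) * mixn q M {..<n} y"
    by (rule mixn_Hoelder[OF pq]) (use m x y in auto)
   also have "... \<le> (MZ p * c2 * X) * Y"
    unfolding X_def Y_def
    by (intro mult_right_mono MZ_single[OF p(1) finite_lessThan lp_op_poly[OF p(1) T] \<rho>]) (use x in auto)
   finally show ?thesis .
  qed
  have 3: "cmod (\<Sum>i<n. B0 (\<tau> N i) i) \<le> t N * (\<Sum>i<n. lp_norm p M (x i) * lp_norm q M (y i))"
  proof -
   have "cmod (\<Sum>i<n. B0 (\<tau> N i) i) \<le> (\<Sum>i<n. cmod (B0 (\<tau> N i) i))" by (rule norm_sum)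
   also have "... \<le> (\<Sum>i<n. t N * lp_norm p M (x i) * lp_norm q M (y i))"
   proof (rule sum_mono)
    fix i assume "i \<in> {..<n}"
    then have i: "i < n" by simp
    have "cmod (B0 (\<tau> N i) i) \<le> lp_norm p M (poly_op (\<tau> N i) T (x i)) * lp_norm q M (y i)"
     unfolding B0_def by (rule Hoelder[OF pq m[OF x[OF i]] y[OF i]])
    also have "... \<le> t N * lp_norm p M (x i) * lp_norm q M (y i)"
     by (rule mult_right_mono[OF op_bdD[OF \<tau>[OF i] x[OF i]]]) simp
    finally show "cmod (B0 (\<tau> N i) i) \<le> t N * lp_norm p M (x i) * lp_norm q M (y i)" .
   qed
   finally show ?thesis by (simp add: sum_distrib_left mult.assoc)
  qed
  have "cmod (\<Sum>i<n. B0 (\<phi> i) i) \<le> A * X * (B * (MZ q * c1 * Y)) + MZ p * c2 * X * Y + t N * (\<Sum>i<n. lp_norm p M (x i) * lp_norm q M (y i))"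
   unfolding split by (intro norm_triangle_le add_mono 1 2 3)
  then show ?thesis by (simp add: algebra_simps)
 qed
 let ?W = "\<Sum>i<n. lp_norm p M (x i) * lp_norm q M (y i)"
 have "cmod (\<Sum>i<n. B0 (\<phi> i) i) \<le> (A * (B * (MZ q * c1)) + MZ p * c2) * X * Y"
 proof (rule LIMSEQ_le_const)
  have "(\<lambda>N. (A * (B * (MZ q * c1)) + MZ p * c2) * X * Y + t N * ?W) \<longlonglongrightarrow> (A * (B * (MZ q * c1)) + MZ p * c2) * X * Y + 0 * ?W"
   by (intro tendsto_intros t)
  then show "(\<lambda>N. (A * (B * (MZ q * c1)) + MZ p * c2) * X * Y + t N * ?W) \<longlonglongrightarrow> (A * (B * (MZ q * c1)) + MZ p * c2) * X * Y" by simp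
 qed (use bound in auto)
 then show "cmod (\<integral>w. (\<Sum>i<n. poly_op (\<phi> i) T (x i) w * y i w) \<partial>M) \<le> (A * (B * (MZ q * c1)) + MZ p * c2) * mixn p M {..<n} x * mixn q M {..<n} y"
  unfolding total X_def Y_def .
qed

text \<open>At most \<open>r + 1\<close> pairs have sum \<open>r\<close>, and the denominator
  \<open>e + r + 1\<close> compensates this multiplicity. Thus the weighted square function
  dominates an unweighted double sum, even after a translation by \<open>e\<close>.\<close>

lemma pair_sum_le:
 fixes h :: "nat => real"
 assumes h: "\<And>k. h k \<ge> 0"
 shows "(\<Sum>(s, l)\<in>{..<N} \<times> {..<N}. h (e + s + l) / real (Suc (e + s + l))) \<le> (\<Sum>k<e + 2 * N. h k)"
proof -
 let ?P = "{..<N} \<times> {..<N}"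
 have "(\<Sum>(s, l)\<in>?P. h (e + s + l) / real (Suc (e + s + l))) = (\<Sum>x\<in>?P. h (e + (fst x + snd x)) / real (Suc (e + (fst x + snd x))))"
  by (intro sum.cong) (auto simp: add.assoc)
 also have "... = (\<Sum>r<2 * N. \<Sum>x\<in>{x \<in> ?P. fst x + snd x = r}. h (e + (fst x + snd x)) / real (Suc (e + (fst x + snd x))))"
  by (rule sum.group[symmetric]) auto
 also have "... = (\<Sum>r<2 * N. real (card {x \<in> ?P. fst x + snd x = r}) * (h (e + r) / real (Suc (e + r))))"
  by (intro sum.cong refl) simp
 also have "... \<le> (\<Sum>r<2 * N. h (e + r))"
 proof (rule sum_mono)
  fix r
  have "card {x \<in> ?P. fst x + snd x = r} \<le> card {..r}"
   by (rule card_inj_on_le[where f=fst]) (auto simp: inj_on_def)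
  then have "real (card {x \<in> ?P. fst x + snd x = r}) \<le> real (Suc (e + r))" by simp
  then have "real (card {x \<in> ?P. fst x + snd x = r}) * (h (e + r) / real (Suc (e + r))) \<le> real (Suc (e + r)) * (h (e + r) / real (Suc (e + r)))"
   using h by (intro mult_right_mono) auto
  then show "real (card {x \<in> ?P. fst x + snd x = r}) * (h (e + r) / real (Suc (e + r))) \<le> h (e + r)" by simp
 qed
 also have "... = (\<Sum>k\<in>(\<lambda>r. e + r) ` {..<2 * N}. h k)" by (subst sum.reindex) (auto simp: inj_on_def)
 also have "... \<le> (\<Sum>k<e + 2 * N. h k)" by (rule sum_mono2) (use h in auto)
 finally show ?thesis .
qed

lemma poly_op_step_square:
 "(cmod (poly_op (zz ^ k * (1 - zz)) T f w))^2 = (cmod (poly_op (sqp k) T f w))^2 / real (Suc k)"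
proof -
 have "sqp k = smult (of_real (sqrt (real (Suc k)))) (- (zz ^ k * (1 - zz)))"
  unfolding sqp_def monom_step by simp
 then have "cmod (poly_op (sqp k) T f w) = sqrt (real (Suc k)) * cmod (poly_op (zz ^ k * (1 - zz)) T f w)"
  by (simp only: poly_op_smult poly_op_uminus norm_mult norm_minus_cancel norm_of_real) simp
 then show ?thesis by (simp add: power_mult_distrib del: of_nat_Suc)
qed

lemma square_family_bound:
 fixes x :: "nat => 'a => complex" and \<alpha> :: "nat => 'k => complex poly"
 assumes p: "p \<ge> 1" and T: "lp_op p M M T" and C: "C \<ge> 0" and c: "c \<ge> 0"
  and sq: "\<And>n f. memLp p M f ==> mixn p M {..<n} (\<lambda>k. poly_op (sqp k) T f) \<le> C * lp_norm p M f"
  and x: "\<And>i. i < n ==> memLp p M (x i)" and K: "finite K"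
  and le: "\<And>i w. i < n ==> (\<Sum>u\<in>K. (cmod (poly_op (\<alpha> i u) T (x i) w))^2) \<le> c^2 * (\<Sum>k<L. (cmod (poly_op (sqp k) T (x i) w))^2)"
 shows "mixn p M ({..<n} \<times> K) (\<lambda>(i, u). poly_op (\<alpha> i u) T (x i)) \<le> c * (MZ p * C) * mixn p M {..<n} x"
proof -
 have m: "memLp p M (poly_op \<phi> T (x i))" if "i < n" for i \<phi> by (rule lp_op_mem[OF lp_op_poly[OF p T] x[OF that]])
 have "mixn p M ({..<n} \<times> K) (\<lambda>(i, u). poly_op (\<alpha> i u) T (x i))
   \<le> c * mixn p M ({..<n} \<times> {..<L}) (\<lambda>(i, k). poly_op (sqp k) T (x i))"
 proof (rule mixn_mono[OF p _ _ c])
  show "AE w in M. (\<Sum>j\<in>{..<n} \<times> K. (cmod ((case j of (i, u) => poly_op (\<alpha> i u) T (x i)) w))^2)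
    \<le> c^2 * (\<Sum>j\<in>{..<n} \<times> {..<L}. (cmod ((case j of (i, k) => poly_op (sqp k) T (x i)) w))^2)"
  proof (rule AE_I2)
   fix w
   have "(\<Sum>i<n. \<Sum>u\<in>K. (cmod (poly_op (\<alpha> i u) T (x i) w))^2) \<le> (\<Sum>i<n. c^2 * (\<Sum>k<L. (cmod (poly_op (sqp k) T (x i) w))^2))"
    by (rule sum_mono[OF le]) simp
   then show "(\<Sum>j\<in>{..<n} \<times> K. (cmod ((case j of (i, u) => poly_op (\<alpha> i u) T (x i)) w))^2)
    \<le> c^2 * (\<Sum>j\<in>{..<n} \<times> {..<L}. (cmod ((case j of (i, k) => poly_op (sqp k) T (x i)) w))^2)"
    by (simp add: sum.cartesian_product sum_distrib_left case_prod_unfold)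
  qed
 qed (use m in auto)
 also have "... \<le> c * (MZ p * C * mixn p M {..<n} x)"
  by (intro mult_left_mono c MZ_square_function[OF p _ _ C lp_op_poly[OF p T] sq x]) auto
 finally show ?thesis by (simp add: mult.assoc)
qed

lemma sum_even_powers: "(\<Sum>k<N. x ^ (e + 2 * k) * (1 - x^2)) = x ^ e * (1 - x ^ (2 * N))" for x :: "'a :: comm_ring_1"
proof -
 have "(\<Sum>k<N. x ^ (e + 2 * k) * (1 - x^2)) = x ^ e * ((1 - x^2) * (\<Sum>k<N. (x^2) ^ k))"
  by (simp only: power_add power_mult sum_distrib_left) (simp only: mult_ac)
 also have "... = x ^ e * (1 - x ^ (2 * N))"
  by (simp only: one_diff_power_eq[symmetric] power_mult)
 finally show ?thesis .
qed

text \<open>Since \<open>(1 - x)^2 (1 + x)^2 = (1 - x^2)^2\<close>, the double sum is a product of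
  two telescoping geometric sums. This is the truncated reproducing identity, with
  \<open>x ^ e\<close> carried by the first factor alone.\<close>

lemma double_sum_powers:
 "(\<Sum>(s, l)\<in>{..<N} \<times> {..<N}. x ^ (e + s + l) * (1 - x) * (x ^ (s + l) * (1 - x) * (1 + x)^2)) = x ^ e * (1 - x ^ (2 * N))^2"
 for x :: "'a :: comm_ring_1"
proof -
 have "x ^ (e + s + l) * (1 - x) * (x ^ (s + l) * (1 - x) * (1 + x)^2)
   = (x ^ (e + 2 * s) * (1 - x^2)) * (x ^ (0 + 2 * l) * (1 - x^2))" for s l
 proof -
  have h: "1 - x^2 = (1 - x) * (1 + x)" by (simp add: algebra_simps power2_eq_square)
  show ?thesis unfolding h by (simp only: power_add mult_2 power2_eq_square add_0_left power_0 mult_1_left) (simp only: mult_ac)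
 qed
 then have "(\<Sum>(s, l)\<in>{..<N} \<times> {..<N}. x ^ (e + s + l) * (1 - x) * (x ^ (s + l) * (1 - x) * (1 + x)^2))
   = (\<Sum>s<N. x ^ (e + 2 * s) * (1 - x^2)) * (\<Sum>l<N. x ^ (0 + 2 * l) * (1 - x^2))"
  by (simp only: sum_product sum.cartesian_product)
 also have "... = x ^ e * (1 - x ^ (2 * N))^2"
  unfolding sum_even_powers by (simp only: power2_eq_square mult_ac power_0 mult_1_left mult_1_right)
 finally show ?thesis .
qed

lemma power_diff_telescope: "x ^ a - x ^ (a + e) = (\<Sum>j<e. x ^ (a + j) * (1 - x))" for x :: "'a :: comm_ring_1"
proof (induction e)
 case (Suc e)
 have "x ^ a - x ^ (a + Suc e) = (x ^ a - x ^ (a + e)) + x ^ (a + e) * (1 - x)"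
  by (simp add: algebra_simps)
 then show ?case using Suc by simp
qed simp

lemma smult_sum_right: "smult c (\<Sum>i\<in>I. f i) = (\<Sum>i\<in>I. smult c (f i))"
 by (induction I rule: infinite_finite_induct) (simp_all add: smult_add_right)

lemma op_bd_zz_power_diff:
 assumes p: "p \<ge> 1" and T: "lp_op p M M T"
  and df: "\<And>n. op_bd p M M (poly_op (zz ^ n * (1 - zz)) T) (c / real (Suc n))"
 shows "op_bd p M M (poly_op (zz ^ a - zz ^ (a + e)) T) (real e * c / real (Suc a))"
 unfolding power_diff_telescope
proof (rule op_bd_mono[OF op_bd_poly_sum[OF p T df]])
 have c: "c \<ge> 0" using op_bd_nonneg[OF df[of 0]] by simp
 have "(\<Sum>j<e. c / real (Suc (a + j))) \<le> (\<Sum>j<e. c / real (Suc a))"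
  using c by (intro sum_mono divide_left_mono) auto
 then show "(\<Sum>j<e. c / real (Suc (a + j))) \<le> real e * c / real (Suc a)" by simp
qed

lemma tendsto_const_over_Suc: "(\<lambda>N. c / real (Suc (2 * N))) \<longlonglongrightarrow> 0"
proof -
 have "(\<lambda>n. c / real (Suc n)) \<longlonglongrightarrow> 0"
  by (rule LIMSEQ_Suc) (rule lim_const_over_n)
 from LIMSEQ_subseq_LIMSEQ[OF this, of "\<lambda>N. 2 * N"] show ?thesis
  by (simp add: strict_mono_def o_def)
qed

text \<open>With \<open>w = zz ^ (2 * N)\<close> the polynomial equals
  \<open>- (w - w * zz ^ e) * (2 - w)\<close>, and the Ritt bound makes the first factor of order
  \<open>e / N\<close>. Hence the defect of the truncated identity is asymptotically fixed by
  \<open>T\<close>.\<close>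

lemma op_bd_remainder:
 assumes p: "p \<ge> 1" and T: "lp_op p M M T"
  and pw: "\<And>n. op_bd p M M (poly_op (zz ^ n) T) c0"
  and df: "\<And>n. op_bd p M M (poly_op (zz ^ n * (1 - zz)) T) (c1 / real (Suc n))"
 shows "op_bd p M M (poly_op ((zz ^ e - 1) * (1 - (1 - zz ^ (2 * N))^2)) T) (real e * c1 / real (Suc (2 * N)) * (2 * c0 + c0))"
proof -
 have "op_bd p M M (poly_op (1 + (1 + smult (- 1) (zz ^ (2 * N)))) T) (c0 + (c0 + norm (- 1 :: complex) * c0))"
  using pw[of 0] by (intro op_bd_poly_add[OF p T] op_bd_poly_smult[OF p] pw) simp_all
 then have two: "op_bd p M M (poly_op (1 + (1 - zz ^ (2 * N))) T) (2 * c0 + c0)" by simp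
 have "op_bd p M M (poly_op (smult (- 1) ((zz ^ (2 * N) - zz ^ (2 * N + e)) * (1 + (1 - zz ^ (2 * N))))) T)
   (norm (- 1 :: complex) * (real e * c1 / real (Suc (2 * N)) * (2 * c0 + c0)))"
  by (intro op_bd_poly_smult p op_bd_poly_mult T op_bd_zz_power_diff df two)
 moreover have "- ((w - w * v) * (1 + (1 - w))) = (v - 1) * (1 - (1 - w)^2)" for v w :: "complex poly"
  by (simp add: algebra_simps power2_eq_square)
 ultimately show ?thesis by (simp only: power_add smult_minus_left smult_1_left norm_minus_cancel norm_one mult_1_left)
qed

text \<open>The exponent \<open>e i\<close> is carried entirely by the factor on the side of
  \<open>T\<close>, where \<open>pair_sum_le\<close> tolerates it. The defect of the exponent 0 is
  common to all \<open>i\<close>, and \<open>op_bd_remainder\<close> says that the other defects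
  differ from it by something small.\<close>

lemma square_functions_Rfam_pows:
 assumes pq: "conj_exp p q" and a: "is_adj p q M T S" and C: "C \<ge> 0"
  and sq: "\<And>n f. memLp p M f ==> mixn p M {..<n} (\<lambda>k. poly_op (sqp k) T f) \<le> C * lp_norm p M f"
  and sqS: "\<And>n f. memLp q M f ==> mixn q M {..<n} (\<lambda>k. poly_op (sqp k) S f) \<le> C * lp_norm q M f"
  and pw: "\<And>n. op_bd p M M (poly_op (zz ^ n) T) c0"
  and df: "\<And>n. op_bd p M M (poly_op (zz ^ n * (1 - zz)) T) (c1 / real (Suc n))"
 shows "\<exists>C. Rfam p M T C pows"
proof -
 have p: "p \<ge> 1" "q \<ge> 1" and T: "lp_op p M M T" and S: "lp_op q M M S" using pq a by (auto simp: conj_exp_def is_adj_def)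
 have c1: "c1 \<ge> 0" using op_bd_nonneg[OF df[of 0]] by simp
 have c0: "c0 \<ge> 0" using op_bd_nonneg[OF pw[of 0]] by simp
 obtain c2 where c2: "op_bd q M M (poly_op ((1 + zz)^2) S) c2" by (rule lp_op_bd[OF lp_op_poly[OF p(2) S]])
 define \<rho> where "\<rho> N = 1 - (1 - zz ^ (2 * N))^2" for N
 have \<rho>b: "op_bd p M M (poly_op (\<rho> N) T) (1 + (1 + c0) * (1 + c0))" for N
 proof -
  have w: "op_bd p M M (poly_op (1 + smult (- 1) (zz ^ (2 * N))) T) (1 + norm (- 1 :: complex) * c0)"
   using pw by (intro op_bd_poly_add[OF p(1) T] op_bd_poly_smult[OF p(1)]) (auto simp: op_bd_def)
  have "op_bd p M M (poly_op (1 + smult (- 1) ((1 + smult (- 1) (zz ^ (2 * N))) * (1 + smult (- 1) (zz ^ (2 * N))))) T)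
    (1 + norm (- 1 :: complex) * ((1 + norm (- 1 :: complex) * c0) * (1 + norm (- 1 :: complex) * c0)))"
   by (intro op_bd_poly_add[OF p(1) T] op_bd_poly_smult[OF p(1)] op_bd_poly_mult[OF p(1) T] w) (auto simp: op_bd_def)
  then show ?thesis by (simp add: \<rho>_def power2_eq_square)
 qed
 have "Rfam p M T (1 * (MZ p * C) * (1 * (MZ q * C) * (MZ q * c2)) + MZ p * (1 + (1 + c0) * (1 + c0))) pows"
 proof (rule RfamI)
  show "0 \<le> 1 * (MZ p * C) * (1 * (MZ q * C) * (MZ q * c2)) + MZ p * (1 + (1 + c0) * (1 + c0))"
   using C c0 op_bd_nonneg[OF c2] by simp
  fix n :: nat and \<phi> and x :: "nat => 'a => complex"
  assume \<phi>: "\<And>i. i < n ==> \<phi> i \<in> pows" and x: "\<And>i. i < n ==> memLp p M (x i)"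
  have "\<exists>e. i < n \<longrightarrow> \<phi> i = zz ^ e" for i
  proof (cases "i < n")
   case True
   then obtain m where "\<phi> i = monom 1 m" using \<phi> by (auto simp: pows_def)
   then have "\<phi> i = zz ^ m" by (simp only: monom_zz[of m])
   then show ?thesis by blast
  qed simp
  then obtain e where e: "\<And>i. i < n ==> \<phi> i = zz ^ e i" by metis
  \<comment> \<open>A common bound for the finitely many exponents, so that one truncation of the
    square function serves all of them.\<close>
  define E where "E = (\<Sum>i<n. e i)"
  have E: "e i \<le> E" if "i < n" for i unfolding E_def by (rule member_le_sum) (use that in auto)
  define \<tau> where "\<tau> N i = (zz ^ e i - 1) * \<rho> N" for N i
  show "mixn p M {..<n} (\<lambda>i. poly_op (\<phi> i) T (x i))
    \<le> (1 * (MZ p * C) * (1 * (MZ q * C) * (MZ q * c2)) + MZ p * (1 + (1 + c0) * (1 + c0))) * mixn p M {..<n} x"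
  proof (rule pairing_bound[OF pq a, where \<alpha>="\<lambda>N i (s, l). zz ^ (e i + s + l) * (1 - zz)" and \<beta>="\<lambda>N i (s, l). zz ^ (s + l) * (1 - zz)"
     and \<eta>="(1 + zz)^2" and K="\<lambda>N. {..<N} \<times> {..<N}" and \<rho>=\<rho> and \<tau>=\<tau>, OF _ _ _ _ _ _ c2 \<rho>b])
   show "\<phi> i = (\<Sum>j\<in>{..<N} \<times> {..<N}. (case j of (s, l) => zz ^ (e i + s + l) * (1 - zz)) * ((case j of (s, l) => zz ^ (s + l) * (1 - zz)) * (1 + zz)^2)) + \<rho> N + \<tau> N i"
    if "i < n" for N i
   proof -
    have "(\<Sum>j\<in>{..<N} \<times> {..<N}. (case j of (s, l) => zz ^ (e i + s + l) * (1 - zz)) * ((case j of (s, l) => zz ^ (s + l) * (1 - zz)) * (1 + zz)^2))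
      = zz ^ e i * (1 - zz ^ (2 * N))^2"
     unfolding double_sum_powers[symmetric] by (intro sum.cong) auto
    then show ?thesis unfolding e[OF that] \<tau>_def \<rho>_def by (simp add: left_diff_distrib right_diff_distrib)
   qed
   show "mixn p M ({..<n} \<times> ({..<N} \<times> {..<N})) (\<lambda>(i, j). poly_op (case j of (s, l) => zz ^ (e i + s + l) * (1 - zz)) T (x i))
     \<le> 1 * (MZ p * C) * mixn p M {..<n} x" for N
   proof (rule square_family_bound[OF p(1) T C _ sq x, where L="E + 2 * N"])
    fix i v assume i: "i < n"
    let ?h = "\<lambda>k. (cmod (poly_op (sqp k) T (x i) v))^2"
    have "(\<Sum>j\<in>{..<N} \<times> {..<N}. (cmod (poly_op (case j of (s, l) => zz ^ (e i + s + l) * (1 - zz)) T (x i) v))^2)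
      = (\<Sum>(s, l)\<in>{..<N} \<times> {..<N}. ?h (e i + s + l) / real (Suc (e i + s + l)))"
     by (intro sum.cong refl) (auto simp only: poly_op_step_square split: prod.splits)
    also have "... \<le> (\<Sum>k<e i + 2 * N. ?h k)" by (rule pair_sum_le) simp
    also have "... \<le> (\<Sum>k<E + 2 * N. ?h k)" by (rule sum_mono2) (use E[OF i] in auto)
    finally show "(\<Sum>j\<in>{..<N} \<times> {..<N}. (cmod (poly_op (case j of (s, l) => zz ^ (e i + s + l) * (1 - zz)) T (x i) v))^2)
      \<le> 1^2 * (\<Sum>k<E + 2 * N. ?h k)" by simp
   qed auto
   show "mixn q M ({..<n} \<times> ({..<N} \<times> {..<N})) (\<lambda>(i, j). poly_op (case j of (s, l) => zz ^ (s + l) * (1 - zz)) S (y i))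
     \<le> 1 * (MZ q * C) * mixn q M {..<n} y" if y: "\<And>i. i < n ==> memLp q M (y i)" for N and y :: "nat => 'a => complex"
   proof (rule square_family_bound[OF p(2) S C _ sqS y, where L="2 * N"])
    fix i v assume i: "i < n"
    let ?h = "\<lambda>k. (cmod (poly_op (sqp k) S (y i) v))^2"
    have "(\<Sum>j\<in>{..<N} \<times> {..<N}. (cmod (poly_op (case j of (s, l) => zz ^ (s + l) * (1 - zz)) S (y i) v))^2)
      = (\<Sum>(s, l)\<in>{..<N} \<times> {..<N}. ?h (0 + s + l) / real (Suc (0 + s + l)))"
     by (intro sum.cong refl) (auto simp only: poly_op_step_square add_0_left split: prod.splits)
    also have "... \<le> (\<Sum>k<0 + 2 * N. ?h k)" by (rule pair_sum_le) simp
    finally show "(\<Sum>j\<in>{..<N} \<times> {..<N}. (cmod (poly_op (case j of (s, l) => zz ^ (s + l) * (1 - zz)) S (y i) v))^2)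
      \<le> 1^2 * (\<Sum>k<2 * N. ?h k)" by simp
   qed auto
   show "op_bd p M M (poly_op (\<tau> N i) T) (real E * c1 * (2 * c0 + c0) / real (Suc (2 * N)))" if i: "i < n" for N i
    unfolding \<tau>_def \<rho>_def
   proof (rule op_bd_mono[OF op_bd_remainder[OF p(1) T pw df]])
    have "real (e i) * (c1 * (2 * c0 + c0) / real (Suc (2 * N))) \<le> real E * (c1 * (2 * c0 + c0) / real (Suc (2 * N)))"
     using E[OF i] c1 c0 by (intro mult_right_mono) auto
    then show "real (e i) * c1 / real (Suc (2 * N)) * (2 * c0 + c0) \<le> real E * c1 * (2 * c0 + c0) / real (Suc (2 * N))"
     by (simp add: field_simps)
   qed
   show "(\<lambda>N. real E * c1 * (2 * c0 + c0) / real (Suc (2 * N))) \<longlonglongrightarrow> 0" by (rule tendsto_const_over_Suc)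
  qed (use C c0 op_bd_nonneg[OF c2] x in auto)
 qed
 then show ?thesis by blast
qed

text \<open>A single summation index suffices here because the factor \<open>e + 1\<close> in front
  supplies the weight. Telescoping \<open>zz ^ e * (1 - zz)\<close> against powers of
  \<open>zz^2\<close> gives terms \<open>zz ^ (e + 2 * k) * (1 - zz)^2 * (1 + zz)\<close>, with one
  factor \<open>1 - zz\<close> for each side of the pairing; the tail is small by the Ritt
  bound.\<close>

lemma square_functions_Rfam_diffs:
 assumes pq: "conj_exp p q" and a: "is_adj p q M T S" and C: "C \<ge> 0"
  and sq: "\<And>n f. memLp p M f ==> mixn p M {..<n} (\<lambda>k. poly_op (sqp k) T f) \<le> C * lp_norm p M f"
  and sqS: "\<And>n f. memLp q M f ==> mixn q M {..<n} (\<lambda>k. poly_op (sqp k) S f) \<le> C * lp_norm q M f"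
  and df: "\<And>n. op_bd p M M (poly_op (zz ^ n * (1 - zz)) T) (c1 / real (Suc n))"
 shows "\<exists>C. Rfam p M T C diffs"
proof -
 have p: "p \<ge> 1" "q \<ge> 1" and T: "lp_op p M M T" and S: "lp_op q M M S" using pq a by (auto simp: conj_exp_def is_adj_def)
 have c1: "c1 \<ge> 0" using op_bd_nonneg[OF df[of 0]] by simp
 obtain c2 where c2: "op_bd q M M (poly_op (1 + zz) S) c2" by (rule lp_op_bd[OF lp_op_poly[OF p(2) S]])
 have z: "op_bd p M M (poly_op 0 T) 0" using lp_norm_zero by (simp add: op_bd_def poly_op_0[abs_def])
 have "Rfam p M T (2 * (MZ p * C) * (1 * (MZ q * C) * (MZ q * c2)) + MZ p * 0) diffs"
 proof (rule RfamI)
  show "0 \<le> 2 * (MZ p * C) * (1 * (MZ q * C) * (MZ q * c2)) + MZ p * 0"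
   using C op_bd_nonneg[OF c2] by simp
  fix n :: nat and \<phi> and x :: "nat => 'a => complex"
  assume \<phi>: "\<And>i. i < n ==> \<phi> i \<in> diffs" and x: "\<And>i. i < n ==> memLp p M (x i)"
  have "\<exists>e. i < n \<longrightarrow> \<phi> i = smult (- of_nat (Suc e)) (zz ^ e * (1 - zz))" for i
  proof (cases "i < n")
   case True
   then obtain m where m: "\<phi> i = smult (of_nat m) (monom 1 m - monom 1 (m - 1))" "m \<ge> 1"
    using \<phi> by (auto simp: diffs_def)
   then have "\<phi> i = smult (of_nat (Suc (m - 1))) (monom 1 (Suc (m - 1)) - monom 1 (m - 1))" by simp
   then have "\<phi> i = smult (- of_nat (Suc (m - 1))) (zz ^ (m - 1) * (1 - zz))" unfolding monom_step by (simp only: smult_minus_right smult_minus_left)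
   then show ?thesis by blast
  qed simp
  then obtain e where e: "\<And>i. i < n ==> \<phi> i = smult (- of_nat (Suc (e i))) (zz ^ e i * (1 - zz))" by metis
  define E where "E = (\<Sum>i<n. Suc (e i))"
  have E: "Suc (e i) \<le> E" if "i < n" for i unfolding E_def by (rule member_le_sum) (use that in auto)
  \<comment> \<open>Each side takes half of the exponent, so that
    \<open>(e + 1)^2 \<le> 4 * (g + k + 1) * (h + k + 1)\<close>; the root of 4 is the constant 2 in
    the bound.\<close>
  define h g where "h i = e i div 2" and "g i = e i - e i div 2" for i
  have hg: "h i + g i = e i" "h i \<le> g i" "Suc (e i) \<le> 2 * Suc (h i)" for i by (auto simp: h_def g_def)
  have hE: "h i \<le> E" "g i \<le> E" if "i < n" for i using E[OF that] hg[of i] by auto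
  define \<alpha> where "\<alpha> i k = smult (of_real (real (Suc (e i)) / sqrt (real (Suc (g i + k))))) (zz ^ (h i + k) * (1 - zz))" for i k
  show "mixn p M {..<n} (\<lambda>i. poly_op (\<phi> i) T (x i))
    \<le> (2 * (MZ p * C) * (1 * (MZ q * C) * (MZ q * c2)) + MZ p * 0) * mixn p M {..<n} x"
  proof (rule pairing_bound[OF pq a, where \<alpha>="\<lambda>N. \<alpha>" and \<beta>="\<lambda>N i k. sqp (g i + k)"
     and \<eta>="1 + zz" and K="\<lambda>N. {..<N}" and \<rho>="\<lambda>N. 0" and \<tau>="\<lambda>N i. smult (- of_nat (Suc (e i))) (zz ^ (e i + 2 * N) * (1 - zz))", OF _ _ _ _ _ _ c2 z])
   show "\<phi> i = (\<Sum>k<N. \<alpha> i k * (sqp (g i + k) * (1 + zz))) + 0 + smult (- of_nat (Suc (e i))) (zz ^ (e i + 2 * N) * (1 - zz))"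
    if "i < n" for N i
   proof -
    have "\<alpha> i k * (sqp (g i + k) * (1 + zz)) = smult (- of_nat (Suc (e i))) ((1 - zz) * (zz ^ (e i + 2 * k) * (1 - zz^2)))" for k
    proof -
     have sq: "sqp (g i + k) = smult (of_real (sqrt (real (Suc (g i + k))))) (- (zz ^ (g i + k) * (1 - zz)))"
      unfolding sqp_def monom_step ..
     have "e i + 2 * k = (h i + k) + (g i + k)" using hg(1)[of i] by simp
     then have zp: "zz ^ (e i + 2 * k) = zz ^ (h i + k) * zz ^ (g i + k)" by (simp only: power_add)
     have id: "a * (1 - x) * (- (b * (1 - x)) * (1 + x)) = - ((1 - x) * (a * b * (1 - x * x)))" for a b x :: "complex poly"
      by (simp add: algebra_simps)
     have "\<alpha> i k * (sqp (g i + k) * (1 + zz)) = smult (of_real (real (Suc (e i)) / sqrt (real (Suc (g i + k)))) * of_real (sqrt (real (Suc (g i + k)))))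
       (zz ^ (h i + k) * (1 - zz) * (- (zz ^ (g i + k) * (1 - zz)) * (1 + zz)))"
      unfolding \<alpha>_def sq by (simp only: mult_smult_left mult_smult_right smult_smult mult.commute)
     also have "of_real (real (Suc (e i)) / sqrt (real (Suc (g i + k)))) * of_real (sqrt (real (Suc (g i + k)))) = (of_nat (Suc (e i)) :: complex)"
      by (simp only: of_real_mult[symmetric]) (simp del: of_nat_Suc)
     also have "zz ^ (h i + k) * (1 - zz) * (- (zz ^ (g i + k) * (1 - zz)) * (1 + zz)) = - ((1 - zz) * (zz ^ (e i + 2 * k) * (1 - zz^2)))"
      unfolding zp power2_eq_square by (rule id)
     finally show ?thesis by (simp only: smult_minus_right smult_minus_left)
    qed
    then have "(\<Sum>k<N. \<alpha> i k * (sqp (g i + k) * (1 + zz))) = smult (- of_nat (Suc (e i))) ((1 - zz) * (\<Sum>k<N. zz ^ (e i + 2 * k) * (1 - zz^2)))"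
     by (simp only: sum_distrib_left smult_sum_right[symmetric])
    also have "... = smult (- of_nat (Suc (e i))) ((1 - zz) * (zz ^ e i * (1 - zz ^ (2 * N))))" unfolding sum_even_powers ..
    finally have S: "(\<Sum>k<N. \<alpha> i k * (sqp (g i + k) * (1 + zz))) = smult (- of_nat (Suc (e i))) ((1 - zz) * (zz ^ e i * (1 - zz ^ (2 * N))))" .
    have id: "a * (1 - x) = (1 - x) * (a * (1 - w)) + a * w * (1 - x)" for a w x :: "complex poly"
     by (simp add: algebra_simps)
    show ?thesis
     unfolding e[OF that] S power_add add_0_right smult_add_right[symmetric] by (rule arg_cong[OF id])
   qed
   show "mixn p M ({..<n} \<times> {..<N}) (\<lambda>(i, k). poly_op (\<alpha> i k) T (x i)) \<le> 2 * (MZ p * C) * mixn p M {..<n} x" for N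
   proof (rule square_family_bound[OF p(1) T C _ sq x, where L="E + N"])
    fix i v assume i: "i < n"
    let ?h = "\<lambda>k. (cmod (poly_op (sqp k) T (x i) v))^2"
    have "(\<Sum>k<N. (cmod (poly_op (\<alpha> i k) T (x i) v))^2) \<le> (\<Sum>k<N. 4 * ?h (h i + k))"
    proof (rule sum_mono)
     fix k
     have "(cmod (poly_op (\<alpha> i k) T (x i) v))^2 = (real (Suc (e i)))^2 / real (Suc (g i + k)) * (?h (h i + k) / real (Suc (h i + k)))"
      unfolding \<alpha>_def poly_op_smult norm_mult power_mult_distrib poly_op_step_square norm_of_real
      by (simp add: power_divide del: of_nat_Suc)
     also have "... = ((real (Suc (e i)))^2 / (real (Suc (g i + k)) * real (Suc (h i + k)))) * ?h (h i + k)" by simp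
     also have "... \<le> 4 * ?h (h i + k)"
     proof (rule mult_right_mono)
      have "(real (Suc (e i)))^2 \<le> (2 * real (Suc (h i)))^2"
       using hg(3)[of i] by (intro power_mono) (simp_all add: of_nat_le_iff[symmetric] del: of_nat_le_iff)
      also have "... = 4 * (real (Suc (h i)) * real (Suc (h i)))" by (simp add: power2_eq_square del: of_nat_Suc)
      also have "... \<le> 4 * (real (Suc (g i + k)) * real (Suc (h i + k)))"
       using hg(2)[of i] by (intro mult_left_mono mult_mono) auto
      finally show "(real (Suc (e i)))^2 / (real (Suc (g i + k)) * real (Suc (h i + k))) \<le> 4"
       by (simp add: pos_divide_le_eq del: of_nat_Suc)
     qed simp
     finally show "(cmod (poly_op (\<alpha> i k) T (x i) v))^2 \<le> 4 * ?h (h i + k)" .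
    qed
    also have "... = 4 * (\<Sum>k\<in>(\<lambda>k. h i + k) ` {..<N}. ?h k)" by (simp add: sum_distrib_left sum.reindex inj_on_def)
    also have "... \<le> 4 * (\<Sum>k<E + N. ?h k)" by (intro mult_left_mono sum_mono2) (use hE[OF i] in auto)
    finally show "(\<Sum>k<N. (cmod (poly_op (\<alpha> i k) T (x i) v))^2) \<le> 2^2 * (\<Sum>k<E + N. ?h k)" by simp
   qed auto
   show "mixn q M ({..<n} \<times> {..<N}) (\<lambda>(i, k). poly_op (sqp (g i + k)) S (y i)) \<le> 1 * (MZ q * C) * mixn q M {..<n} y"
    if y: "\<And>i. i < n ==> memLp q M (y i)" for N and y :: "nat => 'a => complex"
   proof (rule square_family_bound[OF p(2) S C _ sqS y, where L="E + N"])
    fix i v assume i: "i < n"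
    let ?h = "\<lambda>k. (cmod (poly_op (sqp k) S (y i) v))^2"
    have "(\<Sum>k<N. ?h (g i + k)) = (\<Sum>k\<in>(\<lambda>k. g i + k) ` {..<N}. ?h k)" by (simp add: sum.reindex inj_on_def)
    also have "... \<le> (\<Sum>k<E + N. ?h k)" by (intro sum_mono2) (use hE[OF i] in auto)
    finally show "(\<Sum>k<N. ?h (g i + k)) \<le> 1^2 * (\<Sum>k<E + N. ?h k)" by simp
   qed auto
   show "op_bd p M M (poly_op (smult (- of_nat (Suc (e i))) (zz ^ (e i + 2 * N) * (1 - zz))) T) (real E * c1 / real (Suc (2 * N)))" if i: "i < n" for N i
   proof (rule op_bd_mono[OF op_bd_poly_smult[OF p(1) df]])
    have "real (Suc (e i)) * (c1 / real (Suc (e i + 2 * N))) \<le> real E * (c1 / real (Suc (2 * N)))"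
     using E[OF i] c1 by (intro mult_mono divide_left_mono) auto
    moreover have "norm (- of_nat (Suc (e i)) :: complex) = real (Suc (e i))" by (simp only: norm_minus_cancel norm_of_nat)
    ultimately show "norm (- of_nat (Suc (e i)) :: complex) * (c1 / real (Suc (e i + 2 * N))) \<le> real E * c1 / real (Suc (2 * N))"
     by simp
   qed
   show "(\<lambda>N. real E * c1 / real (Suc (2 * N))) \<longlonglongrightarrow> 0" by (rule tendsto_const_over_Suc)
  qed (use C op_bd_nonneg[OF c2] x in auto)
 qed
 then show ?thesis by blast
qed

lemma op_set_bounded_op_bd:
 assumes "op_set_bounded p M F"
 obtains C where "\<And>A. A \<in> F ==> op_bd p M M A C"
proof -
 obtain C where C: "\<And>A f. A \<in> F ==> memLp p M f ==> lp_norm p M (A f) \<le> C * lp_norm p M f"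
  using assms unfolding op_set_bounded_def by blast
 have "op_bd p M M A (max C 0)" if "A \<in> F" for A
  unfolding op_bd_def
 proof (intro conjI allI impI)
  fix f :: "'a => complex" assume f: "memLp p M f"
  have "C * lp_norm p M f \<le> max C 0 * lp_norm p M f" by (intro mult_right_mono) auto
  then show "lp_norm p M (A f) \<le> max C 0 * lp_norm p M f" using C[OF that f] by linarith
 qed simp
 then show ?thesis using that by blast
qed

lemma Ritt_bounds:
 assumes p: "p \<ge> 1" and R: "Ritt p M T"
 obtains c0 c1 where "\<And>n. op_bd p M M (poly_op (zz ^ n) T) c0"
  "\<And>n. op_bd p M M (poly_op (zz ^ n * (1 - zz)) T) (c1 / real (Suc n))"
proof -
 obtain c0 where c0: "\<And>A. A \<in> (\<lambda>\<phi>. poly_op \<phi> T) ` pows ==> op_bd p M M A c0"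
  using R op_set_bounded_op_bd unfolding Ritt_def powers_set_eq by metis
 obtain c1 where c1: "\<And>A. A \<in> (\<lambda>\<phi>. poly_op \<phi> T) ` diffs ==> op_bd p M M A c1"
  using R op_set_bounded_op_bd unfolding Ritt_def ritt_diff_set_eq by metis
 show ?thesis
 proof (rule that)
  show "op_bd p M M (poly_op (zz ^ n) T) c0" for n
   by (rule c0) (auto simp only: pows_def monom_zz[symmetric, of n] intro!: imageI)
  show "op_bd p M M (poly_op (zz ^ n * (1 - zz)) T) (c1 / real (Suc n))" for n
  proof -
   define d :: "complex poly" where "d = smult (of_nat (Suc n)) (monom 1 (Suc n) - monom 1 n)"
   have "d \<in> diffs" unfolding diffs_def d_def by (intro CollectI exI[of _ "Suc n"]) simp
   then have "op_bd p M M (poly_op d T) c1" by (intro c1 imageI)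
   then have "op_bd p M M (poly_op (smult (- 1 / of_nat (Suc n)) d) T) (norm (- 1 / of_nat (Suc n) :: complex) * c1)"
    by (rule op_bd_poly_smult[OF p])
   moreover have "smult (- 1 / of_nat (Suc n)) d = zz ^ n * (1 - zz)"
    unfolding d_def monom_step smult_minus_right smult_smult by (simp del: of_nat_Suc)
   moreover have "norm (- 1 / of_nat (Suc n) :: complex) * c1 = c1 / real (Suc n)"
    by (simp add: norm_divide del: of_nat_Suc)
   ultimately show ?thesis by simp
  qed
 qed
qed

theorem square_functions_imp_R_Ritt:
 assumes pq: "conj_exp p q" and R: "Ritt p M T" and a: "is_adj p q M T S" and C: "C \<ge> 0"
  and sq: "\<And>n f. memLp p M f ==> mixn p M {..<n} (\<lambda>k. poly_op (sqp k) T f) \<le> C * lp_norm p M f"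
  and sqS: "\<And>n f. memLp q M f ==> mixn q M {..<n} (\<lambda>k. poly_op (sqp k) S f) \<le> C * lp_norm q M f"
 shows "R_Ritt p M T"
proof -
 have p: "p \<ge> 1" using pq by (simp add: conj_exp_def)
 obtain c0 c1 where c: "\<And>n. op_bd p M M (poly_op (zz ^ n) T) c0"
  "\<And>n. op_bd p M M (poly_op (zz ^ n * (1 - zz)) T) (c1 / real (Suc n))"
  using Ritt_bounds[OF p R] by blast
 show ?thesis
  unfolding R_Ritt_iff using R square_functions_Rfam_pows[OF pq a C sq sqS c] square_functions_Rfam_diffs[OF pq a C sq sqS c(2)]
  by (simp add: Ritt_def)
qed

section \<open>The loose dilation\<close>

definition coins :: "('i => bool) measure" where
 "coins = PiM UNIV (\<lambda>_. measure_pmf (bernoulli_pmf (1 / 2)))"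

definition rad :: "'i => ('i => bool) => real" where "rad i b = (if b i then 1 else - 1)"

lemma prob_space_coins: "prob_space coins"
 unfolding coins_def by (intro prob_space_PiM measure_pmf.prob_space_axioms)

lemma space_coins [simp]: "space coins = UNIV"
 by (simp add: coins_def space_PiM PiE_UNIV_domain)

lemma coin_measurable [measurable]: "(\<lambda>b. b i) \<in> measurable coins (count_space UNIV)"
proof -
 have "(\<lambda>b. b i) \<in> measurable coins (measure_pmf (bernoulli_pmf (1 / 2)))"
  unfolding coins_def by (rule measurable_component_singleton) simp
 then show ?thesis by simp
qed

lemma rad_measurable [measurable]: "rad i \<in> borel_measurable coins"
 unfolding rad_def[abs_def] by measurable

lemma abs_rad [simp]: "\<bar>rad i b\<bar> = 1"
 by (simp add: rad_def)

lemma indep_coins: "prob_space.indep_vars coins (\<lambda>_. measure_pmf (bernoulli_pmf (1 / 2))) (\<lambda>i b. b i) I" for I :: "'i set"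
proof (cases "I = {}")
 case True
 interpret prob_space coins by (rule prob_space_coins)
 show ?thesis unfolding indep_vars_def indep_sets_def using True by auto
next
 case False
 have "distr coins (measure_pmf (bernoulli_pmf (1 / 2))) (\<lambda>b. b i) = measure_pmf (bernoulli_pmf (1 / 2))" for i :: 'i
  unfolding coins_def by (rule distr_PiM_component) (auto intro: measure_pmf.prob_space_axioms)
 moreover have "distr coins (PiM I (\<lambda>_. measure_pmf (bernoulli_pmf (1 / 2)))) (\<lambda>b. \<lambda>i\<in>I. b i) = PiM I (\<lambda>_. measure_pmf (bernoulli_pmf (1 / 2)))"
  unfolding coins_def using distr_PiM_reindex[of UNIV "\<lambda>_. measure_pmf (bernoulli_pmf (1 / 2))" "\<lambda>i. i" I]
  by (simp add: measure_pmf.prob_space_axioms)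
 ultimately show ?thesis
  by (subst prob_space.indep_vars_iff_distr_eq_PiM'[OF prob_space_coins False]) simp_all
qed

lemma integral_coin:
 fixes f :: "bool => real"
 shows "integrable coins (\<lambda>b. f (b i))" "(\<integral>b. f (b i) \<partial>coins) = (f True + f False) / 2"
proof -
 interpret prob_space coins by (rule prob_space_coins)
 show "integrable coins (\<lambda>b. f (b i))"
 proof (rule integrable_const_bound[of _ "\<bar>f True\<bar> + \<bar>f False\<bar>"])
  show "AE b in coins. norm (f (b i)) \<le> \<bar>f True\<bar> + \<bar>f False\<bar>" by (rule AE_I2) (case_tac "b i", auto)
 qed measurable
 have "(\<integral>b. f (b i) \<partial>coins) = (\<integral>x. f x \<partial>distr coins (measure_pmf (bernoulli_pmf (1 / 2))) (\<lambda>b. b i))"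
  by (rule integral_distr[symmetric]) (simp_all add: measurable_cong_sets[OF refl sets_measure_pmf_count_space])
 also have "distr coins (measure_pmf (bernoulli_pmf (1 / 2))) (\<lambda>b. b i) = measure_pmf (bernoulli_pmf (1 / 2))"
  unfolding coins_def by (rule distr_PiM_component) (auto intro: measure_pmf.prob_space_axioms)
 also have "(\<integral>x. f x \<partial>measure_pmf (bernoulli_pmf (1 / 2))) = (f True + f False) / 2" by simp
 finally show "(\<integral>b. f (b i) \<partial>coins) = (f True + f False) / 2" .
qed

lemma integral_coin_prod:
 fixes f :: "'i => bool => real"
 assumes "finite I"
 shows "integrable coins (\<lambda>b. \<Prod>i\<in>I. f i (b i))" "(\<integral>b. (\<Prod>i\<in>I. f i (b i)) \<partial>coins) = (\<Prod>i\<in>I. (f i True + f i False) / 2)"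
proof -
 interpret prob_space coins by (rule prob_space_coins)
 have "indep_vars (\<lambda>_. borel) (\<lambda>i b. f i (b i)) I"
  by (rule indep_vars_compose2[OF indep_coins]) simp
 from indep_vars_integrable[OF assms this integral_coin(1)] indep_vars_lebesgue_integral[OF assms this integral_coin(1)]
 show "integrable coins (\<lambda>b. \<Prod>i\<in>I. f i (b i))" "(\<integral>b. (\<Prod>i\<in>I. f i (b i)) \<partial>coins) = (\<Prod>i\<in>I. (f i True + f i False) / 2)"
  by (simp_all add: integral_coin(2))
qed

lemma integral_rad: "(\<integral>b. rad i b \<partial>coins) = 0"
 using integral_coin(2)[of "\<lambda>x. if x then 1 else - 1" i] by (simp add: rad_def)

lemma integral_rad_rad: "(\<integral>b. rad i b * rad j b \<partial>coins) = (if i = j then 1 else 0)"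
proof (cases "i = j")
 case True
 then have "rad i b * rad j b = 1" for b by (simp add: rad_def)
 then show ?thesis using True prob_space.prob_space[OF prob_space_coins] by simp
next
 case False
 then show ?thesis using integral_coin_prod(2)[of "{i, j}" "\<lambda>_ x. if x then 1 else - 1"] by (simp add: rad_def)
qed

lemma exp_rad_sum:
 assumes "finite I"
 shows "integrable coins (\<lambda>b. exp (\<Sum>i\<in>I. c i * rad i b))" "(\<integral>b. exp (\<Sum>i\<in>I. c i * rad i b) \<partial>coins) \<le> exp (\<Sum>i\<in>I. (c i)^2)"
proof -
 have eq: "exp (\<Sum>i\<in>I. c i * rad i b) = (\<Prod>i\<in>I. exp (c i * (if b i then 1 else - 1)))" for b
  using assms by (simp add: exp_sum rad_def)
 note h = integral_coin_prod[OF assms, of "\<lambda>i x. exp (c i * (if x then 1 else - 1))"]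
 show "integrable coins (\<lambda>b. exp (\<Sum>i\<in>I. c i * rad i b))" unfolding eq by (rule h(1))
 have "(\<Prod>i\<in>I. (exp (c i) + exp (- c i)) / 2) \<le> (\<Prod>i\<in>I. exp ((c i)^2))"
  by (intro prod_mono conjI cosh_le_exp_square) (simp add: add_nonneg_nonneg)
 then show "(\<integral>b. exp (\<Sum>i\<in>I. c i * rad i b) \<partial>coins) \<le> exp (\<Sum>i\<in>I. (c i)^2)"
  unfolding eq h(2) using assms by (simp add: exp_sum)
qed

definition KB :: "real => real" where "KB p = (2 powr p * p powr p * (4 * exp 1)) powr (1 / p)"

lemma KB_nonneg [simp]: "KB p \<ge> 0"
 by (simp add: KB_def)

text \<open>The exponential moment argument of \<open>Khintchine_upper\<close> again, now on a
  single probability space that carries all signs at once. Independence of the coins replaces the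
  induction over finite averages.\<close>

lemma Khintchine_coins:
 fixes a :: "'i => complex"
 assumes p: "p > 0" and I: "finite I"
 shows "memLp p coins (\<lambda>b. \<Sum>i\<in>I. a i * of_real (rad i b))"
  and "lp_norm p coins (\<lambda>b. \<Sum>i\<in>I. a i * of_real (rad i b)) \<le> KB p * L2_set (\<lambda>i. cmod (a i)) I"
proof -
 interpret prob_space coins by (rule prob_space_coins)
 define F where "F b = (\<Sum>i\<in>I. a i * of_real (rad i b))" for b
 have [measurable]: "F \<in> borel_measurable coins" unfolding F_def[abs_def] by measurable
 have Fb: "cmod (F b) \<le> (\<Sum>i\<in>I. cmod (a i))" for b
  unfolding F_def by (rule order_trans[OF norm_sum]) (simp add: norm_mult)
 have int: "integrable coins (\<lambda>b. cmod (F b) powr p)"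
  by (rule integrable_const_bound[of _ "(\<Sum>i\<in>I. cmod (a i)) powr p"]) (auto intro!: AE_I2 powr_mono2 Fb simp: p less_imp_le)
 show m: "memLp p coins (\<lambda>b. \<Sum>i\<in>I. a i * of_real (rad i b))"
  using int unfolding F_def memLp_def by (simp add: F_def[symmetric]) measurable
 define s where "s = L2_set (\<lambda>i. cmod (a i)) I"
 have s0: "s \<ge> 0" unfolding s_def by (rule L2_set_nonneg)
 have "(\<integral>b. cmod (F b) powr p \<partial>coins) \<le> s powr p * (2 powr p * p powr p * (4 * exp 1))"
 proof (cases "s = 0")
  case True
  then have "\<forall>i\<in>I. a i = 0" using I by (simp add: s_def L2_set_eq_0_iff)
  then have "F b = 0" for b by (simp add: F_def)
  then show ?thesis using p by (simp add: True)
 next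
  case False
  with s0 have s: "s > 0" by simp
  have s2: "s^2 = (\<Sum>i\<in>I. (cmod (a i))^2)" unfolding s_def L2_set_def by (simp add: sum_nonneg)
  have mg: "integrable coins (\<lambda>b. exp (u * (\<Sum>i\<in>I. g (a i) * rad i b) / s))"
    "(\<integral>b. exp (u * (\<Sum>i\<in>I. g (a i) * rad i b) / s) \<partial>coins) \<le> exp 1"
   if g: "\<And>z. \<bar>g z\<bar> \<le> cmod z" and u: "\<bar>u\<bar> = 1" for g :: "complex => real" and u
  proof -
   have eq: "u * (\<Sum>i\<in>I. g (a i) * rad i b) / s = (\<Sum>i\<in>I. (u * g (a i) / s) * rad i b)" for b
    by (simp add: sum_distrib_left sum_divide_distrib mult_ac)
   have "(\<Sum>i\<in>I. (u * g (a i) / s)^2) \<le> (\<Sum>i\<in>I. (cmod (a i))^2 / s^2)"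
   proof (rule sum_mono)
    fix i
    have "(u * g (a i))^2 = \<bar>g (a i)\<bar>^2" using u by (simp add: power_mult_distrib power2_abs[symmetric, of u] del: power2_abs)
    also have "... \<le> (cmod (a i))^2" using g[of "a i"] by (intro power_mono) auto
    finally show "(u * g (a i) / s)^2 \<le> (cmod (a i))^2 / s^2" by (simp add: power_divide divide_right_mono)
   qed
   also have "... = 1" using s by (simp add: sum_divide_distrib[symmetric] s2[symmetric])
   finally have e: "exp (\<Sum>i\<in>I. (u * g (a i) / s)^2) \<le> exp 1" by simp
   show "integrable coins (\<lambda>b. exp (u * (\<Sum>i\<in>I. g (a i) * rad i b) / s))"
    unfolding eq by (rule exp_rad_sum(1)[OF I])
   show "(\<integral>b. exp (u * (\<Sum>i\<in>I. g (a i) * rad i b) / s) \<partial>coins) \<le> exp 1"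
    unfolding eq by (rule order_trans[OF exp_rad_sum(2)[OF I] e])
  qed
  have Re: "Re (F b) = (\<Sum>i\<in>I. Re (a i) * rad i b)" and Im: "Im (F b) = (\<Sum>i\<in>I. Im (a i) * rad i b)" for b
   unfolding F_def by simp_all
  note mR = mg[of Re 1, OF abs_Re_le_cmod] mg[of Re "-1", OF abs_Re_le_cmod]
   and mI = mg[of Im 1, OF abs_Im_le_cmod] mg[of Im "-1", OF abs_Im_le_cmod]
  note ii = mR[simplified, folded Re] mI[simplified, folded Im]
  have "(\<integral>b. cmod (F b) powr p \<partial>coins) \<le> (\<integral>b. s powr p * (2 powr p * p powr p) *
   ((exp (Re (F b) / s) + exp (- Re (F b) / s)) + (exp (Im (F b) / s) + exp (- Im (F b) / s))) \<partial>coins)"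
   using ii by (intro integral_mono int exp_moment_bound p s integrable_mult_right Bochner_Integration.integrable_add) auto
  also have "... = s powr p * (2 powr p * p powr p) * (((\<integral>b. exp (Re (F b) / s) \<partial>coins) + (\<integral>b. exp (- Re (F b) / s) \<partial>coins))
    + ((\<integral>b. exp (Im (F b) / s) \<partial>coins) + (\<integral>b. exp (- Im (F b) / s) \<partial>coins)))"
   using ii by simp
  also have "... \<le> s powr p * (2 powr p * p powr p) * ((exp 1 + exp 1) + (exp 1 + exp 1))"
   using ii by (intro mult_left_mono add_mono) auto
  finally show ?thesis by simp
 qed
 then have "(\<integral>b. cmod (F b) powr p \<partial>coins) powr (1 / p) \<le> (s powr p * (2 powr p * p powr p * (4 * exp 1))) powr (1 / p)"
  using p by (intro powr_mono2) auto
 also have "... = KB p * s" using p s0 by (simp add: KB_def powr_mult powr_powr)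
 finally show "lp_norm p coins (\<lambda>b. \<Sum>i\<in>I. a i * of_real (rad i b)) \<le> KB p * L2_set (\<lambda>i. cmod (a i)) I"
  unfolding lp_norm_def F_def s_def .
qed

text \<open>A product of identical factors is invariant under injective relabelling of the
  coordinates. Translations of the index set thus become isometries, and they form the group in the
  dilation.\<close>

lemma coins_reindex:
 assumes "inj \<pi>"
 shows "(\<lambda>b i. b (\<pi> i)) \<in> measurable coins coins" "distr coins coins (\<lambda>b i. b (\<pi> i)) = coins"
proof -
 show "distr coins coins (\<lambda>b i. b (\<pi> i)) = coins"
  unfolding coins_def using distr_PiM_reindex[of UNIV "\<lambda>_. measure_pmf (bernoulli_pmf (1 / 2))" \<pi> UNIV] assms
  by (simp add: restrict_UNIV measure_pmf.prob_space_axioms)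
 show "(\<lambda>b i. b (\<pi> i)) \<in> measurable coins coins"
  unfolding coins_def
  by (rule measurable_PiM_single') (auto simp: space_PiM coins_def[symmetric])
qed

lemma nn_integral_powr_lp_norm:
 fixes f :: "'a => 'b :: {banach,second_countable_topology}"
 assumes p: "p > 0" and f: "memLp p M f"
 shows "(\<integral>\<^sup>+x. ennreal (norm (f x) powr p) \<partial>M) = ennreal (lp_norm p M f powr p)"
 using f p by (simp add: memLp_def lp_norm_powr nn_integral_eq_integral)

lemma memLp_nn_integral:
 fixes f :: "'a => 'b :: {banach,second_countable_topology}"
 assumes p: "p > 0" and f: "f \<in> borel_measurable M" and C: "C \<ge> 0"
  and le: "(\<integral>\<^sup>+x. ennreal (norm (f x) powr p) \<partial>M) \<le> ennreal (C powr p)"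
 shows "memLp p M f" "lp_norm p M f \<le> C"
proof -
 have i: "integrable M (\<lambda>x. norm (f x) powr p)"
  unfolding integrable_iff_bounded using f le by (auto intro: le_less_trans)
 then show m: "memLp p M f" using f by (simp add: memLp_def)
 have "ennreal (lp_norm p M f powr p) \<le> ennreal (C powr p)"
  using le unfolding nn_integral_powr_lp_norm[OF p m] .
 then have "lp_norm p M f powr p \<le> C powr p" by (simp add: ennreal_le_iff)
 then show "lp_norm p M f \<le> C" using p C by (meson lp_norm_nonneg not_le powr_less_mono2)
qed

section \<open>L^p over the product with a probability space\<close>

context prob_space
begin

lemma AE_slice_memLp:
 fixes f :: "'b \<times> 'a => complex"
 assumes p: "p > 0" and f: "memLp p (N \<Otimes>\<^sub>M M) f"
 shows "AE w in N. memLp p M (\<lambda>b. f (w, b))"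
proof -
 have [measurable]: "f \<in> borel_measurable (N \<Otimes>\<^sub>M M)" by (rule memLp_meas[OF f])
 have "(\<integral>\<^sup>+w. (\<integral>\<^sup>+b. ennreal (norm (f (w, b)) powr p) \<partial>M) \<partial>N) = ennreal (lp_norm p (N \<Otimes>\<^sub>M M) f powr p)"
  using nn_integral_fst[of "\<lambda>x. ennreal (norm (f x) powr p)" N] nn_integral_powr_lp_norm[OF p f] by simp
 then have "AE w in N. (\<integral>\<^sup>+b. ennreal (norm (f (w, b)) powr p) \<partial>M) \<noteq> \<infinity>"
  by (intro nn_integral_noteq_infinite) auto
 with AE_space show ?thesis
 proof eventually_elim
  case (elim w)
  then show ?case
   unfolding memLp_def integrable_iff_bounded by (auto simp: less_top)
 qed
qed

text \<open>Estimates on slices integrate to the product. The probability space is the second factor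
  because integrating it out first is legitimate over an arbitrary base measure.\<close>

lemma lp_norm_le_slice:
 fixes f :: "'b \<times> 'a => complex" and g :: "'b => 'c :: {banach,second_countable_topology}"
 assumes p: "p > 0" and f: "memLp p (N \<Otimes>\<^sub>M M) f" and g: "g \<in> borel_measurable N" and c: "c \<ge> 0"
  and le: "\<And>w. memLp p M (\<lambda>b. f (w, b)) ==> norm (g w) \<le> c * lp_norm p M (\<lambda>b. f (w, b))"
 shows "memLp p N g" "lp_norm p N g \<le> c * lp_norm p (N \<Otimes>\<^sub>M M) f"
proof -
 have [measurable]: "f \<in> borel_measurable (N \<Otimes>\<^sub>M M)" by (rule memLp_meas[OF f])
 have "(\<integral>\<^sup>+w. ennreal (norm (g w) powr p) \<partial>N) \<le> (\<integral>\<^sup>+w. ennreal (c powr p) * (\<integral>\<^sup>+b. ennreal (norm (f (w, b)) powr p) \<partial>M) \<partial>N)"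
 proof (rule nn_integral_mono_AE)
  show "AE w in N. ennreal (norm (g w) powr p) \<le> ennreal (c powr p) * (\<integral>\<^sup>+b. ennreal (norm (f (w, b)) powr p) \<partial>M)"
   using AE_slice_memLp[OF p f]
  proof eventually_elim
   case (elim w)
   have "norm (g w) powr p \<le> (c * lp_norm p M (\<lambda>b. f (w, b))) powr p"
    using le[OF elim] p by (intro powr_mono2) auto
   also have "... = c powr p * lp_norm p M (\<lambda>b. f (w, b)) powr p" using c by (simp add: powr_mult)
   finally show ?case by (simp add: nn_integral_powr_lp_norm[OF p elim] ennreal_mult[symmetric] ennreal_leI)
  qed
 qed
 also have "... = ennreal (c powr p) * (\<integral>\<^sup>+x. ennreal (norm (f x) powr p) \<partial>(N \<Otimes>\<^sub>M M))"
  using nn_integral_fst[of "\<lambda>x. ennreal (norm (f x) powr p)" N]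
  by (subst nn_integral_cmult) (auto intro: borel_measurable_nn_integral_fst[where f="\<lambda>x. ennreal (norm (f x) powr p)"])
 also have "... = ennreal ((c * lp_norm p (N \<Otimes>\<^sub>M M) f) powr p)"
  using c by (simp add: nn_integral_powr_lp_norm[OF p f] ennreal_mult powr_mult)
 finally have "(\<integral>\<^sup>+w. ennreal (norm (g w) powr p) \<partial>N) \<le> ennreal ((c * lp_norm p (N \<Otimes>\<^sub>M M) f) powr p)" .
 from memLp_nn_integral[OF p g _ this] c
 show "memLp p N g" "lp_norm p N g \<le> c * lp_norm p (N \<Otimes>\<^sub>M M) f" by auto
qed

lemma lp_norm_slice_le:
 fixes f :: "'b \<times> 'a => complex" and g :: "'b => 'c :: {banach,second_countable_topology}"
 assumes p: "p > 0" and f: "f \<in> borel_measurable (N \<Otimes>\<^sub>M M)" and g: "memLp p N g" and c: "c \<ge> 0"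
  and le: "\<And>w. memLp p M (\<lambda>b. f (w, b))" "\<And>w. lp_norm p M (\<lambda>b. f (w, b)) \<le> c * norm (g w)"
 shows "memLp p (N \<Otimes>\<^sub>M M) f" "lp_norm p (N \<Otimes>\<^sub>M M) f \<le> c * lp_norm p N g"
proof -
 note f [measurable]
 have [measurable]: "g \<in> borel_measurable N" by (rule memLp_meas[OF g])
 have "(\<integral>\<^sup>+x. ennreal (norm (f x) powr p) \<partial>(N \<Otimes>\<^sub>M M)) = (\<integral>\<^sup>+w. (\<integral>\<^sup>+b. ennreal (norm (f (w, b)) powr p) \<partial>M) \<partial>N)"
  using nn_integral_fst[of "\<lambda>x. ennreal (norm (f x) powr p)" N] by simp
 also have "... \<le> (\<integral>\<^sup>+w. ennreal (c powr p) * ennreal (norm (g w) powr p) \<partial>N)"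
 proof (rule nn_integral_mono)
  fix w
  have "lp_norm p M (\<lambda>b. f (w, b)) powr p \<le> (c * norm (g w)) powr p"
   using le(2)[of w] p by (intro powr_mono2) auto
  also have "... = c powr p * norm (g w) powr p" using c by (simp add: powr_mult)
  finally show "(\<integral>\<^sup>+b. ennreal (norm (f (w, b)) powr p) \<partial>M) \<le> ennreal (c powr p) * ennreal (norm (g w) powr p)"
   by (simp add: nn_integral_powr_lp_norm[OF p le(1)] ennreal_mult[symmetric] ennreal_leI)
 qed
 also have "... = ennreal ((c * lp_norm p N g) powr p)"
  using c by (subst nn_integral_cmult) (auto simp: nn_integral_powr_lp_norm[OF p g] ennreal_mult powr_mult)
 finally have "(\<integral>\<^sup>+x. ennreal (norm (f x) powr p) \<partial>(N \<Otimes>\<^sub>M M)) \<le> ennreal ((c * lp_norm p N g) powr p)" .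
 from memLp_nn_integral[OF p f _ this] c
 show "memLp p (N \<Otimes>\<^sub>M M) f" "lp_norm p (N \<Otimes>\<^sub>M M) f \<le> c * lp_norm p N g" by auto
qed

text \<open>Elementary tensors; \<open>coef\<close> below is the partial pairing with
  \<open>h\<close>, taken without conjugation in accordance with the bilinear duality.\<close>

definition tens :: "('a => complex) => ('b => complex) => 'b \<times> 'a => complex" where
 "tens h x = (\<lambda>(w, b). x w * h b)"

definition coef :: "('a => complex) => ('b \<times> 'a => complex) => 'b => complex" where
 "coef h f = (\<lambda>w. \<integral>b. f (w, b) * h b \<partial>M)"

lemma memLp_bounded:
 fixes h :: "'a => complex"
 assumes "h \<in> borel_measurable M" "\<And>b. cmod (h b) \<le> c" "p > 0"
 shows "memLp p M h"
proof -
 have "integrable M (\<lambda>b. cmod (h b) powr p)"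
  using assms by (intro integrable_const_bound[of _ "c powr p"]) (auto intro!: AE_I2 powr_mono2)
 then show ?thesis using assms by (simp add: memLp_def)
qed

lemma lp_norm_bounded:
 fixes h :: "'a => complex"
 assumes "h \<in> borel_measurable M" "\<And>b. cmod (h b) \<le> 1" "p > 0"
 shows "lp_norm p M h \<le> 1"
proof -
 have "(\<integral>b. cmod (h b) powr p \<partial>M) \<le> (\<integral>b. 1 \<partial>M)"
  using memLp_bounded[OF assms] assms by (intro integral_mono) (auto simp: memLp_def powr_le1)
 then have "(\<integral>b. cmod (h b) powr p \<partial>M) \<le> 1" by (simp add: prob_space)
 then show ?thesis unfolding lp_norm_def using assms(3) by (intro powr_le1) auto
qed

text \<open>The Khintchine bound is assumed for scalar coefficients only; applied on each slice, it
  extends to coefficients in \<open>L^p\<close> by integration over the base.\<close>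

lemma tens_sum:
 fixes x :: "'i => 'b => complex"
 assumes p: "p \<ge> 1" and h: "\<And>i. i \<in> I ==> h i \<in> borel_measurable M" "\<And>i b. i \<in> I ==> cmod (h i b) \<le> 1"
  and x: "\<And>i. i \<in> I ==> memLp p N (x i)" and K: "K \<ge> 0"
  and Kh: "\<And>a. lp_norm p M (\<lambda>b. \<Sum>i\<in>I. a i * h i b) \<le> K * L2_set (\<lambda>i. cmod (a i)) I"
 shows "memLp p (N \<Otimes>\<^sub>M M) (\<lambda>y. \<Sum>i\<in>I. tens (h i) (x i) y)"
  and "lp_norm p (N \<Otimes>\<^sub>M M) (\<lambda>y. \<Sum>i\<in>I. tens (h i) (x i) y) \<le> K * mixn p N I x"
proof -
 have p0: "p > 0" using p by simp
 have [measurable]: "i \<in> I ==> h i \<in> borel_measurable M" "i \<in> I ==> x i \<in> borel_measurable N" for i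
  using h x by (auto simp: memLp_def)
 have hm: "memLp p M (h i)" if "i \<in> I" for i by (rule memLp_bounded[OF h(1)[OF that] h(2)[OF that] p0])
 have meas: "(\<lambda>y. \<Sum>i\<in>I. tens (h i) (x i) y) \<in> borel_measurable (N \<Otimes>\<^sub>M M)"
  unfolding tens_def case_prod_unfold by measurable
 have m: "memLp p M (\<lambda>b. \<Sum>i\<in>I. tens (h i) (x i) (w, b))" for w
  unfolding tens_def using hm by (auto intro!: memLp_sum[OF p] memLp_scale)
 have b: "lp_norm p M (\<lambda>b. \<Sum>i\<in>I. tens (h i) (x i) (w, b)) \<le> K * norm (L2_set (\<lambda>i. cmod (x i w)) I)" for w
  using Kh[of "\<lambda>i. x i w"] by (simp add: tens_def)
 show "memLp p (N \<Otimes>\<^sub>M M) (\<lambda>y. \<Sum>i\<in>I. tens (h i) (x i) y)"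
  "lp_norm p (N \<Otimes>\<^sub>M M) (\<lambda>y. \<Sum>i\<in>I. tens (h i) (x i) y) \<le> K * mixn p N I x"
  unfolding mixn_def by (rule lp_norm_slice_le[OF p0 meas memLp_L2(1)[OF p x] K m b], assumption)+
qed

lemma lp_op_tens:
 assumes p: "p \<ge> 1" and h: "h \<in> borel_measurable M" "\<And>b. cmod (h b) \<le> 1"
 shows "lp_op p N (N \<Otimes>\<^sub>M M) (tens h)"
proof (rule lp_opI)
 have p0: "p > 0" using p by simp
 have *: "memLp p (N \<Otimes>\<^sub>M M) (tens h x) \<and> lp_norm p (N \<Otimes>\<^sub>M M) (tens h x) \<le> 1 * lp_norm p N x" if x: "memLp p N x" for x
 proof -
  have "lp_norm p M (\<lambda>b. \<Sum>i\<in>{()}. a i * h b) \<le> 1 * L2_set (\<lambda>i. cmod (a i)) {()}" for a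
   using lp_norm_bounded[OF h p0] p0 by (simp add: lp_norm_scale mult_left_le)
  from tens_sum[OF p h x _ this] show ?thesis by (simp add: mixn_def)
 qed
 show "memLp p (N \<Otimes>\<^sub>M M) (tens h x)" if "memLp p N x" for x using * that by blast
 show "op_bd p N (N \<Otimes>\<^sub>M M) (tens h) 1" unfolding op_bd_def using * by auto
 show "AE y in N \<Otimes>\<^sub>M M. tens h (\<lambda>w. x w + c * z w) y = tens h x y + c * tens h z y" for x z c
  by (rule AE_I2) (auto simp: tens_def algebra_simps split: prod.splits)
 show "AE y in N \<Otimes>\<^sub>M M. tens h x y = tens h z y" if x: "memLp p N x" and z: "memLp p N z" and eq: "AE w in N. x w = z w" for x z
 proof -
  have d: "memLp p N (\<lambda>w. x w - z w)" by (rule memLp_diff[OF p x z])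
  then have "lp_norm p N (\<lambda>w. x w - z w) = 0" using eq lp_norm_eq_0_iff[OF p0 d] by (auto elim: eventually_mono)
  then have "lp_norm p (N \<Otimes>\<^sub>M M) (tens h (\<lambda>w. x w - z w)) = 0" using *[OF d] lp_norm_nonneg[of p "N \<Otimes>\<^sub>M M" "tens h (\<lambda>w. x w - z w)"] by linarith
  then have "AE y in N \<Otimes>\<^sub>M M. tens h (\<lambda>w. x w - z w) y = 0" using lp_norm_eq_0_iff[OF p0] * d by blast
  then show ?thesis by eventually_elim (auto simp: tens_def algebra_simps split: prod.splits)
 qed
qed

lemma coef_measurable:
 assumes "f \<in> borel_measurable (N \<Otimes>\<^sub>M M)" "h \<in> borel_measurable M"
 shows "coef h f \<in> borel_measurable N"
 unfolding coef_def using assms by measurable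

lemma integrable_slice_mult:
 assumes pq: "conj_exp p q" and h: "h \<in> borel_measurable M" "\<And>b. cmod (h b) \<le> c" and f: "memLp p M (f :: 'a => complex)"
 shows "integrable M (\<lambda>b. f b * h b)"
 by (rule Hoelder_integrable[OF pq f memLp_bounded[OF h]]) (use pq in \<open>simp add: conj_exp_def\<close>)

text \<open>Bessel's inequality in \<open>L\<^sup>p\<close>, dual to the upper Khintchine inequality in \<open>L\<^sup>q\<close>.\<close>

lemma coef_Bessel:
 assumes pq: "conj_exp p q" and I: "finite I" and h: "\<And>i. i \<in> I ==> h i \<in> borel_measurable M" "\<And>i b. i \<in> I ==> cmod (h i b) \<le> 1"
  and f: "memLp p (N \<Otimes>\<^sub>M M) f" and K: "K \<ge> 0"
  and Kh: "\<And>a. lp_norm q M (\<lambda>b. \<Sum>i\<in>I. a i * h i b) \<le> K * L2_set (\<lambda>i. cmod (a i)) I"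
 shows "mixn p N I (\<lambda>i. coef (h i) f) \<le> K * lp_norm p (N \<Otimes>\<^sub>M M) f"
proof -
 have p: "p > 0" "q > 0" "q \<ge> 1" using pq by (auto simp: conj_exp_def)
 have m: "coef (h i) f \<in> borel_measurable N" if "i \<in> I" for i by (rule coef_measurable[OF memLp_meas[OF f] h(1)[OF that]])
 have "norm (L2_set (\<lambda>i. cmod (coef (h i) f w)) I) \<le> K * lp_norm p M (\<lambda>b. f (w, b))" if s: "memLp p M (\<lambda>b. f (w, b))" for w
 proof -
  define a where "a i = coef (h i) f w" for i
  define A where "A = L2_set (\<lambda>i. cmod (a i)) I"
  have int: "integrable M (\<lambda>b. f (w, b) * h i b)" if "i \<in> I" for i
   by (rule integrable_slice_mult[OF pq h(1)[OF that] h(2)[OF that] s])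
  have mq: "memLp q M (\<lambda>b. \<Sum>i\<in>I. cnj (a i) * h i b)"
   using p by (intro memLp_sum memLp_scale memLp_bounded[OF h]) auto
  \<comment> \<open>The slice is tested against the combination of the \<open>h i\<close> with its
    own conjugated coefficients, which reproduces the square of \<open>A\<close>.\<close>
  have "of_real (A^2) = (\<Sum>i\<in>I. cnj (a i) * a i)"
   unfolding A_def L2_set_def by (simp add: sum_nonneg complex_norm_square mult.commute del: of_real_power)
  also have "... = (\<Sum>i\<in>I. \<integral>b. f (w, b) * (cnj (a i) * h i b) \<partial>M)"
  proof -
   have "f (w, b) * (cnj (a i) * h i b) = cnj (a i) * (f (w, b) * h i b)" for i b by (simp add: mult_ac)
   then show ?thesis by (simp only: integral_mult_right_zero) (simp add: a_def coef_def)
  qed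
  also have "... = (\<integral>b. f (w, b) * (\<Sum>i\<in>I. cnj (a i) * h i b) \<partial>M)"
   unfolding sum_distrib_left
  proof (rule Bochner_Integration.integral_sum[symmetric])
   fix i assume "i \<in> I"
   then have "integrable M (\<lambda>b. cnj (a i) * (f (w, b) * h i b))" by (intro integrable_mult_right int)
   then show "integrable M (\<lambda>b. f (w, b) * (cnj (a i) * h i b))" by (simp add: mult_ac)
  qed
  finally have "A^2 = cmod (\<integral>b. f (w, b) * (\<Sum>i\<in>I. cnj (a i) * h i b) \<partial>M)"
   by (metis abs_power2 norm_of_real)
  also have "... \<le> lp_norm p M (\<lambda>b. f (w, b)) * lp_norm q M (\<lambda>b. \<Sum>i\<in>I. cnj (a i) * h i b)"
   by (rule Hoelder[OF pq s mq])
  also have "... \<le> lp_norm p M (\<lambda>b. f (w, b)) * (K * A)"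
   unfolding A_def using Kh[of "\<lambda>i. cnj (a i)"] by (intro mult_left_mono) auto
  finally have *: "A * A \<le> (K * lp_norm p M (\<lambda>b. f (w, b))) * A" by (simp add: power2_eq_square mult_ac)
  have A0: "A \<ge> 0" unfolding A_def by (rule L2_set_nonneg)
  have "A \<le> K * lp_norm p M (\<lambda>b. f (w, b))"
  proof (cases "A = 0")
   case True then show ?thesis using K by simp
  next
   case False
   with A0 show ?thesis using mult_right_le_imp_le[OF *] by simp
  qed
  then show ?thesis using A0 unfolding A_def a_def by simp
 qed
 then show ?thesis
  unfolding mixn_def by (intro lp_norm_le_slice[OF p(1) f _ K]) (use m in \<open>auto intro!: L2_set_measurable\<close>)
qed

lemma lp_op_coef:
 assumes pq: "conj_exp p q" and h: "h \<in> borel_measurable M" "\<And>b. cmod (h b) \<le> 1"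
 shows "lp_op p (N \<Otimes>\<^sub>M M) N (coef h)"
proof (rule lp_opI)
 have p: "p \<ge> 1" "p > 0" "q > 0" using pq by (auto simp: conj_exp_def)
 have *: "memLp p N (coef h f) \<and> lp_norm p N (coef h f) \<le> 1 * lp_norm p (N \<Otimes>\<^sub>M M) f" if f: "memLp p (N \<Otimes>\<^sub>M M) f" for f
 proof -
  have "cmod (coef h f w) \<le> 1 * lp_norm p M (\<lambda>b. f (w, b))" if s: "memLp p M (\<lambda>b. f (w, b))" for w
  proof -
   have "cmod (coef h f w) \<le> lp_norm p M (\<lambda>b. f (w, b)) * lp_norm q M h"
    unfolding coef_def by (rule Hoelder[OF pq s memLp_bounded[OF h p(3)]])
   also have "... \<le> lp_norm p M (\<lambda>b. f (w, b)) * 1" by (intro mult_left_mono lp_norm_bounded h p) simp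
   finally show ?thesis by simp
  qed
  from lp_norm_le_slice[OF p(2) f coef_measurable[OF memLp_meas[OF f] h(1)] _ this] show ?thesis by simp
 qed
 show "memLp p N (coef h f)" if "memLp p (N \<Otimes>\<^sub>M M) f" for f using * that by blast
 show "op_bd p (N \<Otimes>\<^sub>M M) N (coef h) 1" unfolding op_bd_def using * by auto
 have lin: "AE w in N. coef h (\<lambda>x. f x + c * g x) w = coef h f w + c * coef h g w" if f: "memLp p (N \<Otimes>\<^sub>M M) f" and g: "memLp p (N \<Otimes>\<^sub>M M) g" for f g c
  using AE_slice_memLp[OF p(2) f] AE_slice_memLp[OF p(2) g]
 proof eventually_elim
  case (elim w)
  note integrable_slice_mult[OF pq h elim(1)] integrable_slice_mult[OF pq h elim(2)]
  then show ?case unfolding coef_def by (simp add: distrib_right mult.assoc)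
 qed
 then show "AE w in N. coef h (\<lambda>x. f x + c * g x) w = coef h f w + c * coef h g w" if "memLp p (N \<Otimes>\<^sub>M M) f" "memLp p (N \<Otimes>\<^sub>M M) g" for f g c
  using that by blast
 show "AE w in N. coef h f w = coef h g w" if f: "memLp p (N \<Otimes>\<^sub>M M) f" and g: "memLp p (N \<Otimes>\<^sub>M M) g" and eq: "AE y in N \<Otimes>\<^sub>M M. f y = g y" for f g
 proof -
  have d: "memLp p (N \<Otimes>\<^sub>M M) (\<lambda>y. f y - g y)" by (rule memLp_diff[OF p(1) f g])
  then have "lp_norm p (N \<Otimes>\<^sub>M M) (\<lambda>y. f y - g y) = 0" using eq lp_norm_eq_0_iff[OF p(2) d] by (auto elim: eventually_mono)
  then have "lp_norm p N (coef h (\<lambda>y. f y - g y)) = 0" using *[OF d] lp_norm_nonneg[of p N "coef h (\<lambda>y. f y - g y)"] by linarith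
  then have "AE w in N. coef h (\<lambda>y. f y - g y) w = 0" using lp_norm_eq_0_iff[OF p(2)] * d by blast
  with lin[OF f g, of "- 1"] show ?thesis by eventually_elim simp
 qed
qed

lemma coef_tens:
 "coef h (tens g x) w = (\<integral>b. g b * h b \<partial>M) * x w"
proof -
 have "x w * g b * h b = g b * h b * x w" for b by simp
 then show ?thesis unfolding coef_def tens_def by (simp only: prod.case integral_mult_left_zero)
qed

lemma distr_pair_map_snd:
 assumes \<sigma>: "\<sigma> \<in> measurable M M" "distr M M \<sigma> = M"
 shows "(\<lambda>(w, b). (w, \<sigma> b)) \<in> measurable (N \<Otimes>\<^sub>M M) (N \<Otimes>\<^sub>M M)"
  and "distr (N \<Otimes>\<^sub>M M) (N \<Otimes>\<^sub>M M) (\<lambda>(w, b). (w, \<sigma> b)) = N \<Otimes>\<^sub>M M"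
proof -
 note \<sigma>(1) [measurable]
 show m [measurable]: "(\<lambda>(w, b). (w, \<sigma> b)) \<in> measurable (N \<Otimes>\<^sub>M M) (N \<Otimes>\<^sub>M M)" by measurable
 show "distr (N \<Otimes>\<^sub>M M) (N \<Otimes>\<^sub>M M) (\<lambda>(w, b). (w, \<sigma> b)) = N \<Otimes>\<^sub>M M"
 proof (rule measure_eqI)
  fix A assume "A \<in> sets (distr (N \<Otimes>\<^sub>M M) (N \<Otimes>\<^sub>M M) (\<lambda>(w, b). (w, \<sigma> b)))"
  then have A [measurable]: "A \<in> sets (N \<Otimes>\<^sub>M M)" by simp
  have "emeasure (distr (N \<Otimes>\<^sub>M M) (N \<Otimes>\<^sub>M M) (\<lambda>(w, b). (w, \<sigma> b))) A = (\<integral>\<^sup>+y. indicator A (case y of (w, b) => (w, \<sigma> b)) \<partial>(N \<Otimes>\<^sub>M M))"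
   by (subst nn_integral_distr[OF m, symmetric]) simp_all
  also have "... = (\<integral>\<^sup>+w. (\<integral>\<^sup>+b. indicator A (w, \<sigma> b) \<partial>M) \<partial>N)"
   by (subst nn_integral_fst[symmetric]) simp_all
  also have "... = (\<integral>\<^sup>+w. (\<integral>\<^sup>+b. indicator A (w, b) \<partial>M) \<partial>N)"
  proof (rule nn_integral_cong)
   fix w assume [simp]: "w \<in> space N"
   have "(\<integral>\<^sup>+b. indicator A (w, \<sigma> b) \<partial>M) = (\<integral>\<^sup>+b. indicator A (w, b) \<partial>distr M M \<sigma>)"
    by (rule nn_integral_distr[OF \<sigma>(1), symmetric]) simp
   then show "(\<integral>\<^sup>+b. indicator A (w, \<sigma> b) \<partial>M) = (\<integral>\<^sup>+b. indicator A (w, b) \<partial>M)" by (simp add: \<sigma>(2))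
  qed
  also have "... = emeasure (N \<Otimes>\<^sub>M M) A"
   by (subst nn_integral_fst) simp_all
  finally show "emeasure (distr (N \<Otimes>\<^sub>M M) (N \<Otimes>\<^sub>M M) (\<lambda>(w, b). (w, \<sigma> b))) A = emeasure (N \<Otimes>\<^sub>M M) A" .
 qed simp
qed

end

lemma measure_preserving_memLp:
 fixes f :: "'b => complex"
 assumes \<sigma>: "\<sigma> \<in> measurable M N" "distr M N \<sigma> = N" and f: "memLp p N f"
 shows "memLp p M (\<lambda>y. f (\<sigma> y))" "lp_norm p M (\<lambda>y. f (\<sigma> y)) = lp_norm p N f"
proof -
 have [measurable]: "f \<in> borel_measurable N" by (rule memLp_meas[OF f])
 note \<sigma>(1) [measurable]
 have "integrable (distr M N \<sigma>) (\<lambda>x. cmod (f x) powr p)" using f by (simp add: \<sigma>(2) memLp_def)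
 then show "memLp p M (\<lambda>y. f (\<sigma> y))" by (simp add: memLp_def integrable_distr_eq)
 have "(\<integral>x. cmod (f x) powr p \<partial>N) = (\<integral>x. cmod (f x) powr p \<partial>distr M N \<sigma>)" by (simp add: \<sigma>(2))
 also have "... = (\<integral>x. cmod (f (\<sigma> x)) powr p \<partial>M)" by (rule integral_distr) measurable
 finally show "lp_norm p M (\<lambda>y. f (\<sigma> y)) = lp_norm p N f" by (simp add: lp_norm_def)
qed

lemma lp_op_measure_preserving:
 assumes \<sigma>: "\<sigma> \<in> measurable M N" "distr M N \<sigma> = N"
 shows "lp_op p N M (\<lambda>f y. f (\<sigma> y))"
proof (rule lp_opI)
 note * = measure_preserving_memLp[OF \<sigma>]
 show "memLp p M (\<lambda>y. f (\<sigma> y))" if "memLp p N f" for f :: "_ => complex" by (rule *(1)[OF that])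
 show "op_bd p N M (\<lambda>f y. f (\<sigma> y)) 1" using * by (auto simp: op_bd_def)
 show "AE y in M. f (\<sigma> y) = g (\<sigma> y)" if f: "memLp p N f" and g: "memLp p N g" and eq: "AE y in N. f y = g y" for f g :: "_ => complex"
 proof -
  have "AE y in distr M N \<sigma>. f y = g y" by (subst \<sigma>(2)) (rule eq)
  then show ?thesis by (rule AE_distrD[OF \<sigma>(1)])
 qed
qed auto

interpretation coins: prob_space "coins :: ('i => bool) measure"
 by (rule prob_space_coins)

text \<open>Increasing l^2 sums with bounded norms have vanishing tails: with the pointwise limit
  \<open>H\<close>, the tail beyond \<open>I K\<close> is at most \<open>sqrt (H^2 - h^2)\<close>,
  which is dominated by \<open>H\<close> and tends to 0. This gives the Cauchy property of the
  truncated operators in the dilation.\<close>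

lemma mixn_tail:
 fixes x :: "'i => 'a => complex" and I :: "nat => 'i set"
 assumes p: "p \<ge> 1" and I: "\<And>K. finite (I K)" "\<And>K. I K \<subseteq> I (Suc K)" and x: "\<And>i. memLp p M (x i)"
  and C: "\<And>K. mixn p M (I K) x \<le> C"
 obtains t where "t \<longlonglongrightarrow> 0" "\<And>K L. K \<le> L ==> mixn p M (I L - I K) x \<le> t K"
proof -
 have p0: "p > 0" using p by simp
 have IL: "I K \<subseteq> I L" if "K \<le> L" for K L using I(2) that by (rule lift_Suc_mono_le)
 define h where "h K w = L2_set (\<lambda>i. cmod (x i w)) (I K)" for K w
 have h0: "h K w \<ge> 0" for K w unfolding h_def by (rule L2_set_nonneg)
 have mono: "h K w \<le> h L w" if "K \<le> L" for K L w
  unfolding h_def L2_set_def by (intro real_sqrt_le_mono sum_mono2 I IL that) auto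
 have hm: "memLp p M (h K)" for K unfolding h_def by (rule memLp_L2(1)[OF p]) (rule x)
 have hC: "lp_norm p M (h K) \<le> C" for K using C[of K] unfolding mixn_def h_def .
 have "AE w in M. \<exists>B. \<forall>K. h K w \<le> B"
  by (rule lp_monotone_bounded[OF p0 hm hC mono h0]) simp
 then have conv: "AE w in M. (\<lambda>K. h K w) \<longlonglongrightarrow> lim (\<lambda>K. h K w)"
 proof eventually_elim
  case (elim w)
  then obtain B where "\<And>K. h K w \<le> B" by blast
  then have "convergent (\<lambda>K. h K w)" by (intro Bseq_mono_convergent BseqI'[of _ B]) (use h0 mono in auto)
  then show ?case by (simp add: convergent_LIMSEQ_iff)
 qed
 define H where "H w = lim (\<lambda>K. h K w)" for w
 have Hmeas [measurable]: "H \<in> borel_measurable M" and [measurable]: "h K \<in> borel_measurable M" for K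
  unfolding H_def using memLp_meas[OF hm] by (auto intro: borel_measurable_lim_metric)
 have Hm: "memLp p M H"
  by (rule lp_Fatou(1)[OF p0 hm _ Hmeas, where C=C]) (use hC conv in \<open>auto simp: H_def\<close>)
 have HK: "AE w in M. \<forall>K. h K w \<le> H w"
  using conv
 proof eventually_elim
  case (elim w)
  have "incseq (\<lambda>K. h K w)" by (intro incseq_SucI mono) simp
  from incseq_le[OF this elim] show ?case unfolding H_def by blast
 qed
 \<comment> \<open>The absolute value keeps \<open>d K\<close> nonnegative also on the null set
   where \<open>h K\<close> may exceed \<open>H\<close>.\<close>
 define d where "d K w = sqrt (\<bar>(H w)^2 - (h K w)^2\<bar>)" for K w
 have dm [measurable]: "d K \<in> borel_measurable M" for K unfolding d_def[abs_def] by measurable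
 have dH: "AE w in M. norm (d K w) \<le> norm (H w)" for K
  using HK
 proof eventually_elim
  case (elim w)
  then have "(h K w)^2 \<le> (H w)^2" using h0 by (intro power_mono) auto
  then have "d K w \<le> sqrt ((H w)^2)" unfolding d_def by (intro real_sqrt_le_mono) simp
  then show ?case by (simp add: d_def)
 qed
 show ?thesis
 proof (rule that)
  show "(\<lambda>K. lp_norm p M (d K)) \<longlonglongrightarrow> 0"
  proof (rule lp_dominated[OF p0 dm Hm dH])
   show "AE w in M. (\<lambda>K. d K w) \<longlonglongrightarrow> 0"
    using conv
   proof eventually_elim
    case (elim w)
    have "(\<lambda>K. d K w) \<longlonglongrightarrow> sqrt \<bar>(H w)^2 - (H w)^2\<bar>"
     unfolding d_def using elim by (intro tendsto_intros) (simp add: H_def)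
    then show ?case by simp
   qed
  qed
  show "mixn p M (I L - I K) x \<le> lp_norm p M (d K)" if KL: "K \<le> L" for K L
   unfolding mixn_def
  proof (rule memLp_bound(2)[OF p0 memLp_bound(1)[OF p0 Hm dm dH]])
   show "(\<lambda>w. L2_set (\<lambda>i. cmod (x i w)) (I L - I K)) \<in> borel_measurable M"
    by (rule memLp_meas, rule memLp_L2(1)[OF p]) (rule x)
   show "AE w in M. norm (L2_set (\<lambda>i. cmod (x i w)) (I L - I K)) \<le> norm (d K w)"
    using HK
   proof eventually_elim
    case (elim w)
    have sq: "(h N w)^2 = (\<Sum>i\<in>I N. (cmod (x i w))^2)" for N unfolding h_def L2_set_def by (simp add: sum_nonneg)
    have "(\<Sum>i\<in>I L - I K. (cmod (x i w))^2) = (h L w)^2 - (h K w)^2"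
     unfolding sq by (rule sum_diff[OF I(1) IL[OF KL]])
    also have "... \<le> (H w)^2 - (h K w)^2" using elim h0 by (intro diff_right_mono power_mono) auto
    finally show ?case unfolding d_def L2_set_def by (simp add: sum_nonneg)
   qed
  qed
 qed
qed

lemma lp_Cauchy_tail:
 fixes f :: "nat => 'a => complex"
 assumes t: "t \<longlonglongrightarrow> 0" and le: "\<And>K L. K \<le> L ==> lp_norm p M (\<lambda>y. f L y - f K y) \<le> t K"
 shows "lp_Cauchy p M f"
 unfolding lp_Cauchy_def
proof (intro allI impI)
 fix e :: real assume "e > 0"
 with t have "\<forall>\<^sub>F K in sequentially. t K < e" by (rule order_tendstoD(2))
 then obtain N where N: "\<And>K. K \<ge> N ==> t K < e" by (auto simp: eventually_sequentially)
 have "lp_norm p M (\<lambda>y. f m y - f n y) < e" if mn: "m \<ge> N" "n \<ge> N" for m n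
 proof (cases "m \<le> n")
  case True
  have "lp_norm p M (\<lambda>y. f m y - f n y) = lp_norm p M (\<lambda>y. f n y - f m y)" by (rule lp_norm_minus_commute)
  also have "... \<le> t m" by (rule le[OF True])
  finally show ?thesis using N[OF mn(1)] by linarith
 next
  case False
  then have "lp_norm p M (\<lambda>y. f m y - f n y) \<le> t n" by (intro le) simp
  then show ?thesis using N[OF mn(2)] by linarith
 qed
 then show "\<exists>N. \<forall>m\<ge>N. \<forall>n\<ge>N. lp_norm p M (\<lambda>x. f m x - f n x) < e" by blast
qed

section \<open>The dilation: translated signs and the reproducing identity\<close>

definition rsig :: "int \<times> nat => (int \<times> nat => bool) => complex" where
 "rsig i b = of_real (rad i b)"

definition shf :: "int => (int \<times> nat => bool) => int \<times> nat => bool" where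
 "shf m b = (\<lambda>i. b (fst i - m, snd i))"

lemma rsig_measurable [measurable]: "rsig i \<in> borel_measurable coins"
 unfolding rsig_def[abs_def] by measurable

lemma norm_rsig [simp]: "cmod (rsig i b) = 1"
 by (simp add: rsig_def)

lemma rsig_shf: "rsig (s, l) (shf m b) = rsig (s - m, l) b"
 by (simp add: rsig_def rad_def shf_def)

lemma shf_0 [simp]: "shf 0 b = b"
 by (simp add: shf_def)

lemma shf_shf: "shf m (shf n b) = shf (m + n) b"
 by (simp add: shf_def diff_diff_eq add.commute)

lemma shf_preserving: "shf m \<in> measurable coins coins" "distr coins coins (shf m) = coins"
proof -
 have "inj (\<lambda>i :: int \<times> nat. (fst i - m, snd i))" by (auto simp: inj_on_def prod_eq_iff)
 from coins_reindex[OF this] show "shf m \<in> measurable coins coins" "distr coins coins (shf m) = coins"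
  unfolding shf_def[abs_def] by simp_all
qed

lemma integral_rsig: "(\<integral>b. rsig i b \<partial>coins) = 0"
 unfolding rsig_def by (simp add: integral_rad)

lemma integral_rsig_rsig: "(\<integral>b. rsig i b * rsig j b \<partial>coins) = (if i = j then 1 else 0)"
 unfolding rsig_def of_real_mult[symmetric] integral_complex_of_real integral_rad_rad by simp

lemma Khintchine_rsig:
 assumes p: "p > 0" and I: "finite I" and g: "inj_on g I"
 shows "lp_norm p coins (\<lambda>b. \<Sum>j\<in>I. a j * rsig (g j) b) \<le> KB p * L2_set (\<lambda>j. cmod (a j)) I"
proof -
 define c where "c i = a (inv_into I g i)" for i
 have c: "c (g j) = a j" if "j \<in> I" for j using that g by (simp add: c_def)
 have "(\<Sum>j\<in>I. a j * rsig (g j) b) = (\<Sum>i\<in>g ` I. c i * of_real (rad i b))" for b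
  unfolding sum.reindex[OF g] by (intro sum.cong) (auto simp: c rsig_def)
 moreover have "L2_set (\<lambda>i. cmod (c i)) (g ` I) = L2_set (\<lambda>j. cmod (a j)) I"
  unfolding L2_set_def sum.reindex[OF g] by (intro arg_cong[where f=sqrt] sum.cong) (auto simp: c)
 ultimately show ?thesis using Khintchine_coins(2)[OF p finite_imageI[OF I], of c g] by simp
qed

lemma coef_tens_sum:
 assumes "\<And>j. j \<in> I ==> g j \<in> borel_measurable coins" "\<And>j b. cmod (g j b) \<le> 1"
  and "h \<in> borel_measurable coins" "\<And>b. cmod (h b) \<le> 1"
 shows "coins.coef h (\<lambda>y. \<Sum>j\<in>I. coins.tens (g j) (x j) y) w = (\<Sum>j\<in>I. (\<integral>b. g j b * h b \<partial>coins) * x j w)"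
proof -
 have int: "integrable coins (\<lambda>b. g j b * h b * x j w)" if "j \<in> I" for j
 proof (rule integrable_mult_left)
  show "integrable coins (\<lambda>b. g j b * h b)"
   using assms(1)[OF that] assms(2-4)
   by (intro coins.integrable_const_bound[of _ 1]) (auto simp: norm_mult intro!: mult_le_one)
 qed
 have "coins.coef h (\<lambda>y. \<Sum>j\<in>I. coins.tens (g j) (x j) y) w = (\<integral>b. (\<Sum>j\<in>I. g j b * h b * x j w) \<partial>coins)"
  unfolding coins.coef_def coins.tens_def by (simp add: sum_distrib_right sum_distrib_left mult_ac)
 also have "... = (\<Sum>j\<in>I. \<integral>b. g j b * h b * x j w \<partial>coins)"
  by (rule Bochner_Integration.integral_sum[OF int])
 finally show ?thesis by (simp only: integral_mult_left_zero)
qed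

definition bx :: "nat => (nat \<times> nat) set" where "bx K = {..<K} \<times> {..<K}"
definition xp :: "nat \<times> nat => complex poly" where "xp j = zz ^ (fst j + snd j) * (1 - zz)"
text \<open>The first index is embedded in the integers, where translation is invertible. Tensors
  pushed to negative indices are the ones that the coefficients taken at \<open>ix j\<close> no
  longer see.\<close>

definition ix :: "nat \<times> nat => int \<times> nat" where "ix j = (int (fst j), snd j)"

lemma bx_finite [simp]: "finite (bx K)" and bx_Suc: "bx K \<subseteq> bx (Suc K)" by (auto simp: bx_def)

lemma bx_mono: "K \<le> L ==> bx K \<subseteq> bx L" by (auto simp: bx_def)

lemma inj_ix: "inj_on ix I" by (auto simp: ix_def inj_on_def prod_eq_iff)

lemma square_function_bx:
 assumes p: "p \<ge> 1" and T: "lp_op p M M T" and x: "memLp p M x"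
  and sq: "\<And>n f. memLp p M f ==> mixn p M {..<n} (\<lambda>k. poly_op (sqp k) T f) \<le> C * lp_norm p M f"
 shows "mixn p M (bx K) (\<lambda>j. poly_op (xp j) T x) \<le> C * lp_norm p M x"
proof -
 have m: "memLp p M (poly_op \<phi> T x)" for \<phi> by (rule lp_op_mem[OF lp_op_poly[OF p T] x])
 have "mixn p M (bx K) (\<lambda>j. poly_op (xp j) T x) \<le> 1 * mixn p M {..<0 + 2 * K} (\<lambda>k. poly_op (sqp k) T x)"
 proof (rule mixn_mono[OF p m m])
  show "AE w in M. (\<Sum>j\<in>bx K. (cmod (poly_op (xp j) T x w))^2) \<le> 1^2 * (\<Sum>k<0 + 2 * K. (cmod (poly_op (sqp k) T x w))^2)"
  proof (rule AE_I2)
   fix w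
   have "(\<Sum>j\<in>bx K. (cmod (poly_op (xp j) T x w))^2)
    = (\<Sum>(s, l)\<in>{..<K} \<times> {..<K}. (cmod (poly_op (sqp (0 + s + l)) T x w))^2 / real (Suc (0 + s + l)))"
    unfolding bx_def xp_def poly_op_step_square by (intro sum.cong) auto
   also have "... \<le> (\<Sum>k<0 + 2 * K. (cmod (poly_op (sqp k) T x w))^2)" by (rule pair_sum_le) simp
   finally show "(\<Sum>j\<in>bx K. (cmod (poly_op (xp j) T x w))^2) \<le> 1^2 * (\<Sum>k<0 + 2 * K. (cmod (poly_op (sqp k) T x w))^2)" by simp
  qed
 qed simp
 also have "... \<le> C * lp_norm p M x" using sq[OF x] by simp
 finally show ?thesis .
qed

text \<open>The square function estimate for the adjoint in dual form: testing against
  \<open>y\<close> moves every polynomial onto \<open>y\<close>, where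
  \<open>square_function_bx\<close> applies. It bounds the synthesis operator from which
  \<open>Q\<close> is made.\<close>

lemma dual_square_sum:
 assumes pq: "conj_exp p q" and a: "is_adj p q M T S" and D: "D \<subseteq> bx L" and C: "C \<ge> 0"
  and sqS: "\<And>n f. memLp q M f ==> mixn q M {..<n} (\<lambda>k. poly_op (sqp k) S f) \<le> C * lp_norm q M f"
  and \<eta>: "op_bd q M M (poly_op \<eta> S) c2" and g: "\<And>j. memLp p M (g j)"
 shows "lp_norm p M (\<lambda>w. \<Sum>j\<in>D. poly_op (xp j * \<eta>) T (g j) w) \<le> C * c2 * mixn p M D g"
proof (rule lp_norm_dual[OF pq])
 have p: "p \<ge> 1" "q \<ge> 1" and T: "lp_op p M M T" and S: "lp_op q M M S" using pq a by (auto simp: conj_exp_def is_adj_def)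
 have D': "finite D" using D by (rule finite_subset) simp
 note m = lp_op_mem[OF lp_op_poly[OF p(1) T] g] and mS = lp_op_mem[OF lp_op_poly[OF p(2) S]]
 have c2: "c2 \<ge> 0" by (rule op_bd_nonneg[OF \<eta>])
 show "0 \<le> C * c2 * mixn p M D g" using C c2 by simp
 show "memLp p M (\<lambda>w. \<Sum>j\<in>D. poly_op (xp j * \<eta>) T (g j) w)" by (rule memLp_sum[OF p(1) m])
 fix y :: "'a => complex" assume y: "memLp q M y"
 have "mixn q M D (\<lambda>j. poly_op (xp j * \<eta>) S y) = mixn q M D (\<lambda>j. poly_op (xp j) S (poly_op \<eta> S y))"
 proof (rule mixn_cong_AE[OF p(2) D' mS[OF y] mS[OF mS[OF y]]])
  show "AE w in M. cmod (poly_op (xp j * \<eta>) S y w) = cmod (poly_op (xp j) S (poly_op \<eta> S y) w)" for j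
   using poly_op_mult[OF p(2) S y, of "xp j" \<eta>] by eventually_elim simp
 qed
 also have "... \<le> 1 * mixn q M (bx L) (\<lambda>j. poly_op (xp j) S (poly_op \<eta> S y))"
  by (rule mixn_mono[OF p(2) mS[OF mS[OF y]] mS[OF mS[OF y]]]) (use D in \<open>auto intro!: AE_I2 sum_mono2\<close>)
 also have "... \<le> C * lp_norm q M (poly_op \<eta> S y)" using square_function_bx[OF p(2) S mS[OF y] sqS] by simp
 also have "... \<le> C * (c2 * lp_norm q M y)" by (intro mult_left_mono op_bdD[OF \<eta> y] C)
 finally have b: "mixn q M D (\<lambda>j. poly_op (xp j * \<eta>) S y) \<le> C * (c2 * lp_norm q M y)" .
 have "(\<integral>w. (\<Sum>j\<in>D. poly_op (xp j * \<eta>) T (g j) w) * y w \<partial>M) = (\<Sum>j\<in>D. \<integral>w. poly_op (xp j * \<eta>) T (g j) w * y w \<partial>M)"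
  unfolding sum_distrib_right by (rule Bochner_Integration.integral_sum[OF Hoelder_integrable[OF pq m y]])
 also have "... = (\<Sum>j\<in>D. \<integral>w. g j w * poly_op (xp j * \<eta>) S y w \<partial>M)"
  by (intro sum.cong refl is_adjD[OF is_adj_poly[OF pq a] g y])
 also have "... = (\<integral>w. (\<Sum>j\<in>D. g j w * poly_op (xp j * \<eta>) S y w) \<partial>M)"
  by (rule Bochner_Integration.integral_sum[symmetric, OF Hoelder_integrable[OF pq g mS[OF y]]])
 also have "cmod ... \<le> mixn p M D g * mixn q M D (\<lambda>j. poly_op (xp j * \<eta>) S y)"
  by (rule mixn_Hoelder[OF pq g mS[OF y]])
 also have "... \<le> mixn p M D g * (C * (c2 * lp_norm q M y))" by (intro mult_left_mono b) simp
 finally show "cmod (\<integral>w. (\<Sum>j\<in>D. poly_op (xp j * \<eta>) T (g j) w) * y w \<partial>M) \<le> C * c2 * mixn p M D g * lp_norm q M y"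
  by (simp add: mult_ac)
qed

definition UU :: "int => ('a \<times> (int \<times> nat => bool) => complex) => 'a \<times> (int \<times> nat => bool) => complex" where
 "UU m f = (\<lambda>y. f (fst y, shf m (snd y)))"

lemma UU_funpow: "UU m ^^ n = UU (int n * m)"
proof (induction n)
 case (Suc n)
 then show ?case by (auto simp: fun_eq_iff UU_def shf_shf algebra_simps)
qed (auto simp: fun_eq_iff UU_def)

lemma UU_inverse: "UU m (UU (- m) f) = f" "UU (- m) (UU m f) = f"
 by (simp_all add: UU_def shf_shf)

lemma UU_lp:
 shows "lp_op p (M \<Otimes>\<^sub>M coins) (M \<Otimes>\<^sub>M coins) (UU m)"
  and "memLp p (M \<Otimes>\<^sub>M coins) f ==> lp_norm p (M \<Otimes>\<^sub>M coins) (UU m f) = lp_norm p (M \<Otimes>\<^sub>M coins) f"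
proof -
 have e: "(\<lambda>(w, b). (w, shf m b)) = (\<lambda>y. (fst y, shf m (snd y)))" by auto
 note * = coins.distr_pair_map_snd[OF shf_preserving[of m], unfolded e]
 show "lp_op p (M \<Otimes>\<^sub>M coins) (M \<Otimes>\<^sub>M coins) (UU m)"
  unfolding UU_def[abs_def] by (rule lp_op_measure_preserving[OF *])
 show "lp_norm p (M \<Otimes>\<^sub>M coins) (UU m f) = lp_norm p (M \<Otimes>\<^sub>M coins) f" if "memLp p (M \<Otimes>\<^sub>M coins) f"
  unfolding UU_def by (rule measure_preserving_memLp(2)[OF * that])
qed

lemma lp_limit_unique:
 fixes f :: "nat => 'a => complex"
 assumes p: "p \<ge> 1" and m: "memLp p M g" "memLp p M h" and ev: "\<forall>\<^sub>F n in sequentially. AE y in M. f n y = h y"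
  and f: "\<And>n. memLp p M (f n)" and lim: "(\<lambda>n. lp_norm p M (\<lambda>y. f n y - g y)) \<longlonglongrightarrow> 0"
 shows "AE y in M. g y = h y"
proof -
 have p0: "p > 0" using p by simp
 have "\<forall>\<^sub>F n in sequentially. lp_norm p M (\<lambda>y. f n y - g y) = lp_norm p M (\<lambda>y. h y - g y)"
  using ev
 proof eventually_elim
  case (elim n)
  then show ?case by (intro lp_norm_cong_mem memLp_diff p f m) (auto elim: eventually_mono)
 qed
 then have "(\<lambda>n. lp_norm p M (\<lambda>y. h y - g y)) \<longlonglongrightarrow> 0" using lim by (rule Lim_transform_eventually[rotated])
 then have "lp_norm p M (\<lambda>y. h y - g y) = 0" by (simp add: LIMSEQ_const_iff)
 then have "AE y in M. h y - g y = 0" using lp_norm_eq_0_iff[OF p0 memLp_diff[OF p m(2,1)]] by blast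
 then show ?thesis by eventually_elim simp
qed

lemma lp_op_tendsto:
 assumes p: "p \<ge> 1" and A: "lp_op p M N A" and f: "\<And>n. memLp p M (f n)" "memLp p M g"
  and lim: "(\<lambda>n. lp_norm p M (\<lambda>y. f n y - g y)) \<longlonglongrightarrow> 0"
 shows "(\<lambda>n. lp_norm p N (\<lambda>y. A (f n) y - A g y)) \<longlonglongrightarrow> 0"
proof -
 obtain c where c: "op_bd p M N A c" by (rule lp_op_bd[OF A])
 show ?thesis
 proof (rule tendsto_sandwich[where f="\<lambda>_. 0"])
  show "\<forall>\<^sub>F n in sequentially. lp_norm p N (\<lambda>y. A (f n) y - A g y) \<le> c * lp_norm p M (\<lambda>y. f n y - g y)"
  proof (rule always_eventually, rule allI)
   fix n
   have d: "memLp p M (\<lambda>y. f n y - g y)" by (rule memLp_diff[OF p f])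
   have "lp_norm p N (\<lambda>y. A (f n) y - A g y) = lp_norm p N (A (\<lambda>y. f n y - g y))"
   proof (rule lp_norm_cong_mem[OF memLp_diff[OF p lp_op_mem[OF A f(1)] lp_op_mem[OF A f(2)]] lp_op_mem[OF A d]])
    show "AE y in N. A (f n) y - A g y = A (\<lambda>y. f n y - g y) y"
     using lp_op_diff[OF A f(1)[of n] f(2)] by eventually_elim simp
   qed
   also have "... \<le> c * lp_norm p M (\<lambda>y. f n y - g y)" by (rule op_bdD[OF c d])
   finally show "lp_norm p N (\<lambda>y. A (f n) y - A g y) \<le> c * lp_norm p M (\<lambda>y. f n y - g y)" .
  qed
  show "(\<lambda>n. c * lp_norm p M (\<lambda>y. f n y - g y)) \<longlonglongrightarrow> 0" using tendsto_mult_left[OF lim, of c] by simp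
 qed auto
qed

theorem square_functions_imp_dilation:
 fixes M :: "'a measure"
 assumes pq: "conj_exp p q" and R: "Ritt p M T" and a: "is_adj p q M T S" and C: "C \<ge> 0"
  and sq: "\<And>n f. memLp p M f ==> mixn p M {..<n} (\<lambda>k. poly_op (sqp k) T f) \<le> C * lp_norm p M f"
  and sqS: "\<And>n f. memLp q M f ==> mixn q M {..<n} (\<lambda>k. poly_op (sqp k) S f) \<le> C * lp_norm q M f"
 shows "dilation_on p M T (M \<Otimes>\<^sub>M (coins :: (int \<times> nat => bool) measure))"
proof -
 have p: "p \<ge> 1" "q \<ge> 1" "p > 0" "q > 0" and T: "lp_op p M M T" and S: "lp_op q M M S"
  using pq a by (auto simp: conj_exp_def is_adj_def)
 obtain c0 c1 where pw: "\<And>n. op_bd p M M (poly_op (zz ^ n) T) c0"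
  and df: "\<And>n. op_bd p M M (poly_op (zz ^ n * (1 - zz)) T) (c1 / real (Suc n))"
  using Ritt_bounds[OF p(1) R] by blast
 define \<eta> where "\<eta> = (1 + zz)^2"
 obtain c2 where \<eta>: "op_bd q M M (poly_op \<eta> S) c2" by (rule lp_op_bd[OF lp_op_poly[OF p(2) S]])
 have c2: "c2 \<ge> 0" by (rule op_bd_nonneg[OF \<eta>])
 define W where "W = M \<Otimes>\<^sub>M (coins :: (int \<times> nat => bool) measure)"
 define rs where "rs j = rsig (ix j)" for j
 have rs: "rs j \<in> borel_measurable coins" "cmod (rs j b) \<le> 1" for j b by (simp_all add: rs_def)
 have Kp: "lp_norm p coins (\<lambda>b. \<Sum>j\<in>D. a j * rs j b) \<le> KB p * L2_set (\<lambda>j. cmod (a j)) D"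
  and Kq: "lp_norm q coins (\<lambda>b. \<Sum>j\<in>D. a j * rs j b) \<le> KB q * L2_set (\<lambda>j. cmod (a j)) D" if "finite D" for a D
  unfolding rs_def by (intro Khintchine_rsig p that inj_ix)+
 note one = borel_measurable_const[of 1]
 have one1: "cmod 1 \<le> 1" by simp
 have pol: "lp_op p M M (poly_op \<phi> T)" for \<phi> by (rule lp_op_poly[OF p(1) T])
 note pm = lp_op_mem[OF pol]
 have tens: "lp_op p M W (coins.tens (rs j))" and coef: "lp_op p W M (coins.coef (rs j))" for j
  unfolding W_def by (rule coins.lp_op_tens[OF p(1) rs], rule coins.lp_op_coef[OF pq rs])
 have tens1: "lp_op p M W (coins.tens (\<lambda>_. 1))" and coef1: "lp_op p W M (coins.coef (\<lambda>_. 1))"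
  unfolding W_def by (rule coins.lp_op_tens[OF p(1) one one1], rule coins.lp_op_coef[OF pq one one1])
 have UUop: "lp_op p W W (UU m)" and UUn: "memLp p W f ==> lp_norm p W (UU m f) = lp_norm p W f" for m f
  unfolding W_def by (rule UU_lp)+

 define JK where "JK K x y = (\<Sum>j\<in>bx K. 1 * coins.tens (rs j) (poly_op (xp j) T x) y)" for K and x :: "'a => complex" and y
 have JKop: "lp_op p M W (JK K)" for K
  unfolding JK_def[abs_def] by (rule lp_op_sum_ops[OF p(1) lp_op_comp[OF p(1) pol tens]])
 have Jbd: "lp_norm p W (\<lambda>y. \<Sum>j\<in>D. coins.tens (rs j) (poly_op (xp j) T x) y) \<le> KB p * mixn p M D (\<lambda>j. poly_op (xp j) T x)"
  if D: "finite D" and x: "memLp p M x" for D and x :: "'a => complex"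
  unfolding W_def by (rule coins.tens_sum(2)[OF p(1) rs pm[OF x] KB_nonneg Kp[OF D]])
 have sqx: "mixn p M (bx K) (\<lambda>j. poly_op (xp j) T x) \<le> C * lp_norm p M x" if "memLp p M x" for K and x :: "'a => complex"
  by (rule square_function_bx[OF p(1) T that sq])
 have JKbd: "op_bd p M W (JK K) (KB p * C)" for K
  unfolding op_bd_def
 proof (intro conjI allI impI)
  fix x :: "'a => complex" assume x: "memLp p M x"
  have "lp_norm p W (JK K x) \<le> KB p * mixn p M (bx K) (\<lambda>j. poly_op (xp j) T x)"
   using Jbd[OF bx_finite x] by (simp add: JK_def[abs_def])
  also have "... \<le> KB p * (C * lp_norm p M x)" by (intro mult_left_mono sqx x) simp
  finally show "lp_norm p W (JK K x) \<le> KB p * C * lp_norm p M x" by simp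
 qed (simp add: C)
 have JKC: "lp_Cauchy p W (\<lambda>K. JK K x)" if x: "memLp p M x" for x :: "'a => complex"
 proof -
  obtain t where t: "t \<longlonglongrightarrow> 0" "\<And>K L. K \<le> L ==> mixn p M (bx L - bx K) (\<lambda>j. poly_op (xp j) T x) \<le> t K"
   using mixn_tail[where I=bx and x="\<lambda>j. poly_op (xp j) T x", OF p(1) bx_finite bx_Suc pm[OF x] sqx[OF x]] by blast
  show ?thesis
  proof (rule lp_Cauchy_tail)
   show "(\<lambda>K. KB p * t K) \<longlonglongrightarrow> 0" using tendsto_mult_left[OF t(1), of "KB p"] by simp
   fix K L :: nat assume KL: "K \<le> L"
   have "JK L x y - JK K x y = (\<Sum>j\<in>bx L - bx K. coins.tens (rs j) (poly_op (xp j) T x) y)" for y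
    unfolding JK_def by (simp add: sum_diff[OF bx_finite bx_mono[OF KL]])
   then have "lp_norm p W (\<lambda>y. JK L x y - JK K x y) \<le> KB p * mixn p M (bx L - bx K) (\<lambda>j. poly_op (xp j) T x)"
    using Jbd[OF _ x, of "bx L - bx K"] by simp
   also have "... \<le> KB p * t K" by (intro mult_left_mono t(2) KL) simp
   finally show "lp_norm p W (\<lambda>y. JK L x y - JK K x y) \<le> KB p * t K" .
  qed
 qed
 obtain J0 where J0: "lp_op p M W J0" and J0lim: "\<And>x. memLp p M x ==> (\<lambda>K. lp_norm p W (\<lambda>y. JK K x y - J0 x y)) \<longlonglongrightarrow> 0"
  using lp_op_limit[where T=JK, OF p(1) JKop JKbd JKC] by blast

 define QK where "QK K f \<omega> = (\<Sum>j\<in>bx K. 1 * poly_op (xp j * \<eta>) T (coins.coef (rs j) f) \<omega>)" for K f and \<omega> :: 'a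
 have QKop: "lp_op p W M (QK K)" for K
  unfolding QK_def[abs_def] by (rule lp_op_sum_ops[OF p(1) lp_op_comp[OF p(1) coef pol]])
 have Qbd: "lp_norm p M (\<lambda>\<omega>. \<Sum>j\<in>D. poly_op (xp j * \<eta>) T (coins.coef (rs j) f) \<omega>) \<le> C * c2 * mixn p M D (\<lambda>j. coins.coef (rs j) f)"
  if D: "D \<subseteq> bx L" and f: "memLp p W f" for D L f
  by (rule dual_square_sum[OF pq a D C sqS \<eta> lp_op_mem[OF coef f]])
 have Bes: "mixn p M (bx K) (\<lambda>j. coins.coef (rs j) f) \<le> KB q * lp_norm p W f" if "memLp p W f" for K f
  unfolding W_def by (rule coins.coef_Bessel[OF pq bx_finite rs that[unfolded W_def] KB_nonneg Kq[OF bx_finite]])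
 have QKbd: "op_bd p W M (QK K) (C * c2 * KB q)" for K
  unfolding op_bd_def
 proof (intro conjI allI impI)
  fix f :: "_ => complex" assume f: "memLp p W f"
  have "lp_norm p M (QK K f) \<le> C * c2 * mixn p M (bx K) (\<lambda>j. coins.coef (rs j) f)"
   using Qbd[OF subset_refl f] by (simp add: QK_def[abs_def])
  also have "... \<le> C * c2 * (KB q * lp_norm p W f)" using C c2 by (intro mult_left_mono Bes f) simp
  finally show "lp_norm p M (QK K f) \<le> C * c2 * KB q * lp_norm p W f" by simp
 qed (simp add: C c2)
 have QKC: "lp_Cauchy p M (\<lambda>K. QK K f)" if f: "memLp p W f" for f
 proof -
  obtain t where t: "t \<longlonglongrightarrow> 0" "\<And>K L. K \<le> L ==> mixn p M (bx L - bx K) (\<lambda>j. coins.coef (rs j) f) \<le> t K"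
   using mixn_tail[where I=bx and x="\<lambda>j. coins.coef (rs j) f", OF p(1) bx_finite bx_Suc lp_op_mem[OF coef f] Bes[OF f]] by blast
  show ?thesis
  proof (rule lp_Cauchy_tail)
   show "(\<lambda>K. C * c2 * t K) \<longlonglongrightarrow> 0" using tendsto_mult_left[OF t(1), of "C * c2"] by simp
   fix K L :: nat assume KL: "K \<le> L"
   have "QK L f y - QK K f y = (\<Sum>j\<in>bx L - bx K. poly_op (xp j * \<eta>) T (coins.coef (rs j) f) y)" for y
    unfolding QK_def by (simp add: sum_diff[OF bx_finite bx_mono[OF KL]])
   then have "lp_norm p M (\<lambda>y. QK L f y - QK K f y) \<le> C * c2 * mixn p M (bx L - bx K) (\<lambda>j. coins.coef (rs j) f)"
    using Qbd[OF Diff_subset f, of L "bx K"] by simp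
   also have "... \<le> C * c2 * t K" using C c2 by (intro mult_left_mono t(2) KL) simp
   finally show "lp_norm p M (\<lambda>y. QK L f y - QK K f y) \<le> C * c2 * t K" .
  qed
 qed
 obtain Q0 where Q0: "lp_op p W M Q0" and Q0lim: "\<And>f. memLp p W f ==> (\<lambda>K. lp_norm p M (\<lambda>y. QK K f y - Q0 f y)) \<longlonglongrightarrow> 0"
  using lp_op_limit[where T=QK, OF p(1) QKop QKbd QKC] by blast

 \<comment> \<open>Coefficients of the limit \<open>J0 x\<close> are computed on the truncations,
   where they are eventually constant in \<open>K\<close>.\<close>
 have coef_lim: "AE \<omega> in M. coins.coef h (UU m (J0 x)) \<omega> = z \<omega>"
  if h: "h \<in> borel_measurable coins" "\<And>b. cmod (h b) \<le> 1" and x: "memLp p M x" and z: "memLp p M z"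
   and ev: "\<forall>\<^sub>F K in sequentially. \<forall>\<omega>. coins.coef h (UU m (JK K x)) \<omega> = z \<omega>" for h m x z
 proof -
  have A: "lp_op p W M (\<lambda>f. coins.coef h (UU m f))"
   by (rule lp_op_comp[OF p(1) UUop]) (unfold W_def, rule coins.lp_op_coef[OF pq h])
  note Jx = lp_op_mem[OF JKop x] lp_op_mem[OF J0 x]
  show ?thesis
   by (rule lp_limit_unique[OF p(1) lp_op_mem[OF A Jx(2)] z _ lp_op_mem[OF A Jx(1)] lp_op_tendsto[OF p(1) A Jx J0lim[OF x]]])
    (use ev in \<open>auto elim: eventually_mono\<close>)
 qed
 have UUJ: "UU m (JK K x) = (\<lambda>y. \<Sum>j\<in>bx K. coins.tens (rsig (int (fst j) - m, snd j)) (poly_op (xp j) T x) y)" for m K x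
  by (auto simp: fun_eq_iff UU_def JK_def coins.tens_def rs_def ix_def rsig_shf)
 \<comment> \<open>Orthonormality of the signs singles out the index \<open>fst j + n\<close>:
   translating \<open>n\<close> times multiplies the polynomial behind each coefficient by
   \<open>zz ^ n\<close>.\<close>
 have coef_rs: "AE \<omega> in M. coins.coef (rs j) (UU (int n) (J0 x)) \<omega> = poly_op (xp (fst j + n, snd j)) T x \<omega>" if x: "memLp p M x" for j n x
 proof (rule coef_lim[OF rs x pm[OF x]])
  have "coins.coef (rs j) (UU (int n) (JK K x)) \<omega> = poly_op (xp (fst j + n, snd j)) T x \<omega>"
   if K: "K > fst j + n + snd j" for K \<omega>
  proof -
   have "coins.coef (rs j) (UU (int n) (JK K x)) \<omega>
     = (\<Sum>\<nu>\<in>bx K. (\<integral>b. rsig (int (fst \<nu>) - int n, snd \<nu>) b * rs j b \<partial>coins) * poly_op (xp \<nu>) T x \<omega>)"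
    unfolding UUJ by (rule coef_tens_sum) (simp_all add: rs)
   also have "... = (\<Sum>\<nu>\<in>bx K. if \<nu> = (fst j + n, snd j) then poly_op (xp \<nu>) T x \<omega> else 0)"
    unfolding rs_def integral_rsig_rsig by (intro sum.cong refl) (auto simp: ix_def)
   also have "... = poly_op (xp (fst j + n, snd j)) T x \<omega>"
    using K by (subst sum.delta) (auto simp: bx_def)
   finally show ?thesis .
  qed
  then show "\<forall>\<^sub>F K in sequentially. \<forall>\<omega>. coins.coef (rs j) (UU (int n) (JK K x)) \<omega> = poly_op (xp (fst j + n, snd j)) T x \<omega>"
   by (auto intro: eventually_mono[OF eventually_gt_at_top])
 qed
 have coef_1: "AE \<omega> in M. coins.coef (\<lambda>_. 1) (UU (int n) (J0 x)) \<omega> = 0" if x: "memLp p M x" for n x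
 proof (rule coef_lim[OF one one1 x memLp_zero])
  have "coins.coef (\<lambda>_. 1) (UU (int n) (JK K x)) \<omega> = 0" for K \<omega>
   unfolding UUJ by (subst coef_tens_sum) (simp_all add: integral_rsig)
  then show "\<forall>\<^sub>F K in sequentially. \<forall>\<omega>. coins.coef (\<lambda>_. 1) (UU (int n) (JK K x)) \<omega> = 0" by simp
 qed

 \<comment> \<open>The truncated reproducing identity, with the power \<open>n\<close> carried by
   the coefficients of \<open>J0 x\<close>; only the factor \<open>(1 - zz ^ (2 * K))^2\<close>
   separates the result from \<open>T^n\<close>.\<close>
 have QKJ: "AE \<omega> in M. QK K (UU (int n) (J0 x)) \<omega> = poly_op (zz ^ n * (1 - zz ^ (2 * K))^2) T x \<omega>" if x: "memLp p M x" for K n x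
 proof -
  have "AE \<omega> in M. \<forall>j\<in>bx K. poly_op (xp j * \<eta>) T (coins.coef (rs j) (UU (int n) (J0 x))) \<omega> = poly_op (xp j * \<eta> * xp (fst j + n, snd j)) T x \<omega>"
  proof (rule AE_finite_allI[OF bx_finite])
   fix j
   have "AE \<omega> in M. poly_op (xp j * \<eta>) T (coins.coef (rs j) (UU (int n) (J0 x))) \<omega> = poly_op (xp j * \<eta>) T (poly_op (xp (fst j + n, snd j)) T x) \<omega>"
    by (rule lp_op_cong[OF pol lp_op_mem[OF coef lp_op_mem[OF UUop lp_op_mem[OF J0 x]]] pm[OF x] coef_rs[OF x]])
   with poly_op_mult[OF p(1) T x, of "xp j * \<eta>" "xp (fst j + n, snd j)"]
   show "AE \<omega> in M. poly_op (xp j * \<eta>) T (coins.coef (rs j) (UU (int n) (J0 x))) \<omega> = poly_op (xp j * \<eta> * xp (fst j + n, snd j)) T x \<omega>"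
    by eventually_elim simp
  qed
  then show ?thesis
  proof eventually_elim
   case (elim \<omega>)
   have "(\<Sum>j\<in>bx K. xp j * \<eta> * xp (fst j + n, snd j)) = (\<Sum>(s, l)\<in>{..<K} \<times> {..<K}. zz ^ (n + s + l) * (1 - zz) * (zz ^ (s + l) * (1 - zz) * (1 + zz)^2))"
    unfolding bx_def xp_def \<eta>_def
    by (intro sum.cong refl) (simp only: split_beta fst_conv snd_conv mult_ac add_ac)
   then have "(\<Sum>j\<in>bx K. xp j * \<eta> * xp (fst j + n, snd j)) = zz ^ n * (1 - zz ^ (2 * K))^2"
    unfolding double_sum_powers .
   then show ?case using elim unfolding QK_def by (simp add: poly_op_sum[symmetric])
  qed
 qed

 \<comment> \<open>The defect \<open>x - Q0 (J0 x)\<close> is fixed by \<open>T\<close>, so the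
   error in reproducing \<open>T^n x\<close> is the same as for \<open>n = 0\<close>. On the
   truncated level this is \<open>op_bd_remainder\<close>, and the limit in \<open>K\<close>
   transports it.\<close>
 have key: "AE \<omega> in M. Q0 (UU (int n) (J0 x)) \<omega> + (x \<omega> - Q0 (J0 x) \<omega>) = (T ^^ n) x \<omega>" if x: "memLp p M x" for n x
 proof -
  let ?Y = "\<lambda>n. UU (int n) (J0 x)"
  have UU0: "UU 0 f = f" for f :: "_ => complex" by (simp add: UU_def)
  have Ym: "memLp p W (?Y k)" for k by (rule lp_op_mem[OF UUop lp_op_mem[OF J0 x]])
  define P where "P k K = poly_op (zz ^ k * (1 - zz ^ (2 * K))^2) T x" for k K
  have l: "(\<lambda>K. lp_norm p M (\<lambda>\<omega>. P k K \<omega> - Q0 (?Y k) \<omega>)) \<longlonglongrightarrow> 0" for k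
  proof -
   have "lp_norm p M (\<lambda>\<omega>. P k K \<omega> - Q0 (?Y k) \<omega>) = lp_norm p M (\<lambda>\<omega>. QK K (?Y k) \<omega> - Q0 (?Y k) \<omega>)" for K
   proof (rule lp_norm_cong_mem[OF memLp_diff[OF p(1)] memLp_diff[OF p(1)]])
    show "AE \<omega> in M. P k K \<omega> - Q0 (?Y k) \<omega> = QK K (?Y k) \<omega> - Q0 (?Y k) \<omega>"
     using QKJ[OF x, of K k] by eventually_elim (simp add: P_def)
   qed (auto simp: P_def intro!: pm x lp_op_mem[OF Q0] lp_op_mem[OF QKop] Ym)
   then show ?thesis using Q0lim[OF Ym[of k]] by simp
  qed
  define D where "D \<omega> = (T ^^ n) x \<omega> - (Q0 (?Y n) \<omega> + (x \<omega> - Q0 (?Y 0) \<omega>))" for \<omega>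
  have Tn: "(T ^^ n) x = poly_op (zz ^ n) T x" by (rule ext) (simp only: monom_zz[symmetric] poly_op_monom mult_1_left)
  have Dm: "memLp p M D" unfolding D_def Tn by (intro memLp_diff memLp_add p(1) pm x lp_op_mem[OF Q0 Ym])
  define t where "t K = real n * c1 / real (Suc (2 * K)) * (2 * c0 + c0) * lp_norm p M x" for K
  have bound: "lp_norm p M D \<le> t K + (lp_norm p M (\<lambda>\<omega>. P n K \<omega> - Q0 (?Y n) \<omega>) + lp_norm p M (\<lambda>\<omega>. P 0 K \<omega> - Q0 (?Y 0) \<omega>))" for K
  proof -
   define E where "E = poly_op ((zz ^ n - 1) * (1 - (1 - zz ^ (2 * K))^2)) T x"
   have Em: "memLp p M E" unfolding E_def by (rule pm[OF x])
   have En: "lp_norm p M E \<le> t K" unfolding E_def t_def by (rule op_bdD[OF op_bd_remainder[OF p(1) T pw df] x])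
   have id: "(v - 1) * (1 - w) = v - v * w - 1 + 1 * w" for v w :: "complex poly" by (simp add: algebra_simps)
   have Eeq: "E \<omega> = (T ^^ n) x \<omega> - P n K \<omega> - x \<omega> + P 0 K \<omega>" for \<omega>
    unfolding E_def P_def Tn power_0 id by (simp only: poly_op_add poly_op_diff poly_op_1)
   have a1: "memLp p M (\<lambda>\<omega>. P k K \<omega> - Q0 (?Y k) \<omega>)" for k
    unfolding P_def by (intro memLp_diff p(1) pm x lp_op_mem[OF Q0 Ym])
   have Deq: "D = (\<lambda>\<omega>. E \<omega> + ((P n K \<omega> - Q0 (?Y n) \<omega>) - (P 0 K \<omega> - Q0 (?Y 0) \<omega>)))"
    by (rule ext) (simp add: D_def Eeq)
   have "lp_norm p M D \<le> lp_norm p M E + lp_norm p M (\<lambda>\<omega>. (P n K \<omega> - Q0 (?Y n) \<omega>) - (P 0 K \<omega> - Q0 (?Y 0) \<omega>))"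
    unfolding Deq by (rule lp_norm_add[OF p(1) Em memLp_diff[OF p(1) a1 a1]])
   also have "... \<le> t K + (lp_norm p M (\<lambda>\<omega>. P n K \<omega> - Q0 (?Y n) \<omega>) + lp_norm p M (\<lambda>\<omega>. P 0 K \<omega> - Q0 (?Y 0) \<omega>))"
    by (rule add_mono[OF En lp_norm_diff[OF p(1) a1 a1]])
   finally show ?thesis .
  qed
  have "t \<longlonglongrightarrow> 0"
   using tendsto_mult_left[OF tendsto_const_over_Suc[of "real n * c1"], of "(2 * c0 + c0) * lp_norm p M x"]
   unfolding t_def[abs_def] by (simp add: mult_ac)
  from tendsto_add[OF this tendsto_add[OF l[of n] l[of 0]]]
  have "(\<lambda>K. t K + (lp_norm p M (\<lambda>\<omega>. P n K \<omega> - Q0 (?Y n) \<omega>) + lp_norm p M (\<lambda>\<omega>. P 0 K \<omega> - Q0 (?Y 0) \<omega>))) \<longlonglongrightarrow> 0"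
   by (simp only: add_0_right)
  then have "lp_norm p M D \<le> 0" by (rule LIMSEQ_le_const) (use bound in blast)
  then have "lp_norm p M D = 0" using lp_norm_nonneg[of p M D] by linarith
  then have "AE \<omega> in M. D \<omega> = 0" using lp_norm_eq_0_iff[OF p(3) Dm] by blast
  then show ?thesis by eventually_elim (simp add: D_def UU0)
 qed

 define J where "J x y = J0 x y + 1 * coins.tens (\<lambda>_. 1) x y" for x y
 \<comment> \<open>The constant component is fixed by translation and returns \<open>x\<close>;
   adding it and subtracting \<open>Q0 (J0 x)\<close> supplies exactly the defect in
   \<open>key\<close>. The two components do not interfere: \<open>J0 x\<close> has no constant
   component, by \<open>coef_1\<close>, and \<open>Q0\<close> annihilates \<open>x\<close> tensored
   with 1, by \<open>Q0t\<close>.\<close>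
 define Q where "Q f \<omega> = (Q0 f \<omega> + 1 * coins.coef (\<lambda>_. 1) f \<omega>) + (- 1) * Q0 (J0 (coins.coef (\<lambda>_. 1) f)) \<omega>" for f \<omega>
 have Jop: "lp_op p M W J" unfolding J_def[abs_def] by (rule lp_op_lincomb[OF p(1) J0 tens1])
 have Qop: "lp_op p W M Q" unfolding Q_def[abs_def]
  by (rule lp_op_lincomb[OF p(1) lp_op_lincomb[OF p(1) Q0 coef1] lp_op_comp[OF p(1) lp_op_comp[OF p(1) coef1 J0] Q0]])

 have Q0t: "AE \<omega> in M. Q0 (coins.tens (\<lambda>_. 1) x) \<omega> = 0" if x: "memLp p M x" for x
 proof (rule lp_limit_unique[OF p(1) lp_op_mem[OF Q0] memLp_zero _ lp_op_mem[OF QKop] Q0lim])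
  have c: "coins.coef (rs j) (coins.tens (\<lambda>_. 1) x) = (\<lambda>_. 0)" for j
   by (rule ext) (simp add: coins.coef_tens rs_def integral_rsig)
  have "AE \<omega> in M. QK K (coins.tens (\<lambda>_. 1) x) \<omega> = 0" for K
  proof -
   have "AE \<omega> in M. \<forall>j\<in>bx K. poly_op (xp j * \<eta>) T (\<lambda>_. 0) \<omega> = 0"
    by (rule AE_finite_allI[OF bx_finite lp_op_zero[OF pol]])
   then show ?thesis unfolding QK_def c by eventually_elim simp
  qed
  then show "\<forall>\<^sub>F K in sequentially. AE \<omega> in M. QK K (coins.tens (\<lambda>_. 1) x) \<omega> = 0" by simp
 qed (rule lp_op_mem[OF tens1 x])+

 have main: "AE \<omega> in M. (T ^^ n) x \<omega> = Q ((UU 1 ^^ n) (J x)) \<omega>" if x: "memLp p M x" for n x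
 proof -
  define A where "A = UU (int n) (J0 x)"
  define B :: "'a \<times> (int \<times> nat => bool) => complex" where "B = coins.tens (\<lambda>_. 1) x"
  have Am: "memLp p W A" and Bm: "memLp p W B" unfolding A_def B_def
   by (rule lp_op_mem[OF UUop lp_op_mem[OF J0 x]], rule lp_op_mem[OF tens1 x])
  have Y: "(UU 1 ^^ n) (J x) = (\<lambda>y. A y + B y)"
   unfolding UU_funpow A_def B_def by (simp add: UU_def J_def coins.tens_def fun_eq_iff)
  have AB: "memLp p W (\<lambda>y. A y + B y)" by (rule memLp_add[OF p(1) Am Bm])
  have Bx: "coins.coef (\<lambda>_. 1) B = x" unfolding B_def by (rule ext) (simp add: coins.coef_tens coins.prob_space[unfolded space_coins])
  from lp_op_add[OF coef1 Am Bm] coef_1[OF x, of n, folded A_def]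
  have E: "AE \<omega> in M. coins.coef (\<lambda>_. 1) (\<lambda>y. A y + B y) \<omega> = x \<omega>" by eventually_elim (simp add: Bx)
  have "AE \<omega> in M. Q0 (J0 (coins.coef (\<lambda>_. 1) (\<lambda>y. A y + B y))) \<omega> = Q0 (J0 x) \<omega>"
   by (rule lp_op_cong[OF lp_op_comp[OF p(1) J0 Q0] lp_op_mem[OF coef1 AB] x E])
  with E lp_op_add[OF Q0 Am Bm] Q0t[OF x, folded B_def] key[OF x, of n, folded A_def]
  show ?thesis unfolding Y Q_def by eventually_elim (simp add: algebra_simps)
 qed

 have bounded: "op_set_bounded p W (powers_set (UU 1) \<union> powers_set (UU (- 1)))"
  unfolding op_set_bounded_def
 proof (intro exI ballI allI impI)
  fix A :: "('a \<times> (int \<times> nat => bool) => complex) => 'a \<times> (int \<times> nat => bool) => complex" and f :: "'a \<times> (int \<times> nat => bool) => complex" assume "A \<in> powers_set (UU 1) \<union> powers_set (UU (- 1))" and f: "memLp p W f"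
  then obtain m where "A = UU m" by (auto simp: powers_set_def UU_funpow)
  then show "lp_norm p W (A f) \<le> 1 * lp_norm p W f" by (simp add: UUn[OF f])
 qed
 show ?thesis
  unfolding dilation_on_def W_def[symmetric]
  by (intro exI[of _ J] exI[of _ Q] exI[of _ "UU 1"] exI[of _ "UU (- 1)"] conjI allI impI Jop Qop UUop bounded main)
   (simp_all add: UU_inverse)
qed

section \<open>Moving the dilation to the prescribed carrier\<close>

lemma dilation_on_transfer:
 fixes M :: "'a measure" and N :: "'b measure" and E :: "'c measure"
 assumes p: "p \<ge> 1" and \<alpha>: "\<alpha> \<in> measurable N E" "distr N E \<alpha> = E" and \<beta>: "\<beta> \<in> measurable E N" "distr E N \<beta> = N"
  and inv: "\<And>x. \<beta> (\<alpha> x) = x" "AE y in E. \<alpha> (\<beta> y) = y"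
  and D: "dilation_on p M T N"
 shows "dilation_on p M T E"
proof -
 obtain J Q U V where J: "lp_op p M N J" and Q: "lp_op p N M Q" and U: "lp_op p N N U" and V: "lp_op p N N V"
  and UV: "\<And>f. memLp p N f ==> (AE y in N. V (U f) y = f y) \<and> (AE y in N. U (V f) y = f y)"
  and bd: "op_set_bounded p N (powers_set U \<union> powers_set V)"
  and dil: "\<And>n f. memLp p M f ==> AE x in M. (T ^^ n) f x = Q ((U ^^ n) (J f)) x"
  using D unfolding dilation_on_def by blast
 define \<Phi> :: "('b => complex) => 'c => complex" where "\<Phi> f = (\<lambda>y. f (\<beta> y))" for f
 define \<Psi> :: "('c => complex) => 'b => complex" where "\<Psi> f = (\<lambda>x. f (\<alpha> x))" for f
 have \<Phi>: "lp_op p N E \<Phi>" unfolding \<Phi>_def[abs_def] by (rule lp_op_measure_preserving[OF \<beta>])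
 have \<Psi>: "lp_op p E N \<Psi>" unfolding \<Psi>_def[abs_def] by (rule lp_op_measure_preserving[OF \<alpha>])
 have \<Phi>n: "lp_norm p E (\<Phi> f) = lp_norm p N f" if "memLp p N f" for f
  unfolding \<Phi>_def by (rule measure_preserving_memLp(2)[OF \<beta> that])
 have \<Psi>n: "lp_norm p N (\<Psi> f) = lp_norm p E f" if "memLp p E f" for f
  unfolding \<Psi>_def by (rule measure_preserving_memLp(2)[OF \<alpha> that])
 \<comment> \<open>One composition is the identity exactly, the other only almost everywhere. The
   exact one lets powers of conjugated operators telescope without exceptional sets.\<close>
 have \<Psi>\<Phi>: "\<Psi> (\<Phi> f) = f" for f by (simp add: \<Psi>_def \<Phi>_def inv)
 have \<Phi>\<Psi>: "AE y in E. \<Phi> (\<Psi> f) y = f y" for f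
  using inv(2) by eventually_elim (simp add: \<Psi>_def \<Phi>_def)
 define L where "L A f = \<Phi> (A (\<Psi> f))" for A f
 have Lop: "lp_op p E E (L A)" if A: "lp_op p N N A" for A
  unfolding L_def[abs_def] by (rule lp_op_comp[OF p lp_op_comp[OF p \<Psi> A] \<Phi>])
 have Lpow: "(L A ^^ n) (\<Phi> f) = \<Phi> ((A ^^ n) f)" for A n f
  by (induction n) (simp_all add: L_def \<Psi>\<Phi>)
 have Linv: "AE y in E. L A (L B f) y = f y" if f: "memLp p E f" and A: "lp_op p N N A" and B: "lp_op p N N B"
  and AB: "AE y in N. A (B (\<Psi> f)) y = \<Psi> f y" for A B f
 proof -
  note m = lp_op_mem[OF \<Psi> f]
  have "AE y in E. \<Phi> (A (B (\<Psi> f))) y = \<Phi> (\<Psi> f) y"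
   by (rule lp_op_cong[OF \<Phi> lp_op_mem[OF A lp_op_mem[OF B m]] m AB])
  with \<Phi>\<Psi>[of f] show ?thesis unfolding L_def \<Psi>\<Phi> by eventually_elim simp
 qed
 obtain C where C: "\<And>A f. A \<in> powers_set U \<union> powers_set V ==> memLp p N f ==> lp_norm p N (A f) \<le> C * lp_norm p N f"
  using bd unfolding op_set_bounded_def by blast
 have Lbd: "lp_norm p E ((L A ^^ n) f) \<le> C * lp_norm p E f" if f: "memLp p E f" and A: "lp_op p N N A"
  and AC: "\<And>f. memLp p N f ==> lp_norm p N ((A ^^ n) f) \<le> C * lp_norm p N f" for A n f
 proof -
  note m = lp_op_mem[OF \<Psi> f]
  note L = lp_op_pow[OF p Lop[OF A], of n]
  have f': "memLp p E (\<Phi> (\<Psi> f))" by (rule lp_op_mem[OF \<Phi> m])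
  have "lp_norm p E ((L A ^^ n) f) = lp_norm p E ((L A ^^ n) (\<Phi> (\<Psi> f)))"
  proof (rule lp_norm_cong_mem[OF lp_op_mem[OF L f] lp_op_mem[OF L f']])
   show "AE y in E. (L A ^^ n) f y = (L A ^^ n) (\<Phi> (\<Psi> f)) y"
    by (rule lp_op_cong[OF L f f']) (use \<Phi>\<Psi>[of f] in \<open>auto elim: eventually_mono\<close>)
  qed
  also have "... = lp_norm p N ((A ^^ n) (\<Psi> f))" unfolding Lpow by (rule \<Phi>n[OF lp_op_mem[OF lp_op_pow[OF p A] m]])
  also have "... \<le> C * lp_norm p N (\<Psi> f)" by (rule AC[OF m])
  finally show ?thesis by (simp add: \<Psi>n[OF f])
 qed
 have "lp_op p M E (\<lambda>x. \<Phi> (J x))" "lp_op p E M (\<lambda>f. Q (\<Psi> f))" by (rule lp_op_comp[OF p J \<Phi>], rule lp_op_comp[OF p \<Psi> Q])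
 moreover have "(AE y in E. L V (L U f) y = f y) \<and> (AE y in E. L U (L V f) y = f y)" if f: "memLp p E f" for f
  using UV[OF lp_op_mem[OF \<Psi> f]] Linv[OF f V U] Linv[OF f U V] by blast
 moreover have "op_set_bounded p E (powers_set (L U) \<union> powers_set (L V))"
  unfolding op_set_bounded_def
 proof (intro exI ballI allI impI)
  fix A and f :: "'c => complex" assume A: "A \<in> powers_set (L U) \<union> powers_set (L V)" and f: "memLp p E f"
  have UVn: "U ^^ n \<in> powers_set U \<union> powers_set V" "V ^^ n \<in> powers_set U \<union> powers_set V" for n
   by (auto simp: powers_set_def)
  have "lp_norm p E ((L U ^^ n) f) \<le> C * lp_norm p E f" "lp_norm p E ((L V ^^ n) f) \<le> C * lp_norm p E f" for n
   by (rule Lbd[OF f U C[OF UVn(1)]], assumption, rule Lbd[OF f V C[OF UVn(2)]])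
  then show "lp_norm p E (A f) \<le> C * lp_norm p E f" using A by (auto simp: powers_set_def)
 qed
 moreover have "AE x in M. (T ^^ n) f x = Q (\<Psi> ((L U ^^ n) (\<Phi> (J f)))) x" if "memLp p M f" for n f
  unfolding Lpow \<Psi>\<Phi> by (rule dil[OF that])
 ultimately show ?thesis
  unfolding dilation_on_def using Lop[OF U] Lop[OF V] by blast
qed

text \<open>\<open>loose_dilation\<close> prescribes the type of the points. The measure is
  transported along an injection, which is an isomorphism of measure spaces onto its image.\<close>

lemma dilation_on_embed:
 assumes p: "p \<ge> 1" and g: "inj g" and D: "dilation_on p M T N"
 shows "dilation_on p M T (embed_measure N g)"
proof (rule dilation_on_transfer[OF p, where \<alpha>=g and \<beta>="inv g" and N=N])
 let ?E = "embed_measure N g"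
 show gm: "g \<in> measurable N ?E" by (rule measurable_embed_measure2[OF g])
 show gd: "distr N ?E g = ?E" by (rule embed_measure_eq_distr[OF g, symmetric])
 show im: "inv g \<in> measurable ?E N"
  by (rule measurable_embed_measure1) (simp add: inv_f_f[OF g])
 have "distr ?E N (inv g) = distr (distr N ?E g) N (inv g)" by (simp only: gd)
 also have "... = distr N N (inv g \<circ> g)" by (rule distr_distr[OF im gm])
 also have "inv g \<circ> g = (\<lambda>x. x)" using g by (auto simp: fun_eq_iff)
 finally show "distr ?E N (inv g) = N" by (simp add: distr_id)
 show "inv g (g x) = x" for x by (rule inv_f_f[OF g])
 show "AE y in ?E. g (inv g y) = y"
  by (rule AE_I2) (auto simp: space_embed_measure inv_f_f[OF g])
qed (rule D)

text \<open>A family of countably many coins is a set of natural numbers, so the sign space has at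
  most the cardinality of the reals. Any injection will do, since the measurable structure is
  transported with it.\<close>

lemma coins_embedding: "\<exists>g :: 'a \<times> (int \<times> nat => bool) => 'a \<times> real. inj g"
proof -
 obtain f :: "nat set => real" where f: "inj f"
  using nat_sets_eqpoll_reals unfolding eqpoll_def bij_betw_def by blast
 define h where "h b = f (to_nat ` {i. b i})" for b :: "int \<times> nat => bool"
 have "inj h"
 proof (rule injI)
  fix b b' assume "h b = h b'"
  then have "to_nat ` {i. b i} = to_nat ` {i. b' i}" using f by (simp add: h_def inj_eq)
  then have "{i. b i} = {i. b' i}" by (simp add: inj_image_eq_iff)
  then show "b = b'" by auto
 qed
 then have "inj (\<lambda>y :: 'a \<times> (int \<times> nat => bool). (fst y, h (snd y)))" by (auto simp: inj_def)
 then show ?thesis by blast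
qed

lemma is_adj_iff: "is_adj p (p / (p - 1)) M T S \<longleftrightarrow> lp_op p M M T \<and> is_adjoint p M T S"
 by (auto simp: is_adj_def is_adjoint_def)

theorem theorem4p8:
  fixes M :: "'a measure" and p :: real
    and T :: "('a \<Rightarrow> complex) \<Rightarrow> ('a \<Rightarrow> complex)"
  assumes "1 < p" and "Ritt p M T"
  shows "let cond_i = (\<exists>C. (\<forall>x. memLp p M x \<longrightarrow> sqfun p M T x \<le> ereal (C * lp_norm p M x)) \<and>
                           (\<forall>Tstar. is_adjoint p M T Tstar \<longrightarrow>
                              (\<forall>y. memLp (p / (p - 1)) M y \<longrightarrow>
                                 sqfun (p / (p - 1)) M Tstar y \<le> ereal (C * lp_norm (p / (p - 1)) M y))));
             cond_ii = (R_Ritt p M T \<and> loose_dilation p M T);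
             cond_iii = (R_Ritt p M T \<and> p_poly_bounded p M T)
         in (cond_i \<longleftrightarrow> cond_ii) \<and> (cond_ii \<longleftrightarrow> cond_iii) \<and>
            (\<forall>N :: 'b measure. R_Ritt p M T \<and> dilation_on p M T N \<longrightarrow> cond_i)"
proof -
 define q where "q = p / (p - 1)"
 have pq: "conj_exp p q" unfolding q_def by (rule conj_expI[OF assms(1)])
 have p: "p \<ge> 1" "q \<ge> 1" and T: "lp_op p M M T" using pq assms(2) by (auto simp: conj_exp_def Ritt_def)
 define cond_i where "cond_i \<longleftrightarrow> (\<exists>C. (\<forall>x. memLp p M x \<longrightarrow> sqfun p M T x \<le> ereal (C * lp_norm p M x)) \<and>
  (\<forall>Tstar. is_adjoint p M T Tstar \<longrightarrow> (\<forall>y. memLp (p / (p - 1)) M y \<longrightarrow>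
    sqfun (p / (p - 1)) M Tstar y \<le> ereal (C * lp_norm (p / (p - 1)) M y))))"
 have iii_i: cond_i if "R_Ritt p M T" "p_poly_bounded p M T"
  unfolding cond_i_def by (rule R_Ritt_poly_bounded_imp_square_functions[OF assms(1) that])
 \<comment> \<open>Stated for every type of points: it serves the carrier fixed by
   \<open>loose_dilation\<close> as well as the arbitrary \<open>N\<close> in the last
   conjunct.\<close>
 have ii_iii: "p_poly_bounded p M T" if "dilation_on p M T N" for N :: "'d measure"
  by (rule dilation_imp_poly_bounded[OF assms(1) T that])
 have i_ii: "R_Ritt p M T \<and> loose_dilation p M T" if cond_i
 proof -
  from that obtain C where sqT: "\<And>x. memLp p M x ==> sqfun p M T x \<le> ereal (C * lp_norm p M x)"
   and sqT': "\<And>S y. is_adjoint p M T S ==> memLp q M y ==> sqfun q M S y \<le> ereal (C * lp_norm q M y)"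
   unfolding cond_i_def q_def by blast
  obtain S where a: "is_adj p q M T S" using adjoint_exists[OF pq T] by blast
  then have S: "lp_op q M M S" and aS: "is_adjoint p M T S" using is_adj_iff by (auto simp: is_adj_def q_def)
  have abs: "C * lp_norm r M x \<le> \<bar>C\<bar> * lp_norm r M x" for r and x :: "'a => complex"
   by (intro mult_right_mono) auto
  have sq: "mixn p M {..<n} (\<lambda>k. poly_op (sqp k) T f) \<le> \<bar>C\<bar> * lp_norm p M f" if "memLp p M f" for n f
   using sqT[OF that] abs sqfun_le_iff[OF p(1) T that] by (meson order_trans)
  have sqS: "mixn q M {..<n} (\<lambda>k. poly_op (sqp k) S f) \<le> \<bar>C\<bar> * lp_norm q M f" if "memLp q M f" for n f
   using sqT'[OF aS that] abs sqfun_le_iff[OF p(2) S that] by (meson order_trans)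
  obtain g :: "'a \<times> (int \<times> nat => bool) => 'a \<times> real" where g: "inj g" using coins_embedding by blast
  have "loose_dilation p M T"
   unfolding loose_dilation_def
   using dilation_on_embed[OF p(1) g square_functions_imp_dilation[OF pq assms(2) a abs_ge_zero sq sqS]] by blast
  then show ?thesis using square_functions_imp_R_Ritt[OF pq assms(2) a abs_ge_zero sq sqS] by blast
 qed
 have "loose_dilation p M T ==> p_poly_bounded p M T"
  unfolding loose_dilation_def using ii_iii by blast
 then show ?thesis
  unfolding Let_def cond_i_def[symmetric] using iii_i i_ii ii_iii by blast
qed

end
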